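(* Let $Q=D\times(t_1,t_2)\subset\Omega_T$ be a cylinder with $D\subset\Omega$ open, let $M\ge 1$, and let $(u_i)_{i=1}^\infty$ be a sequence of weak supersolutions of $\partial_t u-\operatorname{div}\mathcal A(Du)=0$ in $Q$ such that $|u_i|\le M$ for every $i\in\mathbb N$ and $u_i\to u$ almost everywhere in $Q$. Then $u$ is a weak supersolution in $Q$.
   Context: Standing setting. $n\ge 2$, $\Omega\subset\mathbb R^n$ is a bounded domain, $T>0$, $\Omega_T=\Omega\times(0,T)$. The function $g:[0,\infty)\to[0,\infty)$ is $C^1$, positive on $(0,\infty)$, and satisfies $g_0-1\le \frac{s g'(s)}{g(s)}\le g_1-1$ for all $s>0$, where $\frac{2n}{n+2}<g_0\le g_1<\infty$; it is normalized by $\int_0^1 g(\rho)\,d\rho=1$. Put $G(s)=\int_0^s g(r)\,dr$. The vector field $\mathcal A:\mathbb R^n\to\mathbb R^n$ is $C^1$ with $\mathcal A(0)=0$, and for some $0<\nu\le 1\le L$ it satisfies $\langle D\mathcal A(\xi)\zeta,\zeta\rangle\ge \nu\frac{g(|\xi|)}{|\xi|}|\zeta|^2$ and $|D\mathcal A(\xi)|\le L\frac{g(|\xi|)}{|\xi|}$ for all $\xi\in\mathbb R^n\setminus\{0\}$, $\zeta\in\mathbb R^n$. Function spaces. $L^G(E)$ is the space of measurable $u$ on $E$ with $\int_E G(|u|)<\infty$. For a cylinder $\mathcal K=D\times(t_1,t_2)$, $V^G(\mathcal K)$ is the space of $u\in L^G(\mathcal K)\cap L^1(t_1,t_2;W^{1,1}(D))$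 whose weak spatial gradient $Du$ lies in $L^G(\mathcal K)$, and $V^{2,G}(\mathcal K)=L^\infty(t_1,t_2;L^2(D))\cap V^G(\mathcal K)$. For an open set $U\subset\Omega_T$, $u\in V^{2,G}_{\rm loc}(U)$ means $u\in V^{2,G}(\mathcal K)$ for every cylinder $\mathcal K$ whose closure is a compact subset of $U$. Weak (super/sub)solutions. $u$ is a weak solution in an open set $U\subset\Omega_T$ if $u\in V^{2,G}_{\rm loc}(U)$ and $-\int_U u\,\partial_t\eta\,dx\,dt+\int_U \mathcal A(Du)\cdot D\eta\,dx\,dt=0$ for every $\eta\in C_c^\infty(U)$. If instead the left-hand side is $\ge 0$ (resp. $\le 0$) for every nonnegative $\eta\in C_c^\infty(U)$, $u$ is a weak supersolution (resp. subsolution) in $U$. *)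

theory Defs
  imports "HOL-Analysis.Analysis"
begin

text \<open>
  Space-time points are pairs (x, t). Functions on a set E are total functions of which only the
  values on E matter, up to Lebesgue null sets; measurability is with respect to the completed
  Lebesgue measure.
\<close>

section \<open>Test functions and classical derivatives\<close>

primrec Ck :: "nat \<Rightarrow> ('a::euclidean_space \<Rightarrow> real) \<Rightarrow> bool" where
  "Ck 0 f \<longleftrightarrow> continuous_on UNIV f"
| "Ck (Suc k) f \<longleftrightarrow>
     (\<forall>x. f differentiable (at x)) \<and> (\<forall>v. Ck k (\<lambda>x. frechet_derivative f (at x) v))"

text \<open>The elements of \<open>Cc_infty U\<close> are extended by zero to the whole space.\<close>

definition Cc_infty :: "('a::euclidean_space) set \<Rightarrow> ('a \<Rightarrow> real) set" where
  "Cc_infty U = {\<phi>. (\<forall>k. Ck k \<phi>) \<and> compact (closure {x. \<phi> x \<noteq> 0}) \<and> closure {x. \<phi> x \<noteq> 0} \<subseteq> U}"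

definition grad :: "('a::euclidean_space \<Rightarrow> real) \<Rightarrow> 'a \<Rightarrow> 'a" where
  "grad \<phi> x = (\<Sum>b\<in>Basis. frechet_derivative \<phi> (at x) b *\<^sub>R b)"

definition spatial_grad :: "('a::euclidean_space \<times> real \<Rightarrow> real) \<Rightarrow> 'a \<times> real \<Rightarrow> 'a" where
  "spatial_grad \<eta> z = grad (\<lambda>y. \<eta> (y, snd z)) (fst z)"

definition time_deriv :: "('a::euclidean_space \<times> real \<Rightarrow> real) \<Rightarrow> 'a \<times> real \<Rightarrow> real" where
  "time_deriv \<eta> z = deriv (\<lambda>s. \<eta> (fst z, s)) (snd z)"

section \<open>Weak gradients\<close>

definition locally_integrable_on ::
    "('a::euclidean_space \<Rightarrow> 'b::euclidean_space) \<Rightarrow> 'a set \<Rightarrow> bool" where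
  "locally_integrable_on f U \<longleftrightarrow> (\<forall>K. compact K \<and> K \<subseteq> U \<longrightarrow> f absolutely_integrable_on K)"

definition has_weak_grad ::
    "('a::euclidean_space) set \<Rightarrow> ('a \<Rightarrow> real) \<Rightarrow> ('a \<Rightarrow> 'a) \<Rightarrow> bool" where
  "has_weak_grad D v w \<longleftrightarrow>
     locally_integrable_on v D \<and> locally_integrable_on w D \<and>
     (\<forall>\<phi>\<in>Cc_infty D.
        (LINT x|lebesgue_on D. v x *\<^sub>R grad \<phi> x) = - (LINT x|lebesgue_on D. \<phi> x *\<^sub>R w x))"

definition has_weak_spatial_grad ::
    "('a::euclidean_space \<times> real) set \<Rightarrow> ('a \<times> real \<Rightarrow> real) \<Rightarrow> ('a \<times> real \<Rightarrow> 'a) \<Rightarrow> bool" where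
  "has_weak_spatial_grad U u w \<longleftrightarrow>
     locally_integrable_on u U \<and> locally_integrable_on w U \<and>
     (\<forall>\<phi>\<in>Cc_infty U.
        (LINT z|lebesgue_on U. u z *\<^sub>R spatial_grad \<phi> z) = - (LINT z|lebesgue_on U. \<phi> z *\<^sub>R w z))"

section \<open>Spaces of functions of the space variable\<close>

definition L2 :: "('a::euclidean_space) set \<Rightarrow> ('a \<Rightarrow> real) set" where
  "L2 D = {v \<in> borel_measurable (lebesgue_on D). integrable (lebesgue_on D) (\<lambda>x. (v x)\<^sup>2)}"

definition L2_norm :: "('a::euclidean_space) set \<Rightarrow> ('a \<Rightarrow> real) \<Rightarrow> real" where
  "L2_norm D v = sqrt (LINT x|lebesgue_on D. (v x)\<^sup>2)"

definition W11 :: "('a::euclidean_space) set \<Rightarrow> ('a \<Rightarrow> real) set" where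
  "W11 D = {v. integrable (lebesgue_on D) v \<and>
               (\<exists>w. has_weak_grad D v w \<and> integrable (lebesgue_on D) w)}"

text \<open>The weak gradient is unique up to null sets, so the choice below is immaterial.\<close>

definition W11_norm :: "('a::euclidean_space) set \<Rightarrow> ('a \<Rightarrow> real) \<Rightarrow> real" where
  "W11_norm D v =
     (LINT x|lebesgue_on D. \<bar>v x\<bar>) +
     (LINT x|lebesgue_on D. norm ((SOME w. has_weak_grad D v w) x))"

section \<open>Bochner spaces\<close>

text \<open>
  Here \<open>X\<close> is a space of functions with (semi)norm \<open>N\<close>, and \<open>u\<close> is identified with the map that
  sends t to the slice u(.,t).
\<close>

definition strongly_measurable_into ::
    "('a \<Rightarrow> real) set \<Rightarrow> (('a \<Rightarrow> real) \<Rightarrow> real) \<Rightarrow> real set \<Rightarrow> ('a \<times> real \<Rightarrow> real) \<Rightarrow> bool" where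
  "strongly_measurable_into X N I u \<longleftrightarrow>
     (AE t in lebesgue_on I. (\<lambda>x. u (x, t)) \<in> X) \<and>
     (\<exists>s :: nat \<Rightarrow> real \<Rightarrow> 'a \<Rightarrow> real.
        (\<forall>k. simple_function (lebesgue_on I) (s k) \<and> s k ` I \<subseteq> X) \<and>
        (AE t in lebesgue_on I. (\<lambda>k. N (\<lambda>x. u (x, t) - s k t x)) \<longlonglongrightarrow> 0))"

definition Bochner_L1 ::
    "real set \<Rightarrow> ('a \<Rightarrow> real) set \<Rightarrow> (('a \<Rightarrow> real) \<Rightarrow> real) \<Rightarrow> ('a \<times> real \<Rightarrow> real) set" where
  "Bochner_L1 I X N = {u. strongly_measurable_into X N I u \<and>
                          integrable (lebesgue_on I) (\<lambda>t. N (\<lambda>x. u (x, t)))}"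

definition Bochner_Linf ::
    "real set \<Rightarrow> ('a \<Rightarrow> real) set \<Rightarrow> (('a \<Rightarrow> real) \<Rightarrow> real) \<Rightarrow> ('a \<times> real \<Rightarrow> real) set" where
  "Bochner_Linf I X N = {u. strongly_measurable_into X N I u \<and>
                            (\<exists>C. AE t in lebesgue_on I. N (\<lambda>x. u (x, t)) \<le> C)}"

section \<open>Orlicz and parabolic spaces\<close>

definition primitive :: "(real \<Rightarrow> real) \<Rightarrow> real \<Rightarrow> real" where
  "primitive g s = integral {0..s} g"

definition Orlicz ::
    "(real \<Rightarrow> real) \<Rightarrow> ('a::euclidean_space) set \<Rightarrow> ('a \<Rightarrow> 'b::euclidean_space) set" where
  "Orlicz G E = {f \<in> borel_measurable (lebesgue_on E).
                   (\<integral>\<^sup>+x. ennreal (G (norm (f x))) \<partial>lebesgue_on E) < \<infinity>}"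

definition VG ::
    "(real \<Rightarrow> real) \<Rightarrow> ('a::euclidean_space) set \<Rightarrow> real \<Rightarrow> real \<Rightarrow> ('a \<times> real \<Rightarrow> real) set" where
  "VG G D t1 t2 =
     {u \<in> Orlicz G (D \<times> {t1<..<t2}) \<inter> Bochner_L1 {t1<..<t2} (W11 D) (W11_norm D).
        \<exists>w. has_weak_spatial_grad (D \<times> {t1<..<t2}) u w \<and> w \<in> Orlicz G (D \<times> {t1<..<t2})}"

definition V2G ::
    "(real \<Rightarrow> real) \<Rightarrow> ('a::euclidean_space) set \<Rightarrow> real \<Rightarrow> real \<Rightarrow> ('a \<times> real \<Rightarrow> real) set" where
  "V2G G D t1 t2 = Bochner_Linf {t1<..<t2} (L2 D) (L2_norm D) \<inter> VG G D t1 t2"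

definition V2G_loc ::
    "(real \<Rightarrow> real) \<Rightarrow> ('a::euclidean_space \<times> real) set \<Rightarrow> ('a \<times> real \<Rightarrow> real) set" where
  "V2G_loc G U =
     {u. \<forall>D t1 t2. open D \<and> t1 < t2 \<and> compact (closure (D \<times> {t1<..<t2})) \<and>
           closure (D \<times> {t1<..<t2}) \<subseteq> U \<longrightarrow> u \<in> V2G G D t1 t2}"

section \<open>Weak supersolutions\<close>

text \<open>
  As the weak spatial gradient \<open>Du\<close> is unique up to null sets, quantifying it existentially
  amounts to speaking of the gradient of \<open>u\<close>.
\<close>

definition weak_supersolution ::
    "(real \<Rightarrow> real) \<Rightarrow> ('a::euclidean_space \<Rightarrow> 'a) \<Rightarrow> ('a \<times> real) set \<Rightarrow> ('a \<times> real \<Rightarrow> real) \<Rightarrow> bool"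
    where
  "weak_supersolution g A U u \<longleftrightarrow>
     u \<in> V2G_loc (primitive g) U \<and>
     (\<exists>Du. has_weak_spatial_grad U u Du \<and>
        (\<forall>\<eta>\<in>Cc_infty U. (\<forall>z. 0 \<le> \<eta> z) \<longrightarrow>
           0 \<le> - (LINT z|lebesgue_on U. u z * time_deriv \<eta> z)
               + (LINT z|lebesgue_on U. A (Du z) \<bullet> spatial_grad \<eta> z)))"

end

(*
  Bounded supersolutions satisfy a Caccioppoli estimate (test with a power of a cutoff times M - u),
  so h(|Du_i|) with h(s) = s g(s), comparable to G, is bounded in L^1_loc. Testing the difference of
  two supersolutions with a smooth truncation of u_i - u_j at height d shows that the monotonicity
  quantity (Du_i - Du_j).(A(Du_i) - A(Du_j)), restricted to |u_i - u_j| <= d, has local integral at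
  most C d. As u_i converges a.e., the gradients are Cauchy in measure, hence converge a.e. along a
  subsequence, and since h is superlinear, both Du_i and A(Du_i) converge in L^1_loc: the
  inequality passes to the limit.

  Instead of Steklov averages, everything is mollified in space-time. Young's inequality
  g(s) r <= h(s) + h(r) bounds the products of mollified fluxes and mollified gradients by the
  mollified h, which converges in L^1, so no Orlicz space duality is needed.

  The Bochner measurability of the limit is witnessed by its space-time mollifications sampled on
  finer and finer time grids.
*)
theory Submission
  imports Defs
begin

section \<open>Test functions\<close>

text \<open>The time derivative of a supersolution is only a distribution, so a function of
  \<open>u\<close> is not an admissible test function; and \<open>A\<close> is nonlinear, so weak
  convergence of gradients would not identify the limit of the fluxes. Testing with translated
  mollifiers yields a pointwise inequality between smooth functions: the time derivative of the
  mollified \<open>u\<close> minus the divergence of the mollified flux is nonnegative. From there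
  on all testing is classical integration by parts. The mollified flux is not the flux of the
  mollified gradient, so its product with that gradient has no sign before the limit; Fatou's lemma
  is therefore used with a lower barrier, built from the mollified \<open>h\<close>. The difference
  of two supersolutions satisfies no inequality, but its equation has as right side a difference of
  two nonnegative densities with uniformly bounded local mass, against which a truncation of size
  \<open>\<delta>\<close> integrates to at most a multiple of \<open>\<delta>\<close>. The bound on
  \<open>g0\<close> gives \<open>1 < g0\<close> for \<open>n \<ge> 2\<close>, and this is the source
  of superlinearity.\<close>

lemma Ck_Suc_D: "Ck (Suc k) f \<Longrightarrow> Ck k f"
proof (induction k arbitrary: f)
  case 0
  then show ?case
    by (auto intro!: continuous_at_imp_continuous_on differentiable_imp_continuous_within)
next
  case (Suc k)
  then show ?case by (metis Ck.simps(2))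
qed

lemma Ck_const: "Ck k (\<lambda>x::'a::euclidean_space. c)"
  by (induction k arbitrary: c) (auto simp: frechet_derivative_const)

lemma Ck_add:
  assumes "Ck k f" "Ck k h"
  shows "Ck k (\<lambda>x::'a::euclidean_space. f x + h x)"
  using assms
proof (induction k arbitrary: f h)
  case 0
  then show ?case by (auto intro: continuous_intros)
next
  case (Suc k)
  have d: "((\<lambda>x. f x + h x) has_derivative
      (\<lambda>v. frechet_derivative f (at x) v + frechet_derivative h (at x) v)) (at x)" for x
    using Suc.prems by (auto intro!: derivative_intros simp: frechet_derivative_works[symmetric])
  have "frechet_derivative (\<lambda>x. f x + h x) (at x) =
      (\<lambda>v. frechet_derivative f (at x) v + frechet_derivative h (at x) v)" for x
    by (rule frechet_derivative_at[OF d, symmetric])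
  with d Suc show ?case by (auto simp: differentiable_def)
qed

lemma Ck_mult:
  assumes "Ck k f" "Ck k h"
  shows "Ck k (\<lambda>x::'a::euclidean_space. f x * h x)"
  using assms
proof (induction k arbitrary: f h)
  case 0
  then show ?case by (auto intro: continuous_intros)
next
  case (Suc k)
  have d: "((\<lambda>x. f x * h x) has_derivative
      (\<lambda>v. f x * frechet_derivative h (at x) v + frechet_derivative f (at x) v * h x)) (at x)" for x
    using Suc.prems by (auto intro!: derivative_intros simp: frechet_derivative_works[symmetric])
  have e: "frechet_derivative (\<lambda>x. f x * h x) (at x) =
      (\<lambda>v. f x * frechet_derivative h (at x) v + frechet_derivative f (at x) v * h x)" for x
    by (rule frechet_derivative_at[OF d, symmetric])
  have "Ck k f" "Ck k h" using Suc.prems Ck_Suc_D by blast+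
  with d e Suc show ?case by (auto simp: differentiable_def intro!: Ck_add)
qed

lemma Ck_inner_diff: "Ck k (\<lambda>x::'a::euclidean_space. (x - z) \<bullet> v)"
proof (cases k)
  case 0
  then show ?thesis by (auto intro!: continuous_intros)
next
  case (Suc m)
  have d: "((\<lambda>x. (x - z) \<bullet> v) has_derivative (\<lambda>w. w \<bullet> v)) (at x)" for x
    by (auto intro!: derivative_eq_intros)
  have "frechet_derivative (\<lambda>x. (x - z) \<bullet> v) (at x) = (\<lambda>w. w \<bullet> v)" for x
    by (rule frechet_derivative_at[OF d, symmetric])
  with d Suc show ?thesis by (auto simp: differentiable_def intro!: Ck_const)
qed

section \<open>Smooth bumps and cutoffs\<close>

definition flat :: "nat \<Rightarrow> real \<Rightarrow> real" where
  "flat m s = (if s \<le> 0 then 0 else inverse s ^ m * exp (- inverse s))"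

text \<open>
  The negative powers keep the family closed under differentiation.
\<close>

lemma flat_nonneg: "0 \<le> flat m s"
  by (auto simp: flat_def)

lemma flat_pos_iff: "0 < flat m s \<longleftrightarrow> 0 < s"
  by (auto simp: flat_def)

text \<open>Substituting \<open>1 / s\<close> turns the limit from the right into the decay of a
  power times a negative exponential at infinity; from the left the function is zero.\<close>

lemma flat_tendsto_0: "(flat m \<longlongrightarrow> 0) (at 0)"
proof -
  have "((\<lambda>s. inverse s ^ m * exp (- inverse s)) \<longlongrightarrow> (0::real)) (at_right 0)"
    using filterlim_compose[OF tendsto_power_div_exp_0 filterlim_inverse_at_top_right, of m]
    by (simp add: exp_minus divide_inverse)
  then have "(flat m \<longlongrightarrow> 0) (at_right 0)"
    by (rule Lim_transform_eventually) (auto simp: flat_def eventually_at_filter)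
  moreover have "(flat m \<longlongrightarrow> 0) (at_left 0)"
    by (rule Lim_transform_eventually[OF tendsto_const]) (auto simp: flat_def eventually_at_filter)
  ultimately show ?thesis by (simp add: filterlim_split_at)
qed

text \<open>Away from 0 this is the product rule, each differentiation producing a factor
  \<open>(inverse s)\<^sup>2\<close>. At 0 the difference quotient of \<open>flat m\<close> is
  exactly \<open>flat (m + 1)\<close>, so the derivative is the limit of the next member of the
  family.\<close>

lemma flat_deriv: "(flat m has_real_derivative (flat (m + 2) s - real m * flat (m + 1) s)) (at s)"
proof (cases s "0::real" rule: linorder_cases)
  case less
  have "((\<lambda>s. 0) has_real_derivative (flat (m + 2) s - real m * flat (m + 1) s)) (at s)"
    using less by (auto simp: flat_def)
  then show ?thesis
    by (rule has_field_derivative_transform_within_open[where S="{..<0}"])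
       (use less in \<open>auto simp: flat_def\<close>)
next
  case equal
  have "(\<lambda>h. (flat m (0 + h) - flat m 0) / h) = flat (m + 1)"
    by (auto simp: flat_def fun_eq_iff divide_simps)
  then show ?thesis
    using flat_tendsto_0[of "m + 1"] equal
    by (simp add: DERIV_def flat_def)
next
  case greater
  have i: "(inverse has_real_derivative - (inverse s)\<^sup>2) (at s)"
    using DERIV_inverse[of s UNIV] greater by (simp add: numeral_2_eq_2)
  have "((\<lambda>s. inverse s ^ m * exp (- inverse s)) has_real_derivative
     (real m * inverse s ^ (m - 1) * (- (inverse s)\<^sup>2)) * exp (- inverse s)
       + (exp (- inverse s) * (inverse s)\<^sup>2) * inverse s ^ m) (at s)"
    using greater by (auto intro!: derivative_eq_intros simp: power2_eq_square mult_ac)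
  \<comment> \<open>The case split on \<open>m\<close> deals with the truncated exponent
    \<open>m - 1\<close> at \<open>m = 0\<close>, where the coefficient \<open>real m\<close>
    removes the term.\<close>
  also have "(real m * inverse s ^ (m - 1) * (- (inverse s)\<^sup>2)) * exp (- inverse s)
       + (exp (- inverse s) * (inverse s)\<^sup>2) * inverse s ^ m = flat (m + 2) s - real m * flat (m + 1) s"
    using greater by (cases m) (auto simp: flat_def power2_eq_square)
  finally have "((\<lambda>s. inverse s ^ m * exp (- inverse s)) has_real_derivative
     flat (m + 2) s - real m * flat (m + 1) s) (at s)" .
  then show ?thesis
    by (rule has_field_derivative_transform_within_open[where S="{0<..}"])
       (use greater in \<open>auto simp: flat_def\<close>)
qed

text \<open>The squared distance is used because it is a polynomial; the norm itself would not be
  smooth at the centre.\<close>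

definition bump :: "'a::euclidean_space \<Rightarrow> real \<Rightarrow> 'a \<Rightarrow> real" where
  "bump z r x = flat 0 (r\<^sup>2 - (x - z) \<bullet> (x - z))"

text \<open>The induction runs over all \<open>m\<close> at once: a directional derivative is an
  affine function times a combination of the members \<open>m + 2\<close> and \<open>m + 1\<close>
  of the same family.\<close>

lemma Ck_flat_quadratic:
  "Ck k (\<lambda>x::'a::euclidean_space. flat m (r\<^sup>2 - (x - z) \<bullet> (x - z)))"
proof (induction k arbitrary: m)
  let ?q = "\<lambda>x::'a. r\<^sup>2 - (x - z) \<bullet> (x - z)"
  have d: "((\<lambda>x. flat m (?q x)) has_derivative
     (\<lambda>v. (- 2 * ((x - z) \<bullet> v)) * (flat (m + 2) (?q x) + (- real m) * flat (m + 1) (?q x)))) (at x)" for x m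
  proof -
    have "(?q has_derivative (\<lambda>v. - 2 * ((x - z) \<bullet> v))) (at x)"
      by (auto intro!: derivative_eq_intros simp: inner_commute)
    from DERIV_compose_FDERIV[OF flat_deriv this] show ?thesis by (simp add: algebra_simps)
  qed
  have e: "frechet_derivative (\<lambda>x. flat m (?q x)) (at x) =
     (\<lambda>v. (- 2 * ((x - z) \<bullet> v)) * (flat (m + 2) (?q x) + (- real m) * flat (m + 1) (?q x)))" for x m
    by (rule frechet_derivative_at[OF d, symmetric])
  {
    case 0
    show ?case
      unfolding Ck.simps
      by (intro continuous_at_imp_continuous_on ballI has_derivative_continuous[OF d])
  next
    case (Suc k)
    have "Ck k (\<lambda>x. (- 2 * ((x - z) \<bullet> v)) * (flat (m + 2) (?q x) + (- real m) * flat (m + 1) (?q x)))" for v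
    proof (rule Ck_mult)
      show "Ck k (\<lambda>x. - 2 * ((x - z) \<bullet> v))"
        by (rule Ck_mult[OF Ck_const Ck_inner_diff])
      show "Ck k (\<lambda>x. flat (m + 2) (?q x) + (- real m) * flat (m + 1) (?q x))"
        by (rule Ck_add[OF Suc Ck_mult[OF Ck_const Suc]])
    qed
    moreover have "(\<lambda>x. flat m (?q x)) differentiable (at x)" for x
      using d[of m x] by (rule differentiableI)
    ultimately show ?case
      unfolding Ck.simps e by simp
  }
qed

lemma Ck_bump: "Ck k (bump z r)"
  unfolding bump_def[abs_def] by (rule Ck_flat_quadratic)

lemma bump_nonneg: "0 \<le> bump z r x"
  by (simp add: bump_def flat_nonneg)

lemma bump_pos_iff:
  assumes "0 < r"
  shows "0 < bump z r x \<longleftrightarrow> dist z x < r"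
proof -
  have "0 < bump z r x \<longleftrightarrow> (norm (x - z))\<^sup>2 < r\<^sup>2"
    by (simp add: bump_def flat_pos_iff power2_norm_eq_inner)
  also have "\<dots> \<longleftrightarrow> norm (x - z) < r"
    using assms by (metis norm_ge_zero order_less_imp_le power_mono_iff linorder_not_le zero_less_numeral)
  finally show ?thesis by (simp add: dist_norm norm_minus_commute)
qed

lemma bump_nonzero_subset: "0 < r \<Longrightarrow> {x. bump z r x \<noteq> 0} \<subseteq> ball z r"
  using bump_pos_iff[of r z] bump_nonneg[of z r] by (auto simp: less_le)

lemma Cc_inftyI:
  assumes "\<And>k. Ck k f" "compact K" "K \<subseteq> U" "\<And>x. x \<notin> K \<Longrightarrow> f x = 0"
  shows "f \<in> Cc_infty U"
proof -
  have "closure {x. f x \<noteq> 0} \<subseteq> K"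
    using assms by (intro closure_minimal compact_imp_closed) auto
  moreover have "compact (closure {x. f x \<noteq> 0})"
    using calculation assms(2) by (metis closed_closure compact_Int_closed inf.absorb_iff2)
  ultimately show ?thesis
    using assms(1,3) unfolding Cc_infty_def by blast
qed

lemma Cc_inftyE:
  assumes "f \<in> Cc_infty U"
  obtains K where "compact K" "K \<subseteq> U" "\<And>x. x \<notin> K \<Longrightarrow> f x = 0"
proof (rule that[of "closure {x. f x \<noteq> 0}"])
  show "f x = 0" if "x \<notin> closure {x. f x \<noteq> 0}" for x
    using that closure_subset[of "{x. f x \<noteq> 0}"] by blast
qed (use assms in \<open>simp_all add: Cc_infty_def\<close>)

lemma Cc_infty_Ck: "f \<in> Cc_infty U \<Longrightarrow> Ck k f"
  by (simp add: Cc_infty_def)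

lemma Cc_infty_mono: "U \<subseteq> V \<Longrightarrow> Cc_infty U \<subseteq> Cc_infty V"
  unfolding Cc_infty_def by blast

lemma Cc_infty_add:
  assumes "f \<in> Cc_infty U" "h \<in> Cc_infty U"
  shows "(\<lambda>x. f x + h x) \<in> Cc_infty U"
proof -
  obtain K where K: "compact K" "K \<subseteq> U" "\<And>x. x \<notin> K \<Longrightarrow> f x = 0"
    using Cc_inftyE[OF assms(1)] by blast
  obtain L where L: "compact L" "L \<subseteq> U" "\<And>x. x \<notin> L \<Longrightarrow> h x = 0"
    using Cc_inftyE[OF assms(2)] by blast
  show ?thesis
    by (rule Cc_inftyI[of _ "K \<union> L"])
      (use K L assms in \<open>simp_all add: Ck_add Cc_infty_Ck compact_Un\<close>)
qed

lemma Cc_infty_cmult: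
  assumes "f \<in> Cc_infty U"
  shows "(\<lambda>x. c * f x) \<in> Cc_infty U"
proof -
  obtain K where K: "compact K" "K \<subseteq> U" "\<And>x. x \<notin> K \<Longrightarrow> f x = 0"
    using Cc_inftyE[OF assms] by blast
  show ?thesis
    by (rule Cc_inftyI[of _ K]) (use K assms in \<open>simp_all add: Ck_mult Ck_const Cc_infty_Ck\<close>)
qed

lemma Cc_infty_zero: "(\<lambda>x. 0) \<in> Cc_infty U"
  by (rule Cc_inftyI[where K="{}"]) (simp_all add: Ck_const)

lemma bump_Cc_infty:
  assumes "0 < r" "cball z r \<subseteq> U"
  shows "bump z r \<in> Cc_infty U"
proof (rule Cc_inftyI[where K="cball z r"])
  show "bump z r x = 0" if "x \<notin> cball z r" for x
    using that bump_nonzero_subset[OF assms(1), of z] ball_subset_cball[of z r] by blast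
qed (use assms Ck_bump in auto)

text \<open>Finitely many bumps cover \<open>K\<close>, and their sum is positive there; division by
  its minimum over \<open>K\<close> gives the lower bound 1. An upper bound is arranged afterwards
  in \<open>normalized_cutoff\<close>.\<close>

lemma cutoff_exists:
  fixes U :: "'a::euclidean_space set"
  assumes "open U" "compact K" "K \<subseteq> U"
  obtains \<phi> where "\<phi> \<in> Cc_infty U" "\<And>x. 0 \<le> \<phi> x" "\<And>x. x \<in> K \<Longrightarrow> 1 \<le> \<phi> x"
proof -
  have "\<exists>r>0. cball z r \<subseteq> U" if "z \<in> K" for z
    using assms that open_contains_cball by blast
  then obtain r where r: "\<And>z. z \<in> K \<Longrightarrow> r z > 0 \<and> cball z (r z) \<subseteq> U" by metis
  obtain F where F: "F \<subseteq> K" "finite F" "K \<subseteq> (\<Union>z\<in>F. ball z (r z))"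
    using compactE_image[OF assms(2), of K "\<lambda>z. ball z (r z)"] r by force
  define \<psi> where "\<psi> = (\<lambda>x. \<Sum>z\<in>F. bump z (r z) x)"
  have \<psi>: "\<psi> \<in> Cc_infty U"
    unfolding \<psi>_def using F(2,1)
  proof (induction F rule: finite_induct)
    case (insert x F)
    then have "bump x (r x) \<in> Cc_infty U" using r by (intro bump_Cc_infty) blast+
    then show ?case using insert by (simp add: Cc_infty_add)
  qed (simp add: Cc_infty_zero)
  have \<psi>0: "\<psi> x \<ge> 0" for x
    unfolding \<psi>_def by (auto intro: sum_nonneg bump_nonneg)
  have pos: "\<psi> x > 0" if x: "x \<in> K" for x
  proof -
    obtain z where "z \<in> F" "x \<in> ball z (r z)" using F x by blast
    then have "bump z (r z) x > 0" "z \<in> F" using r F by (auto simp: bump_pos_iff)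
    then show ?thesis unfolding \<psi>_def using F
      by (intro sum_pos2[of F z]) (auto simp: bump_nonneg)
  qed
  have cont: "continuous_on K \<psi>"
    using Cc_infty_Ck[OF \<psi>, of 0] continuous_on_subset by auto
  show thesis
  proof (cases "K = {}")
    case True
    then show ?thesis using that \<psi> \<psi>0 by blast
  next
    case False
    obtain y where y: "y \<in> K" "\<And>x. x \<in> K \<Longrightarrow> \<psi> y \<le> \<psi> x"
      using continuous_attains_inf[OF assms(2) False cont] by blast
    show ?thesis
    proof (rule that[of "\<lambda>x. inverse (\<psi> y) * \<psi> x"])
      show "0 \<le> inverse (\<psi> y) * \<psi> x" for x using \<psi>0 by simp
      show "1 \<le> inverse (\<psi> y) * \<psi> x" if "x \<in> K" for x
        using pos[OF y(1)] y(2)[OF that] by (simp add: field_simps)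
    qed (intro Cc_infty_cmult \<psi>)
  qed
qed

section \<open>Directional derivatives and integration by parts\<close>

text \<open>With the directions \<open>(b, 0)\<close> and \<open>(0, 1)\<close> one notion covers
  spatial and time derivatives on space-time.\<close>

definition dderiv :: "'a::euclidean_space \<Rightarrow> ('a \<Rightarrow> real) \<Rightarrow> 'a \<Rightarrow> real" where
  "dderiv e f x = frechet_derivative f (at x) e"

lemma Cc_infty_continuous:
  assumes "f \<in> Cc_infty U" shows "continuous_on UNIV f"
  using Cc_infty_Ck[OF assms, of 0] by simp

lemma Cc_infty_has_derivative:
  assumes "f \<in> Cc_infty U" shows "(f has_derivative (\<lambda>v. dderiv v f x)) (at x)"
proof -
  have "Ck (Suc 0) f" using assms by (rule Cc_infty_Ck)
  then show ?thesis
    by (auto simp: dderiv_def frechet_derivative_works[symmetric] eta_contract_eq)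
qed

lemma Cc_infty_dderiv_continuous:
  assumes "f \<in> Cc_infty U" shows "continuous_on UNIV (dderiv e f)"
proof -
  have "Ck (Suc 0) f" using assms by (rule Cc_infty_Ck)
  then show ?thesis by (auto simp: dderiv_def[abs_def])
qed

lemma Cc_infty_line_deriv:
  assumes "f \<in> Cc_infty U"
  shows "((\<lambda>s. f (x + s *\<^sub>R e)) has_real_derivative dderiv e f x) (at 0)"
proof -
  have "((\<lambda>s. f (x + s *\<^sub>R e)) has_derivative (\<lambda>s. dderiv (s *\<^sub>R e) f x)) (at 0)"
    by (rule has_derivative_compose[where g=f and f="\<lambda>s. x + s *\<^sub>R e" and f'="\<lambda>s. s *\<^sub>R e" for e])
       (use Cc_infty_has_derivative[OF assms, of x] in \<open>auto intro!: derivative_eq_intros\<close>)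
  moreover have "dderiv (s *\<^sub>R e) f x = dderiv e f x * s" for s
    using linear_cmul[OF has_derivative_linear[OF Cc_infty_has_derivative[OF assms, of x]], of s e] by simp
  ultimately show ?thesis by (simp add: has_field_derivative_def)
qed

lemma dderiv_eq_zero_off:
  assumes "compact K" "\<And>x. x \<notin> K \<Longrightarrow> f x = 0" "x \<notin> K"
  shows "dderiv e f x = 0"
proof -
  have "((\<lambda>_. 0) has_derivative (\<lambda>v. 0)) (at x)"
    by (rule has_derivative_const)
  then have "(f has_derivative (\<lambda>v. 0)) (at x)"
    by (rule has_derivative_transform_within_open[where s="- K"])
      (use assms in \<open>simp_all add: compact_imp_closed open_Compl\<close>)
  from frechet_derivative_at[OF this, symmetric] show ?thesis by (simp add: dderiv_def)
qed

lemma Cc_infty_support: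
  assumes "f \<in> Cc_infty U"
  shows "\<exists>K. compact K \<and> K \<subseteq> U \<and> (\<forall>x. x \<notin> K \<longrightarrow> f x = 0)"
  by (rule Cc_inftyE[OF assms]) (intro exI conjI allI impI)

lemma lborel_shift:
  fixes f :: "'a::euclidean_space \<Rightarrow> 'b::{banach, second_countable_topology}"
  assumes "f \<in> borel_measurable borel"
  shows "(\<integral>x. f (c + x) \<partial>lborel) = (\<integral>x. f x \<partial>lborel)"
    and "integrable lborel (\<lambda>x. f (c + x)) \<longleftrightarrow> integrable lborel f"
  using integral_distr[of "(+) c" lborel borel f] integrable_distr_eq[of "(+) c" lborel borel f] assms
  by (simp_all add: lborel_distr_plus)

lemma compact_support_bounded:
  fixes f :: "'a::euclidean_space \<Rightarrow> 'b::euclidean_space"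
  assumes "continuous_on UNIV f" "compact K" "\<And>x. x \<notin> K \<Longrightarrow> f x = 0"
  obtains B where "B > 0" "\<And>x. norm (f x) \<le> B"
proof -
  have "bounded (f ` K)"
    using assms by (intro compact_imp_bounded compact_continuous_image) (auto intro: continuous_on_subset)
  then obtain B where "B > 0" "\<And>x. x \<in> K \<Longrightarrow> norm (f x) \<le> B"
    by (auto simp: bounded_pos)
  then have "norm (f x) \<le> B" for x
    using assms(3)[of x] by (cases "x \<in> K") auto
  then show thesis using that \<open>B > 0\<close> by blast
qed

lemma integrable_compact_support:
  fixes f :: "'a::euclidean_space \<Rightarrow> 'b::euclidean_space"
  assumes "continuous_on UNIV f" "compact K" "\<And>x. x \<notin> K \<Longrightarrow> f x = 0"
  shows "integrable lborel f"
proof -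
  have "integrable lborel (\<lambda>x. indicator K x *\<^sub>R f x)"
    using assms by (intro borel_integrable_compact) (auto intro: continuous_on_subset)
  also have "(\<lambda>x. indicator K x *\<^sub>R f x) = f"
    using assms(3) by (auto simp: indicator_def)
  finally show ?thesis .
qed

text \<open>Differentiability is recorded only along lines in direction \<open>e\<close>.
  Mollifications can then be treated one direction at a time, without a total derivative, and
  integration by parts asks for no more.\<close>

definition has_line_deriv :: "'a::euclidean_space \<Rightarrow> ('a \<Rightarrow> real) \<Rightarrow> ('a \<Rightarrow> real) \<Rightarrow> bool" where
  "has_line_deriv e f f' \<longleftrightarrow> (\<forall>x. ((\<lambda>s. f (x + s *\<^sub>R e)) has_real_derivative f' x) (at 0))"

lemma has_line_deriv_at:
  assumes "has_line_deriv e f f'"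
  shows "((\<lambda>s. f (x + s *\<^sub>R e)) has_real_derivative f' (x + s *\<^sub>R e)) (at s)"
proof -
  have "((\<lambda>h. f (x + s *\<^sub>R e + h *\<^sub>R e)) has_real_derivative f' (x + s *\<^sub>R e)) (at 0)"
    using assms by (auto simp: has_line_deriv_def)
  also have "(\<lambda>h. f (x + s *\<^sub>R e + h *\<^sub>R e)) = (\<lambda>h. f (x + (h + s) *\<^sub>R e))"
    by (simp add: algebra_simps)
  finally show ?thesis
    using DERIV_shift[of "\<lambda>s. f (x + s *\<^sub>R e)" "f' (x + s *\<^sub>R e)" 0 s] by simp
qed

lemma has_line_deriv_diff:
  "has_line_deriv e f f' \<Longrightarrow> has_line_deriv e h h' \<Longrightarrow> has_line_deriv e (\<lambda>x. f x - h x) (\<lambda>x. f' x - h' x)"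
  by (auto simp: has_line_deriv_def intro!: DERIV_diff)

lemma has_line_deriv_mult:
  "has_line_deriv e f f' \<Longrightarrow> has_line_deriv e h h' \<Longrightarrow>
    has_line_deriv e (\<lambda>x. f x * h x) (\<lambda>x. f' x * h x + h' x * f x)"
  using DERIV_mult[of "\<lambda>s. f (_ + s *\<^sub>R e)" _ 0 UNIV "\<lambda>s. h (_ + s *\<^sub>R e)"]
  by (fastforce simp: has_line_deriv_def)

lemma has_line_deriv_compose:
  assumes "\<And>s. (S has_real_derivative S' s) (at s)" "has_line_deriv e f f'"
  shows "has_line_deriv e (\<lambda>x. S (f x)) (\<lambda>x. S' (f x) * f' x)"
proof -
  have "((\<lambda>s. S (f (x + s *\<^sub>R e))) has_real_derivative S' (f (x + 0 *\<^sub>R e)) * f' x) (at 0)" for x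
    using assms by (intro DERIV_chain2[of S]) (auto simp: has_line_deriv_def)
  then show ?thesis by (simp add: has_line_deriv_def)
qed

lemma has_line_deriv_bound:
  assumes "has_line_deriv e f f'" "\<And>x. \<bar>f' x\<bar> \<le> B"
  shows "\<bar>f (x + s *\<^sub>R e) - f x\<bar> \<le> B * \<bar>s\<bar>"
  using field_differentiable_bound[of UNIV "\<lambda>s. f (x + s *\<^sub>R e)" "\<lambda>s. f' (x + s *\<^sub>R e)" B s 0]
    has_line_deriv_at[OF assms(1)] assms(2) by simp

lemma has_line_deriv_tendsto:
  assumes "has_line_deriv e f f'" "X \<longlonglongrightarrow> 0" "\<And>n::nat. X n \<noteq> (0::real)"
  shows "(\<lambda>n. (f (x + X n *\<^sub>R e) - f x) / X n) \<longlonglongrightarrow> f' x"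
proof -
  have "((\<lambda>h. (f (x + h *\<^sub>R e) - f x) / h) \<longlongrightarrow> f' x) (at 0)"
    using assms(1) by (auto simp: has_line_deriv_def DERIV_def)
  then show ?thesis
    using assms(2,3) unfolding tendsto_at_iff_sequentially by (auto simp: o_def)
qed

text \<open>The derivative is tested along sequences because dominated convergence, which supplies
  the limits, is a statement about sequences.\<close>

lemma has_line_derivI:
  assumes "\<And>X x. X \<longlonglongrightarrow> 0 \<Longrightarrow> (\<And>n::nat. X n \<noteq> (0::real)) \<Longrightarrow> (\<lambda>n. (f (x + X n *\<^sub>R e) - f x) / X n) \<longlonglongrightarrow> f' x"
  shows "has_line_deriv e f f'"
  unfolding has_line_deriv_def DERIV_def tendsto_at_iff_sequentially
  using assms by (auto simp: o_def)

lemma has_line_deriv_zero_off: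
  assumes "has_line_deriv e f f'" "closed K" "\<And>x. x \<notin> K \<Longrightarrow> f x = 0" "x \<notin> K"
  shows "f' x = 0"
proof -
  have "\<forall>\<^sub>F s in nhds 0. x + s *\<^sub>R e \<in> - K"
  proof (rule topological_tendstoD)
    show "((\<lambda>s. x + s *\<^sub>R e) \<longlongrightarrow> x + 0 *\<^sub>R e) (nhds 0)"
      by (intro tendsto_intros filterlim_ident)
  qed (use assms in auto)
  then have "\<forall>\<^sub>F s in nhds 0. f (x + s *\<^sub>R e) = 0"
    by eventually_elim (use assms in auto)
  moreover have "((\<lambda>s. f (x + s *\<^sub>R e)) has_real_derivative f' x) (at 0)"
    using assms by (auto simp: has_line_deriv_def)
  ultimately have "((\<lambda>s. 0) has_real_derivative f' x) (at 0)"
    using DERIV_cong_ev[of 0 0 "\<lambda>s. f (x + s *\<^sub>R e)" "\<lambda>_. 0" "f' x" "f' x"] by simp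
  then show ?thesis by (metis DERIV_const DERIV_unique)
qed

text \<open>By translation invariance every difference quotient of \<open>f\<close> in direction
  \<open>e\<close> has integral zero. The quotients converge to \<open>f'\<close> and are dominated
  by a constant on a fixed ball.\<close>

lemma line_deriv_integral_zero:
  fixes f :: "'a::euclidean_space \<Rightarrow> real"
  assumes d: "has_line_deriv e f f'" and c: "continuous_on UNIV f" "continuous_on UNIV f'"
    and K: "compact K" "\<And>x. x \<notin> K \<Longrightarrow> f x = 0"
  shows "integrable lborel f'" "(\<integral>x. f' x \<partial>lborel) = 0"
proof -
  have K': "f' x = 0" if "x \<notin> K" for x
    using has_line_deriv_zero_off[OF d compact_imp_closed[OF K(1)] K(2) that] .
  show int: "integrable lborel f'" by (rule integrable_compact_support[OF c(2) K(1) K'])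
  have intf: "integrable lborel f" by (rule integrable_compact_support[OF c(1) K])
  obtain B where B: "B > 0" "\<And>x. \<bar>f' x\<bar> \<le> B"
    using compact_support_bounded[OF c(2) K(1) K'] by auto
  obtain R where R: "R > 0" "K \<subseteq> ball 0 R"
    using compact_imp_bounded[OF K(1)] bounded_subset_ballD by blast
  define X where "X = (\<lambda>n. inverse (real (Suc n)))"
  have X: "X \<longlonglongrightarrow> 0" "X n \<noteq> 0" "0 \<le> X n" "X n \<le> 1" for n
    using LIMSEQ_inverse_real_of_nat by (simp_all add: X_def field_simps)
  define q where "q = (\<lambda>n x. (f (x + X n *\<^sub>R e) - f x) / X n)"
  have qint: "integrable lborel (q n) \<and> integral\<^sup>L lborel (q n) = 0" for n
  proof -
    have m: "f \<in> borel_measurable borel" using c(1) by (rule borel_measurable_continuous_onI)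
    have s: "integrable lborel (\<lambda>x. f (x + X n *\<^sub>R e))" "(\<integral>x. f (x + X n *\<^sub>R e) \<partial>lborel) = integral\<^sup>L lborel f"
      using lborel_shift[of f "X n *\<^sub>R e"] m intf by (simp_all add: add.commute)
    then show ?thesis using intf by (simp add: q_def)
  qed
  \<comment> \<open>The steps \<open>X n\<close> are at most 1, so the shifted support stays in the
    ball enlarged by \<open>norm e\<close>.\<close>
  have bd: "\<bar>q n x\<bar> \<le> B * indicator (cball 0 (R + norm e)) x" for n x
  proof (cases "x \<in> cball 0 (R + norm e)")
    case True
    have "\<bar>f (x + X n *\<^sub>R e) - f x\<bar> \<le> B * \<bar>X n\<bar>"
      using has_line_deriv_bound[OF d B(2)] .
    then show ?thesis using True X(2-4)[of n] by (simp add: q_def divide_simps)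
  next
    case False
    have "R + norm e < norm x" using False by simp
    moreover have "norm (X n *\<^sub>R e) \<le> norm e" using X(2-4)[of n] by (simp add: mult_left_le_one_le)
    moreover have "norm x \<le> norm (x + X n *\<^sub>R e) + norm (X n *\<^sub>R e)"
      by (metis add_diff_cancel norm_triangle_ineq4)
    ultimately have "R < norm (x + X n *\<^sub>R e)" by linarith
    then have "x + X n *\<^sub>R e \<notin> K" using R(2) by auto
    moreover have "x \<notin> K" using R(2) \<open>R + norm e < norm x\<close> norm_ge_zero[of e]
      by (smt (verit) mem_ball_0 subsetD)
    ultimately show ?thesis using K(2) False by (simp add: q_def)
  qed
  have "(\<lambda>n. integral\<^sup>L lborel (q n)) \<longlonglongrightarrow> integral\<^sup>L lborel f'"
  proof (rule integral_dominated_convergence[where w="\<lambda>x. B * indicator (cball 0 (R + norm e)) x"])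
    show "integrable lborel (\<lambda>x::'a. B * indicator (cball 0 (R + norm e)) x)"
      by (intro integrable_mult_right integrable_real_indicator emeasure_bounded_finite) auto
    show "AE x in lborel. (\<lambda>n. q n x) \<longlonglongrightarrow> f' x"
      using has_line_deriv_tendsto[OF d X(1,2)] by (auto simp: q_def)
    show "q n \<in> borel_measurable lborel" for n
      using qint[of n] by (auto intro: borel_measurable_integrable)
    show "f' \<in> borel_measurable lborel"
      using int by (rule borel_measurable_integrable)
    show "AE x in lborel. norm (q n x) \<le> B * indicator (cball 0 (R + norm e)) x" for n
      using bd by simp
  qed
  then show "(\<integral>x. f' x \<partial>lborel) = 0"
    using qint by (simp add: LIMSEQ_const_iff)
qed

section \<open>Mollification\<close>

definition conv :: "('a::euclidean_space \<Rightarrow> real) \<Rightarrow> ('a \<Rightarrow> 'b::euclidean_space) \<Rightarrow> 'a \<Rightarrow> 'b" where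
  "conv k f z = (\<integral>y. k (z - y) *\<^sub>R f y \<partial>lborel)"

lemma conv_integrable:
  fixes f :: "'a::euclidean_space \<Rightarrow> 'b::euclidean_space"
  assumes "continuous_on UNIV k" "\<And>x. \<bar>k x\<bar> \<le> B" "integrable lborel f"
  shows "integrable lborel (\<lambda>y. k (z - y) *\<^sub>R f y)"
proof (rule Bochner_Integration.integrable_bound[where f="\<lambda>y. B * norm (f y)"])
  have "continuous_on UNIV (\<lambda>y. k (z - y))"
    by (rule continuous_on_compose2[OF assms(1)]) (auto intro!: continuous_intros)
  then have "(\<lambda>y. k (z - y)) \<in> borel_measurable lborel"
    by (simp add: borel_measurable_continuous_onI)
  then show "(\<lambda>y. k (z - y) *\<^sub>R f y) \<in> borel_measurable lborel"
    using borel_measurable_integrable[OF assms(3)] by (rule borel_measurable_scaleR)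
  have "norm (k (z - y) *\<^sub>R f y) \<le> norm (B * norm (f y))" for y
    using mult_right_mono[OF assms(2)[of "z - y"] norm_ge_zero[of "f y"]] by simp
  then show "AE y in lborel. norm (k (z - y) *\<^sub>R f y) \<le> norm (B * norm (f y))"
    by simp
  show "integrable lborel (\<lambda>y. B * norm (f y))"
    using assms(3) by (intro integrable_mult_right integrable_norm)
qed

lemma conv_continuous:
  fixes f :: "'a::euclidean_space \<Rightarrow> 'b::euclidean_space"
  assumes k: "continuous_on UNIV k" "\<And>x. \<bar>k x\<bar> \<le> B" and f: "integrable lborel f"
  shows "continuous_on UNIV (conv k f)"
proof (intro continuous_on_sequentiallyI)
  fix X z assume X: "X \<longlonglongrightarrow> (z::'a)"
  show "(\<lambda>n. conv k f (X n)) \<longlonglongrightarrow> conv k f z"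
    unfolding conv_def
  proof (rule integral_dominated_convergence[where w="\<lambda>y. B * norm (f y)"])
    have "(\<lambda>n. k (X n - y)) \<longlonglongrightarrow> k (z - y)" for y
      by (rule continuous_on_tendsto_compose[OF k(1)]) (auto intro!: tendsto_intros X)
    then show "AE y in lborel. (\<lambda>n. k (X n - y) *\<^sub>R f y) \<longlonglongrightarrow> k (z - y) *\<^sub>R f y"
      by (auto intro!: tendsto_intros)
    have "norm (k (X n - y) *\<^sub>R f y) \<le> B * norm (f y)" for n y
      using mult_right_mono[OF k(2)[of "X n - y"] norm_ge_zero[of "f y"]] by simp
    then show "AE y in lborel. norm (k (X n - y) *\<^sub>R f y) \<le> B * norm (f y)" for n
      by simp
    have m: "(\<lambda>y. k (x - y) *\<^sub>R f y) \<in> borel_measurable lborel" for x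
      by (rule borel_measurable_integrable[OF conv_integrable[OF k f]])
    show "(\<lambda>y. k (X n - y) *\<^sub>R f y) \<in> borel_measurable lborel" for n by (rule m)
    show "(\<lambda>y. k (z - y) *\<^sub>R f y) \<in> borel_measurable lborel" by (rule m)
    show "integrable lborel (\<lambda>y. B * norm (f y))"
      using f by (intro integrable_mult_right integrable_norm)
  qed
qed

text \<open>Differentiation under the integral sign: the mean value theorem bounds the difference
  quotients of the kernel by the bound on \<open>k'\<close>, which makes
  \<open>B * norm (f y)\<close> a dominating function.\<close>

lemma conv_line_deriv:
  fixes f :: "'a::euclidean_space \<Rightarrow> real"
  assumes k: "continuous_on UNIV k" "\<And>x. \<bar>k x\<bar> \<le> B" "continuous_on UNIV k'" "\<And>x. \<bar>k' x\<bar> \<le> B"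
    and d: "has_line_deriv e k k'" and f: "integrable lborel f"
  shows "has_line_deriv e (conv k f) (conv k' f)"
proof (rule has_line_derivI)
  fix X :: "nat \<Rightarrow> real" and z :: 'a
  assume X: "X \<longlonglongrightarrow> 0" "\<And>n. X n \<noteq> 0"
  have I: "integrable lborel (\<lambda>y. k (z - y) * f y)" "integrable lborel (\<lambda>y. k' (z - y) * f y)" for z
    using conv_integrable[OF k(1,2) f] conv_integrable[OF k(3,4) f] by simp_all
  have sh: "z + X n *\<^sub>R e - y = z - y + X n *\<^sub>R e" for n y
    by simp
  have dist: "(a * c - b * c) / d = (a - b) / d * c" for a b c d :: real
    by (simp add: left_diff_distrib diff_divide_distrib)
  have 1: "(conv k f (z + X n *\<^sub>R e) - conv k f z) / X n =
      (\<integral>y. (k (z - y + X n *\<^sub>R e) - k (z - y)) / X n * f y \<partial>lborel)" for n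
  proof -
    have "(conv k f (z + X n *\<^sub>R e) - conv k f z) / X n =
      (\<integral>y. (k (z + X n *\<^sub>R e - y) * f y - k (z - y) * f y) / X n \<partial>lborel)"
      using Bochner_Integration.integral_diff[OF I(1)[of "z + X n *\<^sub>R e"] I(1)[of z]]
      by (simp add: conv_def)
    also have "\<dots> = (\<integral>y. (k (z - y + X n *\<^sub>R e) - k (z - y)) / X n * f y \<partial>lborel)"
      unfolding sh dist ..
    finally show ?thesis .
  qed
  have 2: "(\<lambda>n. \<integral>y. (k (z - y + X n *\<^sub>R e) - k (z - y)) / X n * f y \<partial>lborel) \<longlonglongrightarrow> (\<integral>y. k' (z - y) * f y \<partial>lborel)"
  proof (rule integral_dominated_convergence[where w="\<lambda>y. B * norm (f y)"])
    show "AE y in lborel. (\<lambda>n. (k (z - y + X n *\<^sub>R e) - k (z - y)) / X n * f y) \<longlonglongrightarrow> k' (z - y) * f y"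
      by (intro AE_I2 tendsto_mult has_line_deriv_tendsto[OF d X] tendsto_const)
    have q: "\<bar>(k (x + X n *\<^sub>R e) - k x) / X n\<bar> \<le> B" for n x
      using has_line_deriv_bound[OF d k(4), of x "X n"] X(2)[of n] by (simp add: divide_simps)
    have m: "norm (a * f y) \<le> B * norm (f y)" if "\<bar>a\<bar> \<le> B" for a y
      using mult_right_mono[OF that abs_ge_zero[of "f y"]] by (simp add: abs_mult)
    show "AE y in lborel. norm ((k (z - y + X n *\<^sub>R e) - k (z - y)) / X n * f y) \<le> B * norm (f y)" for n
      by (intro AE_I2 m q)
    have eq: "(\<lambda>y. (k (z - y + X n *\<^sub>R e) - k (z - y)) / X n * f y) =
       (\<lambda>y. (k (z + X n *\<^sub>R e - y) * f y - k (z - y) * f y) / X n)" for n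
      unfolding sh dist ..
    show "(\<lambda>y. (k (z - y + X n *\<^sub>R e) - k (z - y)) / X n * f y) \<in> borel_measurable lborel" for n
      unfolding eq
      using Bochner_Integration.integrable_divide_zero[OF Bochner_Integration.integrable_diff[OF I(1)[of "z + X n *\<^sub>R e"] I(1)[of z]]]
      by (rule borel_measurable_integrable)
    show "(\<lambda>y. k' (z - y) * f y) \<in> borel_measurable lborel"
      using I(2) by (rule borel_measurable_integrable)
    show "integrable lborel (\<lambda>y. B * norm (f y))"
      using f by (intro integrable_mult_right integrable_norm)
  qed
  have 3: "conv k' f z = (\<integral>y. k' (z - y) * f y \<partial>lborel)"
    by (simp add: conv_def)
  from 2 show "(\<lambda>n. (conv k f (z + X n *\<^sub>R e) - conv k f z) / X n) \<longlonglongrightarrow> conv k' f z"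
    unfolding 1 3 .
qed

section \<open>The standard mollifier\<close>

definition mollifier :: "real \<Rightarrow> 'a::euclidean_space \<Rightarrow> real" where
  "mollifier r x = bump 0 r x / (\<integral>x. bump 0 r (x::'a) \<partial>lborel)"

text \<open>If the integral of this nonnegative function vanished, the ball on which it is positive
  would be a null set.\<close>

lemma bump_integral_pos:
  assumes "0 < r" shows "0 < (\<integral>x. bump 0 r (x::'a::euclidean_space) \<partial>lborel)"
proof -
  have b: "bump 0 r \<in> Cc_infty (UNIV :: 'a set)" using assms by (intro bump_Cc_infty) auto
  have int: "integrable lborel (bump 0 r :: 'a \<Rightarrow> real)"
    by (rule Cc_inftyE[OF b]) (rule integrable_compact_support[OF Cc_infty_continuous[OF b]])
  have "(\<integral>x. bump 0 r (x::'a) \<partial>lborel) \<noteq> 0"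
  proof
    assume "(\<integral>x. bump 0 r (x::'a) \<partial>lborel) = 0"
    then have "AE x::'a in lborel. bump 0 r x = 0"
      using integral_nonneg_eq_0_iff_AE[OF int] by (auto simp: bump_nonneg)
    then have "AE x::'a in lborel. x \<notin> ball 0 r"
      by eventually_elim (use assms bump_pos_iff[of r 0] in force)
    then have "negligible (ball (0::'a) r)"
      unfolding negligible_iff_null_sets by (subst AE_iff_null_sets) (auto intro: AE_completion)
    then show False using assms open_not_negligible[of "ball (0::'a) r"] by auto
  qed
  moreover have "0 \<le> (\<integral>x. bump 0 r (x::'a) \<partial>lborel)"
    by (intro integral_nonneg_AE) (auto simp: bump_nonneg)
  ultimately show ?thesis by linarith
qed

lemma mollifier_Cc_infty: "0 < r \<Longrightarrow> mollifier r \<in> Cc_infty (UNIV :: 'a::euclidean_space set)"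
  using Cc_infty_cmult[OF bump_Cc_infty[of r 0 UNIV], of "inverse (\<integral>x. bump 0 r (x::'a) \<partial>lborel)"]
  by (simp add: mollifier_def[abs_def] divide_inverse_commute)

lemma mollifier_nonneg: "0 \<le> mollifier r x"
  unfolding mollifier_def by (intro divide_nonneg_nonneg integral_nonneg_AE AE_I2 bump_nonneg)

lemma bump_translate: "bump 0 r (z - y) = bump z r y"
  by (simp add: bump_def inner_diff_left inner_diff_right inner_commute algebra_simps)

lemma mollifier_eq_bump: "mollifier r (z - y) = bump z r y / (\<integral>x. bump 0 r (x::'a) \<partial>lborel)"
  for z y :: "'a::euclidean_space"
  by (simp add: mollifier_def bump_translate)

lemma mollifier_even: "mollifier r (x - y) = mollifier r (y - x)"
  unfolding mollifier_eq_bump by (simp add: bump_def inner_diff_left inner_diff_right inner_commute algebra_simps)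

lemma mollifier_zero: "0 < r \<Longrightarrow> r \<le> norm x \<Longrightarrow> mollifier r x = 0"
  using bump_nonzero_subset[of r 0] by (auto simp: mollifier_def)

lemma mollifier_continuous: "0 < r \<Longrightarrow> continuous_on UNIV (mollifier r)"
  by (rule Cc_infty_continuous[OF mollifier_Cc_infty])

lemma mollifier_integrable: "0 < r \<Longrightarrow> integrable lborel (mollifier r)"
  by (rule integrable_compact_support[OF mollifier_continuous, of r "cball 0 r"])
    (auto intro: mollifier_zero)

lemma mollifier_integral: "0 < r \<Longrightarrow> (\<integral>x. mollifier r (x::'a::euclidean_space) \<partial>lborel) = 1"
  using bump_integral_pos[of r, where ?'a='a] by (simp add: mollifier_def)

lemma mollifier_shift:
  fixes z :: "'a::euclidean_space"
  assumes "0 < r"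
  shows "(\<integral>y. mollifier r (z - y) \<partial>lborel) = 1" "(\<integral>y. mollifier r (y - z) \<partial>lborel) = 1"
    "integrable lborel (\<lambda>y. mollifier r (z - y))" "integrable lborel (\<lambda>y. mollifier r (y - z))"
proof -
  have "mollifier r \<in> borel_measurable (borel :: 'a measure)"
    using mollifier_continuous[OF assms] by (rule borel_measurable_continuous_onI)
  note s = lborel_shift[OF this, of "- z"]
  show 2: "(\<integral>y. mollifier r (y - z) \<partial>lborel) = 1"
    using s(1) mollifier_integral[OF assms, where ?'a='a] by simp
  show 4: "integrable lborel (\<lambda>y. mollifier r (y - z))"
    using s(2) mollifier_integrable[OF assms, where ?'a='a] by simp
  show "(\<integral>y. mollifier r (z - y) \<partial>lborel) = 1" "integrable lborel (\<lambda>y. mollifier r (z - y))"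
    using 2 4 by (simp_all add: mollifier_even[of r z])
qed

lemma mollifier_bounded:
  assumes "0 < r"
  obtains B where "B > 0" "\<And>x::'a::euclidean_space. \<bar>mollifier r x\<bar> \<le> B"
  using compact_support_bounded[OF mollifier_continuous[OF assms], of "cball (0::'a) r"]
    mollifier_zero[OF assms] by (metis compact_cball mem_cball_0 linorder_le_cases real_norm_def)

text \<open>As a function of the integration variable the kernel is a rescaled bump centred at
  \<open>z\<close>, hence an admissible test function. This is the bridge from weak formulations to
  pointwise statements on mollifications; the sign in the second claim comes from the reflection in
  \<open>z - y\<close>.\<close>

lemma mollifier_test:
  assumes "0 < r" "cball z r \<subseteq> U"
  shows "(\<lambda>y. mollifier r (z - y)) \<in> Cc_infty U"
    and "dderiv e (\<lambda>y. mollifier r (z - y)) y = - dderiv e (mollifier r) (z - y)"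
proof -
  have "(\<lambda>y. mollifier r (z - y)) = (\<lambda>y. inverse (\<integral>x. bump 0 r (x::'a) \<partial>lborel) * bump z r y)"
    by (simp add: mollifier_eq_bump divide_inverse_commute)
  also have "\<dots> \<in> Cc_infty U"
    by (rule Cc_infty_cmult[OF bump_Cc_infty[OF assms]])
  finally show "(\<lambda>y. mollifier r (z - y)) \<in> Cc_infty U" .
  have "((\<lambda>y. mollifier r (z - y)) has_derivative (\<lambda>v. dderiv (- v) (mollifier r) (z - y))) (at y)"
    by (rule has_derivative_compose[where f="\<lambda>y. z - y" and g="mollifier r"])
       (use Cc_infty_has_derivative[OF mollifier_Cc_infty[OF assms(1)]] in \<open>auto intro!: derivative_eq_intros\<close>)
  from frechet_derivative_at[OF this, symmetric]
  have "dderiv e (\<lambda>y. mollifier r (z - y)) y = dderiv (- e) (mollifier r) (z - y)"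
    by (simp add: dderiv_def)
  also have "\<dots> = - dderiv e (mollifier r) (z - y)"
    using linear_neg[OF has_derivative_linear[OF Cc_infty_has_derivative[OF mollifier_Cc_infty[OF assms(1)]]]] .
  finally show "dderiv e (\<lambda>y. mollifier r (z - y)) y = - dderiv e (mollifier r) (z - y)" .
qed

lemma Cc_infty_has_line_deriv: "f \<in> Cc_infty U \<Longrightarrow> has_line_deriv e f (dderiv e f)"
  using Cc_infty_line_deriv by (auto simp: has_line_deriv_def)

lemma Cc_infty_dderiv_bounded:
  assumes "f \<in> Cc_infty U"
  obtains B where "B > 0" "\<And>x. \<bar>dderiv e f x\<bar> \<le> B"
proof -
  obtain K where K: "compact K" "K \<subseteq> U" "\<And>x. x \<notin> K \<Longrightarrow> f x = 0"
    using Cc_infty_support[OF assms] by blast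
  have z: "dderiv e f x = 0" if "x \<notin> K" for x
    by (rule dderiv_eq_zero_off[OF K(1,3) that])
  obtain B where "B > 0" "\<And>x. norm (dderiv e f x) \<le> B"
    using compact_support_bounded[OF Cc_infty_dderiv_continuous[OF assms] K(1) z] by metis
  then show thesis
    by (metis real_norm_def that)
qed

lemma mollify_line_deriv:
  fixes f :: "'a::euclidean_space \<Rightarrow> real"
  assumes "0 < r" "integrable lborel f"
  shows "has_line_deriv e (conv (mollifier r) f) (conv (dderiv e (mollifier r)) f)"
    and "continuous_on UNIV (conv (dderiv e (mollifier r)) f)"
proof -
  obtain B where B: "\<And>x::'a. \<bar>mollifier r x\<bar> \<le> B" using mollifier_bounded[OF assms(1)] by metis
  obtain C where C: "\<And>x::'a. \<bar>dderiv e (mollifier r) x\<bar> \<le> C"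
    using Cc_infty_dderiv_bounded[OF mollifier_Cc_infty[OF assms(1)]] by metis
  have B': "\<bar>mollifier r x\<bar> \<le> max B C" "\<bar>dderiv e (mollifier r) x\<bar> \<le> max B C" for x::'a
    using B[of x] C[of x] by linarith+
  show "has_line_deriv e (conv (mollifier r) f) (conv (dderiv e (mollifier r)) f)"
    by (rule conv_line_deriv[OF mollifier_continuous[OF assms(1)] B'(1)
          Cc_infty_dderiv_continuous[OF mollifier_Cc_infty[OF assms(1)]] B'(2)
          Cc_infty_has_line_deriv[OF mollifier_Cc_infty[OF assms(1)]] assms(2)])
  show "continuous_on UNIV (conv (dderiv e (mollifier r)) f)"
    by (rule conv_continuous[OF Cc_infty_dderiv_continuous[OF mollifier_Cc_infty[OF assms(1)]] C assms(2)])
qed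

lemma mollify_continuous:
  fixes f :: "'a::euclidean_space \<Rightarrow> 'b::euclidean_space"
  assumes "0 < r" "integrable lborel f"
  shows "continuous_on UNIV (conv (mollifier r) f)"
proof -
  obtain B where B: "\<And>x::'a. \<bar>mollifier r x\<bar> \<le> B" using mollifier_bounded[OF assms(1)] by metis
  show ?thesis by (rule conv_continuous[OF mollifier_continuous[OF assms(1)] B assms(2)])
qed

lemma mollify_integrable_kernel:
  fixes f :: "'a::euclidean_space \<Rightarrow> 'b::euclidean_space"
  assumes "0 < r" "integrable lborel f"
  shows "integrable lborel (\<lambda>y. mollifier r (z - y) *\<^sub>R f y)"
proof -
  obtain B where B: "\<And>x::'a. \<bar>mollifier r x\<bar> \<le> B" using mollifier_bounded[OF assms(1)] by metis
  show ?thesis by (rule conv_integrable[OF mollifier_continuous[OF assms(1)] B assms(2)])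
qed

text \<open>Tonelli's theorem moves the outer integral onto the kernel, which has mass 1.\<close>

lemma mollify_L1:
  fixes f :: "'a::euclidean_space \<Rightarrow> 'b::euclidean_space"
  assumes r: "0 < r" and f: "integrable lborel f"
  shows "integrable lborel (conv (mollifier r) f)"
    and "(\<integral>z. norm (conv (mollifier r) f z) \<partial>lborel) \<le> (\<integral>z. norm (f z) \<partial>lborel)"
proof -
  have [measurable]: "f \<in> borel_measurable borel" using f by auto
  have [measurable]: "mollifier r \<in> borel_measurable (borel :: 'a measure)"
    using mollifier_continuous[OF r] by (rule borel_measurable_continuous_onI)
  have mc[measurable]: "conv (mollifier r) f \<in> borel_measurable borel"
    using mollify_continuous[OF r f] by (rule borel_measurable_continuous_onI)
  have "(\<integral>\<^sup>+z. ennreal (norm (conv (mollifier r) f z)) \<partial>lborel)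
      \<le> (\<integral>\<^sup>+z. (\<integral>\<^sup>+y. ennreal (mollifier r (z - y)) * ennreal (norm (f y)) \<partial>lborel) \<partial>lborel)"
  proof (rule nn_integral_mono)
    fix z :: 'a
    have "norm (conv (mollifier r) f z) \<le> (\<integral>y. norm (mollifier r (z - y) *\<^sub>R f y) \<partial>lborel)"
      unfolding conv_def by (rule integral_norm_bound)
    then have "ennreal (norm (conv (mollifier r) f z)) \<le> ennreal (\<integral>y. norm (mollifier r (z - y) *\<^sub>R f y) \<partial>lborel)"
      by (rule ennreal_leI)
    also have "\<dots> = (\<integral>\<^sup>+y. ennreal (norm (mollifier r (z - y) *\<^sub>R f y)) \<partial>lborel)"
      by (rule nn_integral_eq_integral[symmetric]) (use integrable_norm[OF mollify_integrable_kernel[OF r f, of z]] in auto)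
    also have "\<dots> = (\<integral>\<^sup>+y. ennreal (mollifier r (z - y)) * ennreal (norm (f y)) \<partial>lborel)"
      by (simp add: ennreal_mult mollifier_nonneg)
    finally show "ennreal (norm (conv (mollifier r) f z)) \<le> \<dots>" .
  qed
  also have "\<dots> = (\<integral>\<^sup>+y. (\<integral>\<^sup>+z. ennreal (mollifier r (z - y)) * ennreal (norm (f y)) \<partial>lborel) \<partial>lborel)"
    by (rule lborel_pair.Fubini') measurable
  also have "\<dots> = (\<integral>\<^sup>+y. ennreal (norm (f y)) \<partial>lborel)"
  proof (rule nn_integral_cong)
    fix y :: 'a
    have "(\<integral>\<^sup>+z. ennreal (mollifier r (z - y)) \<partial>lborel) = 1"
      using nn_integral_eq_integral[OF mollifier_shift(4)[OF r, of y]] mollifier_shift(2)[OF r, of y]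
      by (simp add: mollifier_nonneg)
    then show "(\<integral>\<^sup>+z. ennreal (mollifier r (z - y)) * ennreal (norm (f y)) \<partial>lborel) = ennreal (norm (f y))"
      by (subst nn_integral_multc) auto
  qed
  also have "\<dots> = ennreal (\<integral>z. norm (f z) \<partial>lborel)"
    by (rule nn_integral_eq_integral) (use f in auto)
  finally have le: "(\<integral>\<^sup>+z. ennreal (norm (conv (mollifier r) f z)) \<partial>lborel) \<le> ennreal (\<integral>z. norm (f z) \<partial>lborel)" .
  then show int: "integrable lborel (conv (mollifier r) f)"
    by (intro integrableI_bounded) (auto simp: le_less_trans[OF _ ennreal_less_top])
  show "(\<integral>z. norm (conv (mollifier r) f z) \<partial>lborel) \<le> (\<integral>z. norm (f z) \<partial>lborel)"
    using le nn_integral_eq_integral[OF integrable_norm[OF int]] by (simp add: integral_nonneg_AE)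
qed

lemma conv_diff:
  fixes f h :: "'a::euclidean_space \<Rightarrow> 'b::euclidean_space"
  assumes "0 < r" "integrable lborel f" "integrable lborel h"
  shows "conv (mollifier r) (\<lambda>y. f y - h y) z = conv (mollifier r) f z - conv (mollifier r) h z"
  using Bochner_Integration.integral_diff[OF mollify_integrable_kernel[OF assms(1,2), of z] mollify_integrable_kernel[OF assms(1,3), of z]]
  by (simp add: conv_def scaleR_diff_right)

lemma integrable_bounded_support:
  assumes [measurable]: "f \<in> borel_measurable borel" and "bounded S"
    and "\<And>x. norm (f x) \<le> B" "\<And>x. x \<notin> S \<Longrightarrow> f x = 0"
  shows "integrable lborel (f :: 'a::euclidean_space \<Rightarrow> 'b::euclidean_space)"
proof -
  obtain R where R: "R > 0" "S \<subseteq> ball 0 R" using bounded_subset_ballD[OF assms(2)] by blast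
  have i: "integrable lborel (\<lambda>x::'a. B * indicator (ball 0 R) x)"
    by (intro integrable_mult_right integrable_real_indicator emeasure_bounded_finite) auto
  have "norm (f x) \<le> norm (B * indicator (ball 0 R) x)" for x
  proof (cases "x \<in> S")
    case True
    then have "x \<in> ball 0 R" using R by blast
    then show ?thesis using assms(3)[of x] by (auto simp: indicator_def)
  next
    case False
    then show ?thesis using assms(4)[of x] by simp
  qed
  then show ?thesis
    by (intro Bochner_Integration.integrable_bound[OF i]) auto
qed

section \<open>Convergence of mollifications in L^1\<close>

text \<open>Truncating domain and values reduces to a bounded function \<open>F n\<close> of bounded
  support. This is an almost everywhere limit of continuous functions; once those are confined to a
  common height and a common ball, dominated convergence makes the approximation one in L^1.\<close>

lemma integrable_approx_continuous:
  fixes f :: "'a::euclidean_space \<Rightarrow> 'b::euclidean_space"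
  assumes f: "integrable lborel f" and e: "0 < e"
  obtains g K where "continuous_on UNIV g" "compact K" "\<And>x. x \<notin> K \<Longrightarrow> g x = 0"
    "(\<integral>x. norm (f x - g x) \<partial>lborel) < e"
proof -
  have [measurable]: "f \<in> borel_measurable borel" using borel_measurable_integrable[OF f] by simp
  define F where "F = (\<lambda>n::nat. \<lambda>x. if norm x \<le> real n \<and> norm (f x) \<le> real n then f x else 0)"
  have [measurable]: "F n \<in> borel_measurable borel" for n unfolding F_def by measurable
  have 1: "(\<lambda>n. \<integral>x. norm (f x - F n x) \<partial>lborel) \<longlonglongrightarrow> (\<integral>x. 0 \<partial>(lborel :: 'a measure))"
  proof (rule integral_dominated_convergence[where w="\<lambda>x. norm (f x)"])
    show "AE x in lborel. (\<lambda>n. norm (f x - F n x)) \<longlonglongrightarrow> 0"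
    proof (rule AE_I2)
      fix x
      obtain N :: nat where N: "max (norm x) (norm (f x)) \<le> real N" using real_arch_simple by blast
      have "norm (f x - F n x) = 0" if "n \<ge> N" for n
      proof -
        have "real N \<le> real n" using that by simp
        then show ?thesis using N by (simp add: F_def)
      qed
      then show "(\<lambda>n. norm (f x - F n x)) \<longlonglongrightarrow> 0"
        by (intro tendsto_eventually eventually_sequentiallyI)
    qed
    show "AE x in lborel. norm (norm (f x - F n x)) \<le> norm (f x)" for n
      by (rule AE_I2) (simp add: F_def)
    show "integrable lborel (\<lambda>x. norm (f x))" using f by (rule integrable_norm)
  qed measurable
  have "\<forall>\<^sub>F n in sequentially. (\<integral>x. norm (f x - F n x) \<partial>lborel) < e / 2"
    using order_tendstoD(2)[OF 1, of "e/2"] e by simp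
  then obtain n where n: "n \<ge> 1" "(\<integral>x. norm (f x - F n x) \<partial>lborel) < e / 2"
    using eventually_conj[OF eventually_ge_at_top[of 1]] by (metis (mono_tags, lifting) eventually_sequentially order_refl)
  have "F n measurable_on UNIV"
    by (rule lebesgue_measurable_imp_measurable_on) (auto intro!: measurable_completion)
  then obtain N g where N: "negligible N" and g: "\<And>m. continuous_on UNIV (g m)"
    and gF: "\<And>x. x \<notin> N \<Longrightarrow> (\<lambda>m. g m x) \<longlonglongrightarrow> F n x"
    unfolding measurable_on_def by auto
  \<comment> \<open>The radial retraction onto the ball of radius \<open>n\<close>: continuous
    because \<open>n \<ge> 1\<close>, and the identity on the values of \<open>F n\<close>. The
    factor \<open>cut\<close> is a continuous substitute for the indicator of the ball that carries
    \<open>F n\<close>.\<close>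
  define clip where "clip = (\<lambda>y::'b. (real n / max (real n) (norm y)) *\<^sub>R y)"
  define cut where "cut = (\<lambda>x::'a. max 0 (min 1 (real n + 1 - norm x)))"
  define G where "G = (\<lambda>m x. cut x *\<^sub>R clip (g m x))"
  have clipc: "continuous_on UNIV clip"
    unfolding clip_def using n(1) by (intro continuous_intros) (auto simp: max_def)
  have clipn: "norm (clip y) \<le> real n" for y
    using n(1) by (auto simp: clip_def max_def field_simps)
  have clipid: "clip y = y" if "norm y \<le> real n" for y
    using n(1) that by (simp add: clip_def max_def)
  have Gc: "continuous_on UNIV (G m)" for m
    unfolding G_def cut_def
    by (intro continuous_intros continuous_on_compose2[OF clipc g]) auto
  have Gm[measurable]: "G m \<in> borel_measurable borel" for m
    using Gc by (rule borel_measurable_continuous_onI)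
  have cutb: "0 \<le> cut x" "cut x \<le> 1" for x by (auto simp: cut_def)
  have Gn: "norm (G m x) \<le> real n" for m x
    using mult_mono[OF cutb(2)[of x] clipn[of "g m x"]] cutb(1)[of x] by (simp add: G_def)
  have G0: "G m x = 0" if "x \<notin> cball 0 (real n + 1)" for m x
    using that by (simp add: G_def cut_def)
  have Fn: "norm (F n x) \<le> real n" for x by (simp add: F_def)
  have F0: "F n x = 0" if "x \<notin> cball 0 (real n + 1)" for x
    using that by (simp add: F_def)
  have Glim: "(\<lambda>m. G m x) \<longlonglongrightarrow> F n x" if "x \<notin> N" for x
  proof -
    have "(\<lambda>m. clip (g m x)) \<longlonglongrightarrow> clip (F n x)"
      by (rule continuous_on_tendsto_compose[OF clipc gF[OF that]]) auto
    then have "(\<lambda>m. G m x) \<longlonglongrightarrow> cut x *\<^sub>R clip (F n x)"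
      unfolding G_def by (intro tendsto_intros)
    also have "cut x *\<^sub>R clip (F n x) = F n x"
      using clipid[OF Fn] by (simp add: F_def cut_def)
    finally show ?thesis .
  qed
  have Nae: "AE x in lborel. x \<notin> N"
    using N unfolding negligible_iff_null_sets by (metis AE_completion_iff AE_not_in)
  have iG: "integrable lborel (G m)" for m
    by (rule integrable_bounded_support[OF Gm bounded_cball Gn G0])
  have iF: "integrable lborel (F n)"
    by (rule integrable_bounded_support[OF _ bounded_cball Fn F0]) measurable
  have 2: "(\<lambda>m. \<integral>x. norm (F n x - G m x) \<partial>lborel) \<longlonglongrightarrow> (\<integral>x. 0 \<partial>(lborel :: 'a measure))"
  proof (rule integral_dominated_convergence[where w="\<lambda>x. 2 * real n * indicator (cball 0 (real n + 1)) x"])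
    show "AE x in lborel. (\<lambda>m. norm (F n x - G m x)) \<longlonglongrightarrow> 0"
      using Nae
    proof eventually_elim
      fix x assume "x \<notin> N"
      then have "(\<lambda>m. norm (F n x - G m x)) \<longlonglongrightarrow> norm (F n x - F n x)"
        by (intro tendsto_intros Glim)
      then show "(\<lambda>m. norm (F n x - G m x)) \<longlonglongrightarrow> 0" by simp
    qed
    have "norm (norm (F n x - G m x)) \<le> 2 * real n * indicator (cball 0 (real n + 1)) x" for m x
      using norm_triangle_ineq4[of "F n x" "G m x"] Fn[of x] Gn[of m x] F0[of x] G0[of x m]
      by (cases "x \<in> cball 0 (real n + 1)") (simp_all del: mem_cball)
    then show "AE x in lborel. norm (norm (F n x - G m x)) \<le> 2 * real n * indicator (cball 0 (real n + 1)) x" for m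
      by (intro AE_I2)
    show "integrable lborel (\<lambda>x::'a. 2 * real n * indicator (cball 0 (real n + 1)) x)"
      by (intro integrable_mult_right integrable_real_indicator emeasure_bounded_finite) auto
  qed measurable
  have "\<forall>\<^sub>F m in sequentially. (\<integral>x. norm (F n x - G m x) \<partial>lborel) < e / 2"
    using order_tendstoD(2)[OF 2, of "e/2"] e by simp
  then obtain m where m: "(\<integral>x. norm (F n x - G m x) \<partial>lborel) < e / 2"
    by (metis (mono_tags, lifting) eventually_sequentially order_refl)
  have "(\<integral>x. norm (f x - G m x) \<partial>lborel) \<le> (\<integral>x. norm (f x - F n x) + norm (F n x - G m x) \<partial>lborel)"
  proof (rule integral_mono)
    show "norm (f x - G m x) \<le> norm (f x - F n x) + norm (F n x - G m x)" for x
      using norm_triangle_ineq[of "f x - F n x" "F n x - G m x"] by simp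
  qed (intro integrable_norm Bochner_Integration.integrable_add Bochner_Integration.integrable_diff f iF iG)+
  also have "\<dots> = (\<integral>x. norm (f x - F n x) \<partial>lborel) + (\<integral>x. norm (F n x - G m x) \<partial>lborel)"
    by (intro Bochner_Integration.integral_add integrable_norm Bochner_Integration.integrable_diff f iF iG)
  also have "\<dots> < e" using n(2) m by simp
  finally show thesis
    by (intro that[OF Gc compact_cball G0])
qed

text \<open>The radii \<open>1 / (k + 1)\<close> make the mollification a sequence, so that almost
  everywhere convergent subsequences can be extracted.\<close>

definition moll :: "nat \<Rightarrow> ('a::euclidean_space \<Rightarrow> 'b::euclidean_space) \<Rightarrow> 'a \<Rightarrow> 'b" where
  "moll k = conv (mollifier (inverse (real (Suc k))))"

text \<open>Uniform continuity makes the difference uniformly small, and radii at most 1 confine it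
  to one ball of finite volume.\<close>

lemma mollify_tendsto_continuous:
  fixes g :: "'a::euclidean_space \<Rightarrow> 'b::euclidean_space"
  assumes g: "continuous_on UNIV g" and K: "compact K" "\<And>x. x \<notin> K \<Longrightarrow> g x = 0"
  shows "(\<lambda>k. \<integral>z. norm (moll k g z - g z) \<partial>lborel) \<longlonglongrightarrow> 0"
proof -
  obtain R where R: "R > 0" "K \<subseteq> ball 0 R" using bounded_subset_ballD[OF compact_imp_bounded[OF K(1)]] by blast
  have gR: "g x = 0" if "norm x \<ge> R" for x
    using K(2)[of x] R that by force
  have ig: "integrable lborel g" by (rule integrable_compact_support[OF g K])
  let ?V = "measure lborel (cball (0::'a) (R + 1))"
  show ?thesis
  proof (rule LIMSEQ_I)
    fix e :: real assume e: "0 < e"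
    \<comment> \<open>Half of \<open>e\<close> spread over the volume of the ball; the summand 1
      makes the denominator visibly positive.\<close>
    define \<delta> where "\<delta> = e / (2 * (?V + 1))"
    have V: "?V \<ge> 0" by simp
    have \<delta>: "\<delta> > 0" using e V unfolding \<delta>_def by (intro divide_pos_pos mult_pos_pos) linarith+
    have "uniformly_continuous_on (cball 0 (R + 1)) g"
      using g by (intro compact_uniformly_continuous) (auto intro: continuous_on_subset)
    then obtain d where d: "d > 0" "\<And>x y. x \<in> cball 0 (R + 1) \<Longrightarrow> y \<in> cball 0 (R + 1) \<Longrightarrow> dist y x < d \<Longrightarrow> dist (g y) (g x) < \<delta>"
      unfolding uniformly_continuous_on_def using \<delta> by metis
    obtain k0 where k0: "inverse (real (Suc k0)) < d" using reals_Archimedean[OF d(1)] by blast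
    have main: "norm (moll k g z - g z) \<le> \<delta> * indicator (cball 0 (R + 1)) z" if k: "k \<ge> k0" for k z
    proof -
      define r where "r = inverse (real (Suc k))"
      have "r \<le> inverse (real (Suc k0))" using k unfolding r_def by (intro le_imp_inverse_le) auto
      then have "r < d" using k0 by linarith
      then have r: "r > 0" "r < d" "r \<le> 1" by (auto simp: r_def inverse_le_1_iff)
      have i1: "integrable lborel (\<lambda>y. mollifier r (z - y) *\<^sub>R g y)" by (rule mollify_integrable_kernel[OF r(1) ig])
      have i2: "integrable lborel (\<lambda>y. mollifier r (z - y) *\<^sub>R g z)"
        by (rule integrable_scaleR_left) (use mollifier_shift(3)[OF r(1)] in blast)
      have "moll k g z - g z = (\<integral>y. mollifier r (z - y) *\<^sub>R g y \<partial>lborel) - (\<integral>y. mollifier r (z - y) *\<^sub>R g z \<partial>lborel)"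
        using mollifier_shift(1)[OF r(1), of z] mollifier_shift(3)[OF r(1), of z]
        by (simp add: moll_def conv_def r_def)
      also have "\<dots> = (\<integral>y. mollifier r (z - y) *\<^sub>R (g y - g z) \<partial>lborel)"
        by (subst Bochner_Integration.integral_diff[OF i1 i2, symmetric]) (simp add: scaleR_diff_right)
      finally have eq: "moll k g z - g z = (\<integral>y. mollifier r (z - y) *\<^sub>R (g y - g z) \<partial>lborel)" .
      show ?thesis
      proof (cases "z \<in> cball 0 (R + 1)")
        case True
        have pt: "norm (mollifier r (z - y) *\<^sub>R (g y - g z)) \<le> \<delta> * mollifier r (z - y)" for y
        proof (cases "norm (z - y) < r")
          case nr: True
          have "norm (g y - g z) \<le> \<delta>"
          proof (cases "y \<in> cball 0 (R + 1)")
            case True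
            then show ?thesis using d(2)[OF \<open>z \<in> cball 0 (R + 1)\<close> True] nr r by (simp add: dist_norm norm_minus_commute)
          next
            \<comment> \<open>Both values vanish: \<open>y\<close> is beyond \<open>R + 1\<close>
              and \<open>z\<close> closer to it than 1, so \<open>z\<close> is beyond
              \<open>R\<close>.\<close>
            case False
            then have "norm y > R + 1" by simp
            then have "norm z > R" using nr r norm_triangle_ineq2[of y z] by (simp add: norm_minus_commute)
            then show ?thesis using gR[of y] gR[of z] \<open>norm y > R + 1\<close> \<delta> by simp
          qed
          then show ?thesis using mult_right_mono[OF _ mollifier_nonneg[of r "z - y"], of "norm (g y - g z)" \<delta>]
              mollifier_nonneg[of r "z - y"] by (simp add: mult.commute)
        next
          case False
          then show ?thesis using mollifier_zero[OF r(1), of "z - y"] by simp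
        qed
        have "norm (moll k g z - g z) \<le> (\<integral>y. \<delta> * mollifier r (z - y) \<partial>lborel)"
          unfolding eq
        proof (rule order_trans[OF integral_norm_bound integral_mono])
          show "integrable lborel (\<lambda>y. norm (mollifier r (z - y) *\<^sub>R (g y - g z)))"
            using Bochner_Integration.integrable_diff[OF i1 i2] by (intro integrable_norm) (simp add: scaleR_diff_right)
          show "integrable lborel (\<lambda>y. \<delta> * mollifier r (z - y))"
            by (intro integrable_mult_right mollifier_shift(3)[OF r(1)])
        qed (rule pt)
        also have "\<dots> = \<delta>" using mollifier_shift(1)[OF r(1), of z] by simp
        finally show ?thesis using True by simp
      next
        case False
        then have nz: "norm z > R + 1" by simp
        have "mollifier r (z - y) *\<^sub>R (g y - g z) = 0" for y
        proof (cases "norm (z - y) < r")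
          case True
          then have "norm y > R" using nz r norm_triangle_ineq2[of z y] by simp
          then show ?thesis using gR[of y] gR[of z] nz by simp
        next
          case False
          then show ?thesis using mollifier_zero[OF r(1), of "z - y"] by simp
        qed
        then have "(\<lambda>y. mollifier r (z - y) *\<^sub>R (g y - g z)) = (\<lambda>y. 0)" by blast
        then show ?thesis using False \<delta> unfolding eq by simp
      qed
    qed
    show "\<exists>no. \<forall>k\<ge>no. norm ((\<integral>z. norm (moll k g z - g z) \<partial>lborel) - 0) < e"
    proof (intro exI allI impI)
      fix k assume k: "k \<ge> k0"
      have ik: "integrable lborel (moll k g)" unfolding moll_def by (rule mollify_L1[OF _ ig]) simp
      have "(\<integral>z. norm (moll k g z - g z) \<partial>lborel) \<le> (\<integral>z. \<delta> * indicator (cball 0 (R + 1)) z \<partial>(lborel :: 'a measure))"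
      proof (rule integral_mono)
        show "integrable lborel (\<lambda>z. norm (moll k g z - g z))"
          by (intro integrable_norm Bochner_Integration.integrable_diff ik ig)
        show "integrable lborel (\<lambda>z::'a. \<delta> * indicator (cball 0 (R + 1)) z)"
          by (intro integrable_mult_right integrable_real_indicator emeasure_bounded_finite) auto
      qed (use main[OF k] in blast)
      also have "\<dots> = \<delta> * ?V" by simp
      also have "\<dots> \<le> \<delta> * (?V + 1)" using \<delta> by simp
      also have "\<dots> = e / 2"
      proof -
        have "e / (2 * v) * v = e / 2" if "v \<noteq> 0" for v using that by simp
        moreover have "?V + 1 \<noteq> 0" using V by linarith
        ultimately show ?thesis unfolding \<delta>_def by blast
      qed
      also have "\<dots> < e" using e by simp
      finally have "(\<integral>z. norm (moll k g z - g z) \<partial>lborel) < e" .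
      moreover have "0 \<le> (\<integral>z. norm (moll k g z - g z) \<partial>lborel)" by (rule integral_nonneg_AE) simp
      ultimately show "norm ((\<integral>z. norm (moll k g z - g z) \<partial>lborel) - 0) < e" by simp
    qed
  qed
qed

lemma moll_integrable:
  fixes f :: "'a::euclidean_space \<Rightarrow> 'b::euclidean_space"
  assumes "integrable lborel f"
  shows "integrable lborel (moll k f)"
  unfolding moll_def by (rule mollify_L1[OF _ assms]) simp

lemma moll_L1:
  fixes f :: "'a::euclidean_space \<Rightarrow> 'b::euclidean_space"
  assumes "integrable lborel f"
  shows "(\<integral>z. norm (moll k f z) \<partial>lborel) \<le> (\<integral>z. norm (f z) \<partial>lborel)"
  unfolding moll_def by (rule mollify_L1[OF _ assms]) simp

lemma moll_diff:
  fixes f h :: "'a::euclidean_space \<Rightarrow> 'b::euclidean_space"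
  assumes "integrable lborel f" "integrable lborel h"
  shows "moll k (\<lambda>y. f y - h y) z = moll k f z - moll k h z"
  unfolding moll_def by (rule conv_diff[OF _ assms]) simp

text \<open>Density argument: for the remainder \<open>f - g\<close> the mollification is controlled
  by the L^1 contraction, so only a continuous \<open>g\<close> of compact support needs true
  convergence.\<close>

theorem moll_tendsto:
  fixes f :: "'a::euclidean_space \<Rightarrow> 'b::euclidean_space"
  assumes f: "integrable lborel f"
  shows "(\<lambda>k. \<integral>z. norm (moll k f z - f z) \<partial>lborel) \<longlonglongrightarrow> 0"
proof (rule LIMSEQ_I)
  fix e :: real assume e: "0 < e"
  obtain g K where g: "continuous_on UNIV g" "compact K" "\<And>x. x \<notin> K \<Longrightarrow> g x = 0"
    and fg: "(\<integral>x. norm (f x - g x) \<partial>lborel) < e / 3"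
    using integrable_approx_continuous[OF f, of "e/3"] e by auto
  have ig: "integrable lborel g" by (rule integrable_compact_support[OF g])
  note ifg = Bochner_Integration.integrable_diff[OF f ig]
  have "\<forall>\<^sub>F k in sequentially. (\<integral>z. norm (moll k g z - g z) \<partial>lborel) < e / 3"
    using order_tendstoD(2)[OF mollify_tendsto_continuous[OF g], of "e/3"] e by simp
  then obtain k0 where k0: "\<And>k. k \<ge> k0 \<Longrightarrow> (\<integral>z. norm (moll k g z - g z) \<partial>lborel) < e / 3"
    unfolding eventually_sequentially by blast
  show "\<exists>no. \<forall>k\<ge>no. norm ((\<integral>z. norm (moll k f z - f z) \<partial>lborel) - 0) < e"
  proof (intro exI allI impI)
    fix k assume k: "k \<ge> k0"
    note a = integrable_norm[OF moll_integrable[OF ifg, of k]]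
      integrable_norm[OF Bochner_Integration.integrable_diff[OF moll_integrable[OF ig, of k] ig]]
      integrable_norm[OF ifg]
    have "(\<integral>z. norm (moll k f z - f z) \<partial>lborel) \<le>
      (\<integral>z. norm (moll k (\<lambda>y. f y - g y) z) + norm (moll k g z - g z) + norm (f z - g z) \<partial>lborel)"
    proof (rule integral_mono)
      show "integrable lborel (\<lambda>z. norm (moll k f z - f z))"
        by (intro integrable_norm Bochner_Integration.integrable_diff moll_integrable f)
      show "integrable lborel (\<lambda>z. norm (moll k (\<lambda>y. f y - g y) z) + norm (moll k g z - g z) + norm (f z - g z))"
        by (intro Bochner_Integration.integrable_add a)
      fix z
      have "moll k f z - f z = moll k (\<lambda>y. f y - g y) z + (moll k g z - g z) - (f z - g z)"
        by (simp add: moll_diff[OF f ig])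
      then show "norm (moll k f z - f z) \<le> norm (moll k (\<lambda>y. f y - g y) z) + norm (moll k g z - g z) + norm (f z - g z)"
        using norm_triangle_ineq4[of "moll k (\<lambda>y. f y - g y) z + (moll k g z - g z)" "f z - g z"]
          norm_triangle_ineq[of "moll k (\<lambda>y. f y - g y) z" "moll k g z - g z"] by simp
    qed
    also have "\<dots> = (\<integral>z. norm (moll k (\<lambda>y. f y - g y) z) \<partial>lborel) + (\<integral>z. norm (moll k g z - g z) \<partial>lborel)
        + (\<integral>z. norm (f z - g z) \<partial>lborel)"
      by (subst Bochner_Integration.integral_add[OF Bochner_Integration.integrable_add[OF a(1,2)] a(3)],
          subst Bochner_Integration.integral_add[OF a(1,2)]) simp
    also have "\<dots> < e"
      using moll_L1[OF ifg, of k] k0[OF k] fg by linarith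
    finally have "(\<integral>z. norm (moll k f z - f z) \<partial>lborel) < e" .
    moreover have "0 \<le> (\<integral>z. norm (moll k f z - f z) \<partial>lborel)" by (rule integral_nonneg_AE) simp
    ultimately show "norm ((\<integral>z. norm (moll k f z - f z) \<partial>lborel) - 0) < e" by simp
  qed
qed

lemma moll_subseq:
  fixes f :: "'a::euclidean_space \<Rightarrow> 'b::euclidean_space"
  assumes f: "integrable lborel f"
  obtains s :: "nat \<Rightarrow> nat" where "strict_mono s" "AE z in lborel. (\<lambda>k. moll (s k) f z) \<longlonglongrightarrow> f z"
proof -
  obtain s :: "nat \<Rightarrow> nat" where s: "strict_mono s" "AE z in lborel. (\<lambda>k. moll (s k) f z - f z) \<longlonglongrightarrow> 0"
    using tendsto_L1_AE_subseq[OF Bochner_Integration.integrable_diff[OF moll_integrable[OF f] f] moll_tendsto[OF f]] by blast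
  have "AE z in lborel. (\<lambda>k. moll (s k) f z) \<longlonglongrightarrow> f z"
    using s(2) by eventually_elim (rule LIM_zero_cancel)
  with s(1) show thesis by (rule that)
qed

section \<open>The structure conditions\<close>

text \<open>In this setting the lower exponent is assumed in the form \<open>1 < g0\<close>, which
  is what \<open>2n / (n + 2) < g0\<close> yields in dimension at least 2.\<close>

locale growth =
  fixes A :: "'a::euclidean_space \<Rightarrow> 'a" and DA :: "'a \<Rightarrow> 'a \<Rightarrow>\<^sub>L 'a"
    and g g' :: "real \<Rightarrow> real" and g0 g1 \<nu> L :: real
  assumes g_nonneg: "\<And>s. s \<ge> 0 \<Longrightarrow> g s \<ge> 0"
    and g_pos: "\<And>s. s > 0 \<Longrightarrow> g s > 0"
    and g_deriv_within: "\<And>s. s \<ge> 0 \<Longrightarrow> (g has_real_derivative g' s) (at s within {0..})"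
    and g'_cont: "continuous_on {0..} g'"
    and g_growth: "\<And>s. s > 0 \<Longrightarrow> g0 - 1 \<le> s * g' s / g s \<and> s * g' s / g s \<le> g1 - 1"
    and g0_gt: "1 < g0"
    and A_deriv: "\<And>\<xi>. (A has_derivative blinfun_apply (DA \<xi>)) (at \<xi>)"
    and A_zero: "A 0 = 0"
    and \<nu>_pos: "0 < \<nu>" and L_ge: "1 \<le> L"
    and elliptic: "\<And>\<xi> \<zeta>. \<xi> \<noteq> 0 \<Longrightarrow>
           blinfun_apply (DA \<xi>) \<zeta> \<bullet> \<zeta> \<ge> \<nu> * (g (norm \<xi>) / norm \<xi>) * (norm \<zeta>)\<^sup>2"
    and DA_bound: "\<And>\<xi>. \<xi> \<noteq> 0 \<Longrightarrow> norm (DA \<xi>) \<le> L * (g (norm \<xi>) / norm \<xi>)"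
begin

lemma g1_gt: "1 < g1"
  using g_growth[of 1] g0_gt by linarith

lemma g_cont: "continuous_on {0..} g"
  using g_deriv_within by (meson DERIV_continuous atLeast_iff continuous_on_eq_continuous_within)

lemma g_deriv: "s > 0 \<Longrightarrow> (g has_real_derivative g' s) (at s)"
  using g_deriv_within[of s] at_within_interior[of s "{0..}"] by simp

lemma g'_lower: "s > 0 \<Longrightarrow> (g0 - 1) * g s \<le> s * g' s"
  using g_growth[of s] g_pos[of s] by (simp add: pos_le_divide_eq)

lemma g'_upper: "s > 0 \<Longrightarrow> s * g' s \<le> (g1 - 1) * g s"
  using g_growth[of s] g_pos[of s] by (simp add: pos_divide_le_eq)

lemma g'_pos: "s > 0 \<Longrightarrow> 0 < g' s"
  using g'_lower[of s] g_pos[of s] g0_gt by (smt (verit) mult_pos_pos zero_less_mult_pos)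

text \<open>The inequality \<open>(g0 - 1) g(s) \<le> s g'(s)\<close> passes to the limit at 0 from
  the right, where the right side vanishes by continuity of \<open>g'\<close>; the factor
  \<open>g0 - 1\<close> is positive.\<close>

lemma g_zero: "g 0 = 0"
proof -
  have c: "continuous_on {0..} (\<lambda>s. s * g' s - (g0 - 1) * g s)"
    by (intro continuous_intros g_cont g'_cont)
  have "((\<lambda>s. s * g' s - (g0 - 1) * g s) \<longlongrightarrow> 0 * g' 0 - (g0 - 1) * g 0) (at 0 within {0..})"
    using c unfolding continuous_on_def by (metis atLeast_iff order_refl)
  then have "((\<lambda>s. s * g' s - (g0 - 1) * g s) \<longlongrightarrow> 0 * g' 0 - (g0 - 1) * g 0) (at_right 0)"
    by (rule tendsto_within_subset) auto
  then have "0 \<le> 0 * g' 0 - (g0 - 1) * g 0"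
  proof (rule tendsto_lowerbound)
    show "\<forall>\<^sub>F s in at_right 0. 0 \<le> s * g' s - (g0 - 1) * g s"
      unfolding eventually_at_filter using g'_lower by (intro always_eventually) auto
  qed simp
  then have "g 0 \<le> 0" using g0_gt by (simp add: mult_le_0_iff)
  then show ?thesis using g_nonneg[of 0] by simp
qed

lemma g_mono: "0 \<le> s \<Longrightarrow> s \<le> t \<Longrightarrow> g s \<le> g t"
proof (cases "s = t")
  case False
  assume st: "0 \<le> s" "s \<le> t"
  show ?thesis
  proof (rule DERIV_nonneg_imp_increasing_open[of s t g])
    show "\<exists>y. (g has_real_derivative y) (at x) \<and> 0 \<le> y" if "s < x" "x < t" for x
      using g_deriv[of x] g'_pos[of x] that st by fastforce
    show "continuous_on {s..t} g" using st by (auto intro: continuous_on_subset[OF g_cont])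
  qed (use st in auto)
qed simp

definition h :: "real \<Rightarrow> real" where "h s = s * g s"

lemma h_nonneg: "0 \<le> s \<Longrightarrow> 0 \<le> h s"
  by (simp add: h_def g_nonneg)

text \<open>By monotonicity of \<open>g\<close>, the product is at most \<open>h\<close> of the
  larger argument.\<close>

lemma young: "0 \<le> s \<Longrightarrow> 0 \<le> r \<Longrightarrow> g s * r \<le> h s + h r"
proof (cases "r \<le> s")
  case True
  assume "0 \<le> s" "0 \<le> r"
  then have "g s * r \<le> g s * s" using True g_nonneg by (intro mult_left_mono) auto
  then show ?thesis using h_nonneg[OF \<open>0 \<le> r\<close>] by (simp add: h_def mult.commute)
next
  case False
  assume a: "0 \<le> s" "0 \<le> r"
  then have "g s * r \<le> g r * r" using False g_mono by (intro mult_right_mono) auto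
  then show ?thesis using h_nonneg[OF \<open>0 \<le> s\<close>] by (simp add: h_def mult.commute)
qed

text \<open>The quotient \<open>g x / x ^ p\<close> is nonincreasing since
  \<open>x g'(x) \<le> (g1 - 1) g(x) \<le> p g(x)\<close>. A natural exponent is used so that it can
  match the power of a cutoff in the energy estimate.\<close>

lemma g_scale:
  assumes "g1 - 1 \<le> real p" "1 \<le> l" "0 \<le> s"
  shows "g (l * s) \<le> l ^ p * g s"
proof (cases "s = 0")
  case True
  then show ?thesis by (simp add: g_zero)
next
  case False
  then have s: "s > 0" using assms by simp
  have "g (l * s) / (l * s) ^ p \<le> g s / s ^ p"
  proof (rule DERIV_nonpos_imp_nonincreasing[of s "l * s" "\<lambda>x. g x / x ^ p"])
    show "s \<le> l * s" using assms s by simp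
    fix x assume "s \<le> x" "x \<le> l * s"
    then have x: "x > 0" using s by simp
    have "((\<lambda>x. g x / x ^ p) has_real_derivative (g' x * x ^ p - g x * (real p * x ^ (p - 1))) / (x ^ p * x ^ p)) (at x)"
      using x by (auto intro!: derivative_eq_intros g_deriv)
    moreover have "g' x * x ^ p - g x * (real p * x ^ (p - 1)) \<le> 0"
    proof (cases p)
      \<comment> \<open>Treated apart because the exponent \<open>p - 1\<close> of the power rule is
        truncated here.\<close>
      case 0
      then have "x * g' x \<le> 0" using assms(1) g'_upper[OF x] g_pos[OF x]
        by (smt (verit) mult_nonneg_nonneg mult_nonneg_nonpos2 of_nat_0)
      then show ?thesis using 0 x by (simp add: mult_le_0_iff)
    next
      case (Suc m)
      have "x * g' x \<le> real p * g x"
        using g'_upper[OF x] assms(1) g_pos[OF x] by (smt (verit) mult_right_mono)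
      then have "x ^ m * (x * g' x) \<le> x ^ m * (real p * g x)"
        using x by (intro mult_left_mono) auto
      then show ?thesis using Suc by (simp add: algebra_simps)
    qed
    ultimately show "\<exists>y. ((\<lambda>x. g x / x ^ p) has_real_derivative y) (at x) \<and> y \<le> 0"
      using x by (intro exI conjI) (auto intro: divide_nonpos_pos)
  qed
  then show ?thesis using s assms(2) by (simp add: power_mult_distrib divide_simps mult_ac split: if_splits)
qed

text \<open>For \<open>x \<ge> 1\<close> the lower growth bound gives
  \<open>x g'(x) \<ge> (g0 - 1) g(1)\<close>, so \<open>g\<close> grows at least like a positive
  multiple of the logarithm.\<close>

lemma g_unbounded: "\<exists>S\<ge>1. N \<le> g S"
proof -
  \<comment> \<open>The point where \<open>(g0 - 1) * g 1 * ln S\<close> has reached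
    \<open>N\<close>; the maximum with 0 ensures \<open>S \<ge> 1\<close>.\<close>
  define S where "S = exp (max 0 (N / ((g0 - 1) * g 1)))"
  have S: "S \<ge> 1" by (simp add: S_def)
  have c: "(g0 - 1) * g 1 > 0" using g0_gt g_pos[of 1] by simp
  have "g 1 - (g0 - 1) * g 1 * ln 1 \<le> g S - (g0 - 1) * g 1 * ln S"
  proof (rule DERIV_nonneg_imp_nondecreasing[of 1 S "\<lambda>x. g x - (g0 - 1) * g 1 * ln x"])
    fix x assume x: "1 \<le> x" "x \<le> S"
    have "((\<lambda>x. g x - (g0 - 1) * g 1 * ln x) has_real_derivative (g' x - (g0 - 1) * g 1 * (1 / x))) (at x)"
      using x by (auto intro!: derivative_eq_intros g_deriv)
    moreover have "(g0 - 1) * g 1 \<le> (g0 - 1) * g x" using g_mono[of 1 x] x g0_gt by simp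
    then have "(g0 - 1) * g 1 * (1 / x) \<le> g' x"
      using g'_lower[of x] x by (simp add: divide_simps mult.commute)
    ultimately show "\<exists>y. ((\<lambda>x. g x - (g0 - 1) * g 1 * ln x) has_real_derivative y) (at x) \<and> 0 \<le> y"
      by (intro exI conjI) auto
  qed (rule S)
  then have "(g0 - 1) * g 1 * ln S \<le> g S" using g_pos[of 1] by simp
  moreover have "N \<le> (g0 - 1) * g 1 * ln S"
  proof -
    have "N / ((g0 - 1) * g 1) \<le> ln S" by (simp add: S_def)
    then show ?thesis using c by (metis mult.commute pos_divide_le_eq)
  qed
  ultimately have "N \<le> g S" by linarith
  then show ?thesis using S by blast
qed

text \<open>In the product \<open>s * g s\<close> either factor eventually exceeds
  \<open>1 / e\<close>: a large \<open>g s\<close> absorbs \<open>s\<close>, and a large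
  \<open>s\<close> absorbs \<open>g s\<close>. The second half gives equi-integrability of the flux,
  the first that of the gradient.\<close>

lemma superlinear:
  assumes "0 < e"
  shows "\<exists>C\<ge>0. \<forall>s\<ge>0. s \<le> C + e * h s \<and> g s \<le> C + e * h s"
proof -
  obtain S where S: "S \<ge> 1" "1 / e \<le> g S" using g_unbounded by blast
  \<comment> \<open>\<open>S\<close> covers the first estimate below the threshold \<open>S\<close>,
    and \<open>g (1 / e)\<close> covers the second below \<open>1 / e\<close>.\<close>
  define C where "C = S + g (1 / e)"
  have C: "C \<ge> 0" using S(1) g_nonneg[of "1/e"] assms by (simp add: C_def)
  have "s \<le> C + e * h s" if s: "s \<ge> 0" for s
  proof (cases "s \<le> S")
    case True
    then show ?thesis using h_nonneg[OF s] assms g_nonneg[of "1/e"] by (simp add: C_def add_increasing2)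
  next
    case False
    then have "1 / e \<le> g s" using S g_mono[of S s] by simp
    then have "1 \<le> e * g s" using assms by (simp add: divide_simps mult.commute)
    then have "s * 1 \<le> s * (e * g s)" using s by (intro mult_left_mono)
    then show ?thesis using C by (simp add: h_def mult_ac)
  qed
  moreover have "g s \<le> C + e * h s" if s: "s \<ge> 0" for s
  proof (cases "s \<le> 1 / e")
    case True
    then show ?thesis using h_nonneg[OF s] assms g_mono[OF s True] S by (simp add: C_def add_increasing2)
  next
    case False
    then have "1 \<le> e * s" using assms by (simp add: divide_simps mult.commute)
    then have "1 * g s \<le> e * s * g s" using g_nonneg[OF s] by (intro mult_right_mono)
    then show ?thesis using C by (simp add: h_def mult_ac)
  qed
  ultimately show ?thesis using C by blast
qed

lemma primitive_le_h: "0 \<le> s \<Longrightarrow> primitive g s \<le> h s"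
proof -
  assume s: "0 \<le> s"
  have "integral {0..s} g \<le> integral {0..s} (\<lambda>_. g s)"
  proof (rule integral_le)
    show "g integrable_on {0..s}"
      by (intro integrable_continuous_interval continuous_on_subset[OF g_cont]) auto
  qed (auto intro: g_mono)
  then show ?thesis using s by (simp add: primitive_def h_def)
qed

lemma primitive_nonneg: "0 \<le> s \<Longrightarrow> 0 \<le> primitive g s"
  unfolding primitive_def
  by (intro integral_nonneg integrable_continuous_interval continuous_on_subset[OF g_cont]) (auto intro: g_nonneg)

lemma primitive_cont: "continuous_on {0..b} (primitive g)"
  unfolding primitive_def[abs_def]
  by (intro indefinite_integral_continuous_1 integrable_continuous_interval continuous_on_subset[OF g_cont]) auto

lemma primitive_mono: "0 \<le> s \<Longrightarrow> s \<le> t \<Longrightarrow> primitive g s \<le> primitive g t"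
  unfolding primitive_def
  by (intro integral_subset_le integrable_continuous_interval continuous_on_subset[OF g_cont]) (auto intro: g_nonneg)

text \<open>The difference of the two sides vanishes at 0 and has derivative
  \<open>g1 g - (g + x g')\<close>, nonnegative by the upper growth bound.\<close>

lemma h_le_primitive: "0 \<le> s \<Longrightarrow> h s \<le> g1 * primitive g s"
proof (cases "s = 0")
  case True
  then show ?thesis by (simp add: h_def primitive_def)
next
  case False
  assume "0 \<le> s"
  then have s: "0 < s" using False by simp
  have "g1 * primitive g 0 - h 0 \<le> g1 * primitive g s - h s"
  proof (rule DERIV_nonneg_imp_increasing_open[of 0 s "\<lambda>x. g1 * primitive g x - h x"])
    show "continuous_on {0..s} (\<lambda>x. g1 * primitive g x - h x)"
      unfolding h_def by (intro continuous_intros primitive_cont continuous_on_subset[OF g_cont]) auto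
    fix x assume x: "0 < x" "x < s"
    have "(primitive g has_real_derivative g x) (at x within {0..s})"
      unfolding primitive_def[abs_def]
      by (rule integral_has_real_derivative) (use x in \<open>auto intro!: continuous_on_subset[OF g_cont]\<close>)
    moreover have "at x within {0..s} = at x" using x by (intro at_within_interior) auto
    ultimately have "((\<lambda>x. g1 * primitive g x - x * g x) has_real_derivative (g1 * g x - (g x + x * g' x))) (at x)"
      using x by (auto intro!: derivative_eq_intros g_deriv)
    moreover have "0 \<le> g1 * g x - (g x + x * g' x)"
      using g'_upper[OF x(1)] by (simp add: algebra_simps)
    ultimately show "\<exists>y. ((\<lambda>x. g1 * primitive g x - h x) has_real_derivative y) (at x) \<and> 0 \<le> y"
      unfolding h_def by blast
  qed (use s in auto)
  then show ?thesis by (simp add: h_def primitive_def)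
qed

section \<open>Bounds and monotonicity of the vector field\<close>

lemma A_cont: "continuous_on UNIV A"
  using A_deriv by (meson continuous_at_imp_continuous_on has_derivative_continuous)

lemma A_line: "((\<lambda>s. A (z + s *\<^sub>R d) \<bullet> e) has_real_derivative blinfun_apply (DA (z + s *\<^sub>R d)) d \<bullet> e) (at s)"
proof -
  have "((\<lambda>s. A (z + s *\<^sub>R d)) has_derivative (\<lambda>t. blinfun_apply (DA (z + s *\<^sub>R d)) (t *\<^sub>R d))) (at s)"
    by (rule has_derivative_compose[where f="\<lambda>s. z + s *\<^sub>R d" and g=A, OF _ A_deriv])
       (auto intro!: derivative_eq_intros)
  then have "((\<lambda>s. A (z + s *\<^sub>R d) \<bullet> e) has_derivative (\<lambda>t. blinfun_apply (DA (z + s *\<^sub>R d)) (t *\<^sub>R d) \<bullet> e)) (at s)"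
    by (rule has_derivative_inner_left)
  then show ?thesis
    by (simp add: has_field_derivative_def blinfun.scaleR_right mult.commute[of _ "_ \<bullet> _"])
qed

lemma g_line: "\<xi> \<noteq> 0 \<Longrightarrow> 0 < s \<Longrightarrow> ((\<lambda>s. g (s * norm \<xi>)) has_real_derivative g' (s * norm \<xi>) * norm \<xi>) (at s)"
  by (rule DERIV_chain2[where f=g]) (auto intro!: g_deriv derivative_eq_intros)

lemma g_line_cont: "continuous_on {0..1} (\<lambda>s. g (s * norm \<xi>))"
  by (rule continuous_on_compose2[OF g_cont]) (auto intro!: continuous_intros)

lemma A_line_cont: "continuous_on {0..1} (\<lambda>s. A (z + s *\<^sub>R d) \<bullet> e)"
  by (intro continuous_intros continuous_on_compose2[OF A_cont]) auto

text \<open>Both constants come from exchanging \<open>g(s) / s\<close> for \<open>g'(s)\<close>: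
  the upper growth bound costs \<open>g1 - 1\<close> in the ellipticity constant, the lower one
  costs \<open>g0 - 1\<close> in the upper bound of the derivative.\<close>

definition cA :: real where "cA = \<nu> / (g1 - 1)"
definition CA :: real where "CA = L / (g0 - 1)"

lemma cA_pos: "0 < cA" and CA_pos: "0 < CA"
  using \<nu>_pos L_ge g1_gt g0_gt by (auto simp: cA_def CA_def)

text \<open>Both sides, viewed along the segment from 0 to \<open>\<xi>\<close>, start at 0, and
  their derivatives are ordered at interior points. Only the open segment is differentiated, which
  avoids the origin, where ellipticity is not assumed.\<close>

lemma A_coercive: "cA * h (norm \<xi>) \<le> A \<xi> \<bullet> \<xi>"
proof (cases "\<xi> = 0")
  case True
  then show ?thesis by (simp add: h_def)
next
  case False
  let ?f = "\<lambda>s. A (0 + s *\<^sub>R \<xi>) \<bullet> \<xi> - cA * norm \<xi> * g (s * norm \<xi>)"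
  have "?f 0 \<le> ?f 1"
  proof (rule DERIV_nonneg_imp_increasing_open[of 0 1])
    show "continuous_on {0..1} ?f" by (intro continuous_intros A_line_cont g_line_cont)
    fix s :: real assume s: "0 < s" "s < 1"
    let ?n = "s * norm \<xi>"
    have n: "?n > 0" using s False by simp
    have "(?f has_real_derivative blinfun_apply (DA (0 + s *\<^sub>R \<xi>)) \<xi> \<bullet> \<xi> - cA * norm \<xi> * (g' ?n * norm \<xi>)) (at s)"
      by (intro DERIV_diff A_line DERIV_cmult g_line[OF False s(1)])
    moreover have "cA * norm \<xi> * (g' ?n * norm \<xi>) \<le> blinfun_apply (DA (0 + s *\<^sub>R \<xi>)) \<xi> \<bullet> \<xi>"
    proof -
      have "g' ?n \<le> (g1 - 1) * g ?n / ?n" using g'_upper[OF n] n by (simp add: pos_le_divide_eq mult.commute)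
      then have "cA * g' ?n \<le> cA * ((g1 - 1) * g ?n / ?n)" using cA_pos by (intro mult_left_mono) auto
      also have "\<dots> = \<nu> * (g ?n / ?n)" using g1_gt by (simp add: cA_def)
      finally have "(cA * g' ?n) * (norm \<xi>)\<^sup>2 \<le> \<nu> * (g ?n / ?n) * (norm \<xi>)\<^sup>2"
        by (intro mult_right_mono) auto
      also have "\<dots> \<le> blinfun_apply (DA (s *\<^sub>R \<xi>)) \<xi> \<bullet> \<xi>"
        using elliptic[of "s *\<^sub>R \<xi>" \<xi>] s False by simp
      finally show ?thesis by (simp add: power2_eq_square mult_ac)
    qed
    ultimately show "\<exists>y. (?f has_real_derivative y) (at s) \<and> 0 \<le> y"
      by (intro exI conjI) auto
  qed auto
  then show ?thesis by (simp add: A_zero g_zero h_def mult_ac)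
qed

text \<open>The comparison along the segment from 0 is applied to the component of \<open>A\<close>
  in the fixed direction \<open>A \<xi>\<close>; its endpoint value is the square of the norm, and
  one factor is cancelled.\<close>

lemma A_bound: "norm (A \<xi>) \<le> CA * g (norm \<xi>)"
proof (cases "\<xi> = 0 \<or> A \<xi> = 0")
  case True
  then show ?thesis using CA_pos g_nonneg[of "norm \<xi>"] by (auto simp: A_zero)
next
  case False
  then have \<xi>: "\<xi> \<noteq> 0" and e: "norm (A \<xi>) > 0" by auto
  let ?e = "A \<xi>"
  let ?f = "\<lambda>s. CA * norm ?e * g (s * norm \<xi>) - A (0 + s *\<^sub>R \<xi>) \<bullet> ?e"
  have "?f 0 \<le> ?f 1"
  proof (rule DERIV_nonneg_imp_increasing_open[of 0 1])
    show "continuous_on {0..1} ?f" by (intro continuous_intros A_line_cont g_line_cont)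
    fix s :: real assume s: "0 < s" "s < 1"
    let ?n = "s * norm \<xi>"
    have n: "?n > 0" using s \<xi> by simp
    have "(?f has_real_derivative CA * norm ?e * (g' ?n * norm \<xi>) - blinfun_apply (DA (0 + s *\<^sub>R \<xi>)) \<xi> \<bullet> ?e) (at s)"
      by (intro DERIV_diff A_line DERIV_cmult g_line[OF \<xi> s(1)])
    moreover have "blinfun_apply (DA (0 + s *\<^sub>R \<xi>)) \<xi> \<bullet> ?e \<le> CA * norm ?e * (g' ?n * norm \<xi>)"
    proof -
      have "(g0 - 1) * g ?n / ?n \<le> g' ?n" using g'_lower[OF n] n by (simp add: pos_divide_le_eq mult.commute)
      then have "CA * ((g0 - 1) * g ?n / ?n) \<le> CA * g' ?n" using CA_pos by (intro mult_left_mono) auto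
      moreover have "CA * ((g0 - 1) * g ?n / ?n) = L * (g ?n / ?n)" using g0_gt by (simp add: CA_def)
      moreover have "norm (DA (s *\<^sub>R \<xi>)) \<le> L * (g ?n / ?n)"
        using DA_bound[of "s *\<^sub>R \<xi>"] s \<xi> by simp
      ultimately have D: "norm (DA (s *\<^sub>R \<xi>)) \<le> CA * g' ?n" by linarith
      have "blinfun_apply (DA (s *\<^sub>R \<xi>)) \<xi> \<bullet> ?e \<le> norm (blinfun_apply (DA (s *\<^sub>R \<xi>)) \<xi>) * norm ?e"
        by (rule norm_cauchy_schwarz)
      also have "\<dots> \<le> (norm (DA (s *\<^sub>R \<xi>)) * norm \<xi>) * norm ?e"
        by (intro mult_right_mono norm_blinfun) auto
      also have "\<dots> \<le> (CA * g' ?n * norm \<xi>) * norm ?e"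
        using D by (intro mult_right_mono) auto
      finally show ?thesis by (simp add: mult_ac)
    qed
    ultimately show "\<exists>y. (?f has_real_derivative y) (at s) \<and> 0 \<le> y"
      by (intro exI conjI) auto
  qed auto
  then have "norm ?e * norm ?e \<le> norm ?e * (CA * g (norm \<xi>))"
    by (simp add: A_zero g_zero dot_square_norm power2_eq_square mult_ac)
  then show ?thesis using e by simp
qed

text \<open>The derivative of \<open>A\<close> is positive definite off the origin, and the segment
  between distinct points meets the origin at most once. If it does so inside, strict increase on
  the two pieces is combined.\<close>

lemma A_strict_mono:
  assumes "\<xi> \<noteq> \<zeta>"
  shows "0 < (A \<xi> - A \<zeta>) \<bullet> (\<xi> - \<zeta>)"
proof -
  define d where "d = \<xi> - \<zeta>"
  have d: "d \<noteq> 0" using assms by (simp add: d_def)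
  let ?f = "\<lambda>s. A (\<zeta> + s *\<^sub>R d) \<bullet> d"
  have pos: "0 < blinfun_apply (DA (\<zeta> + s *\<^sub>R d)) d \<bullet> d" if "\<zeta> + s *\<^sub>R d \<noteq> 0" for s
  proof -
    have "0 < \<nu> * (g (norm (\<zeta> + s *\<^sub>R d)) / norm (\<zeta> + s *\<^sub>R d)) * (norm d)\<^sup>2"
      using that d \<nu>_pos g_pos by (intro mult_pos_pos divide_pos_pos) auto
    also have "\<dots> \<le> blinfun_apply (DA (\<zeta> + s *\<^sub>R d)) d \<bullet> d" by (rule elliptic[OF that])
    finally show ?thesis .
  qed
  have incr: "?f a < ?f b" if "a < b" "\<And>s. a < s \<Longrightarrow> s < b \<Longrightarrow> \<zeta> + s *\<^sub>R d \<noteq> 0" for a b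
  proof (rule DERIV_pos_imp_increasing_open[OF that(1)])
    show "\<exists>y. (?f has_real_derivative y) (at s) \<and> 0 < y" if "a < s" "s < b" for s
      using A_line pos[OF \<open>\<And>s. a < s \<Longrightarrow> s < b \<Longrightarrow> \<zeta> + s *\<^sub>R d \<noteq> 0\<close>[OF that]] by blast
    show "continuous_on {a..b} ?f"
      by (intro continuous_intros continuous_on_compose2[OF A_cont]) auto
  qed
  have "?f 0 < ?f 1"
  proof (cases "\<exists>s. 0 < s \<and> s < 1 \<and> \<zeta> + s *\<^sub>R d = 0")
    case True
    then obtain s where s: "0 < s" "s < 1" "\<zeta> + s *\<^sub>R d = 0" by blast
    have u: "t = s" if "\<zeta> + t *\<^sub>R d = 0" for t
    proof -
      have "\<zeta> + t *\<^sub>R d = \<zeta> + s *\<^sub>R d" using s(3) that by simp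
      then show ?thesis using d by simp
    qed
    have ne: "\<zeta> + t *\<^sub>R d \<noteq> 0" if "t \<noteq> s" for t
      using u[of t] that by blast
    have "?f 0 < ?f s" by (rule incr[OF s(1) ne]) simp
    also have "?f s < ?f 1" by (rule incr[OF s(2) ne]) simp
    finally show ?thesis .
  next
    case False
    then have "\<zeta> + t *\<^sub>R d \<noteq> 0" if "0 < t" "t < 1" for t using that by blast
    then show ?thesis by (intro incr zero_less_one)
  qed
  then show ?thesis by (simp add: d_def inner_diff_left)
qed

lemma A_mono: "0 \<le> (A \<xi> - A \<zeta>) \<bullet> (\<xi> - \<zeta>)"
  using A_strict_mono[of \<xi> \<zeta>] by (cases "\<xi> = \<zeta>") auto

text \<open>On pairs of norm at most \<open>1 / e\<close> and distance at least \<open>e\<close>, a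
  compact set, the monotonicity quantity has a positive minimum \<open>\<theta>\<close>. For all
  other pairs one of the terms with factor \<open>e\<close> already dominates. This is how smallness
  of the monotonicity integral becomes convergence in measure.\<close>

lemma A_mono_quantitative:
  assumes "0 < e"
  shows "\<exists>C\<ge>0. \<forall>\<xi> \<zeta>. min 1 (norm (\<xi> - \<zeta>)) \<le>
    e + e * norm \<xi> + e * norm \<zeta> + C * ((A \<xi> - A \<zeta>) \<bullet> (\<xi> - \<zeta>))"
proof -
  let ?E = "\<lambda>p. (A (fst p) - A (snd p)) \<bullet> (fst p - snd p)"
  let ?K = "(cball 0 (1 / e) \<times> cball 0 (1 / e)) \<inter> {p :: 'a \<times> 'a. e \<le> norm (fst p - snd p)}"
  have "closed {p :: 'a \<times> 'a. e \<le> norm (fst p - snd p)}"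
    by (intro closed_Collect_le continuous_intros)
  then have K: "compact ?K" by (intro compact_Int_closed compact_Times compact_cball)
  have c: "continuous_on ?K ?E"
    by (intro continuous_intros continuous_on_compose2[OF A_cont]) auto
  obtain \<theta> where \<theta>: "\<theta> > 0" "\<And>p. p \<in> ?K \<Longrightarrow> \<theta> \<le> ?E p"
  proof (cases "?K = {}")
    case True
    then show thesis using that[of 1] by auto
  next
    case False
    obtain q where q: "q \<in> ?K" "\<And>p. p \<in> ?K \<Longrightarrow> ?E q \<le> ?E p"
      using continuous_attains_inf[OF K False c] by blast
    have "fst q \<noteq> snd q" using q(1) assms by auto
    then show thesis using that[of "?E q"] q A_strict_mono by blast
  qed
  show ?thesis
  proof (intro exI[of _ "1 / \<theta>"] conjI allI)
    fix \<xi> \<zeta> :: 'a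
    have E: "0 \<le> 1 / \<theta> * ((A \<xi> - A \<zeta>) \<bullet> (\<xi> - \<zeta>))" using \<theta>(1) A_mono by simp
    have n: "0 \<le> e * norm \<xi>" "0 \<le> e * norm \<zeta>" using assms by simp_all
    consider "norm \<xi> > 1 / e" | "norm \<zeta> > 1 / e" | "norm (\<xi> - \<zeta>) < e"
      | "norm \<xi> \<le> 1 / e" "norm \<zeta> \<le> 1 / e" "e \<le> norm (\<xi> - \<zeta>)" by linarith
    then show "min 1 (norm (\<xi> - \<zeta>)) \<le> e + e * norm \<xi> + e * norm \<zeta> + 1 / \<theta> * ((A \<xi> - A \<zeta>) \<bullet> (\<xi> - \<zeta>))"
    proof cases
      case 1
      then have "1 \<le> e * norm \<xi>" using assms by (simp add: divide_simps mult.commute)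
      then show ?thesis using E n assms by linarith
    next
      case 2
      then have "1 \<le> e * norm \<zeta>" using assms by (simp add: divide_simps mult.commute)
      then show ?thesis using E n assms by linarith
    next
      case 3
      then show ?thesis using E n assms by linarith
    next
      case 4
      then have "\<theta> \<le> (A \<xi> - A \<zeta>) \<bullet> (\<xi> - \<zeta>)" using \<theta>(2)[of "(\<xi>, \<zeta>)"] by simp
      then have "1 \<le> 1 / \<theta> * ((A \<xi> - A \<zeta>) \<bullet> (\<xi> - \<zeta>))" using \<theta>(1) by simp
      then show ?thesis using n assms by linarith
    qed
  qed (use \<theta> in auto)
qed

text \<open>
  Absorbs the cross term of the energy estimate; the power \<open>p \<ge> g1 - 1\<close> of the cutoff compensates
  the growth of \<open>g\<close> under scaling.
\<close>

lemma weighted_absorption: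
  assumes "g1 - 1 \<le> real p" "1 \<le> p" "0 < N" "0 < k"
  shows "\<exists>C\<ge>0. \<forall>\<tau> s. 0 \<le> \<tau> \<longrightarrow> \<tau> \<le> 1 \<longrightarrow> 0 \<le> s \<longrightarrow> N * \<tau> ^ p * g s \<le> k * \<tau> ^ Suc p * h s + C"
proof (intro exI[of _ "N * g (N / k)"] conjI allI impI)
  show "0 \<le> N * g (N / k)" using assms g_nonneg[of "N/k"] by simp
  fix \<tau> s :: real assume a: "0 \<le> \<tau>" "\<tau> \<le> 1" "0 \<le> s"
  have C: "0 \<le> N * g (N / k)" by fact
  have K: "0 \<le> k * \<tau> ^ Suc p * h s" using assms a h_nonneg by simp
  \<comment> \<open>Division at \<open>k \<tau> s = N\<close>. Above it the first term on the right
    already wins; below it \<open>g (\<tau> * s) \<le> g (N / k)\<close>, and scaling from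
    \<open>\<tau> * s\<close> back to \<open>s\<close> costs exactly the factor
    \<open>\<tau> ^ p\<close> that is present.\<close>
  consider "\<tau> = 0" | "\<tau> > 0" "N \<le> k * (\<tau> * s)" | "\<tau> > 0" "k * (\<tau> * s) < N" using a by linarith
  then show "N * \<tau> ^ p * g s \<le> k * \<tau> ^ Suc p * h s + N * g (N / k)"
  proof cases
    case 1
    then show ?thesis using assms(2) C by (simp add: zero_power)
  next
    case 2
    have "N * (\<tau> ^ p * g s) \<le> k * (\<tau> * s) * (\<tau> ^ p * g s)"
      using 2 a g_nonneg by (intro mult_right_mono) auto
    then show ?thesis using C by (simp add: h_def mult_ac)
  next
    case 3
    have "g s = g (1 / \<tau> * (\<tau> * s))" using 3 by simp
    also have "\<dots> \<le> (1 / \<tau>) ^ p * g (\<tau> * s)"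
      using a 3 by (intro g_scale assms) auto
    also have "\<dots> \<le> (1 / \<tau>) ^ p * g (N / k)"
      using a 3 assms by (intro mult_left_mono g_mono) (auto simp: pos_le_divide_eq mult.commute)
    finally have "N * \<tau> ^ p * g s \<le> N * \<tau> ^ p * ((1 / \<tau>) ^ p * g (N / k))"
      using a assms by (intro mult_left_mono) auto
    also have "\<dots> = N * g (N / k)" using 3 by (simp add: power_divide)
    finally show ?thesis using K by linarith
  qed
qed

end

section \<open>A priori estimates\<close>

text \<open>Fatou's lemma applied to the nonnegative functions \<open>X k + H k\<close>; since the
  integrals of \<open>H k\<close> converge, their limit can be subtracted again. The separate bounds
  \<open>B k\<close> allow error terms that vanish only in the limit.\<close>

lemma Fatou_bounded_below:
  fixes X :: "nat \<Rightarrow> 'a \<Rightarrow> real"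
  assumes iX: "\<And>k. integrable M (X k)" and iH: "\<And>k. integrable M (H k)"
    and iX0: "integrable M X0" and iH0: "integrable M H0"
    and limX: "AE z in M. (\<lambda>k. X k z) \<longlonglongrightarrow> X0 z" and limH: "AE z in M. (\<lambda>k. H k z) \<longlonglongrightarrow> H0 z"
    and lower: "\<And>k z. - H k z \<le> X k z"
    and B: "\<And>k. integral\<^sup>L M (X k) \<le> B k" "B \<longlonglongrightarrow> B0"
    and IH: "(\<lambda>k. integral\<^sup>L M (H k)) \<longlonglongrightarrow> integral\<^sup>L M H0"
  shows "integral\<^sup>L M X0 \<le> B0"
proof -
  note i = Bochner_Integration.integrable_add[OF iX iH]
  have i0: "integrable M (\<lambda>z. X0 z + H0 z)" using iX0 iH0 by (rule Bochner_Integration.integrable_add)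
  have lim: "AE z in M. (\<lambda>k. X k z + H k z) \<longlonglongrightarrow> X0 z + H0 z"
    using limX limH by eventually_elim (rule tendsto_add)
  have nn: "0 \<le> X k z + H k z" for k z using lower[of k z] by linarith
  have nn0: "AE z in M. 0 \<le> X0 z + H0 z"
    using lim
  proof eventually_elim
    case (elim z)
    show ?case by (rule LIMSEQ_le_const[OF elim]) (use nn in blast)
  qed
  have "ennreal (integral\<^sup>L M X0 + integral\<^sup>L M H0) = (\<integral>\<^sup>+z. ennreal (X0 z + H0 z) \<partial>M)"
    by (subst nn_integral_eq_integral[OF i0 nn0]) (simp add: iX0 iH0)
  also have "\<dots> = (\<integral>\<^sup>+z. liminf (\<lambda>k. ennreal (X k z + H k z)) \<partial>M)"
  proof (rule nn_integral_cong_AE)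
    show "AE z in M. ennreal (X0 z + H0 z) = liminf (\<lambda>k. ennreal (X k z + H k z))"
      using lim
    proof eventually_elim
      case (elim z)
      have "(\<lambda>k. ennreal (X k z + H k z)) \<longlonglongrightarrow> ennreal (X0 z + H0 z)"
        using elim by (rule tendsto_ennrealI)
      then show ?case by (rule lim_imp_Liminf[symmetric, rotated]) simp
    qed
  qed
  also have "\<dots> \<le> liminf (\<lambda>k. \<integral>\<^sup>+z. ennreal (X k z + H k z) \<partial>M)"
    by (rule nn_integral_liminf) (use borel_measurable_integrable[OF i] in simp)
  also have "\<dots> \<le> liminf (\<lambda>k. ennreal (B k + integral\<^sup>L M (H k)))"
  proof (rule Liminf_mono[OF always_eventually], rule allI)
    fix k
    have "(\<integral>\<^sup>+z. ennreal (X k z + H k z) \<partial>M) = ennreal (\<integral>z. X k z + H k z \<partial>M)"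
      by (rule nn_integral_eq_integral[OF i]) (simp add: nn)
    also have "\<dots> \<le> ennreal (B k + integral\<^sup>L M (H k))"
      by (rule ennreal_leI) (use B(1)[of k] iX iH in simp)
    finally show "(\<integral>\<^sup>+z. ennreal (X k z + H k z) \<partial>M) \<le> ennreal (B k + integral\<^sup>L M (H k))" .
  qed
  also have "\<dots> = ennreal (B0 + integral\<^sup>L M H0)"
    by (rule lim_imp_Liminf) (auto intro!: tendsto_ennrealI tendsto_add B IH)
  finally have le: "ennreal (integral\<^sup>L M X0 + integral\<^sup>L M H0) \<le> ennreal (B0 + integral\<^sup>L M H0)" .
  \<comment> \<open>The embedding \<open>ennreal\<close> sends negative reals to 0, so the
    inequality can be read back in the reals only with a nonnegative right side.\<close>
  have "0 \<le> B0 + integral\<^sup>L M H0"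
  proof (rule LIMSEQ_le_const[OF tendsto_add[OF B(2) IH]])
    have "0 \<le> integral\<^sup>L M (X k) + integral\<^sup>L M (H k)" for k
      using integral_nonneg_AE[of "\<lambda>z. X k z + H k z" M] nn iX iH by simp
    then show "\<exists>N. \<forall>n\<ge>N. 0 \<le> B n + integral\<^sup>L M (H n)"
      using B(1) by (meson add_right_mono order_trans)
  qed
  then have "integral\<^sup>L M X0 + integral\<^sup>L M H0 \<le> B0 + integral\<^sup>L M H0"
    using le by simp
  then show ?thesis by simp
qed

lemma moll_bounded_linear:
  fixes f :: "'a::euclidean_space \<Rightarrow> 'b::euclidean_space" and T :: "'b \<Rightarrow> 'c::euclidean_space"
  assumes "bounded_linear T" "integrable lborel f"
  shows "moll k (\<lambda>y. T (f y)) z = T (moll k f z)"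
proof -
  let ?r = "inverse (real (Suc k))"
  interpret T: bounded_linear T by fact
  have "T (moll k f z) = (\<integral>y. T (mollifier ?r (z - y) *\<^sub>R f y) \<partial>lborel)"
    unfolding moll_def conv_def
    by (rule integral_bounded_linear[OF assms(1), symmetric]) (rule mollify_integrable_kernel[OF _ assms(2)], simp)
  then show ?thesis by (simp add: moll_def conv_def T.scaleR)
qed

text \<open>Mollifying the quadruple as one vector-valued function yields a single subsequence for
  all four; projections commute with mollification.\<close>

lemma moll_subseq4:
  fixes f1 :: "'a::euclidean_space \<Rightarrow> 'b1::euclidean_space" and f2 :: "'a \<Rightarrow> 'b2::euclidean_space"
    and f3 :: "'a \<Rightarrow> 'b3::euclidean_space" and f4 :: "'a \<Rightarrow> 'b4::euclidean_space"
  assumes i: "integrable lborel f1" "integrable lborel f2" "integrable lborel f3" "integrable lborel f4"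
  obtains s :: "nat \<Rightarrow> nat" where "strict_mono s"
    "AE z in lborel. (\<lambda>k. moll (s k) f1 z) \<longlonglongrightarrow> f1 z" "AE z in lborel. (\<lambda>k. moll (s k) f2 z) \<longlonglongrightarrow> f2 z"
    "AE z in lborel. (\<lambda>k. moll (s k) f3 z) \<longlonglongrightarrow> f3 z" "AE z in lborel. (\<lambda>k. moll (s k) f4 z) \<longlonglongrightarrow> f4 z"
proof -
  let ?V = "\<lambda>z. (f1 z, f2 z, f3 z, f4 z)"
  have pair: "integrable lborel (\<lambda>z. (p z, q z))" if "integrable lborel p" "integrable lborel q"
    for p :: "'a \<Rightarrow> 'x::euclidean_space" and q :: "'a \<Rightarrow> 'y::euclidean_space"
  proof -
    have "integrable lborel (\<lambda>z. (p z, 0) + (0, q z))"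
      by (intro Bochner_Integration.integrable_add integrable_bounded_linear[OF bounded_linear_Pair[OF bounded_linear_ident bounded_linear_zero] that(1)]
          integrable_bounded_linear[OF bounded_linear_Pair[OF bounded_linear_zero bounded_linear_ident] that(2)])
    then show ?thesis by simp
  qed
  have iV: "integrable lborel ?V" by (intro pair i)
  obtain s :: "nat \<Rightarrow> nat" where s: "strict_mono s" "AE z in lborel. (\<lambda>k. moll (s k) ?V z) \<longlonglongrightarrow> ?V z"
    using moll_subseq[OF iV] by blast
  have T: "AE z in lborel. (\<lambda>k. moll (s k) (\<lambda>y. T (?V y)) z) \<longlonglongrightarrow> T (?V z)" if T: "bounded_linear T"
    for T :: "_ \<Rightarrow> 'x::euclidean_space"
    using s(2)
  proof eventually_elim
    case (elim z)
    show ?case unfolding moll_bounded_linear[OF T iV] by (rule bounded_linear.tendsto[OF T elim])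
  qed
  show thesis
  proof (rule that[OF s(1)])
    show "AE z in lborel. (\<lambda>k. moll (s k) f1 z) \<longlonglongrightarrow> f1 z"
      using T[of fst] by (simp add: bounded_linear_fst)
    show "AE z in lborel. (\<lambda>k. moll (s k) f2 z) \<longlonglongrightarrow> f2 z"
      using T[of "\<lambda>v. fst (snd v)"] by (simp add: bounded_linear_fst_comp bounded_linear_snd)
    show "AE z in lborel. (\<lambda>k. moll (s k) f3 z) \<longlonglongrightarrow> f3 z"
      using T[of "\<lambda>v. fst (snd (snd v))"] by (simp add: bounded_linear_fst_comp bounded_linear_snd_comp bounded_linear_snd)
    show "AE z in lborel. (\<lambda>k. moll (s k) f4 z) \<longlonglongrightarrow> f4 z"
      using T[of "\<lambda>v. snd (snd (snd v))"] by (simp add: bounded_linear_snd_comp bounded_linear_snd)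
  qed
qed

lemma moll_norm_bound:
  fixes f :: "'a::euclidean_space \<Rightarrow> 'b::euclidean_space"
  assumes "integrable lborel f" "\<And>y. norm (f y) \<le> B"
  shows "norm (moll k f z) \<le> B"
proof -
  let ?r = "inverse (real (Suc k))"
  have r: "?r > 0" by simp
  have "norm (moll k f z) \<le> (\<integral>y. B * mollifier ?r (z - y) \<partial>lborel)"
    unfolding moll_def conv_def
  proof (rule order_trans[OF integral_norm_bound integral_mono])
    show "integrable lborel (\<lambda>y. norm (mollifier ?r (z - y) *\<^sub>R f y))"
      by (rule integrable_norm[OF mollify_integrable_kernel[OF r assms(1)]])
    show "integrable lborel (\<lambda>y. B * mollifier ?r (z - y))"
      by (rule integrable_mult_right[OF mollifier_shift(3)[OF r]])
    show "norm (mollifier ?r (z - y) *\<^sub>R f y) \<le> B * mollifier ?r (z - y)" for y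
      using mult_right_mono[OF assms(2)[of y] mollifier_nonneg[of ?r "z - y"]] mollifier_nonneg[of ?r "z - y"]
      by (simp add: mult.commute)
  qed
  also have "\<dots> = B" using mollifier_shift(1)[OF r, of z] by simp
  finally show ?thesis .
qed

text \<open>The hypothesis compares values at two unrelated points because the two mollifications
  average independently. Integration against the kernel in one variable and then in the other leaves
  a sum on the right, as each kernel has mass 1.\<close>

lemma moll_product_bound:
  fixes f :: "'a::euclidean_space \<Rightarrow> 'b::euclidean_space" and q :: "'a \<Rightarrow> 'c::euclidean_space"
  assumes i: "integrable lborel f" "integrable lborel q" "integrable lborel H1" "integrable lborel H2"
    and le: "\<And>x y. norm (f x) * norm (q y) \<le> H1 x + H2 y"
  shows "norm (moll k f z) * norm (moll k q z) \<le> moll k H1 z + moll k H2 z"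
proof -
  let ?r = "inverse (real (Suc k))" let ?m = "\<lambda>y. mollifier ?r (z - y)"
  have r: "?r > 0" by simp
  note m = mollifier_shift(3)[OF r, of z] and m1 = mollifier_shift(1)[OF r, of z]
  note k = mollify_integrable_kernel[OF r, of _ z]
  have nb: "norm (moll k f z) \<le> (\<integral>y. ?m y * norm (f y) \<partial>lborel)" if "integrable lborel f"
    for f :: "'a \<Rightarrow> 'x::euclidean_space"
    unfolding moll_def conv_def
    by (rule order_trans[OF integral_norm_bound]) (simp add: mollifier_nonneg)
  have kn: "integrable lborel (\<lambda>y. ?m y * norm (f y))" if "integrable lborel f" for f :: "'a \<Rightarrow> 'x::euclidean_space"
    using k[OF integrable_norm[OF that]] by simp
  have kH: "integrable lborel (\<lambda>y. ?m y * f y)" if "integrable lborel f" for f :: "'a \<Rightarrow> real"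
    using k[OF that] by simp
  have 1: "norm (f x) * (\<integral>y. ?m y * norm (q y) \<partial>lborel) \<le> H1 x + moll k H2 z" for x
  proof -
    have "norm (f x) * (\<integral>y. ?m y * norm (q y) \<partial>lborel) = (\<integral>y. norm (f x) * (?m y * norm (q y)) \<partial>lborel)"
      by simp
    also have "\<dots> \<le> (\<integral>y. H1 x * ?m y + ?m y * H2 y \<partial>lborel)"
    proof (rule integral_mono)
      show "norm (f x) * (?m y * norm (q y)) \<le> H1 x * ?m y + ?m y * H2 y" for y
        using mult_left_mono[OF le[of x y] mollifier_nonneg[of ?r "z - y"]] by (simp add: algebra_simps)
      show "integrable lborel (\<lambda>y. norm (f x) * (?m y * norm (q y)))"
        by (intro integrable_mult_right kn i)
      show "integrable lborel (\<lambda>y. H1 x * ?m y + ?m y * H2 y)"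
        by (intro Bochner_Integration.integrable_add integrable_mult_right m kH i)
    qed
    also have "\<dots> = (\<integral>y. H1 x * ?m y \<partial>lborel) + (\<integral>y. ?m y * H2 y \<partial>lborel)"
      by (intro Bochner_Integration.integral_add integrable_mult_right m kH i)
    also have "\<dots> = H1 x + moll k H2 z" using m1 by (simp add: moll_def conv_def)
    finally show ?thesis .
  qed
  let ?Q = "\<integral>y. ?m y * norm (q y) \<partial>lborel"
  have Q: "0 \<le> ?Q" by (intro integral_nonneg_AE AE_I2 mult_nonneg_nonneg mollifier_nonneg norm_ge_zero)
  have "norm (moll k f z) * norm (moll k q z) \<le> (\<integral>y. ?m y * norm (f y) \<partial>lborel) * ?Q"
    using Q by (intro mult_mono nb i) (auto intro!: integral_nonneg_AE AE_I2 mult_nonneg_nonneg mollifier_nonneg)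
  also have "\<dots> = (\<integral>y. ?m y * norm (f y) * ?Q \<partial>lborel)" by simp
  also have "\<dots> \<le> (\<integral>y. ?m y * H1 y + moll k H2 z * ?m y \<partial>lborel)"
  proof (rule integral_mono)
    show "?m y * norm (f y) * ?Q \<le> ?m y * H1 y + moll k H2 z * ?m y" for y
      using mult_left_mono[OF 1[of y] mollifier_nonneg[of ?r "z - y"]] by (simp add: algebra_simps)
    show "integrable lborel (\<lambda>y. ?m y * norm (f y) * ?Q)"
      by (intro integrable_mult_left kn i)
    show "integrable lborel (\<lambda>y. ?m y * H1 y + moll k H2 z * ?m y)"
      by (intro Bochner_Integration.integrable_add integrable_mult_right m kH i)
  qed
  also have "\<dots> = (\<integral>y. ?m y * H1 y \<partial>lborel) + (\<integral>y. moll k H2 z * ?m y \<partial>lborel)"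
    by (intro Bochner_Integration.integral_add integrable_mult_right m kH i)
  also have "\<dots> = moll k H1 z + moll k H2 z" using m1 by (simp add: moll_def conv_def)
  finally show ?thesis .
qed

section \<open>Testing smooth divergence equations\<close>

text \<open>The test function is \<open>\<phi> S(v)\<close>. The functions
  \<open>\<phi> \<Theta>(v)\<close> and \<open>\<phi> S(v) B b\<close> have compact support, so
  their derivatives in time and in the direction \<open>b\<close> integrate to zero; expanding them
  gives the identity. The flux \<open>B\<close> is kept independent of \<open>v\<close>, as befits a
  mollified flux. Three choices of \<open>S\<close> are used later: \<open>M - s\<close>, the
  constant 1, and a truncation.\<close>

lemma tested_divergence_identity:
  fixes \<phi> v vt :: "'a::euclidean_space \<times> real \<Rightarrow> real" and vb B dB :: "'a \<Rightarrow> 'a \<times> real \<Rightarrow> real"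
  assumes \<phi>: "\<phi> \<in> Cc_infty U"
    and v: "continuous_on UNIV v" "has_line_deriv (0, 1) v vt" "continuous_on UNIV vt"
      "\<And>b. b \<in> Basis \<Longrightarrow> has_line_deriv (b, 0) v (vb b)" "\<And>b. b \<in> Basis \<Longrightarrow> continuous_on UNIV (vb b)"
    and B: "\<And>b. b \<in> Basis \<Longrightarrow> continuous_on UNIV (B b)"
      "\<And>b. b \<in> Basis \<Longrightarrow> has_line_deriv (b, 0) (B b) (dB b)" "\<And>b. b \<in> Basis \<Longrightarrow> continuous_on UNIV (dB b)"
    and S: "\<And>s. (S has_real_derivative S' s) (at s)" "\<And>s. (\<Theta> has_real_derivative S s) (at s)"
      "continuous_on UNIV S'"
  shows "(\<integral>z. \<phi> z * S (v z) * (vt z - (\<Sum>b\<in>Basis. dB b z)) \<partial>lborel)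
    = - (\<integral>z. dderiv (0, 1) \<phi> z * \<Theta> (v z) \<partial>lborel)
      + (\<integral>z. (\<Sum>b\<in>Basis. (\<phi> z * S' (v z) * vb b z + S (v z) * dderiv (b, 0) \<phi> z) * B b z) \<partial>lborel)"
proof -
  obtain K where K: "compact K" "K \<subseteq> U" "\<And>z. z \<notin> K \<Longrightarrow> \<phi> z = 0" using Cc_infty_support[OF \<phi>] by blast
  have dz: "dderiv e \<phi> z = 0" if "z \<notin> K" for e z by (rule dderiv_eq_zero_off[OF K(1,3) that])
  note c\<phi> = Cc_infty_continuous[OF \<phi>] and cd = Cc_infty_dderiv_continuous[OF \<phi>]
  have cS: "continuous_on UNIV S" "continuous_on UNIV \<Theta>"
    using S(1,2) by (meson DERIV_isCont continuous_at_imp_continuous_on)+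
  have c: "continuous_on UNIV (\<lambda>z. S (v z))" "continuous_on UNIV (\<lambda>z. \<Theta> (v z))" "continuous_on UNIV (\<lambda>z. S' (v z))"
    by (rule continuous_on_compose2[OF _ v(1)], fact, simp)+
  define F0 where "F0 = (\<lambda>z. dderiv (0, 1) \<phi> z * \<Theta> (v z) + (S (v z) * vt z) * \<phi> z)"
  have F0: "has_line_deriv (0, 1) (\<lambda>z. \<phi> z * \<Theta> (v z)) F0"
    unfolding F0_def by (intro has_line_deriv_mult Cc_infty_has_line_deriv[OF \<phi>] has_line_deriv_compose[OF S(2) v(2)])
  have cF0: "continuous_on UNIV F0" "continuous_on UNIV (\<lambda>z. \<phi> z * \<Theta> (v z))"
    unfolding F0_def by (intro continuous_intros cd c c\<phi> v)+
  have I0: "integrable lborel F0" "integral\<^sup>L lborel F0 = 0"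
    by (rule line_deriv_integral_zero[OF F0 cF0(2,1) K(1)]; simp add: K(3))+
  define F where "F = (\<lambda>b z. dderiv (b, 0) \<phi> z * (S (v z) * B b z) + (S' (v z) * vb b z * B b z + dB b z * S (v z)) * \<phi> z)"
  have Ib: "integrable lborel (F b)" "integral\<^sup>L lborel (F b) = 0" if b: "b \<in> Basis" for b
  proof -
    have F: "has_line_deriv (b, 0) (\<lambda>z. \<phi> z * (S (v z) * B b z)) (F b)"
      unfolding F_def by (intro has_line_deriv_mult Cc_infty_has_line_deriv[OF \<phi>] has_line_deriv_compose[OF S(1) v(4)[OF b]] B(2)[OF b])
    have cF: "continuous_on UNIV (F b)" "continuous_on UNIV (\<lambda>z. \<phi> z * (S (v z) * B b z))"
      unfolding F_def by (intro continuous_intros cd c c\<phi> v B b)+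
    show "integrable lborel (F b)" "integral\<^sup>L lborel (F b) = 0"
      by (rule line_deriv_integral_zero[OF F cF(2,1) K(1)]; simp add: K(3))+
  qed
  have I: "integrable lborel (\<lambda>z. \<phi> z * S (v z) * (vt z - (\<Sum>b\<in>Basis. dB b z)))"
    by (rule integrable_compact_support[OF _ K(1)]) (intro continuous_intros cd c c\<phi> v B | simp add: K(3))+
  have J: "integrable lborel (\<lambda>z. dderiv (0, 1) \<phi> z * \<Theta> (v z))"
    by (rule integrable_compact_support[OF _ K(1)]) (intro continuous_intros cd c c\<phi> v B | simp add: dz)+
  have L: "integrable lborel (\<lambda>z. \<Sum>b\<in>Basis. (\<phi> z * S' (v z) * vb b z + S (v z) * dderiv (b, 0) \<phi> z) * B b z)"
    by (rule integrable_compact_support[OF _ K(1)]) (intro continuous_intros cd c c\<phi> v B | simp add: dz K(3))+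
  have "(\<integral>z. \<phi> z * S (v z) * (vt z - (\<Sum>b\<in>Basis. dB b z)) \<partial>lborel) + (\<integral>z. dderiv (0, 1) \<phi> z * \<Theta> (v z) \<partial>lborel)
      - (\<integral>z. (\<Sum>b\<in>Basis. (\<phi> z * S' (v z) * vb b z + S (v z) * dderiv (b, 0) \<phi> z) * B b z) \<partial>lborel)
    = (\<integral>z. \<phi> z * S (v z) * (vt z - (\<Sum>b\<in>Basis. dB b z)) + dderiv (0, 1) \<phi> z * \<Theta> (v z)
        - (\<Sum>b\<in>Basis. (\<phi> z * S' (v z) * vb b z + S (v z) * dderiv (b, 0) \<phi> z) * B b z) \<partial>lborel)"
    by (simp add: I J L)
  also have "\<dots> = integral\<^sup>L lborel (\<lambda>z::'a \<times> real. F0 z - (\<Sum>b\<in>Basis. F b z))"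
  proof (rule arg_cong[where f="integral\<^sup>L lborel"], rule ext)
    fix z :: "'a \<times> real"
    have "(\<Sum>b\<in>Basis. F b z) = (\<Sum>b\<in>Basis. (\<phi> z * S' (v z) * vb b z + S (v z) * dderiv (b, 0) \<phi> z) * B b z)
        + (\<Sum>b\<in>Basis. \<phi> z * S (v z) * dB b z)"
      unfolding F_def sum.distrib[symmetric] by (rule sum.cong) (simp_all add: algebra_simps)
    also have "(\<Sum>b\<in>Basis. \<phi> z * S (v z) * dB b z) = \<phi> z * S (v z) * (\<Sum>b\<in>Basis. dB b z)"
      by (simp add: sum_distrib_left)
    finally show "\<phi> z * S (v z) * (vt z - (\<Sum>b\<in>Basis. dB b z)) + dderiv (0, 1) \<phi> z * \<Theta> (v z)
        - (\<Sum>b\<in>Basis. (\<phi> z * S' (v z) * vb b z + S (v z) * dderiv (b, 0) \<phi> z) * B b z)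
        = F0 z - (\<Sum>b\<in>Basis. F b z)"
      by (simp add: F0_def algebra_simps)
  qed
  also have "\<dots> = integral\<^sup>L lborel F0 - (\<Sum>b\<in>Basis. integral\<^sup>L lborel (F b))"
    by (subst Bochner_Integration.integral_diff) (use I0 Ib in \<open>auto intro!: Bochner_Integration.integral_sum\<close>)
  also have "\<dots> = 0" using I0 Ib by simp
  finally show ?thesis by simp
qed

lemma Cc_infty_mult:
  assumes "f \<in> Cc_infty U" "q \<in> Cc_infty U"
  shows "(\<lambda>x. f x * q x) \<in> Cc_infty U"
proof -
  obtain K where K: "compact K" "K \<subseteq> U" "\<forall>x. x \<notin> K \<longrightarrow> f x = 0"
    using Cc_infty_support[OF assms(1)] by blast
  show ?thesis
    by (rule Cc_inftyI[of _ K]) (use K assms in \<open>simp_all add: Ck_mult Cc_infty_Ck\<close>)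
qed

lemma Cc_infty_power_Suc:
  assumes "f \<in> Cc_infty U"
  shows "(\<lambda>x. f x ^ Suc p) \<in> Cc_infty U"
  using assms by (induction p) (simp_all add: Cc_infty_mult)

lemma dderiv_power_Suc:
  assumes "f \<in> Cc_infty U"
  shows "dderiv e (\<lambda>x. f x ^ Suc p) x = real (Suc p) * f x ^ p * dderiv e f x"
proof -
  have "((\<lambda>x. f x ^ Suc p) has_derivative (\<lambda>v. real (Suc p) * dderiv v f x * f x ^ (Suc p - 1))) (at x)"
    using has_derivative_power[OF Cc_infty_has_derivative[OF assms], of "Suc p"] by (simp add: algebra_simps)
  from frechet_derivative_at[OF this, symmetric] show ?thesis
    by (simp add: dderiv_def mult_ac)
qed

definition dmoll :: "'a::euclidean_space \<Rightarrow> nat \<Rightarrow> ('a \<Rightarrow> real) \<Rightarrow> 'a \<Rightarrow> real" where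
  "dmoll e k = conv (dderiv e (mollifier (inverse (real (Suc k)))))"

lemma dmoll_line_deriv: "integrable lborel f \<Longrightarrow> has_line_deriv e (moll k f) (dmoll e k f)"
  unfolding moll_def dmoll_def by (rule mollify_line_deriv) simp

lemma dmoll_continuous: "integrable lborel f \<Longrightarrow> continuous_on UNIV (dmoll e k f)"
  unfolding dmoll_def by (rule mollify_line_deriv) simp

lemma moll_continuous:
  fixes f :: "'a::euclidean_space \<Rightarrow> 'b::euclidean_space"
  shows "integrable lborel f \<Longrightarrow> continuous_on UNIV (moll k f)"
  unfolding moll_def by (rule mollify_continuous) simp

lemma moll_integral_tendsto:
  fixes f :: "'a::euclidean_space \<Rightarrow> real"
  assumes "integrable lborel f"
  shows "(\<lambda>k. integral\<^sup>L lborel (moll k f)) \<longlonglongrightarrow> integral\<^sup>L lborel f"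
proof -
  have "norm (integral\<^sup>L lborel (moll k f) - integral\<^sup>L lborel f) \<le> (\<integral>z. norm (moll k f z - f z) \<partial>lborel)" for k
    using integral_norm_bound[of lborel "\<lambda>z. moll k f z - f z"] moll_integrable[OF assms, of k] assms by simp
  then have "(\<lambda>k. integral\<^sup>L lborel (moll k f) - integral\<^sup>L lborel f) \<longlonglongrightarrow> 0"
    by (intro Lim_null_comparison[OF _ moll_tendsto[OF assms]] always_eventually) blast
  then show "(\<lambda>k. integral\<^sup>L lborel (moll k f)) \<longlonglongrightarrow> integral\<^sup>L lborel f"
    by (rule LIM_zero_cancel)
qed

lemma Cc_infty_spatial_bound:
  fixes \<phi> :: "'a::euclidean_space \<times> real \<Rightarrow> real"
  assumes "\<phi> \<in> Cc_infty U"
  obtains c where "c > 0" "\<And>z. (\<Sum>b\<in>Basis. \<bar>dderiv (b, 0) \<phi> z\<bar>) \<le> c"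
proof -
  have "\<exists>B>0. \<forall>z. \<bar>dderiv (b, 0) \<phi> z\<bar> \<le> B" for b
    by (rule Cc_infty_dderiv_bounded[OF assms, of "(b, 0)"]) blast
  then obtain B where B: "\<And>b::'a. B b > 0" "\<And>b z. \<bar>dderiv (b, 0) \<phi> z\<bar> \<le> B b" by metis
  show thesis
  proof (rule that[of "\<Sum>b\<in>Basis. B b"])
    show "0 < (\<Sum>b\<in>Basis. B (b::'a))" by (intro sum_pos B) auto
    show "(\<Sum>b\<in>Basis. \<bar>dderiv (b, 0) \<phi> z\<bar>) \<le> (\<Sum>b\<in>Basis. B b)" for z by (intro sum_mono B)
  qed
qed

lemma sum_inner_bound:
  fixes x :: "'a::euclidean_space"
  shows "\<bar>\<Sum>b\<in>Basis. d b * (x \<bullet> b)\<bar> \<le> (\<Sum>b\<in>Basis. \<bar>d b\<bar>) * norm x"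
proof -
  have "\<bar>\<Sum>b\<in>Basis. d b * (x \<bullet> b)\<bar> \<le> (\<Sum>b\<in>Basis. \<bar>d b\<bar> * norm x)"
    by (rule order_trans[OF sum_abs sum_mono]) (simp add: abs_mult mult_left_mono Basis_le_norm)
  then show ?thesis by (simp add: sum_distrib_right)
qed

text \<open>Room for mollification: for large \<open>k\<close> the kernels centred in
  \<open>S\<close> see only \<open>K\<close>. Functions may thus be set to zero outside
  \<open>K\<close>, which makes them integrable, without changing their mollifications on
  \<open>S\<close>.\<close>

lemma compact_neighbourhood:
  fixes S :: "'e::euclidean_space set"
  assumes "compact S" "S \<subseteq> U" "open U"
  obtains K k0 where "compact K" "K \<subseteq> U" "S \<subseteq> K" "\<And>k z. k \<ge> k0 \<Longrightarrow> z \<in> S \<Longrightarrow> cball z (inverse (real (Suc k))) \<subseteq> K"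
proof -
  obtain e where e: "e > 0" "(\<Union>x\<in>S. cball x e) \<subseteq> U"
    using compact_subset_open_imp_cball_epsilon_subset[OF assms(1,3,2)] by blast
  let ?K = "{x + y |x y. x \<in> S \<and> y \<in> cball 0 e}"
  have K: "compact ?K" by (rule compact_sums[OF assms(1) compact_cball])
  have sub: "cball x e \<subseteq> ?K" if "x \<in> S" for x
  proof
    fix y assume "y \<in> cball x e"
    then have "y = x + (y - x)" "y - x \<in> cball 0 e" by (auto simp: dist_norm norm_minus_commute)
    then show "y \<in> ?K" using that by blast
  qed
  have KU: "?K \<subseteq> U"
  proof
    fix y assume "y \<in> ?K"
    then obtain x d where "x \<in> S" "d \<in> cball 0 e" "y = x + d" by blast
    then have "x \<in> S" "y \<in> cball x e" by (auto simp: dist_norm)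
    then show "y \<in> U" using e(2) by blast
  qed
  obtain k0 where k0: "inverse (real (Suc k0)) < e" using reals_Archimedean[OF e(1)] by blast
  show thesis
  proof (rule that[OF K KU])
    show "S \<subseteq> ?K" using sub e(1) by (meson centre_in_cball less_imp_le subset_iff)
    fix k z assume k: "k \<ge> k0" and z: "z \<in> S"
    have "inverse (real (Suc k)) \<le> inverse (real (Suc k0))"
      using k by (intro le_imp_inverse_le) auto
    then show "cball z (inverse (real (Suc k))) \<subseteq> ?K" using sub[OF z] k0 by (meson less_imp_le order_trans subset_cball)
  qed
qed

section \<open>Mollified supersolutions and the energy estimate\<close>

context growth
begin

text \<open>
  Borel representatives defined on the whole space; the function \<open>h\<close> stands in for the Orlicz
  function \<open>G\<close>, which lies between \<open>h / g1\<close> and \<open>h\<close>.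
\<close>

definition wsuper :: "('a \<times> real) set \<Rightarrow> ('a \<times> real \<Rightarrow> real) \<Rightarrow> ('a \<times> real \<Rightarrow> 'a) \<Rightarrow> bool" where
  "wsuper U u w \<longleftrightarrow> u \<in> borel_measurable borel \<and> w \<in> borel_measurable borel \<and>
    (\<forall>K. compact K \<and> K \<subseteq> U \<longrightarrow> integrable lborel (\<lambda>z. indicator K z * h (norm (w z)))) \<and>
    (\<forall>\<phi>\<in>Cc_infty U. \<forall>b\<in>Basis.
      (\<integral>z. u z * dderiv (b, 0) \<phi> z \<partial>lborel) = - (\<integral>z. \<phi> z * (w z \<bullet> b) \<partial>lborel)) \<and>
    (\<forall>\<phi>\<in>Cc_infty U. (\<forall>z. 0 \<le> \<phi> z) \<longrightarrow>
      0 \<le> - (\<integral>z. u z * dderiv (0, 1) \<phi> z \<partial>lborel)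
        + (\<integral>z. (\<Sum>b\<in>Basis. (A (w z) \<bullet> b) * dderiv (b, 0) \<phi> z) \<partial>lborel))"

lemma h_norm_measurable[measurable]: "(\<lambda>x::'a. h (norm x)) \<in> borel_measurable borel"
  unfolding h_def
  by (intro borel_measurable_continuous_onI continuous_intros continuous_on_compose2[OF g_cont]) auto

lemma A_measurable[measurable]: "A \<in> borel_measurable borel"
  by (rule borel_measurable_continuous_onI[OF A_cont])

text \<open>Superlinearity with parameter 1 dominates gradient and flux on \<open>K\<close> by a
  constant plus a multiple of \<open>h\<close>.\<close>

lemma integrable_loc:
  fixes w :: "'a \<times> real \<Rightarrow> 'a"
  assumes [measurable]: "w \<in> borel_measurable borel" and K: "compact K"
    and h: "integrable lborel (\<lambda>z. indicator K z * h (norm (w z)))"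
  shows "integrable lborel (\<lambda>z. indicator K z *\<^sub>R w z)"
    and "integrable lborel (\<lambda>z. indicator K z *\<^sub>R A (w z))"
proof -
  have [measurable]: "K \<in> sets borel" using K by (simp add: borel_compact)
  obtain C where C: "C \<ge> 0" "\<And>s. s \<ge> 0 \<Longrightarrow> s \<le> C + 1 * h s \<and> g s \<le> C + 1 * h s"
    using superlinear[of 1] by auto
  have iK: "integrable lborel (\<lambda>z. indicator K z *\<^sub>R (C::real))"
    using emeasure_bounded_finite[OF compact_imp_bounded[OF K]]
    by (intro integrable_scaleR_left integrable_real_indicator) auto
  have i: "integrable lborel (\<lambda>z. indicator K z *\<^sub>R C + indicator K z * h (norm (w z)))"
    by (intro Bochner_Integration.integrable_add iK h)
  show "integrable lborel (\<lambda>z. indicator K z *\<^sub>R w z)"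
  proof (rule Bochner_Integration.integrable_bound[OF i])
    show "AE z in lborel. norm (indicator K z *\<^sub>R w z) \<le> norm (indicator K z *\<^sub>R C + indicator K z * h (norm (w z)))"
    proof (rule AE_I2)
      fix z
      show "norm (indicator K z *\<^sub>R w z) \<le> norm (indicator K z *\<^sub>R C + indicator K z * h (norm (w z)))"
        using C(2)[of "norm (w z)"] C(1) h_nonneg[of "norm (w z)"] by (auto simp: indicator_def)
    qed
  qed measurable
  have i2: "integrable lborel (\<lambda>z. CA * (indicator K z *\<^sub>R C + indicator K z * h (norm (w z))))"
    by (rule integrable_mult_right[OF i])
  show "integrable lborel (\<lambda>z. indicator K z *\<^sub>R A (w z))"
  proof (rule Bochner_Integration.integrable_bound[OF i2])
    show "AE z in lborel. norm (indicator K z *\<^sub>R A (w z)) \<le> norm (CA * (indicator K z *\<^sub>R C + indicator K z * h (norm (w z))))"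
    proof (rule AE_I2)
      fix z
      have "norm (A (w z)) \<le> CA * (C + h (norm (w z)))"
        using order_trans[OF A_bound mult_left_mono[of "g (norm (w z))" "C + h (norm (w z))" CA]] C(2)[of "norm (w z)"] CA_pos by simp
      then show "norm (indicator K z *\<^sub>R A (w z)) \<le> norm (CA * (indicator K z *\<^sub>R C + indicator K z * h (norm (w z))))"
        by (auto simp: indicator_def)
    qed
  qed measurable
qed

lemma integrable_loc_bounded:
  fixes u :: "'a \<times> real \<Rightarrow> real"
  assumes [measurable]: "u \<in> borel_measurable borel" and K: "compact K" and M: "\<And>z. \<bar>u z\<bar> \<le> M"
  shows "integrable lborel (\<lambda>z::'a \<times> real. indicator K z *\<^sub>R u z)"
proof -
  have [measurable]: "K \<in> sets borel" using K by (simp add: borel_compact)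
  have "0 \<le> M" using M[of undefined] abs_ge_zero[of "u undefined"] by linarith
  then show ?thesis
    by (intro integrable_bounded_support[OF _ compact_imp_bounded[OF K], of _ M])
      (use M in \<open>auto simp: indicator_def\<close>)
qed

text \<open>The test function is the kernel centred at \<open>z\<close>. Moving the derivative onto
  the kernel changes its sign, so the definition of the weak gradient and the supersolution
  inequality become pointwise statements on smooth functions. The ball condition hides the cut at
  the boundary of \<open>K\<close>.\<close>

lemma moll_equations:
  assumes w: "wsuper U u w" and M: "\<And>z. \<bar>u z\<bar> \<le> M" and K: "compact K" "K \<subseteq> U"
    and r: "cball z (inverse (real (Suc k))) \<subseteq> K"
  shows "b \<in> Basis \<Longrightarrow> dmoll (b, 0) k (\<lambda>z. indicator K z *\<^sub>R u z) z = moll k (\<lambda>z. indicator K z *\<^sub>R w z) z \<bullet> b"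
    and "0 \<le> dmoll (0, 1) k (\<lambda>z. indicator K z *\<^sub>R u z) z
          - (\<Sum>b\<in>Basis. dmoll (b, 0) k (\<lambda>z. (indicator K z *\<^sub>R A (w z)) \<bullet> b) z)"
proof -
  let ?r = "inverse (real (Suc k))"
  define \<eta> where "\<eta> = (\<lambda>y. mollifier ?r (z - y))"
  have rp: "?r > 0" by simp
  have \<eta>: "\<eta> \<in> Cc_infty U" "\<eta> \<in> Cc_infty K" unfolding \<eta>_def
    using mollifier_test(1)[OF rp] r K(2) by blast+
  have d\<eta>: "dderiv e (mollifier ?r) (z - y) = - dderiv e \<eta> y" for e y
    unfolding \<eta>_def mollifier_test(2)[OF rp r] by simp
  have z0: "\<eta> y = 0" if "y \<notin> K" for y
  proof -
    have "y \<notin> cball z ?r" using that r by blast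
    then show ?thesis unfolding \<eta>_def by (intro mollifier_zero) (auto simp: dist_norm)
  qed
  have z1: "dderiv e \<eta> y = 0" if "y \<notin> K" for y e
    by (rule dderiv_eq_zero_off[OF K(1) z0 that])
  have wm: "w \<in> borel_measurable borel" "u \<in> borel_measurable borel"
    and hK: "integrable lborel (\<lambda>z. indicator K z * h (norm (w z)))"
    using w K unfolding wsuper_def by blast+
  note iw = integrable_loc[OF wm(1) K(1) hK]
  have uk: "dderiv e (mollifier ?r) (z - y) *\<^sub>R (indicator K y *\<^sub>R u y) = - (u y * dderiv e \<eta> y)" for e y
    unfolding d\<eta> using z1[of y e] by (cases "y \<in> K") auto
  have ak: "dderiv (b, 0) (mollifier ?r) (z - y) *\<^sub>R ((indicator K y *\<^sub>R A (w y)) \<bullet> b) = - ((A (w y) \<bullet> b) * dderiv (b, 0) \<eta> y)" for b y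
    unfolding d\<eta> using z1[of y "(b, 0)"] by (cases "y \<in> K") auto
  have wk: "mollifier ?r (z - y) *\<^sub>R ((indicator K y *\<^sub>R w y) \<bullet> b) = \<eta> y * (w y \<bullet> b)" for b y
    using z0[of y] by (cases "y \<in> K") (auto simp: \<eta>_def)
  show "dmoll (b, 0) k (\<lambda>z. indicator K z *\<^sub>R u z) z = moll k (\<lambda>z. indicator K z *\<^sub>R w z) z \<bullet> b" if b: "b \<in> Basis"
  proof -
    have "dmoll (b, 0) k (\<lambda>z. indicator K z *\<^sub>R u z) z = - (\<integral>y. u y * dderiv (b, 0) \<eta> y \<partial>lborel)"
      unfolding dmoll_def conv_def uk by simp
    also have "\<dots> = (\<integral>y. \<eta> y * (w y \<bullet> b) \<partial>lborel)"
      using w \<eta>(1) b unfolding wsuper_def by simp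
    also have "\<dots> = moll k (\<lambda>z. (indicator K z *\<^sub>R w z) \<bullet> b) z"
      unfolding moll_def conv_def wk ..
    also have "\<dots> = moll k (\<lambda>z. indicator K z *\<^sub>R w z) z \<bullet> b"
      by (rule moll_bounded_linear[OF bounded_linear_inner_left iw(1)])
    finally show ?thesis .
  qed
  have "(\<Sum>b\<in>Basis. dmoll (b, 0) k (\<lambda>z. (indicator K z *\<^sub>R A (w z)) \<bullet> b) z)
      = (\<Sum>b\<in>Basis. - (\<integral>y. (A (w y) \<bullet> b) * dderiv (b, 0) \<eta> y \<partial>lborel))"
    unfolding dmoll_def conv_def ak by simp
  also have "\<dots> = - (\<integral>y. (\<Sum>b\<in>Basis. (A (w y) \<bullet> b) * dderiv (b, 0) \<eta> y) \<partial>lborel)"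
  proof -
    have "integrable lborel (\<lambda>y. (A (w y) \<bullet> b) * dderiv (b, 0) \<eta> y)" for b
    proof -
      obtain B where B: "\<And>y. \<bar>dderiv (b, 0) \<eta> y\<bar> \<le> B"
        by (rule Cc_infty_dderiv_bounded[OF \<eta>(1), of "(b, 0)"]) blast
      have "(\<lambda>y. (A (w y) \<bullet> b) * dderiv (b, 0) \<eta> y) = (\<lambda>y. dderiv (b, 0) \<eta> y * ((indicator K y *\<^sub>R A (w y)) \<bullet> b))"
        using z1[of _ "(b, 0)"] by (auto simp: indicator_def fun_eq_iff)
      moreover have "integrable lborel (\<lambda>y. dderiv (b, 0) \<eta> y * ((indicator K y *\<^sub>R A (w y)) \<bullet> b))"
      proof (rule Bochner_Integration.integrable_bound)
        show "integrable lborel (\<lambda>y. B * ((indicator K y *\<^sub>R A (w y)) \<bullet> b))"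
          by (intro integrable_mult_right integrable_inner_left iw(2))
        have "dderiv (b, 0) \<eta> \<in> borel_measurable lborel"
          using borel_measurable_continuous_onI[OF Cc_infty_dderiv_continuous[OF \<eta>(1)]] by simp
        then show "(\<lambda>y. dderiv (b, 0) \<eta> y * ((indicator K y *\<^sub>R A (w y)) \<bullet> b)) \<in> borel_measurable lborel"
          by (rule borel_measurable_times) (rule borel_measurable_integrable[OF integrable_inner_left[OF iw(2)]])
        have "0 \<le> B" using B[of undefined] abs_ge_zero[of "dderiv (b, 0) \<eta> undefined"] by linarith
        then show "AE y in lborel. norm (dderiv (b, 0) \<eta> y * ((indicator K y *\<^sub>R A (w y)) \<bullet> b))
            \<le> norm (B * ((indicator K y *\<^sub>R A (w y)) \<bullet> b))"
          using B by (intro AE_I2) (simp add: abs_mult mult_right_mono)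
      qed
      ultimately show ?thesis by simp
    qed
    then show ?thesis by (simp add: sum_negf)
  qed
  finally have S: "(\<Sum>b\<in>Basis. dmoll (b, 0) k (\<lambda>z. (indicator K z *\<^sub>R A (w z)) \<bullet> b) z)
      = - (\<integral>y. (\<Sum>b\<in>Basis. (A (w y) \<bullet> b) * dderiv (b, 0) \<eta> y) \<partial>lborel)" .
  have T: "dmoll (0, 1) k (\<lambda>z. indicator K z *\<^sub>R u z) z = - (\<integral>y. u y * dderiv (0, 1) \<eta> y \<partial>lborel)"
    unfolding dmoll_def conv_def uk by simp
  have "\<forall>y. 0 \<le> \<eta> y" by (simp add: \<eta>_def mollifier_nonneg)
  then show "0 \<le> dmoll (0, 1) k (\<lambda>z. indicator K z *\<^sub>R u z) z
          - (\<Sum>b\<in>Basis. dmoll (b, 0) k (\<lambda>z. (indicator K z *\<^sub>R A (w z)) \<bullet> b) z)"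
    unfolding S T using w \<eta>(1) unfolding wsuper_def by simp
qed

text \<open>Restriction to a compact set turns locally integrable functions into integrable ones on
  the whole space, the domain on which \<open>moll\<close> acts.\<close>

definition zero_extend :: "('a \<times> real) set \<Rightarrow> ('a \<times> real \<Rightarrow> 'b::real_vector) \<Rightarrow> 'a \<times> real \<Rightarrow> 'b" where
  "zero_extend K f z = indicator K z *\<^sub>R f z"

text \<open>The multiplier \<open>M - u\<close> is nonnegative, so the tested mollified inequality
  keeps its direction, and its derivative \<open>-1\<close> produces the coercive term on the
  favourable side. The flux paired with the gradient of the cutoff is absorbed through
  \<open>weighted_absorption\<close>. The bound depends on \<open>\<phi>\<close>, \<open>M\<close>
  and the structure, but not on the supersolution.\<close>

lemma energy_estimate:
  assumes \<phi>: "\<phi> \<in> Cc_infty U" "\<And>z. 0 \<le> \<phi> z" "\<And>z. \<phi> z \<le> 1" and U: "open U"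
    and p: "g1 - 1 \<le> real p" "1 \<le> p" and M: "0 \<le> M"
  shows "\<exists>C. \<forall>u w. wsuper U u w \<longrightarrow> (\<forall>z. \<bar>u z\<bar> \<le> M) \<longrightarrow>
    (\<integral>z. \<phi> z ^ Suc p * h (norm (w z)) \<partial>lborel) \<le> C"
proof -
  obtain S where S: "compact S" "S \<subseteq> U" "\<And>z. z \<notin> S \<Longrightarrow> \<phi> z = 0" using Cc_infty_support[OF \<phi>(1)] by metis
  obtain K k0 where K: "compact K" "K \<subseteq> U" "S \<subseteq> K"
    and k0: "\<And>k z. k \<ge> k0 \<Longrightarrow> z \<in> S \<Longrightarrow> cball z (inverse (real (Suc k))) \<subseteq> K"
    by (rule compact_neighbourhood[OF S(1,2) U]) blast
  have [measurable]: "K \<in> sets borel" using K by (simp add: borel_compact)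
  obtain c where c: "c > 0" "\<And>z. (\<Sum>b\<in>Basis. \<bar>dderiv (b, 0) \<phi> z\<bar>) \<le> c"
    using Cc_infty_spatial_bound[OF \<phi>(1)] by blast
  define \<psi> where "\<psi> = (\<lambda>z. \<phi> z ^ Suc p)"
  have \<psi>: "\<psi> \<in> Cc_infty U" unfolding \<psi>_def by (rule Cc_infty_power_Suc[OF \<phi>(1)])
  have d\<psi>: "dderiv e \<psi> z = real (Suc p) * \<phi> z ^ p * dderiv e \<phi> z" for e z
    unfolding \<psi>_def by (rule dderiv_power_Suc[OF \<phi>(1)])
  have \<psi>01: "0 \<le> \<psi> z" "\<psi> z \<le> 1" for z
    using \<phi>(2,3)[of z] unfolding \<psi>_def by (simp_all add: power_le_one del: power_Suc)
  have \<psi>S: "\<psi> z = 0" if "z \<notin> S" for z using S(3)[OF that] by (simp add: \<psi>_def)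
  have dS: "dderiv e \<psi> z = 0" if "z \<notin> S" for e z by (rule dderiv_eq_zero_off[OF S(1) \<psi>S that])
  note c\<psi> = Cc_infty_continuous[OF \<psi>] and cd\<psi> = Cc_infty_dderiv_continuous[OF \<psi>]
  note c\<phi> = Cc_infty_continuous[OF \<phi>(1)]
  have i\<psi>t: "integrable lborel (\<lambda>z. \<bar>dderiv (0, 1) \<psi> z\<bar>)"
    by (rule integrable_compact_support[OF _ S(1)]) (intro continuous_intros cd\<psi>, simp add: dS)
  \<comment> \<open>The factor \<open>2 * M\<close> bounds \<open>M - u\<close>, and
    \<open>Suc p * c\<close> bounds the gradient of \<open>\<phi> ^ Suc p\<close> up to a remaining
    \<open>\<phi> ^ p\<close>. The summand 1 gives \<open>N > 0\<close> even for
    \<open>M = 0\<close>.\<close>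
  define N where "N = 2 * M * real (Suc p) * c + 1"
  have N: "N > 0" using M c(1) unfolding N_def by (intro add_nonneg_pos mult_nonneg_nonneg) auto
  have NCA: "N * CA > 0" "cA / 2 > 0" using N CA_pos cA_pos by auto
  \<comment> \<open>The choice \<open>cA / 2\<close> lets the flux term consume only half of the
    coercive term.\<close>
  obtain C1 where C1: "C1 \<ge> 0" "\<And>\<tau> s. 0 \<le> \<tau> \<Longrightarrow> \<tau> \<le> 1 \<Longrightarrow> 0 \<le> s \<Longrightarrow> (N * CA) * \<tau> ^ p * g s \<le> (cA / 2) * \<tau> ^ Suc p * h s + C1"
    using weighted_absorption[OF p NCA] by blast
  \<comment> \<open>Since \<open>M - u\<close> lies between 0 and \<open>2 * M\<close>, its half
    square is at most \<open>2 * M\<^sup>2\<close>, the weight of the time derivative of the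
    cutoff.\<close>
  define Z where "Z = 2 * M\<^sup>2 * (\<integral>z. \<bar>dderiv (0, 1) \<psi> z\<bar> \<partial>lborel) + C1 * measure lborel S"
  show ?thesis
  proof (intro exI[of _ "2 / cA * Z"] allI impI)
    fix u w assume w: "wsuper U u w" and uM: "\<forall>z. \<bar>u z\<bar> \<le> M"
    have uM': "\<And>z. \<bar>u z\<bar> \<le> M" using uM by blast
    have wm[measurable]: "w \<in> borel_measurable borel" "u \<in> borel_measurable borel"
      and hK: "integrable lborel (\<lambda>z. indicator K z * h (norm (w z)))"
      using w K unfolding wsuper_def by blast+
    define uK where "uK = zero_extend K u"
    define wK where "wK = zero_extend K w"
    define aK where "aK = zero_extend K (\<lambda>z. A (w z))"
    define hh where "hh = (\<lambda>z. CA * (indicator K z * h (norm (w z))))"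
    have iw: "integrable lborel wK" and ia: "integrable lborel aK"
      unfolding wK_def aK_def zero_extend_def using integrable_loc[OF wm(1) K(1) hK] .
    have iu: "integrable lborel uK"
      unfolding uK_def zero_extend_def by (rule integrable_loc_bounded[OF wm(2) K(1) uM'])
    have ih: "integrable lborel hh" unfolding hh_def by (rule integrable_mult_right[OF hK])
    have iab: "integrable lborel (\<lambda>z. aK z \<bullet> b)" for b by (rule integrable_inner_left[OF ia])
    have uKM: "norm (uK z) \<le> M" for z
      using uM'[of z] M by (auto simp: uK_def zero_extend_def indicator_def)
    have eq1: "dmoll (b, 0) k uK z = moll k wK z \<bullet> b" if "k \<ge> k0" "z \<in> S" "b \<in> Basis" for b k z
      unfolding uK_def wK_def zero_extend_def using moll_equations(1)[OF w uM' K(1,2) k0[OF that(1,2)] that(3)] .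
    have eq2: "0 \<le> dmoll (0, 1) k uK z - (\<Sum>b\<in>Basis. dmoll (b, 0) k (\<lambda>z. aK z \<bullet> b) z)" if "k \<ge> k0" "z \<in> S" for k z
      unfolding uK_def aK_def zero_extend_def using moll_equations(2)[OF w uM' K(1,2) k0[OF that]] .
    have ab: "moll k (\<lambda>z. aK z \<bullet> b) z = moll k aK z \<bullet> b" for k b z
      by (rule moll_bounded_linear[OF bounded_linear_inner_left ia])
    have prod: "norm (moll k wK z) * norm (moll k aK z) \<le> moll k hh z + moll k hh z" for k z
    proof (rule moll_product_bound[OF iw ia ih ih])
      fix x y
      have hn: "0 \<le> hh x" for x unfolding hh_def using CA_pos h_nonneg by auto
      show "norm (wK x) * norm (aK y) \<le> hh x + hh y"
      proof (cases "x \<in> K \<and> y \<in> K")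
        case True
        have "norm (w x) * norm (A (w y)) \<le> norm (w x) * (CA * g (norm (w y)))"
          by (intro mult_left_mono A_bound) auto
        also have "\<dots> = CA * (g (norm (w y)) * norm (w x))" by simp
        also have "\<dots> \<le> CA * (h (norm (w y)) + h (norm (w x)))"
          using CA_pos by (intro mult_left_mono young) auto
        finally show ?thesis using True by (simp add: wK_def aK_def zero_extend_def hh_def algebra_simps)
      next
        case False
        then have "norm (wK x) * norm (aK y) = 0" by (auto simp: wK_def aK_def zero_extend_def)
        then show ?thesis using hn[of x] hn[of y] by linarith
      qed
    qed
    define X where "X = (\<lambda>k z. \<psi> z * (moll k wK z \<bullet> moll k aK z))"
    define H where "H = (\<lambda>k z. moll k hh z + moll k hh z)"
    define ipt where "ipt = (\<integral>z. \<bar>dderiv (0, 1) \<psi> z\<bar> \<partial>lborel)"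
    define Na where "Na = (\<integral>z. N * \<phi> z ^ p * norm (aK z) \<partial>lborel)"
    \<comment> \<open>The flux term is stated for the unmollified \<open>aK\<close>, because
      absorption is a pointwise statement on \<open>g\<close> and \<open>h\<close>; the last summand
      is the L^1 error of this replacement and tends to 0.\<close>
    define Bd where "Bd = (\<lambda>k. 2 * M\<^sup>2 * ipt + Na + N * (\<integral>z. norm (moll k aK z - aK z) \<partial>lborel))"
    have iX: "integrable lborel (X k)" for k
      unfolding X_def by (rule integrable_compact_support[OF _ S(1)])
        (intro continuous_intros c\<psi> moll_continuous iw ia, simp add: \<psi>S)
    have iNa: "integrable lborel (\<lambda>z. N * \<phi> z ^ p * norm (f z))" if "integrable lborel f" for f :: "'a \<times> real \<Rightarrow> 'a"
    proof (rule Bochner_Integration.integrable_bound)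
      show "integrable lborel (\<lambda>z. N * norm (f z))" by (intro integrable_mult_right integrable_norm that)
      have "(\<lambda>z. N * \<phi> z ^ p) \<in> borel_measurable lborel"
        using borel_measurable_continuous_onI[OF c\<phi>] by simp
      then show "(\<lambda>z. N * \<phi> z ^ p * norm (f z)) \<in> borel_measurable lborel"
        using borel_measurable_integrable[OF integrable_norm[OF that]] by (rule borel_measurable_times)
      have "N * \<phi> z ^ p * norm (f z) \<le> N * 1 * norm (f z)" for z
        using N \<phi>(2,3)[of z] by (intro mult_right_mono mult_left_mono power_le_one) auto
      then show "AE z in lborel. norm (N * \<phi> z ^ p * norm (f z)) \<le> norm (N * norm (f z))"
        using N \<phi>(2) by (intro AE_I2) (simp add: abs_mult)
    qed
    have ineq: "integral\<^sup>L lborel (X k) \<le> Bd k" if k: "k \<ge> k0" for k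
    proof -
      let ?v = "moll k uK"
      let ?Y = "\<lambda>z. (M - ?v z) * (\<Sum>b\<in>Basis. dderiv (b, 0) \<psi> z * (moll k aK z \<bullet> b))"
      have vM: "\<bar>?v z\<bar> \<le> M" for z using moll_norm_bound[OF iu uKM] by simp
      note cv = moll_continuous[OF iu] and ca = moll_continuous[OF ia]
      have cB: "continuous_on UNIV (\<lambda>z. moll k aK z \<bullet> b)" for b by (intro continuous_intros ca)
      have id: "(\<integral>z. \<psi> z * (M - ?v z) * (dmoll (0, 1) k uK z - (\<Sum>b\<in>Basis. dmoll (b, 0) k (\<lambda>z. aK z \<bullet> b) z)) \<partial>lborel)
        = - (\<integral>z. dderiv (0, 1) \<psi> z * (- ((M - ?v z)\<^sup>2 / 2)) \<partial>lborel)
          + (\<integral>z. (\<Sum>b\<in>Basis. (\<psi> z * (- 1) * dmoll (b, 0) k uK z + (M - ?v z) * dderiv (b, 0) \<psi> z) * (moll k aK z \<bullet> b)) \<partial>lborel)"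
      proof (rule tested_divergence_identity[OF \<psi>, where v="?v" and vt="dmoll (0, 1) k uK" and vb="\<lambda>b. dmoll (b, 0) k uK"
            and B="\<lambda>b z. moll k aK z \<bullet> b" and dB="\<lambda>b. dmoll (b, 0) k (\<lambda>z. aK z \<bullet> b)"
            and S="\<lambda>s. M - s" and S'="\<lambda>s. - 1" and \<Theta>="\<lambda>s. - ((M - s)\<^sup>2 / 2)"])
        show "((\<lambda>s. M - s) has_real_derivative - 1) (at s)" for s by (auto intro!: derivative_eq_intros)
        show "((\<lambda>s. - ((M - s)\<^sup>2 / 2)) has_real_derivative M - s) (at s)" for s
          by (auto intro!: derivative_eq_intros simp: field_simps)
        show "has_line_deriv (b, 0) (\<lambda>z. moll k aK z \<bullet> b) (dmoll (b, 0) k (\<lambda>z. aK z \<bullet> b))" for b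
          using dmoll_line_deriv[OF iab] unfolding ab .
      qed (intro cv dmoll_line_deriv dmoll_continuous iu iab cB continuous_on_const)+
      have iY: "integrable lborel ?Y"
        by (rule integrable_compact_support[OF _ S(1)]) (intro continuous_intros cv cB cd\<psi>, simp add: dS)
      have pt: "(\<Sum>b\<in>Basis. (\<psi> z * (- 1) * dmoll (b, 0) k uK z + (M - ?v z) * dderiv (b, 0) \<psi> z) * (moll k aK z \<bullet> b))
          = ?Y z - X k z" for z
      proof (cases "z \<in> S")
        case True
        have "(\<Sum>b\<in>Basis. (\<psi> z * (- 1) * dmoll (b, 0) k uK z + (M - ?v z) * dderiv (b, 0) \<psi> z) * (moll k aK z \<bullet> b))
          = (\<Sum>b\<in>Basis. (M - ?v z) * (dderiv (b, 0) \<psi> z * (moll k aK z \<bullet> b)) - \<psi> z * ((moll k wK z \<bullet> b) * (moll k aK z \<bullet> b)))"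
          by (rule sum.cong) (simp_all add: eq1[OF k True] algebra_simps)
        also have "\<dots> = ?Y z - X k z"
          by (simp add: sum_subtractf sum_distrib_left X_def euclidean_inner[of "moll k wK z" "moll k aK z"])
        finally show ?thesis .
      next
        case False
        then show ?thesis by (simp add: \<psi>S dS X_def)
      qed
      have 1: "0 \<le> (\<integral>z. \<psi> z * (M - ?v z) * (dmoll (0, 1) k uK z - (\<Sum>b\<in>Basis. dmoll (b, 0) k (\<lambda>z. aK z \<bullet> b) z)) \<partial>lborel)"
      proof (rule integral_nonneg_AE, rule AE_I2)
        fix z
        have "0 \<le> M - ?v z" using vM[of z] by linarith
        then show "0 \<le> \<psi> z * (M - ?v z) * (dmoll (0, 1) k uK z - (\<Sum>b\<in>Basis. dmoll (b, 0) k (\<lambda>z. aK z \<bullet> b) z))"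
          using eq2[OF k, of z] \<psi>01(1)[of z] \<psi>S[of z] by (cases "z \<in> S") (auto intro: mult_nonneg_nonneg)
      qed
      have 2: "- (\<integral>z. dderiv (0, 1) \<psi> z * (- ((M - ?v z)\<^sup>2 / 2)) \<partial>lborel) \<le> 2 * M\<^sup>2 * ipt"
      proof -
        have "- (\<integral>z. dderiv (0, 1) \<psi> z * (- ((M - ?v z)\<^sup>2 / 2)) \<partial>lborel) = (\<integral>z. dderiv (0, 1) \<psi> z * ((M - ?v z)\<^sup>2 / 2) \<partial>lborel)"
          by simp
        also have "\<dots> \<le> (\<integral>z. 2 * M\<^sup>2 * \<bar>dderiv (0, 1) \<psi> z\<bar> \<partial>lborel)"
        proof (rule integral_mono)
          show "integrable lborel (\<lambda>z. dderiv (0, 1) \<psi> z * ((M - ?v z)\<^sup>2 / 2))"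
            by (rule integrable_compact_support[OF _ S(1)]) (intro continuous_intros cv cd\<psi>, simp_all add: dS)
          show "integrable lborel (\<lambda>z. 2 * M\<^sup>2 * \<bar>dderiv (0, 1) \<psi> z\<bar>)"
            by (rule integrable_mult_right[OF i\<psi>t])
          fix z
          have "(M - ?v z)\<^sup>2 \<le> (2 * M)\<^sup>2" using vM[of z] by (intro power_mono) linarith+
          then have "(M - ?v z)\<^sup>2 / 2 \<le> 2 * M\<^sup>2" by (simp add: power_mult_distrib)
          then have 1: "(M - ?v z)\<^sup>2 / 2 * \<bar>dderiv (0, 1) \<psi> z\<bar> \<le> 2 * M\<^sup>2 * \<bar>dderiv (0, 1) \<psi> z\<bar>"
            by (intro mult_right_mono) auto
          have "(M - ?v z)\<^sup>2 / 2 * dderiv (0, 1) \<psi> z \<le> (M - ?v z)\<^sup>2 / 2 * \<bar>dderiv (0, 1) \<psi> z\<bar>"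
            by (intro mult_left_mono) auto
          from order_trans[OF this 1] show "dderiv (0, 1) \<psi> z * ((M - ?v z)\<^sup>2 / 2) \<le> 2 * M\<^sup>2 * \<bar>dderiv (0, 1) \<psi> z\<bar>" by (simp only: mult.commute)
        qed
        also have "\<dots> = 2 * M\<^sup>2 * ipt" by (simp add: ipt_def)
        finally show ?thesis .
      qed
      have 3: "integral\<^sup>L lborel ?Y \<le> Na + N * (\<integral>z. norm (moll k aK z - aK z) \<partial>lborel)"
      proof -
        have imm: "integrable lborel (\<lambda>z. norm (moll k aK z - aK z))"
          by (intro integrable_norm Bochner_Integration.integrable_diff moll_integrable ia)
        have "integral\<^sup>L lborel ?Y \<le> (\<integral>z. N * \<phi> z ^ p * norm (aK z) + N * norm (moll k aK z - aK z) \<partial>lborel)"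
        proof (rule integral_mono[OF iY])
          show "integrable lborel (\<lambda>z. N * \<phi> z ^ p * norm (aK z) + N * norm (moll k aK z - aK z))"
            by (intro Bochner_Integration.integrable_add iNa ia integrable_mult_right imm)
          fix z
          let ?q = "\<phi> z ^ p"
          have q: "0 \<le> ?q" "?q \<le> 1" using \<phi>(2,3)[of z] by (auto intro: power_le_one)
          have "\<bar>?Y z\<bar> \<le> (2 * M) * ((real (Suc p) * ?q * c) * norm (moll k aK z))"
          proof -
            have "(\<Sum>b\<in>Basis. \<bar>dderiv (b, 0) \<psi> z\<bar>) = real (Suc p) * ?q * (\<Sum>b\<in>Basis. \<bar>dderiv (b, 0) \<phi> z\<bar>)"
              unfolding d\<psi> sum_distrib_left using q by (simp add: abs_mult)
            also have "\<dots> \<le> real (Suc p) * ?q * c" using q c(2) by (intro mult_left_mono) auto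
            finally have "(\<Sum>b\<in>Basis. \<bar>dderiv (b, 0) \<psi> z\<bar>) * norm (moll k aK z) \<le> real (Suc p) * ?q * c * norm (moll k aK z)"
              by (intro mult_right_mono) auto
            with sum_inner_bound[of "\<lambda>b. dderiv (b, 0) \<psi> z" "moll k aK z"]
            have s: "\<bar>\<Sum>b\<in>Basis. dderiv (b, 0) \<psi> z * (moll k aK z \<bullet> b)\<bar> \<le> real (Suc p) * ?q * c * norm (moll k aK z)" by linarith
            have "\<bar>M - ?v z\<bar> \<le> 2 * M" using vM[of z] by linarith
            then show ?thesis unfolding abs_mult using M by (intro mult_mono s) auto
          qed
          also have "\<dots> = (N - 1) * ?q * norm (moll k aK z)" by (simp add: N_def)
          also have "\<dots> \<le> N * ?q * norm (moll k aK z)" using q by (intro mult_right_mono) auto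
          also have "\<dots> \<le> N * ?q * (norm (aK z) + norm (moll k aK z - aK z))"
            using N q norm_triangle_ineq[of "aK z" "moll k aK z - aK z"] by (intro mult_left_mono) auto
          also have "\<dots> \<le> N * ?q * norm (aK z) + N * norm (moll k aK z - aK z)"
          proof -
            have "N * ?q * norm (moll k aK z - aK z) \<le> N * 1 * norm (moll k aK z - aK z)"
              using N q by (intro mult_right_mono mult_left_mono) auto
            then show ?thesis by (simp add: distrib_left)
          qed
          finally show "?Y z \<le> N * ?q * norm (aK z) + N * norm (moll k aK z - aK z)" by linarith
        qed
        also have "\<dots> = Na + N * (\<integral>z. norm (moll k aK z - aK z) \<partial>lborel)"
          unfolding Na_def by (subst Bochner_Integration.integral_add[OF iNa[OF ia] integrable_mult_right[OF imm]]) simp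
        finally show ?thesis .
      qed
      have "(\<integral>z. ?Y z - X k z \<partial>lborel) = integral\<^sup>L lborel ?Y - integral\<^sup>L lborel (X k)"
        by (rule Bochner_Integration.integral_diff[OF iY iX])
      then show ?thesis using id 1 2 3 unfolding pt Bd_def by linarith
    qed
    obtain s :: "nat \<Rightarrow> nat" where s: "strict_mono s"
      "AE z in lborel. (\<lambda>k. moll (s k) wK z) \<longlonglongrightarrow> wK z" "AE z in lborel. (\<lambda>k. moll (s k) aK z) \<longlonglongrightarrow> aK z"
      "AE z in lborel. (\<lambda>k. moll (s k) hh z) \<longlonglongrightarrow> hh z"
      using moll_subseq4[OF iu iw ia ih] by blast
    \<comment> \<open>The shift by \<open>k0\<close> keeps all indices in the range where the
      kernels stay inside \<open>K\<close>, as a strictly increasing sequence of naturals satisfies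
      \<open>n \<le> s n\<close>.\<close>
    define r where "r = (\<lambda>k. s (k + k0))"
    have rk: "k0 \<le> r k" for k using strict_mono_imp_increasing[OF s(1), of "k + k0"] unfolding r_def by linarith
    have r: "strict_mono r" unfolding r_def using s(1) by (simp add: strict_mono_def)
    have X0: "\<psi> z * (wK z \<bullet> aK z) = \<psi> z * (w z \<bullet> A (w z))" for z
      using \<psi>S[of z] K(3) by (cases "z \<in> S") (auto simp: wK_def aK_def zero_extend_def)
    have i0: "integrable lborel (\<lambda>z. \<psi> z * (wK z \<bullet> aK z))"
    proof (rule Bochner_Integration.integrable_bound[OF ih])
      have "\<psi> \<in> borel_measurable lborel" using borel_measurable_continuous_onI[OF c\<psi>] by simp
      then show "(\<lambda>z. \<psi> z * (wK z \<bullet> aK z)) \<in> borel_measurable lborel"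
        using borel_measurable_integrable[OF iw] borel_measurable_integrable[OF ia] by (intro borel_measurable_times borel_measurable_inner)
      show "AE z in lborel. norm (\<psi> z * (wK z \<bullet> aK z)) \<le> norm (hh z)"
      proof (rule AE_I2)
        fix z
        show "norm (\<psi> z * (wK z \<bullet> aK z)) \<le> norm (hh z)"
        proof (cases "z \<in> K")
          case True
          have "\<bar>w z \<bullet> A (w z)\<bar> \<le> norm (w z) * norm (A (w z))" by (rule Cauchy_Schwarz_ineq2)
          also have "\<dots> \<le> norm (w z) * (CA * g (norm (w z)))" by (intro mult_left_mono A_bound) auto
          finally have "\<bar>w z \<bullet> A (w z)\<bar> \<le> CA * h (norm (w z))" by (simp add: h_def mult_ac)
          moreover have "\<psi> z * \<bar>w z \<bullet> A (w z)\<bar> \<le> 1 * \<bar>w z \<bullet> A (w z)\<bar>" using \<psi>01 by (intro mult_right_mono) auto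
          ultimately show ?thesis using True \<psi>01[of z] CA_pos h_nonneg[of "norm (w z)"]
            by (simp add: wK_def aK_def zero_extend_def hh_def abs_mult)
        qed (simp add: wK_def zero_extend_def)
      qed
    qed
    \<comment> \<open>The functions \<open>X k\<close> may be negative, because the mollified
      gradient and the mollified flux are paired without a structural relation. The barrier
      \<open>H\<close> comes from \<open>moll_product_bound\<close>, and its integrals
      converge.\<close>
    have main: "(\<integral>z. \<psi> z * (wK z \<bullet> aK z) \<partial>lborel) \<le> 2 * M\<^sup>2 * ipt + Na"
    proof (rule Fatou_bounded_below[where X="\<lambda>k. X (r k)" and H="\<lambda>k. H (r k)" and B="\<lambda>k. Bd (r k)" and ?H0.0="\<lambda>z. hh z + hh z"])
      show "integrable lborel (X (r k))" for k by (rule iX)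
      show iH: "integrable lborel (H (r k))" for k
        unfolding H_def by (intro Bochner_Integration.integrable_add moll_integrable ih)
      show "integrable lborel (\<lambda>z. hh z + hh z)" by (intro Bochner_Integration.integrable_add ih)
      show "AE z in lborel. (\<lambda>k. X (r k) z) \<longlonglongrightarrow> \<psi> z * (wK z \<bullet> aK z)"
        using s(2,3)
      proof eventually_elim
        case (elim z)
        show ?case unfolding X_def r_def
          using LIMSEQ_ignore_initial_segment[OF elim(1), of k0] LIMSEQ_ignore_initial_segment[OF elim(2), of k0]
          by (intro tendsto_intros)
      qed
      show "AE z in lborel. (\<lambda>k. H (r k) z) \<longlonglongrightarrow> hh z + hh z"
        using s(4)
      proof eventually_elim
        case (elim z)
        show ?case unfolding H_def r_def
          using LIMSEQ_ignore_initial_segment[OF elim(1), of k0] by (intro tendsto_intros)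
      qed
      show "- H (r k) z \<le> X (r k) z" for k z
      proof -
        have "\<bar>moll (r k) wK z \<bullet> moll (r k) aK z\<bar> \<le> H (r k) z"
          using Cauchy_Schwarz_ineq2[of "moll (r k) wK z" "moll (r k) aK z"] prod[of "r k" z] unfolding H_def by linarith
        then have "\<bar>X (r k) z\<bar> \<le> 1 * H (r k) z"
          unfolding X_def abs_mult using \<psi>01[of z] by (intro mult_mono) auto
        then show ?thesis by linarith
      qed
      show "integral\<^sup>L lborel (X (r k)) \<le> Bd (r k)" for k by (rule ineq[OF rk])
      have "(\<lambda>k. Bd (r k)) \<longlonglongrightarrow> 2 * M\<^sup>2 * ipt + Na + N * 0"
        unfolding Bd_def using LIMSEQ_subseq_LIMSEQ[OF moll_tendsto[OF ia] r]
        by (intro tendsto_intros) (simp add: o_def)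
      then show "(\<lambda>k. Bd (r k)) \<longlonglongrightarrow> 2 * M\<^sup>2 * ipt + Na" by simp
      have "(\<lambda>k. integral\<^sup>L lborel (moll (r k) hh) + integral\<^sup>L lborel (moll (r k) hh)) \<longlonglongrightarrow> integral\<^sup>L lborel hh + integral\<^sup>L lborel hh"
        using LIMSEQ_subseq_LIMSEQ[OF moll_integral_tendsto[OF ih] r] by (intro tendsto_intros) (simp_all add: o_def)
      then show "(\<lambda>k. integral\<^sup>L lborel (H (r k))) \<longlonglongrightarrow> (\<integral>z. hh z + hh z \<partial>lborel)"
        unfolding H_def using moll_integrable[OF ih] ih by simp
    qed (rule i0)
    have hS: "integrable lborel (\<lambda>z. \<psi> z * h (norm (w z)))"
    proof (rule Bochner_Integration.integrable_bound[OF hK])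
      have "\<psi> \<in> borel_measurable borel" using borel_measurable_continuous_onI[OF c\<psi>] by simp
      then show "(\<lambda>z. \<psi> z * h (norm (w z))) \<in> borel_measurable lborel" by measurable
      show "AE z in lborel. norm (\<psi> z * h (norm (w z))) \<le> norm (indicator K z * h (norm (w z)))"
      proof (rule AE_I2)
        fix z
        show "norm (\<psi> z * h (norm (w z))) \<le> norm (indicator K z * h (norm (w z)))"
        proof (cases "z \<in> S")
          case True
          then show ?thesis using K(3) mult_right_mono[OF \<psi>01(2)[of z] abs_ge_zero[of "h (norm (w z))"]] \<psi>01(1)[of z]
            by (auto simp: abs_mult)
        qed (simp add: \<psi>S)
      qed
    qed
    have iS: "integrable lborel (\<lambda>z. C1 * indicator S z)"
      using emeasure_bounded_finite[OF compact_imp_bounded[OF S(1)]] S(1)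
      by (intro integrable_mult_right integrable_real_indicator) (auto simp: borel_compact)
    have NaB: "Na \<le> cA / 2 * (\<integral>z. \<psi> z * h (norm (w z)) \<partial>lborel) + C1 * measure lborel S"
    proof -
      have "Na \<le> (\<integral>z. cA / 2 * (\<psi> z * h (norm (w z))) + C1 * indicator S z \<partial>lborel)"
        unfolding Na_def
      proof (rule integral_mono[OF iNa[OF ia]])
        show "integrable lborel (\<lambda>z. cA / 2 * (\<psi> z * h (norm (w z))) + C1 * indicator S z)"
          by (intro Bochner_Integration.integrable_add integrable_mult_right hS iS)
        fix z
        show "N * \<phi> z ^ p * norm (aK z) \<le> cA / 2 * (\<psi> z * h (norm (w z))) + C1 * indicator S z"
        proof (cases "z \<in> S")
          case True
          have "norm (aK z) \<le> CA * g (norm (w z))"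
            using A_bound[of "w z"] CA_pos g_nonneg[of "norm (w z)"] by (auto simp: aK_def zero_extend_def indicator_def)
          then have "N * \<phi> z ^ p * norm (aK z) \<le> N * \<phi> z ^ p * (CA * g (norm (w z)))"
            using N \<phi>(2)[of z] by (intro mult_left_mono) auto
          also have "\<dots> = (N * CA) * \<phi> z ^ p * g (norm (w z))" by simp
          also have "\<dots> \<le> (cA / 2) * \<phi> z ^ Suc p * h (norm (w z)) + C1"
            by (rule C1(2)) (use \<phi>(2,3) in auto)
          finally show ?thesis using True by (simp add: \<psi>_def mult_ac)
        next
          case False
          then show ?thesis using S(3)[OF False] \<psi>S[OF False] p(2) by (simp add: zero_power)
        qed
      qed
      also have "\<dots> = cA / 2 * (\<integral>z. \<psi> z * h (norm (w z)) \<partial>lborel) + C1 * measure lborel S"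
        by (subst Bochner_Integration.integral_add[OF integrable_mult_right[OF hS] iS]) simp
      finally show ?thesis .
    qed
    have low: "cA * (\<integral>z. \<psi> z * h (norm (w z)) \<partial>lborel) \<le> (\<integral>z. \<psi> z * (wK z \<bullet> aK z) \<partial>lborel)"
    proof -
      have "cA * (\<integral>z. \<psi> z * h (norm (w z)) \<partial>lborel) = (\<integral>z. cA * (\<psi> z * h (norm (w z))) \<partial>lborel)" by simp
      also have "\<dots> \<le> (\<integral>z. \<psi> z * (wK z \<bullet> aK z) \<partial>lborel)"
      proof (rule integral_mono[OF integrable_mult_right[OF hS] i0])
        fix z
        show "cA * (\<psi> z * h (norm (w z))) \<le> \<psi> z * (wK z \<bullet> aK z)"
          unfolding X0 using mult_left_mono[OF A_coercive[of "w z"] \<psi>01(1)[of z]] by (simp add: inner_commute mult_ac)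
      qed
      finally show ?thesis .
    qed
    \<comment> \<open>Half of the coercive integral is moved to the left, which is legitimate
      because \<open>hS\<close> makes that integral finite.\<close>
    have "cA / 2 * (\<integral>z. \<psi> z * h (norm (w z)) \<partial>lborel) \<le> Z"
      using main NaB low unfolding Z_def ipt_def by linarith
    then have "(2 / cA) * (cA / 2 * (\<integral>z. \<psi> z * h (norm (w z)) \<partial>lborel)) \<le> 2 / cA * Z"
      using cA_pos by (intro mult_left_mono) auto
    then show "(\<integral>z. \<phi> z ^ Suc p * h (norm (w z)) \<partial>lborel) \<le> 2 / cA * Z"
      using cA_pos unfolding \<psi>_def by simp
  qed
qed

end

text \<open>
  A smooth truncation at height \<open>\<delta>\<close>, given by \<open>\<delta> s / sqrt (\<delta>\<^sup>2 + s\<^sup>2)\<close>, together with its primitive.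
\<close>

lemma smooth_truncation:
  fixes \<delta> :: real
  assumes "0 < \<delta>"
  obtains S S' \<Theta> :: "real \<Rightarrow> real" where
    "\<And>s. (S has_real_derivative S' s) (at s)" "\<And>s. (\<Theta> has_real_derivative S s) (at s)"
    "continuous_on UNIV S'" "\<And>s. \<bar>S s\<bar> \<le> \<delta>" "\<And>s. \<bar>\<Theta> s\<bar> \<le> \<delta> * (\<delta> + \<bar>s\<bar>)"
    "\<And>s. 0 \<le> S' s" "\<And>s. S' s \<le> 1" "\<And>s. \<bar>s\<bar> \<le> \<delta> \<Longrightarrow> 1 / 4 \<le> S' s"
proof -
  let ?q = "\<lambda>s. sqrt (\<delta>\<^sup>2 + s\<^sup>2)"
  have p: "0 < \<delta>\<^sup>2 + s\<^sup>2" for s using assms by (simp add: add_pos_nonneg)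
  have q: "0 < ?q s" "(?q s)\<^sup>2 = \<delta>\<^sup>2 + s\<^sup>2" "\<delta> \<le> ?q s" "\<bar>s\<bar> \<le> ?q s" for s
  proof -
    show "0 < ?q s" by (rule real_sqrt_gt_zero[OF p])
    show "(?q s)\<^sup>2 = \<delta>\<^sup>2 + s\<^sup>2" using p[of s] by simp
    show "\<delta> \<le> ?q s" by (rule real_le_rsqrt) simp
    show "\<bar>s\<bar> \<le> ?q s" by (rule real_le_rsqrt) simp
  qed
  have dq: "(?q has_real_derivative s / ?q s) (at s)" for s
  proof -
    have "((\<lambda>s. \<delta>\<^sup>2 + s\<^sup>2) has_real_derivative 2 * s) (at s)" by (auto intro!: derivative_eq_intros)
    with DERIV_real_sqrt[OF p[of s]]
    have "(?q has_real_derivative inverse (?q s) / 2 * (2 * s)) (at s)"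
      by (rule DERIV_chain2[where f=sqrt])
    moreover have "inverse t / 2 * (2 * s) = s / t" for t :: real by (cases "t = 0") (simp_all add: field_simps)
    ultimately show ?thesis by (rule DERIV_cong)
  qed
  let ?S = "\<lambda>s. \<delta> * (s / ?q s)" and ?S' = "\<lambda>s. (\<delta> / ?q s) ^ 3" and ?T = "\<lambda>s. \<delta> * ?q s"
  show thesis
  proof (rule that[of ?S ?S' ?T])
    fix s
    have "((\<lambda>s. \<delta> * (s / ?q s)) has_real_derivative \<delta> * ((1 * ?q s - s * (s / ?q s)) / (?q s * ?q s))) (at s)"
      by (intro DERIV_cmult DERIV_divide DERIV_ident dq less_imp_neq[THEN not_sym] q(1))
    moreover have "\<delta> * ((1 * ?q s - s * (s / ?q s)) / (?q s * ?q s)) = (\<delta> / ?q s) ^ 3"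
    proof -
      have "\<delta> * ((1 * t - s * (s / t)) / (t * t)) = (\<delta> / t) ^ 3" if "0 < t" "t\<^sup>2 = \<delta>\<^sup>2 + s\<^sup>2" for t
      proof -
        have "t - s * (s / t) = (t\<^sup>2 - s\<^sup>2) / t" using that(1) by (simp add: field_simps power2_eq_square)
        also have "\<dots> = \<delta>\<^sup>2 / t" using that(2) by simp
        finally show ?thesis using that(1) by (simp add: power3_eq_cube power2_eq_square)
      qed
      then show ?thesis using q(1,2)[of s] by blast
    qed
    ultimately show "(?S has_real_derivative ?S' s) (at s)" by (rule DERIV_cong)
    show "(?T has_real_derivative ?S s) (at s)" by (intro DERIV_cmult dq)
    have "\<bar>s / ?q s\<bar> \<le> 1" using q(1,4)[of s] by (simp add: abs_divide)
    then have "\<delta> * \<bar>s / ?q s\<bar> \<le> \<delta> * 1" using assms by (intro mult_left_mono) auto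
    then show "\<bar>?S s\<bar> \<le> \<delta>" using assms by (simp add: abs_mult)
    have "?q s \<le> \<delta> + \<bar>s\<bar>" using assms sqrt_sum_squares_le_sum_abs[of \<delta> s] by simp
    then show "\<bar>?T s\<bar> \<le> \<delta> * (\<delta> + \<bar>s\<bar>)" using assms q(1)[of s] by (simp add: abs_mult)
    have r: "0 \<le> \<delta> / ?q s" "\<delta> / ?q s \<le> 1" using assms q(1,3)[of s] by simp_all
    then show "0 \<le> ?S' s" "?S' s \<le> 1" by (auto intro: power_le_one)
    assume s: "\<bar>s\<bar> \<le> \<delta>"
    have "s\<^sup>2 \<le> \<delta>\<^sup>2" using s assms by (metis abs_le_square_iff abs_of_pos)
    \<comment> \<open>The rational number \<open>3 / 2\<close> replaces the square root of 2 as an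
      upper bound.\<close>
    have "2 * \<delta>\<^sup>2 \<le> (3 / 2 * \<delta>)\<^sup>2" using assms by (simp add: power2_eq_square)
    then have "?q s \<le> sqrt ((3 / 2 * \<delta>)\<^sup>2)"
      using \<open>s\<^sup>2 \<le> \<delta>\<^sup>2\<close> by (intro real_sqrt_le_mono) linarith
    then have "?q s \<le> 3 / 2 * \<delta>" using assms by simp
    then have "2 / 3 \<le> \<delta> / ?q s" using q(1)[of s] by (simp add: field_simps)
    \<comment> \<open>The cube is \<open>8 / 27\<close>, which exceeds \<open>1 / 4\<close>.\<close>
    then have "(2 / 3) ^ 3 \<le> ?S' s" by (intro power_mono) auto
    then show "1 / 4 \<le> ?S' s" by (simp add: power3_eq_cube)
  next
    show "continuous_on UNIV ?S'"
      using p by (intro continuous_intros) (auto simp: less_imp_neq[symmetric])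
  qed
qed

section \<open>Differences of two supersolutions\<close>

context growth
begin

text \<open>The mollified difference is tested with \<open>\<phi> S0(u1 - u2)\<close>. Every term
  other than the monotonicity term carries a factor \<open>\<delta>\<close>: the densities
  \<open>m1\<close> and \<open>m2\<close> have bounded mass and meet
  \<open>|S0| \<le> \<delta>\<close>, the time term contains the primitive \<open>\<Theta>\<close>,
  and the remaining flux term contains \<open>S0\<close>. The predicate \<open>P\<close> singles out
  a family with uniform energy bounds, so that \<open>C\<close> is the same for all pairs and all
  \<open>\<delta>\<close>.\<close>

lemma difference_estimate:
  assumes \<phi>: "\<phi> \<in> Cc_infty U" "\<And>z. 0 \<le> \<phi> z" "\<And>z. \<phi> z \<le> 1" and U: "open U" and M: "0 \<le> M"
    and bd: "\<And>K. compact K \<Longrightarrow> K \<subseteq> U \<Longrightarrow> \<exists>C. \<forall>u w. P u w \<longrightarrow> (\<integral>z. indicator K z * h (norm (w z)) \<partial>lborel) \<le> C"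
    and P: "\<And>u w. P u w \<Longrightarrow> wsuper U u w" "\<And>u w z. P u w \<Longrightarrow> \<bar>u z\<bar> \<le> M"
  shows "\<exists>C\<ge>0. \<forall>u1 w1 u2 w2 \<delta>. P u1 w1 \<longrightarrow> P u2 w2 \<longrightarrow> 0 < \<delta> \<longrightarrow> \<delta> \<le> 1 \<longrightarrow>
    integrable lborel (\<lambda>z. \<phi> z * (if \<bar>u1 z - u2 z\<bar> \<le> \<delta> then (w1 z - w2 z) \<bullet> (A (w1 z) - A (w2 z)) else 0)) \<and>
    (\<integral>z. \<phi> z * (if \<bar>u1 z - u2 z\<bar> \<le> \<delta> then (w1 z - w2 z) \<bullet> (A (w1 z) - A (w2 z)) else 0) \<partial>lborel) \<le> \<delta> * C"
proof -
  obtain S where S: "compact S" "S \<subseteq> U" "\<And>z. z \<notin> S \<Longrightarrow> \<phi> z = 0" using Cc_infty_support[OF \<phi>(1)] by metis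
  obtain K k0 where K: "compact K" "K \<subseteq> U" "S \<subseteq> K"
    and k0: "\<And>k z. k \<ge> k0 \<Longrightarrow> z \<in> S \<Longrightarrow> cball z (inverse (real (Suc k))) \<subseteq> K"
    by (rule compact_neighbourhood[OF S(1,2) U]) blast
  have [measurable]: "K \<in> sets borel" using K by (simp add: borel_compact)
  obtain c where c: "c > 0" "\<And>z. (\<Sum>b\<in>Basis. \<bar>dderiv (b, 0) \<phi> z\<bar>) \<le> c"
    using Cc_infty_spatial_bound[OF \<phi>(1)] by blast
  have dS: "dderiv e \<phi> z = 0" if "z \<notin> S" for e z by (rule dderiv_eq_zero_off[OF S(1,3) that])
  note c\<phi> = Cc_infty_continuous[OF \<phi>(1)] and cd = Cc_infty_dderiv_continuous[OF \<phi>(1)]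
  have m\<phi>[measurable]: "\<phi> \<in> borel_measurable borel" by (rule borel_measurable_continuous_onI[OF c\<phi>])
  have i\<phi>t: "integrable lborel (\<lambda>z. \<bar>dderiv (0, 1) \<phi> z\<bar>)"
    by (rule integrable_compact_support[OF _ S(1)]) (intro continuous_intros cd, simp add: dS)
  define ipt where "ipt = (\<integral>z. \<bar>dderiv (0, 1) \<phi> z\<bar> \<partial>lborel)"
  have ipt0: "0 \<le> ipt" unfolding ipt_def by (rule integral_nonneg_AE) simp
  obtain C0 where C0: "\<And>u w. P u w \<Longrightarrow> (\<integral>z. indicator K z * h (norm (w z)) \<partial>lborel) \<le> C0"
    using bd[OF K(1,2)] by blast
  obtain C1 where C1: "C1 \<ge> 0" "\<And>s. s \<ge> 0 \<Longrightarrow> s \<le> C1 + 1 * h s \<and> g s \<le> C1 + 1 * h s"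
    using superlinear[of 1] by auto
  \<comment> \<open>A common bound for the L^1 norms of the fluxes on \<open>K\<close>; the absolute
    value provides nonnegativity without knowing the sign of \<open>C0\<close>.\<close>
  define Z where "Z = \<bar>CA * (C1 * measure lborel K + C0)\<bar>"
  have Z0: "0 \<le> Z" by (simp add: Z_def)
  have iK: "integrable lborel (\<lambda>z. C1 * indicator K z)"
    using emeasure_bounded_finite[OF compact_imp_bounded[OF K(1)]]
    by (intro integrable_mult_right integrable_real_indicator) auto
  have aZ: "integrable lborel (zero_extend K (\<lambda>z. A (w z)))" "(\<integral>z. norm (zero_extend K (\<lambda>z. A (w z)) z) \<partial>lborel) \<le> Z"
    if w: "P u w" for u w
  proof -
    have wm: "w \<in> borel_measurable borel" and hK: "integrable lborel (\<lambda>z. indicator K z * h (norm (w z)))"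
      using P(1)[OF w] K unfolding wsuper_def by blast+
    show i: "integrable lborel (zero_extend K (\<lambda>z. A (w z)))"
      unfolding zero_extend_def[abs_def] using integrable_loc(2)[OF wm K(1) hK] .
    have "(\<integral>z. norm (zero_extend K (\<lambda>z. A (w z)) z) \<partial>lborel) \<le> (\<integral>z. CA * (C1 * indicator K z + indicator K z * h (norm (w z))) \<partial>lborel)"
    proof (rule integral_mono[OF integrable_norm[OF i]])
      show "integrable lborel (\<lambda>z. CA * (C1 * indicator K z + indicator K z * h (norm (w z))))"
        by (intro integrable_mult_right Bochner_Integration.integrable_add iK hK)
      fix z
      have "norm (A (w z)) \<le> CA * (C1 + h (norm (w z)))"
        using order_trans[OF A_bound mult_left_mono[of "g (norm (w z))" "C1 + h (norm (w z))" CA]] C1(2)[of "norm (w z)"] CA_pos by simp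
      then show "norm (zero_extend K (\<lambda>z. A (w z)) z) \<le> CA * (C1 * indicator K z + indicator K z * h (norm (w z)))"
        by (auto simp: zero_extend_def indicator_def)
    qed
    also have "\<dots> = CA * (C1 * measure lborel K + (\<integral>z. indicator K z * h (norm (w z)) \<partial>lborel))"
      using iK hK by simp
    also have "\<dots> \<le> CA * (C1 * measure lborel K + C0)"
      using C0[OF w] CA_pos by (intro mult_left_mono) auto
    also have "\<dots> \<le> Z" by (simp add: Z_def)
    finally show "(\<integral>z. norm (zero_extend K (\<lambda>z. A (w z)) z) \<partial>lborel) \<le> Z" .
  qed
  \<comment> \<open>\<open>Q\<close> bounds the mass of one density. The summands of
    \<open>CC\<close> belong to the two densities, to the time term, where
    \<open>|u1 - u2| \<le> 2 * M\<close> and \<open>\<delta> \<le> 1\<close>, and to the two fluxes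
    against the gradient of \<open>\<phi>\<close>.\<close>
  define Q where "Q = M * ipt + c * Z"
  define CC where "CC = 2 * Q + (1 + 2 * M) * ipt + 2 * c * Z"
  have CC0: "0 \<le> 4 * CC" unfolding CC_def Q_def using M ipt0 c(1) Z0 by simp
  show ?thesis
  proof (intro exI[of _ "4 * CC"] conjI[OF CC0] allI impI)
    fix u1 w1 u2 w2 and \<delta> :: real
    assume P1: "P u1 w1" and P2: "P u2 w2" and \<delta>: "0 < \<delta>" "\<delta> \<le> 1"
    obtain S0 S' \<Theta> where tr: "\<And>s. (S0 has_real_derivative S' s) (at s)" "\<And>s. (\<Theta> has_real_derivative S0 s) (at s)"
      "continuous_on UNIV S'" "\<And>s. \<bar>S0 s\<bar> \<le> \<delta>" "\<And>s. \<bar>\<Theta> s\<bar> \<le> \<delta> * (\<delta> + \<bar>s\<bar>)"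
      "\<And>s. 0 \<le> S' s" "\<And>s. S' s \<le> 1" "\<And>s. \<bar>s\<bar> \<le> \<delta> \<Longrightarrow> 1 / 4 \<le> S' s"
      using smooth_truncation[OF \<delta>(1)] by metis
    have cS: "continuous_on UNIV S0" "continuous_on UNIV \<Theta>"
      using tr(1,2) by (meson DERIV_isCont continuous_at_imp_continuous_on)+
    have [measurable]: "S' \<in> borel_measurable borel" by (rule borel_measurable_continuous_onI[OF tr(3)])
    note W1 = P(1)[OF P1] and W2 = P(1)[OF P2]
    have wm[measurable]: "w1 \<in> borel_measurable borel" "u1 \<in> borel_measurable borel"
      "w2 \<in> borel_measurable borel" "u2 \<in> borel_measurable borel"
      and hK1: "integrable lborel (\<lambda>z. indicator K z * h (norm (w1 z)))"
      and hK2: "integrable lborel (\<lambda>z. indicator K z * h (norm (w2 z)))"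
      using W1 W2 K unfolding wsuper_def by blast+
    define p1 where "p1 = zero_extend K u1" define p2 where "p2 = zero_extend K u2"
    define y1 where "y1 = zero_extend K w1" define y2 where "y2 = zero_extend K w2"
    define a1 where "a1 = zero_extend K (\<lambda>z. A (w1 z))" define a2 where "a2 = zero_extend K (\<lambda>z. A (w2 z))"
    \<comment> \<open>The product of a difference of gradients and a difference of fluxes expands
      into four Young terms, in which each \<open>h\<close> occurs twice; hence the factor
      2.\<close>
    define hh where "hh = (\<lambda>z. 2 * CA * (indicator K z * h (norm (w1 z)) + indicator K z * h (norm (w2 z))))"
    have iy1: "integrable lborel y1" and iy2: "integrable lborel y2"
      unfolding y1_def y2_def zero_extend_def using integrable_loc(1)[OF wm(1) K(1) hK1] integrable_loc(1)[OF wm(3) K(1) hK2] .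
    have ip1: "integrable lborel p1" and ip2: "integrable lborel p2"
      unfolding p1_def p2_def zero_extend_def
      using integrable_loc_bounded[OF wm(2) K(1) P(2)[OF P1]] integrable_loc_bounded[OF wm(4) K(1) P(2)[OF P2]] .
    have ia1: "integrable lborel a1" and ia2: "integrable lborel a2"
      unfolding a1_def a2_def using aZ(1)[OF P1] aZ(1)[OF P2] .
    have Z1: "(\<integral>z. norm (a1 z) \<partial>lborel) \<le> Z" and Z2: "(\<integral>z. norm (a2 z) \<partial>lborel) \<le> Z"
      unfolding a1_def a2_def using aZ(2)[OF P1] aZ(2)[OF P2] .
    have ih: "integrable lborel hh" unfolding hh_def
      by (intro integrable_mult_right Bochner_Integration.integrable_add hK1 hK2)
    have pM: "norm (p1 z) \<le> M" "norm (p2 z) \<le> M" for z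
      using P(2)[OF P1, of z] P(2)[OF P2, of z] M by (auto simp: p1_def p2_def zero_extend_def indicator_def)
    define y where "y = (\<lambda>z. y1 z - y2 z)"
    define a where "a = (\<lambda>z. a1 z - a2 z)"
    define v where "v = (\<lambda>z. p1 z - p2 z)"
    have iy: "integrable lborel y" and ia: "integrable lborel a" and iv: "integrable lborel v"
      unfolding y_def a_def v_def by (intro Bochner_Integration.integrable_diff iy1 iy2 ia1 ia2 ip1 ip2)+
    have ab1: "integrable lborel (\<lambda>z. a1 z \<bullet> b)" and ab2: "integrable lborel (\<lambda>z. a2 z \<bullet> b)" for b
      by (intro integrable_inner_left ia1 ia2)+
    \<comment> \<open>The mollified defects in the two supersolution inequalities. Only their sign
      and their local mass will be used.\<close>
    define m1 where "m1 = (\<lambda>k z. dmoll (0, 1) k p1 z - (\<Sum>b\<in>Basis. dmoll (b, 0) k (\<lambda>z. a1 z \<bullet> b) z))"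
    define m2 where "m2 = (\<lambda>k z. dmoll (0, 1) k p2 z - (\<Sum>b\<in>Basis. dmoll (b, 0) k (\<lambda>z. a2 z \<bullet> b) z))"
    have m0: "0 \<le> m1 k z" "0 \<le> m2 k z" if "k \<ge> k0" "z \<in> S" for k z
      unfolding m1_def m2_def p1_def p2_def a1_def a2_def zero_extend_def
      using moll_equations(2)[OF W1 P(2)[OF P1] K(1,2) k0[OF that]] moll_equations(2)[OF W2 P(2)[OF P2] K(1,2) k0[OF that]] .
    have eqd: "dmoll (b, 0) k p1 z - dmoll (b, 0) k p2 z = moll k y z \<bullet> b" if "k \<ge> k0" "z \<in> S" "b \<in> Basis" for b k z
      unfolding y_def moll_diff[OF iy1 iy2] inner_diff_left
      unfolding p1_def p2_def y1_def y2_def zero_extend_def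
      using moll_equations(1)[OF W1 P(2)[OF P1] K(1,2) k0[OF that(1,2)] that(3)]
        moll_equations(1)[OF W2 P(2)[OF P2] K(1,2) k0[OF that(1,2)] that(3)] by simp
    have cm: "continuous_on UNIV (m1 k)" "continuous_on UNIV (m2 k)" for k
      unfolding m1_def m2_def by (intro continuous_intros dmoll_continuous ip1 ip2 ab1 ab2)+
    have spat: "\<bar>\<Sum>b\<in>Basis. dderiv (b, 0) \<phi> z * (x \<bullet> b)\<bar> \<le> c * norm x" for z x
      using sum_inner_bound[of "\<lambda>b. dderiv (b, 0) \<phi> z" x] mult_right_mono[OF c(2)[of z] norm_ge_zero[of x]] by linarith
    \<comment> \<open>The multiplier is the constant 1, so no gradient of the solution appears, and
      the mass is controlled by the sup norm of \<open>p\<close> and the L^1 norm of the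
      flux.\<close>
    have mass: "(\<integral>z. \<phi> z * m k z \<partial>lborel) \<le> Q"
      if m: "m = (\<lambda>k z. dmoll (0, 1) k p z - (\<Sum>b\<in>Basis. dmoll (b, 0) k (\<lambda>z. q z \<bullet> b) z))"
        and ip: "integrable lborel p" and iq: "integrable lborel q" and pM: "\<And>z. norm (p z) \<le> M"
        and qZ: "(\<integral>z. norm (q z) \<partial>lborel) \<le> Z"
      for m p k and q :: "'a \<times> real \<Rightarrow> 'a"
    proof -
      have iqb: "integrable lborel (\<lambda>z. q z \<bullet> b)" for b by (rule integrable_inner_left[OF iq])
      have qb: "moll k (\<lambda>z. q z \<bullet> b) z = moll k q z \<bullet> b" for b z
        by (rule moll_bounded_linear[OF bounded_linear_inner_left iq])
      note cp = moll_continuous[OF ip, of k] and cq = moll_continuous[OF iq, of k]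
      have cqb: "continuous_on UNIV (\<lambda>z. moll k q z \<bullet> b)" for b by (intro continuous_intros cq)
      let ?Y = "\<lambda>z. \<Sum>b\<in>Basis. dderiv (b, 0) \<phi> z * (moll k q z \<bullet> b)"
      have id: "(\<integral>z. \<phi> z * 1 * (dmoll (0, 1) k p z - (\<Sum>b\<in>Basis. dmoll (b, 0) k (\<lambda>z. q z \<bullet> b) z)) \<partial>lborel)
        = - (\<integral>z. dderiv (0, 1) \<phi> z * moll k p z \<partial>lborel)
          + (\<integral>z. (\<Sum>b\<in>Basis. (\<phi> z * 0 * dmoll (b, 0) k p z + 1 * dderiv (b, 0) \<phi> z) * (moll k q z \<bullet> b)) \<partial>lborel)"
      proof (rule tested_divergence_identity[OF \<phi>(1), where v="moll k p" and vt="dmoll (0, 1) k p" and vb="\<lambda>b. dmoll (b, 0) k p"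
            and B="\<lambda>b z. moll k q z \<bullet> b" and dB="\<lambda>b. dmoll (b, 0) k (\<lambda>z. q z \<bullet> b)"
            and S="\<lambda>s. 1" and S'="\<lambda>s. 0" and \<Theta>="\<lambda>s. s"])
        show "((\<lambda>s. 1) has_real_derivative 0) (at s)" for s by (rule DERIV_const)
        show "((\<lambda>s. s) has_real_derivative 1) (at s)" for s by (rule DERIV_ident)
        show "has_line_deriv (b, 0) (\<lambda>z. moll k q z \<bullet> b) (dmoll (b, 0) k (\<lambda>z. q z \<bullet> b))" for b
          using dmoll_line_deriv[OF iqb, where k=k] unfolding qb .
      qed (intro cp dmoll_line_deriv dmoll_continuous ip iqb cqb continuous_on_const)+
      have 1: "- (\<integral>z. dderiv (0, 1) \<phi> z * moll k p z \<partial>lborel) \<le> M * ipt"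
      proof -
        have "- (\<integral>z. dderiv (0, 1) \<phi> z * moll k p z \<partial>lborel) = (\<integral>z. - (dderiv (0, 1) \<phi> z * moll k p z) \<partial>lborel)" by simp
        also have "\<dots> \<le> (\<integral>z. M * \<bar>dderiv (0, 1) \<phi> z\<bar> \<partial>lborel)"
        proof (rule integral_mono[OF _ integrable_mult_right[OF i\<phi>t]])
          show "integrable lborel (\<lambda>z. - (dderiv (0, 1) \<phi> z * moll k p z))"
            by (rule integrable_compact_support[OF _ S(1)]) (intro continuous_intros cp cd, simp add: dS)
          fix z
          have "\<bar>dderiv (0, 1) \<phi> z * moll k p z\<bar> \<le> \<bar>dderiv (0, 1) \<phi> z\<bar> * M"
            unfolding abs_mult using moll_norm_bound[OF ip pM, of k z] by (intro mult_left_mono) auto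
          then show "- (dderiv (0, 1) \<phi> z * moll k p z) \<le> M * \<bar>dderiv (0, 1) \<phi> z\<bar>" by (simp add: mult.commute)
        qed
        also have "\<dots> = M * ipt" by (simp add: ipt_def)
        finally show ?thesis .
      qed
      have 2: "integral\<^sup>L lborel ?Y \<le> c * Z"
      proof -
        have "integral\<^sup>L lborel ?Y \<le> (\<integral>z. c * norm (moll k q z) \<partial>lborel)"
        proof (rule integral_mono)
          show "integrable lborel ?Y"
            by (rule integrable_compact_support[OF _ S(1)]) (intro continuous_intros cqb cd, simp add: dS)
          show "integrable lborel (\<lambda>z. c * norm (moll k q z))"
            by (intro integrable_mult_right integrable_norm moll_integrable iq)
          show "?Y z \<le> c * norm (moll k q z)" for z using spat[of z "moll k q z"] by linarith
        qed
        also have "\<dots> = c * (\<integral>z. norm (moll k q z) \<partial>lborel)" by simp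
        also have "\<dots> \<le> c * Z" using moll_L1[OF iq, of k] qZ c(1) by (intro mult_left_mono) auto
        finally show ?thesis .
      qed
      have "(\<integral>z. \<phi> z * m k z \<partial>lborel) = - (\<integral>z. dderiv (0, 1) \<phi> z * moll k p z \<partial>lborel) + integral\<^sup>L lborel ?Y"
        using id unfolding m by simp
      then show ?thesis using 1 2 unfolding Q_def by linarith
    qed
    have mass1: "(\<integral>z. \<phi> z * m1 k z \<partial>lborel) \<le> Q" for k by (rule mass[OF m1_def ip1 ia1 pM(1) Z1])
    have mass2: "(\<integral>z. \<phi> z * m2 k z \<partial>lborel) \<le> Q" for k by (rule mass[OF m2_def ip2 ia2 pM(2) Z2])
    define X where "X = (\<lambda>k z. \<phi> z * S' (moll k v z) * (moll k y z \<bullet> moll k a z))"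
    define H where "H = (\<lambda>k z. moll k hh z + moll k hh z)"
    have prod: "norm (moll k y z) * norm (moll k a z) \<le> moll k hh z + moll k hh z" for k z
    proof (rule moll_product_bound[OF iy ia ih ih])
      fix x x'
      have hn: "0 \<le> hh x" for x unfolding hh_def using CA_pos h_nonneg by simp
      show "norm (y x) * norm (a x') \<le> hh x + hh x'"
      proof (cases "x \<in> K \<and> x' \<in> K")
        case True
        let ?r1 = "norm (w1 x)" and ?r2 = "norm (w2 x)" and ?s1 = "norm (w1 x')" and ?s2 = "norm (w2 x')"
        have "norm (y x) \<le> ?r1 + ?r2"
          using True norm_triangle_ineq4[of "w1 x" "w2 x"] by (simp add: y_def y1_def y2_def zero_extend_def)
        moreover have "norm (a x') \<le> CA * g ?s1 + CA * g ?s2"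
          using True norm_triangle_ineq4[of "A (w1 x')" "A (w2 x')"] A_bound[of "w1 x'"] A_bound[of "w2 x'"]
          by (simp add: a_def a1_def a2_def zero_extend_def)
        ultimately have "norm (y x) * norm (a x') \<le> (?r1 + ?r2) * (CA * g ?s1 + CA * g ?s2)"
          by (intro mult_mono) auto
        also have "\<dots> = CA * (g ?s1 * ?r1 + g ?s1 * ?r2 + g ?s2 * ?r1 + g ?s2 * ?r2)"
          by (simp add: algebra_simps)
        also have "\<dots> \<le> CA * ((h ?s1 + h ?r1) + (h ?s1 + h ?r2) + (h ?s2 + h ?r1) + (h ?s2 + h ?r2))"
          using CA_pos by (intro mult_left_mono add_mono young) auto
        finally show ?thesis using True by (simp add: hh_def algebra_simps)
      next
        case False
        then have "norm (y x) * norm (a x') = 0" by (auto simp: y_def y1_def y2_def a_def a1_def a2_def zero_extend_def)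
        then show ?thesis using hn[of x] hn[of x'] by linarith
      qed
    qed
    have vd: "moll k v z = moll k p1 z - moll k p2 z" for k z unfolding v_def by (rule moll_diff[OF ip1 ip2])
    have ad: "moll k a z = moll k a1 z - moll k a2 z" for k z unfolding a_def by (rule moll_diff[OF ia1 ia2])
    have cv: "continuous_on UNIV (moll k v)" and cy: "continuous_on UNIV (moll k y)" and ca: "continuous_on UNIV (moll k a)" for k
      by (intro moll_continuous iv iy ia)+
    have cSv: "continuous_on UNIV (\<lambda>z. S0 (moll k v z))" "continuous_on UNIV (\<lambda>z. S' (moll k v z))" "continuous_on UNIV (\<lambda>z. \<Theta> (moll k v z))" for k
      by (rule continuous_on_compose2[OF _ cv], fact, simp)+
    have iX: "integrable lborel (X k)" for k
      unfolding X_def by (rule integrable_compact_support[OF _ S(1)])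
        (intro continuous_intros c\<phi> cSv cy ca, simp add: S(3))
    have vM: "\<bar>moll k v z\<bar> \<le> 2 * M" for k z
      using moll_norm_bound[OF ip1 pM(1), of k z] moll_norm_bound[OF ip2 pM(2), of k z] unfolding vd by simp
    have ineq: "integral\<^sup>L lborel (X k) \<le> \<delta> * CC" if k: "k \<ge> k0" for k
    proof -
      let ?v = "moll k v"
      let ?D = "\<lambda>b z. dmoll (b, 0) k (\<lambda>z. a1 z \<bullet> b) z - dmoll (b, 0) k (\<lambda>z. a2 z \<bullet> b) z"
      let ?vt = "\<lambda>z. dmoll (0, 1) k p1 z - dmoll (0, 1) k p2 z"
      let ?Y = "\<lambda>z. S0 (?v z) * (\<Sum>b\<in>Basis. dderiv (b, 0) \<phi> z * (moll k a z \<bullet> b))"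
      have cab: "continuous_on UNIV (\<lambda>z. moll k a z \<bullet> b)" for b by (intro continuous_intros ca)
      have ldv: "has_line_deriv e ?v (\<lambda>z. dmoll e k p1 z - dmoll e k p2 z)" for e
        unfolding vd[abs_def] by (intro has_line_deriv_diff dmoll_line_deriv ip1 ip2)
      have lda: "has_line_deriv (b, 0) (\<lambda>z. moll k a z \<bullet> b) (?D b)" for b
      proof -
        have "(\<lambda>z. moll k a z \<bullet> b) = (\<lambda>z. moll k (\<lambda>z. a1 z \<bullet> b) z - moll k (\<lambda>z. a2 z \<bullet> b) z)"
          by (simp add: ad inner_diff_left moll_bounded_linear[OF bounded_linear_inner_left ia1] moll_bounded_linear[OF bounded_linear_inner_left ia2])
        then show ?thesis by (simp add: has_line_deriv_diff dmoll_line_deriv ab1 ab2)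
      qed
      have id: "(\<integral>z. \<phi> z * S0 (?v z) * (?vt z - (\<Sum>b\<in>Basis. ?D b z)) \<partial>lborel)
        = - (\<integral>z. dderiv (0, 1) \<phi> z * \<Theta> (?v z) \<partial>lborel)
          + (\<integral>z. (\<Sum>b\<in>Basis. (\<phi> z * S' (?v z) * (dmoll (b, 0) k p1 z - dmoll (b, 0) k p2 z) + S0 (?v z) * dderiv (b, 0) \<phi> z) * (moll k a z \<bullet> b)) \<partial>lborel)"
        by (rule tested_divergence_identity[OF \<phi>(1), where v="?v" and vt="?vt" and vb="\<lambda>b z. dmoll (b, 0) k p1 z - dmoll (b, 0) k p2 z"
            and B="\<lambda>b z. moll k a z \<bullet> b" and dB="?D"
            and S=S0 and S'=S' and \<Theta>=\<Theta>, OF cv ldv _ ldv _ cab lda _ tr(1,2,3)])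
          (intro continuous_intros dmoll_continuous ip1 ip2 ab1 ab2)+
      have iY: "integrable lborel ?Y"
        by (rule integrable_compact_support[OF _ S(1)]) (intro continuous_intros cSv cab cd, simp add: dS)
      have pt: "(\<Sum>b\<in>Basis. (\<phi> z * S' (?v z) * (dmoll (b, 0) k p1 z - dmoll (b, 0) k p2 z) + S0 (?v z) * dderiv (b, 0) \<phi> z) * (moll k a z \<bullet> b))
          = X k z + ?Y z" for z
      proof (cases "z \<in> S")
        case True
        have "(\<Sum>b\<in>Basis. (\<phi> z * S' (?v z) * (dmoll (b, 0) k p1 z - dmoll (b, 0) k p2 z) + S0 (?v z) * dderiv (b, 0) \<phi> z) * (moll k a z \<bullet> b))
          = (\<Sum>b\<in>Basis. \<phi> z * S' (?v z) * ((moll k y z \<bullet> b) * (moll k a z \<bullet> b)) + S0 (?v z) * (dderiv (b, 0) \<phi> z * (moll k a z \<bullet> b)))"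
          by (rule sum.cong) (simp_all add: eqd[OF k True] distrib_right)
        also have "\<dots> = X k z + ?Y z"
          by (simp add: sum.distrib sum_distrib_left X_def euclidean_inner[of "moll k y z" "moll k a z"])
        finally show ?thesis .
      next
        case False
        then show ?thesis by (simp add: S(3) dS X_def)
      qed
      \<comment> \<open>The difference \<open>m1 - m2\<close> has no sign, but nonnegativity of both
        densities bounds its modulus by their sum, whose mass is at most
        \<open>2 * Q\<close>.\<close>
      have L: "(\<integral>z. \<phi> z * S0 (?v z) * (?vt z - (\<Sum>b\<in>Basis. ?D b z)) \<partial>lborel) \<le> 2 * \<delta> * Q"
      proof -
        have im: "integrable lborel (\<lambda>z. \<phi> z * m1 k z)" "integrable lborel (\<lambda>z. \<phi> z * m2 k z)"
          by (rule integrable_compact_support[OF _ S(1)], intro continuous_intros c\<phi> cm, simp add: S(3))+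
        have eq: "?vt z - (\<Sum>b\<in>Basis. ?D b z) = m1 k z - m2 k z" for z
          by (simp add: m1_def m2_def sum_subtractf)
        have "(\<integral>z. \<phi> z * S0 (?v z) * (m1 k z - m2 k z) \<partial>lborel) \<le> (\<integral>z. \<delta> * (\<phi> z * m1 k z) + \<delta> * (\<phi> z * m2 k z) \<partial>lborel)"
        proof (rule integral_mono)
          show "integrable lborel (\<lambda>z. \<phi> z * S0 (?v z) * (m1 k z - m2 k z))"
            by (rule integrable_compact_support[OF _ S(1)]) (intro continuous_intros c\<phi> cm cSv, simp add: S(3))
          show "integrable lborel (\<lambda>z. \<delta> * (\<phi> z * m1 k z) + \<delta> * (\<phi> z * m2 k z))"
            by (intro Bochner_Integration.integrable_add integrable_mult_right im)
          fix z
          show "\<phi> z * S0 (?v z) * (m1 k z - m2 k z) \<le> \<delta> * (\<phi> z * m1 k z) + \<delta> * (\<phi> z * m2 k z)"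
          proof (cases "z \<in> S")
            case True
            have "S0 (?v z) * (m1 k z - m2 k z) \<le> \<bar>S0 (?v z)\<bar> * \<bar>m1 k z - m2 k z\<bar>"
              by (metis abs_ge_self abs_mult)
            also have "\<dots> \<le> \<delta> * (m1 k z + m2 k z)"
              using tr(4)[of "?v z"] m0[OF k True] \<delta> by (intro mult_mono) auto
            finally have "\<phi> z * (S0 (?v z) * (m1 k z - m2 k z)) \<le> \<phi> z * (\<delta> * (m1 k z + m2 k z))"
              using \<phi>(2) by (intro mult_left_mono) auto
            then show ?thesis by (simp add: algebra_simps)
          qed (simp add: S(3))
        qed
        also have "\<dots> = \<delta> * (\<integral>z. \<phi> z * m1 k z \<partial>lborel) + \<delta> * (\<integral>z. \<phi> z * m2 k z \<partial>lborel)"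
          using im by simp
        also have "\<dots> \<le> \<delta> * Q + \<delta> * Q"
          using mass1[of k] mass2[of k] \<delta> by (intro add_mono mult_left_mono) auto
        finally show ?thesis unfolding eq by (simp add: mult.commute mult.left_commute)
      qed
      have R1: "(\<integral>z. dderiv (0, 1) \<phi> z * \<Theta> (?v z) \<partial>lborel) \<le> \<delta> * ((1 + 2 * M) * ipt)"
      proof -
        have "(\<integral>z. dderiv (0, 1) \<phi> z * \<Theta> (?v z) \<partial>lborel) \<le> (\<integral>z. \<delta> * (1 + 2 * M) * \<bar>dderiv (0, 1) \<phi> z\<bar> \<partial>lborel)"
        proof (rule integral_mono[OF _ integrable_mult_right[OF i\<phi>t]])
          show "integrable lborel (\<lambda>z. dderiv (0, 1) \<phi> z * \<Theta> (?v z))"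
            by (rule integrable_compact_support[OF _ S(1)]) (intro continuous_intros cSv cd, simp add: dS)
          fix z
          have "\<bar>\<Theta> (?v z)\<bar> \<le> \<delta> * (\<delta> + \<bar>?v z\<bar>)" by (rule tr(5))
          also have "\<dots> \<le> \<delta> * (1 + 2 * M)" using vM[of k z] \<delta> by (intro mult_left_mono) auto
          finally have "\<bar>dderiv (0, 1) \<phi> z * \<Theta> (?v z)\<bar> \<le> \<bar>dderiv (0, 1) \<phi> z\<bar> * (\<delta> * (1 + 2 * M))"
            unfolding abs_mult by (intro mult_left_mono) auto
          then show "dderiv (0, 1) \<phi> z * \<Theta> (?v z) \<le> \<delta> * (1 + 2 * M) * \<bar>dderiv (0, 1) \<phi> z\<bar>"
            by (simp add: mult.commute)
        qed
        then show ?thesis by (simp add: ipt_def)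
      qed
      have R2: "- integral\<^sup>L lborel ?Y \<le> \<delta> * (2 * c * Z)"
      proof -
        have "- integral\<^sup>L lborel ?Y = (\<integral>z. - ?Y z \<partial>lborel)" by simp
        also have "\<dots> \<le> (\<integral>z. \<delta> * c * (norm (moll k a1 z) + norm (moll k a2 z)) \<partial>lborel)"
        proof (rule integral_mono)
          show "integrable lborel (\<lambda>z. - ?Y z)" using iY by simp
          show "integrable lborel (\<lambda>z. \<delta> * c * (norm (moll k a1 z) + norm (moll k a2 z)))"
            by (intro integrable_mult_right Bochner_Integration.integrable_add integrable_norm moll_integrable ia1 ia2)
          fix z
          have "\<bar>?Y z\<bar> \<le> \<delta> * (c * norm (moll k a z))"
            unfolding abs_mult using tr(4)[of "?v z"] spat[of z "moll k a z"] \<delta> by (intro mult_mono) auto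
          also have "\<dots> \<le> \<delta> * (c * (norm (moll k a1 z) + norm (moll k a2 z)))"
            using \<delta> c(1) norm_triangle_ineq4[of "moll k a1 z" "moll k a2 z"] unfolding ad by (intro mult_left_mono) auto
          finally show "- ?Y z \<le> \<delta> * c * (norm (moll k a1 z) + norm (moll k a2 z))" by (simp add: mult.assoc)
        qed
        also have "\<dots> = \<delta> * c * ((\<integral>z. norm (moll k a1 z) \<partial>lborel) + (\<integral>z. norm (moll k a2 z) \<partial>lborel))"
          using integrable_norm[OF moll_integrable[OF ia1]] integrable_norm[OF moll_integrable[OF ia2]] by simp
        also have "\<dots> \<le> \<delta> * c * (Z + Z)"
          using moll_L1[OF ia1, of k] moll_L1[OF ia2, of k] Z1 Z2 \<delta> c(1) by (intro mult_left_mono add_mono) auto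
        finally show ?thesis by (simp add: mult_ac)
      qed
      have "(\<integral>z. X k z + ?Y z \<partial>lborel) = integral\<^sup>L lborel (X k) + integral\<^sup>L lborel ?Y"
        by (rule Bochner_Integration.integral_add[OF iX iY])
      then have "integral\<^sup>L lborel (X k) \<le> 2 * \<delta> * Q + \<delta> * ((1 + 2 * M) * ipt) + \<delta> * (2 * c * Z)"
        using id L R1 R2 unfolding pt by linarith
      also have "\<dots> = \<delta> * CC" by (simp add: CC_def algebra_simps)
      finally show ?thesis .
    qed
    obtain s :: "nat \<Rightarrow> nat" where s: "strict_mono s"
      "AE z in lborel. (\<lambda>k. moll (s k) v z) \<longlonglongrightarrow> v z"
      "AE z in lborel. (\<lambda>k. moll (s k) y z) \<longlonglongrightarrow> y z" "AE z in lborel. (\<lambda>k. moll (s k) a z) \<longlonglongrightarrow> a z"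
      "AE z in lborel. (\<lambda>k. moll (s k) hh z) \<longlonglongrightarrow> hh z"
      using moll_subseq4[OF iv iy ia ih] by blast
    define r where "r = (\<lambda>k. s (k + k0))"
    have rk: "k0 \<le> r k" for k using strict_mono_imp_increasing[OF s(1), of "k + k0"] unfolding r_def by linarith
    have r: "strict_mono r" unfolding r_def using s(1) by (simp add: strict_mono_def)
    define E where "E = (\<lambda>z. (w1 z - w2 z) \<bullet> (A (w1 z) - A (w2 z)))"
    have E0: "0 \<le> E z" for z unfolding E_def using A_mono[of "w1 z" "w2 z"] by (simp add: inner_commute)
    have Em[measurable]: "E \<in> borel_measurable borel" unfolding E_def by measurable
    have X0: "\<phi> z * S' (v z) * (y z \<bullet> a z) = \<phi> z * S' (u1 z - u2 z) * E z" for z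
      using S(3)[of z] K(3) by (cases "z \<in> S") (auto simp: v_def p1_def p2_def y_def y1_def y2_def a_def a1_def a2_def zero_extend_def E_def)
    have Ebd: "\<phi> z * E z \<le> hh z + hh z" for z
    proof (cases "z \<in> S")
      case True
      then have zK: "z \<in> K" using K(3) by blast
      let ?r1 = "norm (w1 z)" and ?r2 = "norm (w2 z)"
      have "norm (w1 z - w2 z) \<le> ?r1 + ?r2" by (rule norm_triangle_ineq4)
      moreover have "norm (A (w1 z) - A (w2 z)) \<le> CA * g ?r1 + CA * g ?r2"
        using norm_triangle_ineq4[of "A (w1 z)" "A (w2 z)"] A_bound[of "w1 z"] A_bound[of "w2 z"] by linarith
      ultimately have "norm (w1 z - w2 z) * norm (A (w1 z) - A (w2 z)) \<le> (?r1 + ?r2) * (CA * g ?r1 + CA * g ?r2)"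
        by (intro mult_mono) auto
      also have "\<dots> = CA * (g ?r1 * ?r1 + g ?r1 * ?r2 + g ?r2 * ?r1 + g ?r2 * ?r2)"
        by (simp add: algebra_simps)
      also have "\<dots> \<le> CA * ((h ?r1 + h ?r1) + (h ?r1 + h ?r2) + (h ?r2 + h ?r1) + (h ?r2 + h ?r2))"
        using CA_pos by (intro mult_left_mono add_mono young) auto
      also have "\<dots> = hh z + hh z" using zK by (simp add: hh_def algebra_simps)
      finally have "E z \<le> hh z + hh z" unfolding E_def using norm_cauchy_schwarz[of "w1 z - w2 z" "A (w1 z) - A (w2 z)"] by linarith
      moreover have "\<phi> z * E z \<le> 1 * E z" using \<phi>(3) E0 by (intro mult_right_mono) auto
      ultimately show ?thesis by linarith
    next
      case False
      have "0 \<le> hh z" unfolding hh_def using CA_pos h_nonneg by simp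
      then show ?thesis using S(3)[OF False] by simp
    qed
    have ih2: "integrable lborel (\<lambda>z. hh z + hh z)" by (intro Bochner_Integration.integrable_add ih)
    have dom: "integrable lborel (\<lambda>z. \<phi> z * (q z * E z))"
      if [measurable]: "q \<in> borel_measurable borel" and q: "\<And>z. 0 \<le> q z" "\<And>z. q z \<le> 1" for q
    proof (rule Bochner_Integration.integrable_bound[OF ih2])
      show "AE z in lborel. norm (\<phi> z * (q z * E z)) \<le> norm (hh z + hh z)"
      proof (rule AE_I2)
        fix z
        have "\<phi> z * (q z * E z) = q z * (\<phi> z * E z)" by simp
        also have "\<dots> \<le> 1 * (\<phi> z * E z)" using q \<phi>(2) E0 by (intro mult_right_mono mult_nonneg_nonneg) auto
        finally have "\<phi> z * (q z * E z) \<le> hh z + hh z" using Ebd[of z] by linarith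
        moreover have "0 \<le> \<phi> z * (q z * E z)" using q \<phi>(2) E0 by (intro mult_nonneg_nonneg) auto
        ultimately show "norm (\<phi> z * (q z * E z)) \<le> norm (hh z + hh z)" by simp
      qed
    qed measurable
    have i0': "integrable lborel (\<lambda>z. \<phi> z * (S' (u1 z - u2 z) * E z))"
      by (rule dom[of "\<lambda>z. S' (u1 z - u2 z)"]) (measurable, rule tr(6), rule tr(7))
    have i0: "integrable lborel (\<lambda>z. \<phi> z * S' (v z) * (y z \<bullet> a z))"
      unfolding X0 using i0' by (simp add: mult.assoc)
    have main: "(\<integral>z. \<phi> z * S' (v z) * (y z \<bullet> a z) \<partial>lborel) \<le> \<delta> * CC"
    proof (rule Fatou_bounded_below[where X="\<lambda>k. X (r k)" and H="\<lambda>k. H (r k)" and B="\<lambda>k. \<delta> * CC" and ?H0.0="\<lambda>z. hh z + hh z"])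
      show "integrable lborel (X (r k))" for k by (rule iX)
      show iH: "integrable lborel (H (r k))" for k
        unfolding H_def by (intro Bochner_Integration.integrable_add moll_integrable ih)
      show "integrable lborel (\<lambda>z. hh z + hh z)" by (rule ih2)
      show "AE z in lborel. (\<lambda>k. X (r k) z) \<longlonglongrightarrow> \<phi> z * S' (v z) * (y z \<bullet> a z)"
        using s(2,3,4)
      proof eventually_elim
        case (elim z)
        have "(\<lambda>k. S' (moll (r k) v z)) \<longlonglongrightarrow> S' (v z)"
          unfolding r_def by (rule continuous_on_tendsto_compose[OF tr(3) LIMSEQ_ignore_initial_segment[OF elim(1)]]) auto
        then show ?case unfolding X_def
          using LIMSEQ_ignore_initial_segment[OF elim(2), of k0] LIMSEQ_ignore_initial_segment[OF elim(3), of k0]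
          unfolding r_def by (intro tendsto_intros)
      qed
      show "AE z in lborel. (\<lambda>k. H (r k) z) \<longlonglongrightarrow> hh z + hh z"
        using s(5)
      proof eventually_elim
        case (elim z)
        show ?case unfolding H_def r_def
          using LIMSEQ_ignore_initial_segment[OF elim(1), of k0] by (intro tendsto_intros)
      qed
      show "- H (r k) z \<le> X (r k) z" for k z
      proof -
        have "\<bar>moll (r k) y z \<bullet> moll (r k) a z\<bar> \<le> H (r k) z"
          using Cauchy_Schwarz_ineq2[of "moll (r k) y z" "moll (r k) a z"] prod[of "r k" z] unfolding H_def by linarith
        moreover have "\<bar>\<phi> z * S' (moll (r k) v z)\<bar> \<le> 1 * 1"
          unfolding abs_mult using \<phi>(2,3)[of z] tr(6,7)[of "moll (r k) v z"] by (intro mult_mono) auto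
        ultimately have "\<bar>X (r k) z\<bar> \<le> (1 * 1) * H (r k) z"
          unfolding X_def abs_mult[of "\<phi> z * S' (moll (r k) v z)"] by (intro mult_mono) auto
        then show ?thesis by linarith
      qed
      show "integral\<^sup>L lborel (X (r k)) \<le> \<delta> * CC" for k by (rule ineq[OF rk])
      show "(\<lambda>k. \<delta> * CC) \<longlonglongrightarrow> \<delta> * CC" by (rule tendsto_const)
      have "(\<lambda>k. integral\<^sup>L lborel (moll (r k) hh) + integral\<^sup>L lborel (moll (r k) hh)) \<longlonglongrightarrow> integral\<^sup>L lborel hh + integral\<^sup>L lborel hh"
        using LIMSEQ_subseq_LIMSEQ[OF moll_integral_tendsto[OF ih] r] by (intro tendsto_intros) (simp_all add: o_def)
      then show "(\<lambda>k. integral\<^sup>L lborel (H (r k))) \<longlonglongrightarrow> (\<integral>z. hh z + hh z \<partial>lborel)"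
        unfolding H_def using moll_integrable[OF ih] ih by simp
    qed (rule i0)
    let ?q = "\<lambda>z. if \<bar>u1 z - u2 z\<bar> \<le> \<delta> then 1 else 0 :: real"
    have iq: "integrable lborel (\<lambda>z. \<phi> z * (?q z * E z))" by (rule dom) auto
    have qE: "(\<lambda>z. \<phi> z * (?q z * E z)) = (\<lambda>z. \<phi> z * (if \<bar>u1 z - u2 z\<bar> \<le> \<delta> then (w1 z - w2 z) \<bullet> (A (w1 z) - A (w2 z)) else 0))"
      by (auto simp: E_def)
    have fin: "integrable lborel (\<lambda>z. \<phi> z * (if \<bar>u1 z - u2 z\<bar> \<le> \<delta> then (w1 z - w2 z) \<bullet> (A (w1 z) - A (w2 z)) else 0))"
      using iq unfolding qE .
    \<comment> \<open>Where \<open>|u1 - u2| \<le> \<delta>\<close> the weight \<open>S'\<close> is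
      at least \<open>1 / 4\<close>, and elsewhere it is nonnegative. This exchanges the smooth
      weight for the sharp one at the cost of a factor 4.\<close>
    have "(\<integral>z. \<phi> z * (?q z * E z) \<partial>lborel) \<le> (\<integral>z. 4 * (\<phi> z * (S' (u1 z - u2 z) * E z)) \<partial>lborel)"
    proof (rule integral_mono[OF iq integrable_mult_right[OF i0']])
      fix z
      have "?q z \<le> 4 * S' (u1 z - u2 z)" using tr(8)[of "u1 z - u2 z"] tr(6)[of "u1 z - u2 z"] by auto
      then have "(\<phi> z * E z) * ?q z \<le> (\<phi> z * E z) * (4 * S' (u1 z - u2 z))"
        using \<phi>(2) E0 by (intro mult_left_mono mult_nonneg_nonneg) auto
      then show "\<phi> z * (?q z * E z) \<le> 4 * (\<phi> z * (S' (u1 z - u2 z) * E z))" by (simp only: mult_ac)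
    qed
    also have "\<dots> = 4 * (\<integral>z. \<phi> z * S' (v z) * (y z \<bullet> a z) \<partial>lborel)" unfolding X0 by (simp add: mult.assoc)
    also have "\<dots> \<le> \<delta> * (4 * CC)" using main by simp
    finally have "(\<integral>z. \<phi> z * (?q z * E z) \<partial>lborel) \<le> \<delta> * (4 * CC)" .
    then show "integrable lborel (\<lambda>z. \<phi> z * (if \<bar>u1 z - u2 z\<bar> \<le> \<delta> then (w1 z - w2 z) \<bullet> (A (w1 z) - A (w2 z)) else 0)) \<and>
      (\<integral>z. \<phi> z * (if \<bar>u1 z - u2 z\<bar> \<le> \<delta> then (w1 z - w2 z) \<bullet> (A (w1 z) - A (w2 z)) else 0) \<partial>lborel) \<le> \<delta> * (4 * CC)"
      using fin unfolding qE by blast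
  qed
qed

end

section \<open>Convergence of the gradients\<close>

text \<open>A theorem of Vitali type, with equi-integrability expressed through the functions
  \<open>H k\<close> of bounded integral. The difference is split at height \<open>2 * C\<close>:
  below it dominated convergence applies on \<open>K\<close>, and the excess is at most
  \<open>e1\<close> times bounded integrals.\<close>

lemma uniformly_integrable_L1:
  fixes f :: "nat \<Rightarrow> 'a::euclidean_space \<Rightarrow> 'b::euclidean_space"
  assumes i: "\<And>k. integrable lborel (f k)" "integrable lborel f0"
    and iH: "\<And>k. integrable lborel (H k)" "integrable lborel H0"
    and H0: "\<And>k z. 0 \<le> H k z" "\<And>z. 0 \<le> H0 z"
    and B: "\<And>k. integral\<^sup>L lborel (H k) \<le> B" "integral\<^sup>L lborel H0 \<le> B"
    and lim: "AE z in lborel. (\<lambda>k. f k z) \<longlonglongrightarrow> f0 z" and K: "compact K"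
    and bd: "\<And>e. 0 < e \<Longrightarrow> \<exists>C\<ge>0. \<forall>z. (\<forall>k. norm (f k z) \<le> C * indicator K z + e * H k z) \<and> norm (f0 z) \<le> C * indicator K z + e * H0 z"
  shows "(\<lambda>k. \<integral>z. norm (f k z - f0 z) \<partial>lborel) \<longlonglongrightarrow> 0"
proof (rule LIMSEQ_I)
  fix e :: real assume e: "0 < e"
  have B0: "0 \<le> B" using B(2) integral_nonneg_AE[of H0 lborel] H0(2) by fastforce
  \<comment> \<open>The integrals of \<open>H k\<close> and \<open>H0\<close>, each at most
    \<open>B\<close>, then contribute at most \<open>e / 4\<close> apiece; the summand 1 keeps the
    denominator positive.\<close>
  define e1 where "e1 = e / (4 * (B + 1))"
  have e1: "0 < e1" "e1 * B \<le> e / 4"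
  proof -
    show "0 < e1" using e B0 by (simp add: e1_def)
    have "e1 * B \<le> e1 * (B + 1)" using \<open>0 < e1\<close> by simp
    also have "\<dots> = e / 4"
    proof -
      have "e / (4 * t) * t = e / 4" if "t \<noteq> 0" for t using that by simp
      moreover have "B + 1 \<noteq> 0" using B0 by linarith
      ultimately show ?thesis unfolding e1_def by blast
    qed
    finally show "e1 * B \<le> e / 4" .
  qed
  obtain C where C: "C \<ge> 0" "\<And>z k. norm (f k z) \<le> C * indicator K z + e1 * H k z" "\<And>z. norm (f0 z) \<le> C * indicator K z + e1 * H0 z"
    using bd[OF e1(1)] by metis
  have iK: "integrable lborel (\<lambda>z. 2 * C * indicator K z)"
    using emeasure_bounded_finite[OF compact_imp_bounded[OF K]] K
    by (intro integrable_mult_right integrable_real_indicator) (auto simp: borel_compact)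
  have idf: "integrable lborel (\<lambda>z. norm (f k z - f0 z))" for k
    by (intro integrable_norm Bochner_Integration.integrable_diff i)
  define m where "m = (\<lambda>k z. min (norm (f k z - f0 z)) (2 * C * indicator K z))"
  have im: "integrable lborel (m k)" for k unfolding m_def by (intro integrable_min idf iK)
  have mlim: "(\<lambda>k. integral\<^sup>L lborel (m k)) \<longlonglongrightarrow> (\<integral>z. 0 \<partial>(lborel :: 'a measure))"
  proof (rule integral_dominated_convergence[where w="\<lambda>z. 2 * C * indicator K z"])
    show "AE z in lborel. (\<lambda>k. m k z) \<longlonglongrightarrow> 0"
      using lim
    proof eventually_elim
      case (elim z)
      have "(\<lambda>k. m k z) \<longlonglongrightarrow> min (norm (f0 z - f0 z)) (2 * C * indicator K z)"
        unfolding m_def by (intro tendsto_intros elim)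
      then show ?case using C(1) by simp
    qed
    have "0 \<le> m k z" "m k z \<le> 2 * C * indicator K z" for k z
      using C(1) by (simp_all add: m_def)
    then show "AE z in lborel. norm (m k z) \<le> 2 * C * indicator K z" for k
      by (intro AE_I2) (simp only: real_norm_def abs_of_nonneg)
    show "m k \<in> borel_measurable lborel" for k by (rule borel_measurable_integrable[OF im])
    show "integrable lborel (\<lambda>z. 2 * C * indicator K z)" by (rule iK)
  qed simp
  have "\<forall>\<^sub>F k in sequentially. integral\<^sup>L lborel (m k) < e / 2"
    using order_tendstoD(2)[OF mlim, of "e/2"] e by simp
  then obtain k0 where k0: "\<And>k. k \<ge> k0 \<Longrightarrow> integral\<^sup>L lborel (m k) < e / 2"
    unfolding eventually_sequentially by blast
  show "\<exists>no. \<forall>k\<ge>no. norm ((\<integral>z. norm (f k z - f0 z) \<partial>lborel) - 0) < e"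
  proof (intro exI allI impI)
    fix k assume k: "k \<ge> k0"
    have iS: "integrable lborel (\<lambda>z. e1 * H k z)" "integrable lborel (\<lambda>z. e1 * H0 z)"
      by (intro integrable_mult_right iH)+
    have "(\<integral>z. norm (f k z - f0 z) \<partial>lborel) \<le> (\<integral>z. m k z + (e1 * H k z + e1 * H0 z) \<partial>lborel)"
    proof (rule integral_mono[OF idf])
      show "integrable lborel (\<lambda>z. m k z + (e1 * H k z + e1 * H0 z))"
        by (intro Bochner_Integration.integrable_add im iS)
      fix z
      have "norm (f k z - f0 z) \<le> 2 * C * indicator K z + (e1 * H k z + e1 * H0 z)"
        using norm_triangle_ineq4[of "f k z" "f0 z"] C(2)[of k z] C(3)[of z] by simp
      moreover have "0 \<le> e1 * H k z + e1 * H0 z" using e1 H0 by simp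
      ultimately show "norm (f k z - f0 z) \<le> m k z + (e1 * H k z + e1 * H0 z)"
        unfolding m_def by linarith
    qed
    also have "\<dots> = integral\<^sup>L lborel (m k) + (\<integral>z. e1 * H k z + e1 * H0 z \<partial>lborel)"
      by (rule Bochner_Integration.integral_add[OF im Bochner_Integration.integrable_add[OF iS]])
    also have "(\<integral>z. e1 * H k z + e1 * H0 z \<partial>lborel) = e1 * integral\<^sup>L lborel (H k) + e1 * integral\<^sup>L lborel H0"
      by (subst Bochner_Integration.integral_add[OF iS]) simp
    also have "integral\<^sup>L lborel (m k) + (e1 * integral\<^sup>L lborel (H k) + e1 * integral\<^sup>L lborel H0) < e"
    proof -
      have "e1 * integral\<^sup>L lborel (H k) \<le> e1 * B" "e1 * integral\<^sup>L lborel H0 \<le> e1 * B"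
        using B e1 by (auto intro: mult_left_mono)
      then show ?thesis using k0[OF k] e1(2) by linarith
    qed
    finally have "(\<integral>z. norm (f k z - f0 z) \<partial>lborel) < e" .
    moreover have "0 \<le> (\<integral>z. norm (f k z - f0 z) \<partial>lborel)" by (rule integral_nonneg_AE) simp
    ultimately show "norm ((\<integral>z. norm (f k z - f0 z) \<partial>lborel) - 0) < e" by simp
  qed
qed

lemma L1_tested_limit:
  fixes f :: "nat \<Rightarrow> 'a::euclidean_space \<Rightarrow> 'b::euclidean_space" and \<psi> :: "'a \<Rightarrow> 'b"
  assumes i: "\<And>k. integrable lborel (f k)" "integrable lborel f0"
    and lim: "(\<lambda>k. \<integral>z. norm (f k z - f0 z) \<partial>lborel) \<longlonglongrightarrow> 0"
    and \<psi>: "continuous_on UNIV \<psi>" "\<And>z. norm (\<psi> z) \<le> B"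
  shows "integrable lborel (\<lambda>z. \<psi> z \<bullet> f0 z)"
    and "(\<lambda>k. \<integral>z. \<psi> z \<bullet> f k z \<partial>lborel) \<longlonglongrightarrow> (\<integral>z. \<psi> z \<bullet> f0 z \<partial>lborel)"
proof -
  have int: "integrable lborel (\<lambda>z. \<psi> z \<bullet> q z)" if q: "integrable lborel q" for q
  proof (rule Bochner_Integration.integrable_bound)
    show "integrable lborel (\<lambda>z. B * norm (q z))" by (intro integrable_mult_right integrable_norm q)
    have "\<psi> \<in> borel_measurable lborel" using borel_measurable_continuous_onI[OF \<psi>(1)] by simp
    then show "(\<lambda>z. \<psi> z \<bullet> q z) \<in> borel_measurable lborel"
      using borel_measurable_integrable[OF q] by (rule borel_measurable_inner)
    have "\<bar>\<psi> z \<bullet> q z\<bar> \<le> B * norm (q z)" for z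
      using Cauchy_Schwarz_ineq2[of "\<psi> z" "q z"] mult_right_mono[OF \<psi>(2)[of z] norm_ge_zero[of "q z"]] by linarith
    then show "AE z in lborel. norm (\<psi> z \<bullet> q z) \<le> norm (B * norm (q z))"
      unfolding real_norm_def by (intro AE_I2 order_trans[OF _ abs_ge_self])
  qed
  show "integrable lborel (\<lambda>z. \<psi> z \<bullet> f0 z)" by (rule int[OF i(2)])
  have "norm ((\<integral>z. \<psi> z \<bullet> f k z \<partial>lborel) - (\<integral>z. \<psi> z \<bullet> f0 z \<partial>lborel)) \<le> B * (\<integral>z. norm (f k z - f0 z) \<partial>lborel)" for k
  proof -
    have "(\<integral>z. \<psi> z \<bullet> f k z \<partial>lborel) - (\<integral>z. \<psi> z \<bullet> f0 z \<partial>lborel) = (\<integral>z. \<psi> z \<bullet> (f k z - f0 z) \<partial>lborel)"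
      by (simp add: inner_diff_right int i)
    also have "norm \<dots> \<le> (\<integral>z. norm (\<psi> z \<bullet> (f k z - f0 z)) \<partial>lborel)" by (rule integral_norm_bound)
    also have "\<dots> \<le> (\<integral>z. B * norm (f k z - f0 z) \<partial>lborel)"
    proof (rule integral_mono)
      show "integrable lborel (\<lambda>z. norm (\<psi> z \<bullet> (f k z - f0 z)))"
        by (intro integrable_norm int Bochner_Integration.integrable_diff i)
      show "integrable lborel (\<lambda>z. B * norm (f k z - f0 z))"
        by (intro integrable_mult_right integrable_norm Bochner_Integration.integrable_diff i)
      show "norm (\<psi> z \<bullet> (f k z - f0 z)) \<le> B * norm (f k z - f0 z)" for z
        using Cauchy_Schwarz_ineq2[of "\<psi> z" "f k z - f0 z"] mult_right_mono[OF \<psi>(2)[of z] norm_ge_zero[of "f k z - f0 z"]]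
        unfolding real_norm_def by linarith
    qed
    finally show ?thesis by simp
  qed
  then have 1: "\<forall>\<^sub>F k in sequentially. norm ((\<integral>z. \<psi> z \<bullet> f k z \<partial>lborel) - (\<integral>z. \<psi> z \<bullet> f0 z \<partial>lborel))
      \<le> B * (\<integral>z. norm (f k z - f0 z) \<partial>lborel)"
    by (intro always_eventually allI)
  have 2: "(\<lambda>k. B * (\<integral>z. norm (f k z - f0 z) \<partial>lborel)) \<longlonglongrightarrow> 0"
    using tendsto_mult_left[OF lim, of B] by simp
  have "(\<lambda>k. (\<integral>z. \<psi> z \<bullet> f k z \<partial>lborel) - (\<integral>z. \<psi> z \<bullet> f0 z \<partial>lborel)) \<longlonglongrightarrow> 0"
    by (rule Lim_null_comparison[OF 1 2])
  then show "(\<lambda>k. \<integral>z. \<psi> z \<bullet> f k z \<partial>lborel) \<longlonglongrightarrow> (\<integral>z. \<psi> z \<bullet> f0 z \<partial>lborel)"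
    by (rule LIM_zero_cancel)
qed

text \<open>Division by an upper bound, so values lie in \<open>[0, 1]\<close> as the estimates
  require. On \<open>K\<close> a positive lower bound remains, and comparison of integrals then
  costs a factor depending on \<open>c\<close>.\<close>

lemma normalized_cutoff:
  fixes U :: "'a::euclidean_space set"
  assumes "open U" "compact K" "K \<subseteq> U"
  obtains \<phi> c where "\<phi> \<in> Cc_infty U" "\<And>x. 0 \<le> \<phi> x" "\<And>x. \<phi> x \<le> 1" "c > 0" "\<And>x. x \<in> K \<Longrightarrow> c \<le> \<phi> x"
proof -
  obtain \<psi> where \<psi>: "\<psi> \<in> Cc_infty U" "\<And>x. 0 \<le> \<psi> x" "\<And>x. x \<in> K \<Longrightarrow> 1 \<le> \<psi> x"
    using cutoff_exists[OF assms] by blast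
  obtain S where S: "compact S" "S \<subseteq> U" "\<And>x. x \<notin> S \<Longrightarrow> \<psi> x = 0" using Cc_infty_support[OF \<psi>(1)] by metis
  obtain B where B: "B > 0" "\<And>x. norm (\<psi> x) \<le> B"
    using compact_support_bounded[OF Cc_infty_continuous[OF \<psi>(1)] S(1,3)] by metis
  show thesis
  proof (rule that[of "\<lambda>x. inverse B * \<psi> x" "inverse B"])
    show "(\<lambda>x. inverse B * \<psi> x) \<in> Cc_infty U" by (rule Cc_infty_cmult[OF \<psi>(1)])
    show "0 \<le> inverse B * \<psi> x" for x using B(1) \<psi>(2)[of x] by simp
    show "inverse B * \<psi> x \<le> 1" for x
    proof -
      have "\<psi> x \<le> B" using B(2)[of x] by simp
      then show ?thesis using B(1) by (simp add: field_simps)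
    qed
    show "inverse B > 0" using B(1) by simp
    show "inverse B \<le> inverse B * \<psi> x" if "x \<in> K" for x
      using mult_left_mono[OF \<psi>(3)[OF that], of "inverse B"] B(1) by simp
  qed
qed

section \<open>Almost everywhere convergence of the gradients\<close>

context growth
begin

lemma local_energy_bound:
  assumes U: "open U" and M: "0 \<le> M" and K: "compact K" "K \<subseteq> U"
  shows "\<exists>C. \<forall>u w. wsuper U u w \<and> (\<forall>z. \<bar>u z\<bar> \<le> M) \<longrightarrow> (\<integral>z. indicator K z * h (norm (w z)) \<partial>lborel) \<le> C"
proof -
  obtain \<phi> c where \<phi>: "\<phi> \<in> Cc_infty U" "\<And>x. 0 \<le> \<phi> x" "\<And>x. \<phi> x \<le> 1" "c > 0" "\<And>x. x \<in> K \<Longrightarrow> c \<le> \<phi> x"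
    using normalized_cutoff[OF U K] by metis
  obtain S where S: "compact S" "S \<subseteq> U" "\<And>z. z \<notin> S \<Longrightarrow> \<phi> z = 0" using Cc_infty_support[OF \<phi>(1)] by metis
  \<comment> \<open>Large enough for both requirements of the energy estimate;
    \<open>1 \<le> p\<close> follows from \<open>1 < g1\<close>.\<close>
  define p where "p = nat \<lceil>g1\<rceil>"
  have p: "g1 - 1 \<le> real p" "1 \<le> p" using g1_gt unfolding p_def by linarith+
  obtain C where C: "\<And>u w. wsuper U u w \<Longrightarrow> (\<forall>z. \<bar>u z\<bar> \<le> M) \<Longrightarrow> (\<integral>z. \<phi> z ^ Suc p * h (norm (w z)) \<partial>lborel) \<le> C"
    using energy_estimate[OF \<phi>(1,2,3) U p M] by blast
  let ?q = "inverse (c ^ Suc p)"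
  have q: "?q > 0" using \<phi>(4) by simp
  show ?thesis
  proof (intro exI[of _ "?q * C"] allI impI)
    fix u w assume w: "wsuper U u w \<and> (\<forall>z. \<bar>u z\<bar> \<le> M)"
    have [measurable]: "w \<in> borel_measurable borel" using w unfolding wsuper_def by blast
    have hK: "integrable lborel (\<lambda>z. indicator K z * h (norm (w z)))"
      and hS: "integrable lborel (\<lambda>z. indicator S z * h (norm (w z)))"
      using w K S unfolding wsuper_def by blast+
    have i: "integrable lborel (\<lambda>z. \<phi> z ^ Suc p * h (norm (w z)))"
    proof (rule Bochner_Integration.integrable_bound[OF hS])
      have "\<phi> \<in> borel_measurable borel" using borel_measurable_continuous_onI[OF Cc_infty_continuous[OF \<phi>(1)]] .
      then show "(\<lambda>z. \<phi> z ^ Suc p * h (norm (w z))) \<in> borel_measurable lborel" by measurable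
      have "norm (\<phi> z ^ Suc p * h (norm (w z))) \<le> norm (indicator S z * h (norm (w z)))" for z
      proof (cases "z \<in> S")
        case True
        have "\<bar>\<phi> z ^ Suc p\<bar> \<le> 1" using \<phi>(2,3)[of z] by (simp add: power_le_one del: power_Suc)
        from mult_right_mono[OF this abs_ge_zero[of "h (norm (w z))"]] show ?thesis
          using True by (simp add: abs_mult)
      qed (simp add: S(3))
      then show "AE z in lborel. norm (\<phi> z ^ Suc p * h (norm (w z))) \<le> norm (indicator S z * h (norm (w z)))" by simp
    qed
    have "(\<integral>z. indicator K z * h (norm (w z)) \<partial>lborel) \<le> (\<integral>z. ?q * (\<phi> z ^ Suc p * h (norm (w z))) \<partial>lborel)"
    proof (rule integral_mono[OF hK integrable_mult_right[OF i]])
      fix z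
      have h0: "0 \<le> h (norm (w z))" by (simp add: h_nonneg)
      show "indicator K z * h (norm (w z)) \<le> ?q * (\<phi> z ^ Suc p * h (norm (w z)))"
      proof (cases "z \<in> K")
        case True
        have "c ^ Suc p \<le> \<phi> z ^ Suc p" using \<phi>(4,5) True by (intro power_mono) auto
        then have "1 \<le> ?q * \<phi> z ^ Suc p" using \<phi>(4) by (simp add: field_simps)
        from mult_right_mono[OF this h0] show ?thesis using True by (simp add: mult.assoc)
      next
        case False
        have "0 \<le> ?q * (\<phi> z ^ Suc p * h (norm (w z)))"
          using q h0 \<phi>(2)[of z] by (intro mult_nonneg_nonneg zero_le_power) auto
        then show ?thesis using False by simp
      qed
    qed
    also have "\<dots> = ?q * (\<integral>z. \<phi> z ^ Suc p * h (norm (w z)) \<partial>lborel)" by simp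
    also have "\<dots> \<le> ?q * C" using C w q by (intro mult_left_mono) auto
    finally show "(\<integral>z. indicator K z * h (norm (w z)) \<partial>lborel) \<le> ?q * C" .
  qed
qed

text \<open>Where \<open>|us i - us j| \<le> \<delta>\<close>, the quantitative monotonicity and the
  difference estimate apply; on the rest the integrand is at most \<open>\<phi>\<close> and
  Chebyshev's inequality for \<open>|us i - us j|\<close> gives smallness. The order of choices is
  essential: \<open>e1\<close> determines \<open>C\<close>, then \<open>\<delta>\<close> is chosen
  depending on \<open>C\<close>, and finally \<open>N\<close> depending on
  \<open>\<delta>\<close>.\<close>

lemma gradients_Cauchy:
  assumes U: "open U" and M: "0 \<le> M"
    and w: "\<And>i. wsuper U (us i) (ws i)" "\<And>i z. \<bar>us i z\<bar> \<le> M"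
    and u: "u \<in> borel_measurable borel" "\<And>z. \<bar>u z\<bar> \<le> M"
    and lim: "AE z in lborel. z \<in> U \<longrightarrow> (\<lambda>i. us i z) \<longlonglongrightarrow> u z"
    and \<phi>: "\<phi> \<in> Cc_infty U" "\<And>z. 0 \<le> \<phi> z" "\<And>z. \<phi> z \<le> 1" and e: "0 < e"
  shows "\<exists>N. \<forall>i\<ge>N. \<forall>j\<ge>N. (\<integral>z. \<phi> z * min 1 (norm (ws i z - ws j z)) \<partial>lborel) < e"
proof -
  obtain S where S: "compact S" "S \<subseteq> U" "\<And>z. z \<notin> S \<Longrightarrow> \<phi> z = 0" using Cc_infty_support[OF \<phi>(1)] by metis
  have [measurable]: "S \<in> sets borel" using S by (simp add: borel_compact)
  have wm[measurable]: "us i \<in> borel_measurable borel" "ws i \<in> borel_measurable borel" for i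
    using w(1)[of i] unfolding wsuper_def by blast+
  note [measurable] = u(1)
  have m\<phi>[measurable]: "\<phi> \<in> borel_measurable borel" using borel_measurable_continuous_onI[OF Cc_infty_continuous[OF \<phi>(1)]] .
  have hS: "integrable lborel (\<lambda>z. indicator S z * h (norm (ws i z)))" for i
    using w(1)[of i] S unfolding wsuper_def by blast
  have i\<phi>: "integrable lborel \<phi>" by (rule integrable_compact_support[OF Cc_infty_continuous[OF \<phi>(1)] S(1,3)])
  obtain C0 where C0: "\<And>i. (\<integral>z. indicator S z * h (norm (ws i z)) \<partial>lborel) \<le> C0"
    using local_energy_bound[OF U M S(1,2)] w by blast
  obtain C1 where C1: "C1 \<ge> 0" "\<And>s. s \<ge> 0 \<Longrightarrow> s \<le> C1 + 1 * h s \<and> g s \<le> C1 + 1 * h s"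
    using superlinear[of 1] by auto
  have iS: "integrable lborel (\<lambda>z. C1 * indicator S z)"
    using emeasure_bounded_finite[OF compact_imp_bounded[OF S(1)]]
    by (intro integrable_mult_right integrable_real_indicator) auto
  define V where "V = integral\<^sup>L lborel \<phi>"
  have V0: "0 \<le> V" unfolding V_def by (intro integral_nonneg_AE AE_I2 \<phi>(2))
  define W where "W = C1 * measure lborel S + C0"
  have iw: "integrable lborel (\<lambda>z. \<phi> z * norm (ws i z))" and W: "(\<integral>z. \<phi> z * norm (ws i z) \<partial>lborel) \<le> W" for i
  proof -
    have i: "integrable lborel (\<lambda>z. C1 * indicator S z + indicator S z * h (norm (ws i z)))"
      by (intro Bochner_Integration.integrable_add iS hS)
    have le: "\<phi> z * norm (ws i z) \<le> C1 * indicator S z + indicator S z * h (norm (ws i z))" for z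
    proof (cases "z \<in> S")
      case True
      have "\<phi> z * norm (ws i z) \<le> 1 * norm (ws i z)" using \<phi>(3) by (intro mult_right_mono) auto
      then show ?thesis using True C1(2)[of "norm (ws i z)"] by simp
    qed (simp add: S(3))
    show iw: "integrable lborel (\<lambda>z. \<phi> z * norm (ws i z))"
    proof (rule Bochner_Integration.integrable_bound[OF i])
      have "norm (\<phi> z * norm (ws i z)) \<le> norm (C1 * indicator S z + indicator S z * h (norm (ws i z)))" for z
        using le[of z] \<phi>(2)[of z] by (simp add: abs_mult)
      then show "AE z in lborel. norm (\<phi> z * norm (ws i z)) \<le> norm (C1 * indicator S z + indicator S z * h (norm (ws i z)))" by simp
    qed measurable
    have "(\<integral>z. \<phi> z * norm (ws i z) \<partial>lborel) \<le> (\<integral>z. C1 * indicator S z + indicator S z * h (norm (ws i z)) \<partial>lborel)"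
      by (rule integral_mono[OF iw i le])
    also have "\<dots> = C1 * measure lborel S + (\<integral>z. indicator S z * h (norm (ws i z)) \<partial>lborel)"
      using iS hS by simp
    finally show "(\<integral>z. \<phi> z * norm (ws i z) \<partial>lborel) \<le> W" using C0[of i] unfolding W_def by linarith
  qed
  have W0: "0 \<le> W" using W[of 0] integral_nonneg_AE[of "\<lambda>z. \<phi> z * norm (ws 0 z)" lborel] \<phi>(2) by fastforce
  \<comment> \<open>\<open>V\<close> and twice \<open>W\<close> are the integrals that get
    multiplied by \<open>e1\<close>; together they contribute at most \<open>e / 3\<close>.\<close>
  define e1 where "e1 = e / (3 * (V + 2 * W + 1))"
  have e1: "0 < e1" "e1 * (V + 2 * W) < e / 3 + e1" "e1 * (V + 2 * W) \<le> e / 3"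
  proof -
    show p: "0 < e1" using e V0 W0 by (simp add: e1_def)
    have nz: "V + 2 * W + 1 \<noteq> 0" using V0 W0 by linarith
    have "e / (3 * t) * t = e / 3" if "t \<noteq> 0" for t using that by simp
    then have "e1 * (V + 2 * W + 1) = e / 3" unfolding e1_def using nz by blast
    then show "e1 * (V + 2 * W) \<le> e / 3" "e1 * (V + 2 * W) < e / 3 + e1" using p by (simp_all add: distrib_left)
  qed
  obtain C where C: "C \<ge> 0" "\<And>\<xi> \<zeta>. min 1 (norm (\<xi> - \<zeta>)) \<le> e1 + e1 * norm \<xi> + e1 * norm \<zeta> + C * ((A \<xi> - A \<zeta>) \<bullet> (\<xi> - \<zeta>))"
    using A_mono_quantitative[OF e1(1)] by blast
  let ?P = "\<lambda>u w. wsuper U u w \<and> (\<forall>z. \<bar>u z\<bar> \<le> M)"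
  define E where "E = (\<lambda>\<delta> i j z. if \<bar>us i z - us j z\<bar> \<le> \<delta> then (ws i z - ws j z) \<bullet> (A (ws i z) - A (ws j z)) else 0)"
  obtain CC where CC: "CC \<ge> 0"
    "\<And>i j \<delta>. 0 < \<delta> \<Longrightarrow> \<delta> \<le> 1 \<Longrightarrow> integrable lborel (\<lambda>z. \<phi> z * E \<delta> i j z) \<and> (\<integral>z. \<phi> z * E \<delta> i j z \<partial>lborel) \<le> \<delta> * CC"
  proof -
    have "\<exists>C\<ge>0. \<forall>u1 w1 u2 w2 \<delta>. ?P u1 w1 \<longrightarrow> ?P u2 w2 \<longrightarrow> 0 < \<delta> \<longrightarrow> \<delta> \<le> 1 \<longrightarrow>
      integrable lborel (\<lambda>z. \<phi> z * (if \<bar>u1 z - u2 z\<bar> \<le> \<delta> then (w1 z - w2 z) \<bullet> (A (w1 z) - A (w2 z)) else 0)) \<and>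
      (\<integral>z. \<phi> z * (if \<bar>u1 z - u2 z\<bar> \<le> \<delta> then (w1 z - w2 z) \<bullet> (A (w1 z) - A (w2 z)) else 0) \<partial>lborel) \<le> \<delta> * C"
    proof (rule difference_estimate[OF \<phi> U M, of ?P])
      show "\<exists>C. \<forall>u w. ?P u w \<longrightarrow> (\<integral>z. indicator K z * h (norm (w z)) \<partial>lborel) \<le> C" if "compact K" "K \<subseteq> U" for K
        using local_energy_bound[OF U M that] by blast
    qed auto
    then obtain C' where C': "C' \<ge> 0" "\<forall>u1 w1 u2 w2 \<delta>. ?P u1 w1 \<longrightarrow> ?P u2 w2 \<longrightarrow> 0 < \<delta> \<longrightarrow> \<delta> \<le> 1 \<longrightarrow>
      integrable lborel (\<lambda>z. \<phi> z * (if \<bar>u1 z - u2 z\<bar> \<le> \<delta> then (w1 z - w2 z) \<bullet> (A (w1 z) - A (w2 z)) else 0)) \<and>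
      (\<integral>z. \<phi> z * (if \<bar>u1 z - u2 z\<bar> \<le> \<delta> then (w1 z - w2 z) \<bullet> (A (w1 z) - A (w2 z)) else 0) \<partial>lborel) \<le> \<delta> * C'" by blast
    have P: "?P (us i) (ws i)" for i using w by blast
    show thesis
      by (rule that[OF C'(1)]) (use C'(2)[rule_format, OF P P] in \<open>simp add: E_def\<close>)
  qed
  \<comment> \<open>This gives the monotonicity term at most \<open>e / 6\<close>; the difference
    estimate requires the cap at 1.\<close>
  define \<delta> where "\<delta> = min 1 (e / (6 * (C * CC + 1)))"
  have CC1: "0 < C * CC + 1" using C CC by (simp add: add_nonneg_pos)
  have \<delta>: "0 < \<delta>" "\<delta> \<le> 1" using e CC1 by (simp_all add: \<delta>_def)
  have \<delta>C: "C * (\<delta> * CC) \<le> e / 6"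
  proof -
    have "C * (\<delta> * CC) = \<delta> * (C * CC)" by simp
    also have "\<dots> \<le> \<delta> * (C * CC + 1)" using \<delta> by simp
    also have "\<dots> \<le> e / (6 * (C * CC + 1)) * (C * CC + 1)" using CC1 by (intro mult_right_mono) (auto simp: \<delta>_def)
    also have "\<dots> = e / 6"
    proof -
      have "e / (6 * t) * t = e / 6" if "t \<noteq> 0" for t using that by simp
      then show ?thesis using CC1 by (metis less_irrefl)
    qed
    finally show ?thesis .
  qed
  have iu: "integrable lborel (\<lambda>z. \<phi> z * \<bar>p z - q z\<bar>)"
    if [measurable]: "p \<in> borel_measurable borel" "q \<in> borel_measurable borel" and pq: "\<And>z. \<bar>p z\<bar> \<le> M" "\<And>z. \<bar>q z\<bar> \<le> M" for p q
  proof (rule Bochner_Integration.integrable_bound[OF integrable_mult_right[OF i\<phi>, of "2 * M"]])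
    have "norm (\<phi> z * \<bar>p z - q z\<bar>) \<le> norm (2 * M * \<phi> z)" for z
    proof -
      have "\<phi> z * \<bar>p z - q z\<bar> \<le> \<phi> z * (2 * M)"
        using \<phi>(2)[of z] pq[of z] by (intro mult_left_mono) auto
      then show ?thesis using \<phi>(2)[of z] M by (simp add: abs_mult mult_ac)
    qed
    then show "AE z in lborel. norm (\<phi> z * \<bar>p z - q z\<bar>) \<le> norm (2 * M * \<phi> z)" by simp
  qed measurable
  note iuu = iu[OF wm(1) u(1) w(2) u(2)]
  have ulim: "(\<lambda>i. \<integral>z. \<phi> z * \<bar>us i z - u z\<bar> \<partial>lborel) \<longlonglongrightarrow> (\<integral>z. 0 \<partial>(lborel :: ('a \<times> real) measure))"
  proof (rule integral_dominated_convergence[where w="\<lambda>z. 2 * M * \<phi> z"])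
    show "AE z in lborel. (\<lambda>i. \<phi> z * \<bar>us i z - u z\<bar>) \<longlonglongrightarrow> 0"
      using lim
    proof eventually_elim
      case (elim z)
      show ?case
      proof (cases "z \<in> S")
        case True
        then have "(\<lambda>i. us i z) \<longlonglongrightarrow> u z" using elim S(2) by blast
        then have "(\<lambda>i. \<phi> z * \<bar>us i z - u z\<bar>) \<longlonglongrightarrow> \<phi> z * \<bar>u z - u z\<bar>" by (intro tendsto_intros)
        then show ?thesis by simp
      qed (simp add: S(3))
    qed
    have "norm (\<phi> z * \<bar>us i z - u z\<bar>) \<le> 2 * M * \<phi> z" for i z
    proof -
      have "\<phi> z * \<bar>us i z - u z\<bar> \<le> \<phi> z * (2 * M)"
        using \<phi>(2)[of z] w(2)[of i z] u(2)[of z] by (intro mult_left_mono) auto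
      then show ?thesis using \<phi>(2)[of z] by (simp add: abs_mult mult_ac)
    qed
    then show "AE z in lborel. norm (\<phi> z * \<bar>us i z - u z\<bar>) \<le> 2 * M * \<phi> z" for i by simp
    show "integrable lborel (\<lambda>z. 2 * M * \<phi> z)" by (rule integrable_mult_right[OF i\<phi>])
  qed measurable
  have "\<forall>\<^sub>F i in sequentially. (\<integral>z. \<phi> z * \<bar>us i z - u z\<bar> \<partial>lborel) < \<delta> * (e / 6)"
    using order_tendstoD(2)[OF ulim, of "\<delta> * (e / 6)"] e \<delta> by simp
  \<comment> \<open>Two such terms, divided by \<open>\<delta>\<close>, give at most
    \<open>e / 3\<close>. With \<open>e / 3\<close> and \<open>e / 6\<close> from the other parts
    the total stays below \<open>e\<close>.\<close>
  then obtain N where N: "\<And>i. i \<ge> N \<Longrightarrow> (\<integral>z. \<phi> z * \<bar>us i z - u z\<bar> \<partial>lborel) < \<delta> * (e / 6)"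
    unfolding eventually_sequentially by blast
  show ?thesis
  proof (intro exI[of _ N] allI impI)
    fix i j assume ij: "i \<ge> N" "j \<ge> N"
    let ?r = "\<lambda>z. 1 / \<delta> * (\<phi> z * \<bar>us i z - us j z\<bar>)"
    have iE: "integrable lborel (\<lambda>z. \<phi> z * E \<delta> i j z)" and IE: "(\<integral>z. \<phi> z * E \<delta> i j z \<partial>lborel) \<le> \<delta> * CC"
      using CC(2)[OF \<delta>, of i j] by blast+
    note iij = iu[OF wm(1) wm(1) w(2) w(2), of i j]
    let ?s = "\<lambda>z. e1 * \<phi> z + (e1 * (\<phi> z * norm (ws i z)) + e1 * (\<phi> z * norm (ws j z)))"
    have i1: "integrable lborel ?s"
      by (intro Bochner_Integration.integrable_add integrable_mult_right i\<phi> iw)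
    have i2: "integrable lborel (\<lambda>z. C * (\<phi> z * E \<delta> i j z) + ?r z)"
      by (intro Bochner_Integration.integrable_add integrable_mult_right iE iij)
    have E0: "0 \<le> E \<delta> i j z" for z
      unfolding E_def using A_mono[of "ws i z" "ws j z"] by (simp add: inner_commute)
    have pt: "\<phi> z * min 1 (norm (ws i z - ws j z)) \<le> ?s z + (C * (\<phi> z * E \<delta> i j z) + ?r z)" for z
    proof -
      have "min 1 (norm (ws i z - ws j z)) \<le> e1 + (e1 * norm (ws i z) + e1 * norm (ws j z)) + (C * E \<delta> i j z + 1 / \<delta> * \<bar>us i z - us j z\<bar>)"
      proof (cases "\<bar>us i z - us j z\<bar> \<le> \<delta>")
        case True
        then have "C * E \<delta> i j z = C * ((A (ws i z) - A (ws j z)) \<bullet> (ws i z - ws j z))" by (simp add: E_def inner_commute)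
        moreover have "0 \<le> 1 / \<delta> * \<bar>us i z - us j z\<bar>" using \<delta> by simp
        ultimately show ?thesis using C(2)[of "ws i z" "ws j z"] by linarith
      next
        case False
        then have "1 \<le> 1 / \<delta> * \<bar>us i z - us j z\<bar>" using \<delta> by (simp add: field_simps)
        moreover have "0 \<le> C * E \<delta> i j z" "0 \<le> e1 * norm (ws i z)" "0 \<le> e1 * norm (ws j z)" using C(1) E0 e1(1) by simp_all
        ultimately show ?thesis using e1(1) by linarith
      qed
      from mult_left_mono[OF this \<phi>(2)[of z]] show ?thesis by (simp add: distrib_left mult_ac)
    qed
    have "(\<integral>z. \<phi> z * min 1 (norm (ws i z - ws j z)) \<partial>lborel) \<le> (\<integral>z. ?s z + (C * (\<phi> z * E \<delta> i j z) + ?r z) \<partial>lborel)"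
    proof (rule integral_mono[OF _ Bochner_Integration.integrable_add[OF i1 i2] pt])
      show "integrable lborel (\<lambda>z. \<phi> z * min 1 (norm (ws i z - ws j z)))"
      proof (rule Bochner_Integration.integrable_bound[OF i\<phi>])
        have "norm (\<phi> z * min 1 (norm (ws i z - ws j z))) \<le> norm (\<phi> z)" for z
          using \<phi>(2)[of z] mult_left_mono[of "min 1 (norm (ws i z - ws j z))" 1 "\<phi> z"] by (simp add: abs_mult)
        then show "AE z in lborel. norm (\<phi> z * min 1 (norm (ws i z - ws j z))) \<le> norm (\<phi> z)" by simp
      qed measurable
    qed
    also have "\<dots> = integral\<^sup>L lborel ?s + (\<integral>z. C * (\<phi> z * E \<delta> i j z) + ?r z \<partial>lborel)"
      by (rule Bochner_Integration.integral_add[OF i1 i2])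
    also have "integral\<^sup>L lborel ?s = e1 * V + (e1 * (\<integral>z. \<phi> z * norm (ws i z) \<partial>lborel) + e1 * (\<integral>z. \<phi> z * norm (ws j z) \<partial>lborel))"
      using i\<phi> iw[of i] iw[of j] by (simp add: V_def)
    also have "(\<integral>z. C * (\<phi> z * E \<delta> i j z) + ?r z \<partial>lborel) = C * (\<integral>z. \<phi> z * E \<delta> i j z \<partial>lborel) + 1 / \<delta> * (\<integral>z. \<phi> z * \<bar>us i z - us j z\<bar> \<partial>lborel)"
      using iE iij by simp
    also have "e1 * V + (e1 * (\<integral>z. \<phi> z * norm (ws i z) \<partial>lborel) + e1 * (\<integral>z. \<phi> z * norm (ws j z) \<partial>lborel))
        + (C * (\<integral>z. \<phi> z * E \<delta> i j z \<partial>lborel) + 1 / \<delta> * (\<integral>z. \<phi> z * \<bar>us i z - us j z\<bar> \<partial>lborel)) < e"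
    proof -
      have a: "e1 * (\<integral>z. \<phi> z * norm (ws i z) \<partial>lborel) \<le> e1 * W" "e1 * (\<integral>z. \<phi> z * norm (ws j z) \<partial>lborel) \<le> e1 * W"
        using W e1(1) by (auto intro: mult_left_mono)
      have b: "C * (\<integral>z. \<phi> z * E \<delta> i j z \<partial>lborel) \<le> C * (\<delta> * CC)" using IE C(1) by (rule mult_left_mono)
      have "(\<integral>z. \<phi> z * \<bar>us i z - us j z\<bar> \<partial>lborel) \<le> (\<integral>z. \<phi> z * \<bar>us i z - u z\<bar> + \<phi> z * \<bar>us j z - u z\<bar> \<partial>lborel)"
      proof (rule integral_mono[OF iij Bochner_Integration.integrable_add[OF iuu iuu]])
        fix z
        have "\<phi> z * \<bar>us i z - us j z\<bar> \<le> \<phi> z * (\<bar>us i z - u z\<bar> + \<bar>us j z - u z\<bar>)"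
          using \<phi>(2) by (intro mult_left_mono) auto
        then show "\<phi> z * \<bar>us i z - us j z\<bar> \<le> \<phi> z * \<bar>us i z - u z\<bar> + \<phi> z * \<bar>us j z - u z\<bar>" by (simp add: distrib_left)
      qed
      also have "\<dots> = (\<integral>z. \<phi> z * \<bar>us i z - u z\<bar> \<partial>lborel) + (\<integral>z. \<phi> z * \<bar>us j z - u z\<bar> \<partial>lborel)"
        by (rule Bochner_Integration.integral_add[OF iuu iuu])
      also have "\<dots> < \<delta> * (e / 3)" using N[OF ij(1)] N[OF ij(2)] by simp
      finally have "1 / \<delta> * (\<integral>z. \<phi> z * \<bar>us i z - us j z\<bar> \<partial>lborel) < e / 3"
        using \<delta>(1) by (simp add: field_simps)
      then show ?thesis using a b \<delta>C e1(3) e by (simp add: distrib_left)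
    qed
    finally show "(\<integral>z. \<phi> z * min 1 (norm (ws i z - ws j z)) \<partial>lborel) < e" .
  qed
qed

text \<open>Indices are chosen diagonally over a compact exhaustion, so that consecutive gradients
  differ by less than \<open>(1 / 2) ^ k\<close> in the truncated weighted integral of each of the
  first cutoffs. The differences are then summable at almost every point, and the telescoping series
  converges.\<close>

lemma gradients_converge:
  assumes U: "open U" and M: "0 \<le> M"
    and w: "\<And>i. wsuper U (us i) (ws i)" "\<And>i z. \<bar>us i z\<bar> \<le> M"
    and u: "u \<in> borel_measurable borel" "\<And>z. \<bar>u z\<bar> \<le> M"
    and lim: "AE z in lborel. z \<in> U \<longrightarrow> (\<lambda>i. us i z) \<longlonglongrightarrow> u z"
  shows "\<exists>r w. strict_mono (r :: nat \<Rightarrow> nat) \<and> w \<in> borel_measurable borel \<and>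
    (AE z in lborel. z \<in> U \<longrightarrow> (\<lambda>k. ws (r k) z) \<longlonglongrightarrow> w z)"
proof -
  have wm[measurable]: "ws i \<in> borel_measurable borel" for i
    using w(1)[of i] unfolding wsuper_def by blast
  obtain K :: "nat \<Rightarrow> ('a \<times> real) set" where K: "\<And>n. compact (K n)" "\<And>n. K n \<subseteq> U" "\<Union> (range K) = U"
    using open_Union_compact_subsets[OF U] by metis
  have "\<exists>\<phi> c. \<phi> \<in> Cc_infty U \<and> (\<forall>x. 0 \<le> \<phi> x) \<and> (\<forall>x. \<phi> x \<le> 1) \<and> 0 < c \<and> (\<forall>x\<in>K n. c \<le> \<phi> x)" for n
    by (rule normalized_cutoff[OF U K(1,2)]) blast
  then obtain \<phi> c where \<phi>: "\<And>n. \<phi> n \<in> Cc_infty U" "\<And>n x. 0 \<le> \<phi> n x" "\<And>n x. \<phi> n x \<le> 1"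
    and c: "\<And>n. (0::real) < c n" "\<And>n x. x \<in> K n \<Longrightarrow> c n \<le> \<phi> n x" by metis
  have m\<phi>[measurable]: "\<phi> n \<in> borel_measurable borel" for n
    by (rule borel_measurable_continuous_onI[OF Cc_infty_continuous[OF \<phi>(1)]])
  have i\<phi>: "integrable lborel (\<phi> n)" for n
  proof -
    obtain S where S: "compact S" "\<And>z. z \<notin> S \<Longrightarrow> \<phi> n z = 0" using Cc_infty_support[OF \<phi>(1)[of n]] by metis
    show ?thesis by (rule integrable_compact_support[OF Cc_infty_continuous[OF \<phi>(1)] S])
  qed
  define J where "J = (\<lambda>n i j. \<integral>z. \<phi> n z * min 1 (norm (ws i z - ws j z)) \<partial>lborel)"
  have "\<exists>N. \<forall>i\<ge>N. \<forall>j\<ge>N. J n i j < (1 / 2) ^ k" for n k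
    unfolding J_def by (rule gradients_Cauchy[OF U M w u lim \<phi>]) simp
  then obtain N where N: "\<And>n k i j. i \<ge> N n k \<Longrightarrow> j \<ge> N n k \<Longrightarrow> J n i j < (1 / 2) ^ k" by metis
  \<comment> \<open>The double sum dominates every \<open>N n k\<close> with
    \<open>n \<le> k\<close> and is nondecreasing in \<open>k\<close>; adding \<open>k\<close> makes
    it strictly increasing.\<close>
  define r where "r = (\<lambda>k::nat. (\<Sum>m\<le>k. \<Sum>n\<le>m. N n m) + k)"
  have r: "strict_mono r" unfolding strict_mono_Suc_iff r_def by simp
  have rN: "N n k \<le> r k" if "n \<le> k" for n k
  proof -
    have "N n k \<le> (\<Sum>n\<le>k. N n k)" using that by (intro member_le_sum) auto
    also have "\<dots> \<le> (\<Sum>m\<le>k. \<Sum>n\<le>m. N n m)" by (rule member_le_sum[where f="\<lambda>m. \<Sum>n\<le>m. N n m"]) auto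
    finally show ?thesis unfolding r_def by simp
  qed
  \<comment> \<open>Points of divergence in \<open>U\<close> form a null set, so the default value
    of \<open>lim\<close> there is harmless, and the function is Borel everywhere.\<close>
  define w where "w = (\<lambda>z. lim (\<lambda>k. ws (r k) z))"
  have wb: "w \<in> borel_measurable borel" unfolding w_def by measurable
  have conv: "AE z in lborel. z \<in> K n \<longrightarrow> (\<lambda>k. ws (r k) z) \<longlonglongrightarrow> w z" for n
  proof -
    \<comment> \<open>The shift by \<open>n\<close> is due to \<open>rN\<close>: the sequence
      \<open>r\<close> respects the \<open>n\<close>-th cutoff only from index \<open>n\<close>
      on.\<close>
    define d where "d = (\<lambda>k z. min 1 (norm (ws (r (Suc (k + n))) z - ws (r (k + n)) z)))"
    have d0: "0 \<le> d k z" for k z by (simp add: d_def)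
    have [measurable]: "d k \<in> borel_measurable borel" for k unfolding d_def by measurable
    have id: "integrable lborel (\<lambda>z. \<phi> n z * d k z)" for k
    proof (rule Bochner_Integration.integrable_bound[OF i\<phi>[of n]])
      have "norm (\<phi> n z * d k z) \<le> norm (\<phi> n z)" for z
        using \<phi>(2)[of n z] d0[of k z] mult_left_mono[of "d k z" 1 "\<phi> n z"] by (simp add: abs_mult d_def)
      then show "AE z in lborel. norm (\<phi> n z * d k z) \<le> norm (\<phi> n z)" by simp
    qed measurable
    have Id: "(\<integral>z. \<phi> n z * d k z \<partial>lborel) \<le> (1 / 2) ^ k" for k
    proof -
      have "(\<integral>z. \<phi> n z * d k z \<partial>lborel) = J n (r (Suc (k + n))) (r (k + n))" by (simp add: J_def d_def)
      moreover have 1: "N n (k + n) \<le> r (k + n)" by (rule rN) simp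
      moreover have "r (k + n) \<le> r (Suc (k + n))" by (rule strict_mono_leD[OF r]) simp
      ultimately have "(\<integral>z. \<phi> n z * d k z \<partial>lborel) < (1 / 2) ^ (k + n)"
        using N[OF order_trans[OF 1] 1] by simp
      also have "(1 / 2) ^ (k + n) \<le> (1 / 2 :: real) ^ k" by (rule power_decreasing) simp_all
      finally show ?thesis by (rule less_imp_le)
    qed
    have "(\<integral>\<^sup>+z. (\<Sum>k. ennreal (\<phi> n z * d k z)) \<partial>lborel) = (\<Sum>k. \<integral>\<^sup>+z. ennreal (\<phi> n z * d k z) \<partial>lborel)"
      by (rule nn_integral_suminf) measurable
    also have "\<dots> \<le> (\<Sum>k. ennreal ((1 / 2) ^ k))"
    proof (intro suminf_le summableI)
      fix k
      have "(\<integral>\<^sup>+z. ennreal (\<phi> n z * d k z) \<partial>lborel) = ennreal (\<integral>z. \<phi> n z * d k z \<partial>lborel)"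
        by (rule nn_integral_eq_integral[OF id]) (simp add: \<phi>(2) d0)
      then show "(\<integral>\<^sup>+z. ennreal (\<phi> n z * d k z) \<partial>lborel) \<le> ennreal ((1 / 2) ^ k)"
        using Id[of k] by (simp add: ennreal_leI)
    qed
    also have "\<dots> < \<infinity>"
    proof -
      have "(\<Sum>k. ennreal ((1 / 2) ^ k)) = ennreal (\<Sum>k. (1 / 2) ^ k)"
        by (rule suminf_ennreal2) (auto intro: summable_geometric)
      then show ?thesis by simp
    qed
    finally have fin: "(\<integral>\<^sup>+z. (\<Sum>k. ennreal (\<phi> n z * d k z)) \<partial>lborel) \<noteq> \<infinity>" by simp
    have "AE z in lborel. (\<Sum>k. ennreal (\<phi> n z * d k z)) \<noteq> \<infinity>"
      by (rule nn_integral_PInf_AE[OF _ fin]) measurable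
    then show ?thesis
    proof eventually_elim
      case (elim z)
      show ?case
      proof
        assume z: "z \<in> K n"
        have p: "0 < \<phi> n z" using c(1)[of n] c(2)[OF z] by linarith
        have "summable (\<lambda>k. \<phi> n z * d k z)"
          by (rule summable_suminf_not_top) (use elim \<phi>(2) d0 in auto)
        from summable_mult[OF this, of "inverse (\<phi> n z)"] have sd: "summable (\<lambda>k. d k z)"
          using p by simp
        \<comment> \<open>Summable terms tend to 0, so from some index on the minimum with 1 is
          inactive and \<open>d\<close> is the true distance.\<close>
        have "(\<lambda>k. d k z) \<longlonglongrightarrow> 0" by (rule summable_LIMSEQ_zero[OF sd])
        then have "\<forall>\<^sub>F k in sequentially. d k z < 1" by (rule order_tendstoD) simp
        then obtain k1 where k1: "\<And>k. k \<ge> k1 \<Longrightarrow> d k z < 1" unfolding eventually_sequentially by blast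
        let ?a = "\<lambda>k. ws (r (k + n)) z"
        have "summable (\<lambda>k. ?a (Suc k) - ?a k)"
        proof (rule summable_comparison_test[OF _ sd], intro exI allI impI)
          fix k assume "k \<ge> k1"
          then have "d k z = norm (ws (r (Suc (k + n))) z - ws (r (k + n)) z)" using k1[of k] by (simp add: d_def min_def split: if_splits)
          then show "norm (?a (Suc k) - ?a k) \<le> d k z" by simp
        qed
        then have "convergent (\<lambda>m. \<Sum>k<m. ?a (Suc k) - ?a k)" by (simp add: summable_iff_convergent)
        moreover have "(\<Sum>k<m. ?a (Suc k) - ?a k) = ?a m - ?a 0" for m
          by (rule sum_lessThan_telescope)
        ultimately have "convergent (\<lambda>m. ?a m - ?a 0)" by simp
        then have "convergent (\<lambda>m. (?a m - ?a 0) + ?a 0)" by (rule convergent_add[OF _ convergent_const])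
        then have "convergent (\<lambda>k. ws (r (k + n)) z)" by simp
        then have "convergent (\<lambda>k. ws (r k) z)" by (subst (asm) convergent_ignore_initial_segment)
        then show "(\<lambda>k. ws (r k) z) \<longlonglongrightarrow> w z" unfolding w_def by (simp add: convergent_LIMSEQ_iff)
      qed
    qed
  qed
  have "AE z in lborel. \<forall>n. z \<in> K n \<longrightarrow> (\<lambda>k. ws (r k) z) \<longlonglongrightarrow> w z"
    unfolding AE_all_countable using conv by blast
  then have "AE z in lborel. z \<in> U \<longrightarrow> (\<lambda>k. ws (r k) z) \<longlonglongrightarrow> w z"
    by eventually_elim (use K(3) in blast)
  then show ?thesis using r wb by blast
qed

section \<open>Passage to the limit in the weak formulation\<close>

text \<open>Fatou's lemma transfers the local energy bound to the limit gradient. Superlinearity of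
  \<open>h\<close> then upgrades almost everywhere convergence of gradients and fluxes to
  convergence in L^1 on compact sets, and both integral conditions are continuous under it. The
  functions themselves converge under the domination by \<open>M\<close>.\<close>

theorem wsuper_limit:
  assumes U: "open U" and M: "0 \<le> M"
    and w: "\<And>i. wsuper U (us i) (ws i)" "\<And>i z. \<bar>us i z\<bar> \<le> M"
    and u: "u \<in> borel_measurable borel" "\<And>z. \<bar>u z\<bar> \<le> M"
    and lim: "AE z in lborel. z \<in> U \<longrightarrow> (\<lambda>i. us i z) \<longlonglongrightarrow> u z"
  shows "\<exists>w. wsuper U u w"
proof -
  obtain r w0 where r: "strict_mono (r :: nat \<Rightarrow> nat)" and wb: "w0 \<in> borel_measurable borel"
    and wlim: "AE z in lborel. z \<in> U \<longrightarrow> (\<lambda>k. ws (r k) z) \<longlonglongrightarrow> w0 z"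
    using gradients_converge[OF U M w u lim] by blast
  note [measurable] = wb u(1)
  have wm[measurable]: "us i \<in> borel_measurable borel" "ws i \<in> borel_measurable borel" for i
    using w(1)[of i] unfolding wsuper_def by blast+
  have hK: "integrable lborel (\<lambda>z. indicator K z * h (norm (ws i z)))" if "compact K" "K \<subseteq> U" for K i
    using w(1)[of i] that unfolding wsuper_def by blast
  have hcont: "continuous_on UNIV (\<lambda>x::'a. h (norm x))"
    unfolding h_def by (intro continuous_intros continuous_on_compose2[OF g_cont]) auto
  \<comment> \<open>One constant bounds the limit and the whole sequence, in the form that
    \<open>uniformly_integrable_L1\<close> expects.\<close>
  have fatou: "integrable lborel (\<lambda>z. indicator K z * h (norm (w0 z))) \<and>
      (\<exists>C. (\<integral>z. indicator K z * h (norm (w0 z)) \<partial>lborel) \<le> C \<and> (\<forall>i. (\<integral>z. indicator K z * h (norm (ws i z)) \<partial>lborel) \<le> C))"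
    if K: "compact K" "K \<subseteq> U" for K
  proof -
    have [measurable]: "K \<in> sets borel" using K by (simp add: borel_compact)
    obtain C where C: "\<And>i. (\<integral>z. indicator K z * h (norm (ws i z)) \<partial>lborel) \<le> C"
      using local_energy_bound[OF U M K] w by blast
    have nn: "0 \<le> indicator K z * h (norm x)" for z :: "'a \<times> real" and x :: 'a
      using h_nonneg by simp
    have C0: "0 \<le> C" using C[of 0] integral_nonneg_AE[of "\<lambda>z. indicator K z * h (norm (ws 0 z))" lborel] nn by fastforce
    have "(\<integral>\<^sup>+z. ennreal (indicator K z * h (norm (w0 z))) \<partial>lborel)
        = (\<integral>\<^sup>+z. liminf (\<lambda>k. ennreal (indicator K z * h (norm (ws (r k) z)))) \<partial>lborel)"
    proof (rule nn_integral_cong_AE)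
      show "AE z in lborel. ennreal (indicator K z * h (norm (w0 z))) = liminf (\<lambda>k. ennreal (indicator K z * h (norm (ws (r k) z))))"
        using wlim
      proof eventually_elim
        case (elim z)
        have "(\<lambda>k. indicator K z * h (norm (ws (r k) z))) \<longlonglongrightarrow> indicator K z * h (norm (w0 z))"
        proof (cases "z \<in> K")
          case True
          then have "(\<lambda>k. ws (r k) z) \<longlonglongrightarrow> w0 z" using elim K(2) by blast
          then have "(\<lambda>k. h (norm (ws (r k) z))) \<longlonglongrightarrow> h (norm (w0 z))"
            by (rule continuous_on_tendsto_compose[OF hcont]) auto
          then show ?thesis by (intro tendsto_intros)
        qed simp
        then have "(\<lambda>k. ennreal (indicator K z * h (norm (ws (r k) z)))) \<longlonglongrightarrow> ennreal (indicator K z * h (norm (w0 z)))"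
          by (rule tendsto_ennrealI)
        then show ?case by (rule lim_imp_Liminf[symmetric, rotated]) simp
      qed
    qed
    also have "\<dots> \<le> liminf (\<lambda>k. \<integral>\<^sup>+z. ennreal (indicator K z * h (norm (ws (r k) z))) \<partial>lborel)"
      by (rule nn_integral_liminf) measurable
    also have "\<dots> \<le> liminf (\<lambda>k::nat. ennreal C)"
    proof (rule Liminf_mono[OF always_eventually], rule allI)
      fix k
      have "(\<integral>\<^sup>+z. ennreal (indicator K z * h (norm (ws (r k) z))) \<partial>lborel) = ennreal (\<integral>z. indicator K z * h (norm (ws (r k) z)) \<partial>lborel)"
        by (rule nn_integral_eq_integral[OF hK[OF K]]) (simp only: nn AE_I2)
      then show "(\<integral>\<^sup>+z. ennreal (indicator K z * h (norm (ws (r k) z))) \<partial>lborel) \<le> ennreal C"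
        using C by (simp add: ennreal_leI)
    qed
    also have "\<dots> = ennreal C" by (simp add: Liminf_const)
    finally have le: "(\<integral>\<^sup>+z. ennreal (indicator K z * h (norm (w0 z))) \<partial>lborel) \<le> ennreal C" .
    have int: "integrable lborel (\<lambda>z. indicator K z * h (norm (w0 z)))"
    proof (rule integrableI_nonneg)
      show "AE z in lborel. 0 \<le> indicator K z * h (norm (w0 z))" by (simp only: nn AE_I2)
      show "(\<integral>\<^sup>+z. ennreal (indicator K z * h (norm (w0 z))) \<partial>lborel) < \<infinity>"
        using le by (rule le_less_trans) simp
    qed measurable
    have "ennreal (\<integral>z. indicator K z * h (norm (w0 z)) \<partial>lborel) \<le> ennreal C"
      using le nn_integral_eq_integral[OF int] nn by simp
    then have "(\<integral>z. indicator K z * h (norm (w0 z)) \<partial>lborel) \<le> C" using C0 by simp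
    then show ?thesis using int C by blast
  qed
  \<comment> \<open>A general continuous \<open>F\<close> is used because the identity and
    \<open>A\<close> are needed with the same argument; only the growth condition \<open>Fb\<close>
    has to be verified for each.\<close>
  have L1: "(\<lambda>k. \<integral>z. norm (zero_extend K (\<lambda>z. F (ws (r k) z)) z - zero_extend K (\<lambda>z. F (w0 z)) z) \<partial>lborel) \<longlonglongrightarrow> 0"
    and iF: "\<And>i. integrable lborel (zero_extend K (\<lambda>z. F (ws i z)))" "integrable lborel (zero_extend K (\<lambda>z. F (w0 z)))"
    if K: "compact K" "K \<subseteq> U" and F: "continuous_on UNIV F"
      and Fb: "\<And>e. 0 < e \<Longrightarrow> \<exists>C\<ge>0. \<forall>x. norm (F x) \<le> C + e * h (norm x)"
    for K and F :: "'a \<Rightarrow> 'a"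
  proof -
    have [measurable]: "K \<in> sets borel" using K by (simp add: borel_compact)
    have [measurable]: "F \<in> borel_measurable borel" using F by (rule borel_measurable_continuous_onI)
    obtain C1 where C1: "C1 \<ge> 0" "\<And>x. norm (F x) \<le> C1 + 1 * h (norm x)" using Fb[of 1] by auto
    have int: "integrable lborel (zero_extend K (\<lambda>z. F (v z)))"
      if [measurable]: "v \<in> borel_measurable borel" and iv: "integrable lborel (\<lambda>z. indicator K z * h (norm (v z)))" for v
    proof -
      have iK: "integrable lborel (\<lambda>z. C1 * indicator K z)"
        using emeasure_bounded_finite[OF compact_imp_bounded[OF K(1)]]
        by (intro integrable_mult_right integrable_real_indicator) auto
      show ?thesis
      proof (rule Bochner_Integration.integrable_bound[OF Bochner_Integration.integrable_add[OF iK iv]])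
        have "norm (zero_extend K (\<lambda>z. F (v z)) z) \<le> norm (C1 * indicator K z + indicator K z * h (norm (v z)))" for z
          using C1(2)[of "v z"] C1(1) h_nonneg[of "norm (v z)"] by (auto simp: zero_extend_def indicator_def)
        then show "AE z in lborel. norm (zero_extend K (\<lambda>z. F (v z)) z) \<le> norm (C1 * indicator K z + indicator K z * h (norm (v z)))" by simp
        show "zero_extend K (\<lambda>z. F (v z)) \<in> borel_measurable lborel" unfolding zero_extend_def[abs_def] by measurable
      qed
    qed
    show i1: "integrable lborel (zero_extend K (\<lambda>z. F (ws i z)))" for i
      by (rule int[OF wm(2) hK[OF K]])
    show i2: "integrable lborel (zero_extend K (\<lambda>z. F (w0 z)))"
      using fatou[OF K] by (intro int wb) blast
    obtain C where C: "(\<integral>z. indicator K z * h (norm (w0 z)) \<partial>lborel) \<le> C" "\<And>i. (\<integral>z. indicator K z * h (norm (ws i z)) \<partial>lborel) \<le> C"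
      using fatou[OF K] by blast
    show "(\<lambda>k. \<integral>z. norm (zero_extend K (\<lambda>z. F (ws (r k) z)) z - zero_extend K (\<lambda>z. F (w0 z)) z) \<partial>lborel) \<longlonglongrightarrow> 0"
    proof (rule uniformly_integrable_L1[where H="\<lambda>k z. indicator K z * h (norm (ws (r k) z))" and ?H0.0="\<lambda>z. indicator K z * h (norm (w0 z))", OF i1 i2])
      show "integrable lborel (\<lambda>z. indicator K z * h (norm (ws (r k) z)))" for k by (rule hK[OF K])
      show "integrable lborel (\<lambda>z. indicator K z * h (norm (w0 z)))" using fatou[OF K] by blast
      show "0 \<le> indicator K z * h (norm (ws (r k) z))" "0 \<le> indicator K z * h (norm (w0 z))" for k z
        using h_nonneg by simp_all
      show "(\<integral>z. indicator K z * h (norm (ws (r k) z)) \<partial>lborel) \<le> C" for k by (rule C(2))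
      show "(\<integral>z. indicator K z * h (norm (w0 z)) \<partial>lborel) \<le> C" by (rule C(1))
      show "AE z in lborel. (\<lambda>k. zero_extend K (\<lambda>z. F (ws (r k) z)) z) \<longlonglongrightarrow> zero_extend K (\<lambda>z. F (w0 z)) z"
        using wlim
      proof eventually_elim
        case (elim z)
        show ?case
        proof (cases "z \<in> K")
          case True
          then have "(\<lambda>k. ws (r k) z) \<longlonglongrightarrow> w0 z" using elim K(2) by blast
          then have "(\<lambda>k. F (ws (r k) z)) \<longlonglongrightarrow> F (w0 z)"
            by (rule continuous_on_tendsto_compose[OF F]) auto
          then show ?thesis unfolding zero_extend_def by (intro tendsto_intros)
        qed (simp add: zero_extend_def)
      qed
      show "compact K" by (rule K(1))
      fix e :: real assume "0 < e"
      then obtain C' where C': "C' \<ge> 0" "\<And>x. norm (F x) \<le> C' + e * h (norm x)" using Fb by blast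
      have b: "norm (zero_extend K (\<lambda>z. F (v z)) z) \<le> C' * indicator K z + e * (indicator K z * h (norm (v z)))" for v z
        using C'(2)[of "v z"] by (auto simp: zero_extend_def indicator_def)
      show "\<exists>C\<ge>0. \<forall>z. (\<forall>k. norm (zero_extend K (\<lambda>z. F (ws (r k) z)) z) \<le> C * indicator K z + e * (indicator K z * h (norm (ws (r k) z)))) \<and>
          norm (zero_extend K (\<lambda>z. F (w0 z)) z) \<le> C * indicator K z + e * (indicator K z * h (norm (w0 z)))"
        by (intro exI[of _ C'] conjI allI b C'(1))
    qed
  qed
  have bI: "\<exists>C\<ge>0. \<forall>x::'a. norm x \<le> C + e * h (norm x)" if "0 < e" for e
    using superlinear[OF that] by (meson norm_ge_zero)
  have bA: "\<exists>C\<ge>0. \<forall>x::'a. norm (A x) \<le> C + e * h (norm x)" if e: "0 < e" for e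
  proof -
    obtain C where C: "C \<ge> 0" "\<And>s. s \<ge> 0 \<Longrightarrow> g s \<le> C + e / CA * h s"
      using superlinear[of "e / CA"] e CA_pos by auto
    have "norm (A x) \<le> CA * C + e * h (norm x)" for x
    proof -
      have "norm (A x) \<le> CA * g (norm x)" by (rule A_bound)
      also have "\<dots> \<le> CA * (C + e / CA * h (norm x))" using C(2)[of "norm x"] CA_pos by (intro mult_left_mono) auto
      also have "\<dots> = CA * C + e * h (norm x)" using CA_pos by (simp add: distrib_left)
      finally show ?thesis .
    qed
    moreover have "0 \<le> CA * C" using C CA_pos by simp
    ultimately show ?thesis by blast
  qed
  have ulim: "(\<lambda>k. \<integral>z. us (r k) z * dderiv e \<phi> z \<partial>lborel) \<longlonglongrightarrow> (\<integral>z. u z * dderiv e \<phi> z \<partial>lborel)"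
    if \<phi>: "\<phi> \<in> Cc_infty U" for e \<phi>
  proof (rule integral_dominated_convergence[where w="\<lambda>z. M * \<bar>dderiv e \<phi> z\<bar>"])
    obtain S where S: "compact S" "S \<subseteq> U" "\<And>z. z \<notin> S \<Longrightarrow> \<phi> z = 0" using Cc_infty_support[OF \<phi>] by metis
    have dS: "dderiv e \<phi> z = 0" if "z \<notin> S" for z by (rule dderiv_eq_zero_off[OF S(1,3) that])
    have [measurable]: "dderiv e \<phi> \<in> borel_measurable borel"
      by (rule borel_measurable_continuous_onI[OF Cc_infty_dderiv_continuous[OF \<phi>]])
    show "AE z in lborel. (\<lambda>k. us (r k) z * dderiv e \<phi> z) \<longlonglongrightarrow> u z * dderiv e \<phi> z"
      using lim
    proof eventually_elim
      case (elim z)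
      show ?case
      proof (cases "z \<in> S")
        case True
        then have "(\<lambda>i. us i z) \<longlonglongrightarrow> u z" using elim S(2) by blast
        from LIMSEQ_subseq_LIMSEQ[OF this r] have "(\<lambda>k. us (r k) z) \<longlonglongrightarrow> u z" by (simp add: o_def)
        then show ?thesis by (intro tendsto_intros)
      qed (simp add: dS)
    qed
    show "integrable lborel (\<lambda>z. M * \<bar>dderiv e \<phi> z\<bar>)"
      by (rule integrable_compact_support[OF _ S(1)]) (intro continuous_intros Cc_infty_dderiv_continuous[OF \<phi>], simp add: dS)
    show "AE z in lborel. norm (us (r k) z * dderiv e \<phi> z) \<le> M * \<bar>dderiv e \<phi> z\<bar>" for k
      using w(2) by (intro AE_I2) (simp add: abs_mult mult_right_mono)
    show "(\<lambda>z. us (r k) z * dderiv e \<phi> z) \<in> borel_measurable lborel" for k by measurable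
    show "(\<lambda>z. u z * dderiv e \<phi> z) \<in> borel_measurable lborel" by measurable
  qed
  have weak: "(\<integral>z. u z * dderiv (b, 0) \<phi> z \<partial>lborel) = - (\<integral>z. \<phi> z * (w0 z \<bullet> b) \<partial>lborel)"
    if \<phi>: "\<phi> \<in> Cc_infty U" and b: "b \<in> Basis" for \<phi> b
  proof -
    obtain S where S: "compact S" "S \<subseteq> U" "\<And>z. z \<notin> S \<Longrightarrow> \<phi> z = 0" using Cc_infty_support[OF \<phi>] by metis
    obtain B where B: "\<And>z. norm (\<phi> z) \<le> B"
      using compact_support_bounded[OF Cc_infty_continuous[OF \<phi>] S(1,3)] by metis
    have eq: "\<phi> z * (v z \<bullet> b) = (\<phi> z *\<^sub>R b) \<bullet> zero_extend S (\<lambda>z. v z) z" for v z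
      using S(3)[of z] by (cases "z \<in> S") (simp_all add: zero_extend_def inner_commute)
    have nb: "norm (\<phi> z *\<^sub>R b) \<le> B" for z using B[of z] b by simp
    have cb: "continuous_on UNIV (\<lambda>z. \<phi> z *\<^sub>R b)" by (intro continuous_intros Cc_infty_continuous[OF \<phi>])
    have "(\<lambda>k. \<integral>z. (\<phi> z *\<^sub>R b) \<bullet> zero_extend S (\<lambda>z. ws (r k) z) z \<partial>lborel) \<longlonglongrightarrow> (\<integral>z. (\<phi> z *\<^sub>R b) \<bullet> zero_extend S (\<lambda>z. w0 z) z \<partial>lborel)"
      by (rule L1_tested_limit(2)[OF iF(1)[OF S(1,2) continuous_on_id bI] iF(2)[OF S(1,2) continuous_on_id bI] L1[OF S(1,2) continuous_on_id bI] cb nb])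
    then have "(\<lambda>k. - (\<integral>z. \<phi> z * (ws (r k) z \<bullet> b) \<partial>lborel)) \<longlonglongrightarrow> - (\<integral>z. \<phi> z * (w0 z \<bullet> b) \<partial>lborel)"
      unfolding eq by (rule tendsto_minus)
    moreover have "(\<integral>z. us (r k) z * dderiv (b, 0) \<phi> z \<partial>lborel) = - (\<integral>z. \<phi> z * (ws (r k) z \<bullet> b) \<partial>lborel)" for k
      using w(1)[of "r k"] \<phi> b unfolding wsuper_def by blast
    ultimately show ?thesis using ulim[OF \<phi>, of "(b, 0)"] LIMSEQ_unique by simp
  qed
  have super: "0 \<le> - (\<integral>z. u z * dderiv (0, 1) \<phi> z \<partial>lborel) + (\<integral>z. (\<Sum>b\<in>Basis. (A (w0 z) \<bullet> b) * dderiv (b, 0) \<phi> z) \<partial>lborel)"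
    if \<phi>: "\<phi> \<in> Cc_infty U" "\<forall>z. 0 \<le> \<phi> z" for \<phi>
  proof -
    obtain S where S: "compact S" "S \<subseteq> U" "\<And>z. z \<notin> S \<Longrightarrow> \<phi> z = 0" using Cc_infty_support[OF \<phi>(1)] by metis
    have dS: "dderiv e \<phi> z = 0" if "z \<notin> S" for z e by (rule dderiv_eq_zero_off[OF S(1,3) that])
    define \<psi> where "\<psi> = (\<lambda>z. \<Sum>b\<in>Basis. dderiv (b, 0) \<phi> z *\<^sub>R (b::'a))"
    have c\<psi>: "continuous_on UNIV \<psi>" unfolding \<psi>_def by (intro continuous_intros Cc_infty_dderiv_continuous[OF \<phi>(1)])
    have \<psi>S: "\<psi> z = 0" if "z \<notin> S" for z using dS[OF that] by (simp add: \<psi>_def)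
    obtain B where B: "\<And>z. norm (\<psi> z) \<le> B" using compact_support_bounded[OF c\<psi> S(1) \<psi>S] by metis
    have eq: "(\<Sum>b\<in>Basis. (A (v z) \<bullet> b) * dderiv (b, 0) \<phi> z) = \<psi> z \<bullet> zero_extend S (\<lambda>z. A (v z)) z" for v z
    proof (cases "z \<in> S")
      case True
      then show ?thesis by (simp add: \<psi>_def zero_extend_def inner_sum_left inner_commute[of "A (v z)"] mult.commute)
    qed (simp add: \<psi>S dS)
    have "(\<lambda>k. \<integral>z. \<psi> z \<bullet> zero_extend S (\<lambda>z. A (ws (r k) z)) z \<partial>lborel) \<longlonglongrightarrow> (\<integral>z. \<psi> z \<bullet> zero_extend S (\<lambda>z. A (w0 z)) z \<partial>lborel)"
      by (rule L1_tested_limit(2)[OF iF(1)[OF S(1,2) A_cont bA] iF(2)[OF S(1,2) A_cont bA] L1[OF S(1,2) A_cont bA] c\<psi> B])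
    then have l: "(\<lambda>k. - (\<integral>z. us (r k) z * dderiv (0, 1) \<phi> z \<partial>lborel) + (\<integral>z. (\<Sum>b\<in>Basis. (A (ws (r k) z) \<bullet> b) * dderiv (b, 0) \<phi> z) \<partial>lborel))
      \<longlonglongrightarrow> - (\<integral>z. u z * dderiv (0, 1) \<phi> z \<partial>lborel) + (\<integral>z. (\<Sum>b\<in>Basis. (A (w0 z) \<bullet> b) * dderiv (b, 0) \<phi> z) \<partial>lborel)"
      unfolding eq by (intro tendsto_add tendsto_minus ulim[OF \<phi>(1)])
    have n: "0 \<le> - (\<integral>z. us (r k) z * dderiv (0, 1) \<phi> z \<partial>lborel) + (\<integral>z. (\<Sum>b\<in>Basis. (A (ws (r k) z) \<bullet> b) * dderiv (b, 0) \<phi> z) \<partial>lborel)" for k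
      using w(1)[of "r k"] \<phi> unfolding wsuper_def by blast
    show ?thesis by (rule LIMSEQ_le_const[OF l]) (use n in blast)
  qed
  have "wsuper U u w0"
    unfolding wsuper_def using wb u(1) fatou weak super by blast
  then show ?thesis by blast
qed

end

section \<open>Borel representatives\<close>

lemma AE_lebesgue_on:
  assumes "S \<in> sets borel"
  shows "(AE x in lebesgue_on S. P x) \<longleftrightarrow> (AE x in lborel. x \<in> S \<longrightarrow> P x)"
  using assms by (subst AE_restrict_space_iff) (auto simp: AE_completion_iff)

lemma borel_measurable_lebesgue_on_AE:
  fixes f f' :: "'e::euclidean_space \<Rightarrow> 'b::euclidean_space"
  assumes S: "S \<in> sets borel" and f': "f' \<in> borel_measurable borel"
    and eq: "AE x in lborel. x \<in> S \<longrightarrow> f x = f' x"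
  shows "f \<in> borel_measurable (lebesgue_on S)"
proof -
  have SL: "S \<in> sets lebesgue" using S by auto
  have "f' \<in> borel_measurable (lebesgue_on S)"
    using f' by (intro measurable_restrict_space1 measurable_completion) simp
  then have m: "f' measurable_on S" using measurable_on_iff_borel_measurable[OF SL] by blast
  obtain N where N: "{x \<in> space lborel. \<not> (x \<in> S \<longrightarrow> f x = f' x)} \<subseteq> N" "N \<in> null_sets lborel"
    using eq by (auto simp: eventually_ae_filter)
  have "negligible N" using N(2) by (simp add: negligible_iff_null_sets null_sets_completionI)
  then have "f measurable_on S"
    by (rule measurable_on_spike[OF m]) (use N(1) in auto)
  then show ?thesis using measurable_on_iff_borel_measurable[OF SL] by blast
qed

text \<open>The dictionary between the two settings: the definitions integrate over a restricted
  completed measure, whereas mollification and Fubini work with Borel functions on the whole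
  space.\<close>

lemma lebesgue_on_transfer:
  fixes f f' :: "'e::euclidean_space \<Rightarrow> 'b::euclidean_space"
  assumes S: "S \<in> sets borel" and f': "f' \<in> borel_measurable borel"
    and eq: "AE x in lborel. x \<in> S \<longrightarrow> f x = f' x"
  shows "integrable (lebesgue_on S) f \<longleftrightarrow> integrable lborel (\<lambda>x. indicator S x *\<^sub>R f' x)"
    and "integral\<^sup>L (lebesgue_on S) f = (\<integral>x. indicator S x *\<^sub>R f' x \<partial>lborel)"
proof -
  have m: "f \<in> borel_measurable (lebesgue_on S)" by (rule borel_measurable_lebesgue_on_AE[OF assms])
  have m': "f' \<in> borel_measurable (lebesgue_on S)"
    using f' by (intro measurable_restrict_space1 measurable_completion) simp
  have ae: "AE x in lebesgue_on S. f x = f' x" using eq AE_lebesgue_on[OF S] by blast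
  have s: "S \<inter> space lebesgue \<in> sets lebesgue" using S by auto
  have b: "(\<lambda>x. indicator S x *\<^sub>R f' x) \<in> borel_measurable lborel" using S f' by measurable
  have "integrable (lebesgue_on S) f \<longleftrightarrow> integrable (lebesgue_on S) f'"
    by (rule integrable_cong_AE[OF m m' ae])
  also have "\<dots> \<longleftrightarrow> integrable lebesgue (\<lambda>x. indicator S x *\<^sub>R f' x)"
    by (rule integrable_restrict_space[OF s])
  also have "\<dots> \<longleftrightarrow> integrable lborel (\<lambda>x. indicator S x *\<^sub>R f' x)"
    by (rule integrable_completion[OF b])
  finally show "integrable (lebesgue_on S) f \<longleftrightarrow> integrable lborel (\<lambda>x. indicator S x *\<^sub>R f' x)" .
  have "integral\<^sup>L (lebesgue_on S) f = integral\<^sup>L (lebesgue_on S) f'"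
    by (rule integral_cong_AE[OF m m' ae])
  also have "\<dots> = integral\<^sup>L lebesgue (\<lambda>x. indicator S x *\<^sub>R f' x)"
    by (rule integral_restrict_space[OF s])
  also have "\<dots> = (\<integral>x. indicator S x *\<^sub>R f' x \<partial>lborel)"
    by (rule integral_completion[OF b])
  finally show "integral\<^sup>L (lebesgue_on S) f = (\<integral>x. indicator S x *\<^sub>R f' x \<partial>lborel)" .
qed

lemma nn_integral_lebesgue_on:
  assumes S: "S \<in> sets (borel :: 'e::euclidean_space measure)" and eq: "AE x in lborel. x \<in> S \<longrightarrow> F x = F' x"
  shows "(\<integral>\<^sup>+x. F x \<partial>lebesgue_on S) = (\<integral>\<^sup>+x. F' x * indicator S x \<partial>lborel)"
proof -
  have ae: "AE x in lebesgue_on S. F x = F' x" using eq AE_lebesgue_on[OF S] by blast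
  have s: "S \<inter> space lebesgue \<in> sets lebesgue" using S by auto
  have "(\<integral>\<^sup>+x. F x \<partial>lebesgue_on S) = (\<integral>\<^sup>+x. F' x \<partial>lebesgue_on S)" by (rule nn_integral_cong_AE[OF ae])
  also have "\<dots> = (\<integral>\<^sup>+x. F' x * indicator S x \<partial>lebesgue)" by (rule nn_integral_restrict_space[OF s])
  also have "\<dots> = (\<integral>\<^sup>+x. F' x * indicator S x \<partial>lborel)" by (rule nn_integral_completion)
  finally show ?thesis .
qed

text \<open>A Lebesgue measurable function is, off a null set, a limit of continuous functions, and
  the \<open>lim\<close> of these is Borel.\<close>

lemma borel_representative:
  fixes f :: "'e::euclidean_space \<Rightarrow> 'b::euclidean_space"
  assumes "f \<in> borel_measurable (lebesgue_on S)" and S: "S \<in> sets borel"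
  obtains f' where "f' \<in> borel_measurable borel" "AE x in lborel. f' x = (if x \<in> S then f x else 0)"
proof -
  have "f measurable_on S" using assms measurable_on_iff_borel_measurable[of S f] by auto
  then obtain N q where N: "negligible N" and q: "\<And>n. continuous_on UNIV (q n)"
    and lim: "\<And>x. x \<notin> N \<Longrightarrow> (\<lambda>n. q n x) \<longlonglongrightarrow> (if x \<in> S then f x else 0)"
    unfolding measurable_on_def by blast
  have [measurable]: "q n \<in> borel_measurable borel" for n by (rule borel_measurable_continuous_onI[OF q])
  have "AE x in lborel. x \<notin> N"
    using N unfolding negligible_iff_null_sets by (metis AE_completion_iff AE_not_in)
  then have "AE x in lborel. lim (\<lambda>n. q n x) = (if x \<in> S then f x else 0)"
    by eventually_elim (rule limI, rule lim)
  then show thesis by (intro that[of "\<lambda>x. lim (\<lambda>n. q n x)"]) measurable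
qed

lemma absolutely_integrable_on_transfer:
  fixes f f' :: "'e::euclidean_space \<Rightarrow> 'b::euclidean_space"
  assumes K: "compact K" and f': "f' \<in> borel_measurable borel" and eq: "AE x in lborel. x \<in> K \<longrightarrow> f x = f' x"
  shows "f absolutely_integrable_on K \<longleftrightarrow> integrable lborel (\<lambda>x. indicator K x *\<^sub>R f' x)"
proof -
  have B: "K \<in> sets borel" using K by (simp add: borel_compact)
  then have "K \<inter> space lebesgue \<in> sets lebesgue" by auto
  from integrable_restrict_space[OF this, of f]
  have "f absolutely_integrable_on K \<longleftrightarrow> integrable (lebesgue_on K) f"
    by (simp add: set_integrable_def)
  then show ?thesis using lebesgue_on_transfer(1)[OF B f' eq] by simp
qed

lemma locally_integrable_on_transfer:
  fixes f f' :: "'e::euclidean_space \<Rightarrow> 'b::euclidean_space"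
  assumes f': "f' \<in> borel_measurable borel" and eq: "AE x in lborel. x \<in> U \<longrightarrow> f x = f' x"
  shows "locally_integrable_on f U \<longleftrightarrow> (\<forall>K. compact K \<and> K \<subseteq> U \<longrightarrow> integrable lborel (\<lambda>x. indicator K x *\<^sub>R f' x))"
proof -
  have "f absolutely_integrable_on K \<longleftrightarrow> integrable lborel (\<lambda>x. indicator K x *\<^sub>R f' x)" if "compact K" "K \<subseteq> U" for K
  proof (rule absolutely_integrable_on_transfer[OF that(1) f'])
    show "AE x in lborel. x \<in> K \<longrightarrow> f x = f' x" using eq by eventually_elim (use that(2) in blast)
  qed
  then show ?thesis unfolding locally_integrable_on_def by blast
qed

text \<open>Representatives on an increasing exhaustion agree with \<open>f\<close> at a given point
  of \<open>U\<close> from some index on, up to a countable union of null sets, so their limit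
  represents \<open>f\<close> on all of \<open>U\<close>.\<close>

lemma locally_integrable_representative:
  fixes f :: "'e::euclidean_space \<Rightarrow> 'b::euclidean_space"
  assumes U: "open U" and f: "locally_integrable_on f U"
  obtains f' where "f' \<in> borel_measurable borel" "AE x in lborel. x \<in> U \<longrightarrow> f x = f' x"
proof -
  obtain K :: "nat \<Rightarrow> 'e set" where K: "\<And>n. compact (K n)" "\<And>n. K n \<subseteq> U" "\<And>n. K n \<subseteq> interior (K (Suc n))" "\<Union> (range K) = U"
    using open_Union_compact_subsets[OF U] by metis
  have mono: "K m \<subseteq> K n" if "m \<le> n" for m n
    by (rule lift_Suc_mono_le[OF _ that]) (use K(3) interior_subset in blast)
  have B: "K n \<in> sets borel" for n using K(1) by (simp add: borel_compact)
  have fK: "f \<in> borel_measurable (lebesgue_on (K n))" for n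
  proof -
    have "f absolutely_integrable_on K n" using f K(1,2) unfolding locally_integrable_on_def by blast
    moreover have "K n \<inter> space lebesgue \<in> sets lebesgue" using B[of n] by auto
    ultimately have "integrable (lebesgue_on (K n)) f"
      using integrable_restrict_space[of "K n" lebesgue f] by (simp add: set_integrable_def)
    then show ?thesis by (rule borel_measurable_integrable)
  qed
  have "\<forall>n. \<exists>f'. f' \<in> borel_measurable borel \<and> (AE x in lborel. f' x = (if x \<in> K n then f x else 0))"
  proof
    show "\<exists>f'. f' \<in> borel_measurable borel \<and> (AE x in lborel. f' x = (if x \<in> K n then f x else 0))" for n
      by (rule borel_representative[OF fK B]) blast
  qed
  from choice[OF this] obtain q
    where "\<forall>n. q n \<in> borel_measurable borel \<and> (AE x in lborel. q n x = (if x \<in> K n then f x else 0))" ..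
  then have q[measurable]: "\<And>n. q n \<in> borel_measurable borel"
    and qe: "\<And>n. AE x in lborel. q n x = (if x \<in> K n then f x else 0)" by simp_all
  have "AE x in lborel. \<forall>n. q n x = (if x \<in> K n then f x else 0)"
    unfolding AE_all_countable using qe by blast
  then have "AE x in lborel. x \<in> U \<longrightarrow> f x = lim (\<lambda>n. q n x)"
  proof eventually_elim
    case (elim x)
    show ?case
    proof
      assume "x \<in> U"
      then obtain m where m: "x \<in> K m" using K(4) by blast
      have "\<forall>\<^sub>F n in sequentially. q n x = f x"
        using eventually_ge_at_top[of m] by eventually_elim (use elim mono m in auto)
      then have "(\<lambda>n. q n x) \<longlonglongrightarrow> f x" by (rule tendsto_eventually)
      then show "f x = lim (\<lambda>n. q n x)" by (simp add: limI)
    qed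
  qed
  then show thesis by (intro that[of "\<lambda>x. lim (\<lambda>n. q n x)"]) measurable
qed

lemma integrable_mult_locally:
  fixes f :: "'e::euclidean_space \<Rightarrow> 'b::euclidean_space"
  assumes \<psi>: "continuous_on UNIV \<psi>" and K: "compact K" "\<And>x. x \<notin> K \<Longrightarrow> \<psi> x = (0::real)"
    and f: "integrable lborel (\<lambda>x. indicator K x *\<^sub>R f x)"
  shows "integrable lborel (\<lambda>x. \<psi> x *\<^sub>R f x)"
proof -
  obtain B where B: "B > 0" "\<And>x. norm (\<psi> x) \<le> B" using compact_support_bounded[OF \<psi> K] by metis
  have eq: "\<psi> x *\<^sub>R f x = \<psi> x *\<^sub>R (indicator K x *\<^sub>R f x)" for x using K(2)[of x] by (cases "x \<in> K") auto
  show ?thesis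
    unfolding eq
  proof (rule Bochner_Integration.integrable_bound)
    show "integrable lborel (\<lambda>x. B * norm (indicator K x *\<^sub>R f x))" by (intro integrable_mult_right integrable_norm f)
    have "\<psi> \<in> borel_measurable lborel" using borel_measurable_continuous_onI[OF \<psi>] by simp
    then show "(\<lambda>x. \<psi> x *\<^sub>R (indicator K x *\<^sub>R f x)) \<in> borel_measurable lborel"
      using borel_measurable_integrable[OF f] by (rule borel_measurable_scaleR)
    have "norm (\<psi> x *\<^sub>R (indicator K x *\<^sub>R f x)) \<le> norm (B * norm (indicator K x *\<^sub>R f x))" for x
      using mult_right_mono[OF B(2)[of x] norm_ge_zero[of "indicator K x *\<^sub>R f x"]] B(1) by (simp add: abs_mult)
    then show "AE x in lborel. norm (\<psi> x *\<^sub>R (indicator K x *\<^sub>R f x)) \<le> norm (B * norm (indicator K x *\<^sub>R f x))" by simp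
  qed
qed

section \<open>The fundamental lemma and weak gradients\<close>

text \<open>A mollification evaluated at a point of \<open>C n\<close> is the pairing with a test
  function and hence 0 for large \<open>k\<close>. Convergence of mollifications in L^1 leaves
  \<open>f = 0\<close> almost everywhere on \<open>C n\<close>.\<close>

lemma fundamental_lemma:
  fixes f :: "'e::euclidean_space \<Rightarrow> real"
  assumes U: "open U" and f: "f \<in> borel_measurable borel"
    and loc: "\<And>K. compact K \<Longrightarrow> K \<subseteq> U \<Longrightarrow> integrable lborel (\<lambda>x. indicator K x *\<^sub>R f x)"
    and zero: "\<And>\<phi>. \<phi> \<in> Cc_infty U \<Longrightarrow> (\<integral>x. \<phi> x * f x \<partial>lborel) = 0"
  shows "AE x in lborel. x \<in> U \<longrightarrow> f x = 0"
proof -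
  obtain C :: "nat \<Rightarrow> 'e set" where C: "\<And>n. compact (C n)" "\<And>n. C n \<subseteq> U" "\<Union> (range C) = U"
    using open_Union_compact_subsets[OF U] by metis
  have "AE x in lborel. x \<in> C n \<longrightarrow> f x = 0" for n
  proof -
    obtain K k0 where K: "compact K" "K \<subseteq> U" "C n \<subseteq> K"
      and k0: "\<And>k z. k \<ge> k0 \<Longrightarrow> z \<in> C n \<Longrightarrow> cball z (inverse (real (Suc k))) \<subseteq> K"
      by (rule compact_neighbourhood[OF C(1,2) U]) blast
    define F where "F = (\<lambda>x. indicator K x *\<^sub>R f x)"
    have iF: "integrable lborel F" unfolding F_def by (rule loc[OF K(1,2)])
    have z: "moll k F z = 0" if k: "k \<ge> k0" and z: "z \<in> C n" for k z
    proof -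
      let ?r = "inverse (real (Suc k))"
      have "?r > 0" by simp
      note t = mollifier_test(1)[OF this order_trans[OF k0[OF k z] K(2)]]
      have e: "mollifier ?r (z - y) *\<^sub>R F y = mollifier ?r (z - y) * f y" for y
      proof (cases "y \<in> K")
        case False
        then have "y \<notin> cball z ?r" using k0[OF k z] by blast
        then have "mollifier ?r (z - y) = 0" by (intro mollifier_zero) (auto simp: dist_norm)
        then show ?thesis by simp
      qed (simp add: F_def)
      show ?thesis unfolding moll_def conv_def e by (rule zero[OF t])
    qed
    have B: "C n \<in> sets borel" using C(1) by (simp add: borel_compact)
    have iC: "integrable lborel (\<lambda>x. indicator (C n) x * \<bar>f x\<bar>)"
      using integrable_norm[OF loc[OF C(1,2), of n]] by (simp add: abs_mult)
    have le: "(\<integral>x. indicator (C n) x * \<bar>f x\<bar> \<partial>lborel) \<le> (\<integral>x. norm (moll k F x - F x) \<partial>lborel)" if k: "k \<ge> k0" for k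
    proof (rule integral_mono[OF iC])
      show "integrable lborel (\<lambda>x. norm (moll k F x - F x))"
        by (intro integrable_norm Bochner_Integration.integrable_diff moll_integrable iF)
      show "indicator (C n) x * \<bar>f x\<bar> \<le> norm (moll k F x - F x)" for x
        using z[OF k, of x] K(3) by (cases "x \<in> C n") (auto simp: F_def)
    qed
    have "(\<integral>x. indicator (C n) x * \<bar>f x\<bar> \<partial>lborel) \<le> 0"
      by (rule LIMSEQ_le_const[OF moll_tendsto[OF iF]]) (use le in blast)
    moreover have "0 \<le> (\<integral>x. indicator (C n) x * \<bar>f x\<bar> \<partial>lborel)"
      by (rule integral_nonneg_AE) simp
    ultimately have "(\<integral>x. indicator (C n) x * \<bar>f x\<bar> \<partial>lborel) = 0" by linarith
    then have "AE x in lborel. indicator (C n) x * \<bar>f x\<bar> = 0"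
      using integral_nonneg_eq_0_iff_AE[OF iC] by simp
    then show ?thesis by eventually_elim auto
  qed
  then have "AE x in lborel. \<forall>n. x \<in> C n \<longrightarrow> f x = 0" unfolding AE_all_countable by blast
  then show ?thesis by eventually_elim (use C(3) in blast)
qed

lemma fundamental_lemma_vector:
  fixes f q :: "'e::euclidean_space \<Rightarrow> 'b::euclidean_space"
  assumes U: "open U" and m: "f \<in> borel_measurable borel" "q \<in> borel_measurable borel"
    and loc: "\<And>K. compact K \<Longrightarrow> K \<subseteq> U \<Longrightarrow> integrable lborel (\<lambda>x. indicator K x *\<^sub>R f x)"
      "\<And>K. compact K \<Longrightarrow> K \<subseteq> U \<Longrightarrow> integrable lborel (\<lambda>x. indicator K x *\<^sub>R q x)"
    and eq: "\<And>\<phi> b. \<phi> \<in> Cc_infty U \<Longrightarrow> b \<in> Basis \<Longrightarrow> (\<integral>x. \<phi> x * (f x \<bullet> b) \<partial>lborel) = (\<integral>x. \<phi> x * (q x \<bullet> b) \<partial>lborel)"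
  shows "AE x in lborel. x \<in> U \<longrightarrow> f x = q x"
proof -
  have "AE x in lborel. x \<in> U \<longrightarrow> (f x - q x) \<bullet> b = 0" if b: "b \<in> Basis" for b
  proof (rule fundamental_lemma[OF U])
    show "(\<lambda>x. (f x - q x) \<bullet> b) \<in> borel_measurable borel" using m by measurable
    show "integrable lborel (\<lambda>x. indicator K x *\<^sub>R ((f x - q x) \<bullet> b))" if "compact K" "K \<subseteq> U" for K
      using integrable_inner_left[OF Bochner_Integration.integrable_diff[OF loc(1)[OF that] loc(2)[OF that]], of b]
      by (simp add: inner_diff_left scaleR_diff_right right_diff_distrib)
    fix \<phi> :: "'e \<Rightarrow> real" assume \<phi>: "\<phi> \<in> Cc_infty U"
    obtain S where S: "compact S" "S \<subseteq> U" "\<And>z. z \<notin> S \<Longrightarrow> \<phi> z = 0" using Cc_infty_support[OF \<phi>] by metis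
    have i: "integrable lborel (\<lambda>x. \<phi> x * (f x \<bullet> b))" "integrable lborel (\<lambda>x. \<phi> x * (q x \<bullet> b))"
      using integrable_inner_left[OF integrable_mult_locally[OF Cc_infty_continuous[OF \<phi>] S(1,3) loc(1)[OF S(1,2)]], of b]
        integrable_inner_left[OF integrable_mult_locally[OF Cc_infty_continuous[OF \<phi>] S(1,3) loc(2)[OF S(1,2)]], of b] by simp_all
    show "(\<integral>x. \<phi> x * ((f x - q x) \<bullet> b) \<partial>lborel) = 0"
      using eq[OF \<phi> b] i by (simp add: inner_diff_left right_diff_distrib)
  qed
  then have "AE x in lborel. \<forall>b\<in>Basis. x \<in> U \<longrightarrow> (f x - q x) \<bullet> b = 0"
    by (intro AE_finite_allI) auto
  then show ?thesis
    by eventually_elim (metis euclidean_all_zero_iff eq_iff_diff_eq_0)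
qed

text \<open>The vector identity is compared component by component. The map \<open>\<iota>\<close>
  sends basis vectors to directions of differentiation, \<open>(b, 0)\<close> in space-time or
  \<open>b\<close> in space, so that both kinds of weak gradient are covered.\<close>

lemma weak_gradient_pairing:
  fixes v v' :: "'e::euclidean_space \<Rightarrow> real" and w w' :: "'e \<Rightarrow> 'b::euclidean_space" and \<iota> :: "'b \<Rightarrow> 'e"
  assumes U: "open U" and m: "v' \<in> borel_measurable borel" "w' \<in> borel_measurable borel"
    and eq: "AE x in lborel. x \<in> U \<longrightarrow> v x = v' x" "AE x in lborel. x \<in> U \<longrightarrow> w x = w' x"
    and loc: "\<And>K. compact K \<Longrightarrow> K \<subseteq> U \<Longrightarrow> integrable lborel (\<lambda>x. indicator K x *\<^sub>R v' x)"
      "\<And>K. compact K \<Longrightarrow> K \<subseteq> U \<Longrightarrow> integrable lborel (\<lambda>x. indicator K x *\<^sub>R w' x)"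
    and \<phi>: "\<phi> \<in> Cc_infty U"
  shows "(LINT x|lebesgue_on U. v x *\<^sub>R (\<Sum>b\<in>Basis. dderiv (\<iota> b) \<phi> x *\<^sub>R b)) = - (LINT x|lebesgue_on U. \<phi> x *\<^sub>R w x)
    \<longleftrightarrow> (\<forall>b\<in>Basis. (\<integral>x. v' x * dderiv (\<iota> b) \<phi> x \<partial>lborel) = - (\<integral>x. \<phi> x * (w' x \<bullet> b) \<partial>lborel))"
proof -
  obtain S where S: "compact S" "S \<subseteq> U" "\<And>z. z \<notin> S \<Longrightarrow> \<phi> z = 0" using Cc_infty_support[OF \<phi>] by metis
  have dS: "dderiv e \<phi> z = 0" if "z \<notin> S" for z e by (rule dderiv_eq_zero_off[OF S(1,3) that])
  have B: "U \<in> sets borel" using U by simp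
  note [measurable] = m borel_measurable_continuous_onI[OF Cc_infty_continuous[OF \<phi>]]
    borel_measurable_continuous_onI[OF Cc_infty_dderiv_continuous[OF \<phi>]]
  let ?\<psi> = "\<lambda>x. (\<Sum>b\<in>Basis. dderiv (\<iota> b) \<phi> x *\<^sub>R b)"
  have 1: "(LINT x|lebesgue_on U. v x *\<^sub>R ?\<psi> x) = (\<integral>x. indicator U x *\<^sub>R (v' x *\<^sub>R ?\<psi> x) \<partial>lborel)"
    by (rule lebesgue_on_transfer(2)[OF B]) (measurable, use eq(1) in eventually_elim, simp)
  have 2: "(LINT x|lebesgue_on U. \<phi> x *\<^sub>R w x) = (\<integral>x. indicator U x *\<^sub>R (\<phi> x *\<^sub>R w' x) \<partial>lborel)"
    by (rule lebesgue_on_transfer(2)[OF B]) (measurable, use eq(2) in eventually_elim, simp)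
  have e1: "indicator U x *\<^sub>R (v' x *\<^sub>R ?\<psi> x) = v' x *\<^sub>R ?\<psi> x" for x
    using dS[of x] S(2) by (cases "x \<in> S") auto
  have e2: "indicator U x *\<^sub>R (\<phi> x *\<^sub>R w' x) = \<phi> x *\<^sub>R w' x" for x
    using S(3)[of x] S(2) by (cases "x \<in> S") auto
  have id: "integrable lborel (\<lambda>x. dderiv (\<iota> b) \<phi> x *\<^sub>R v' x)" for b
    by (rule integrable_mult_locally[OF Cc_infty_dderiv_continuous[OF \<phi>] S(1) dS loc(1)[OF S(1,2)]])
  have i1: "integrable lborel (\<lambda>x. v' x *\<^sub>R ?\<psi> x)"
  proof -
    have "integrable lborel (\<lambda>x. \<Sum>b\<in>Basis. (dderiv (\<iota> b) \<phi> x *\<^sub>R v' x) *\<^sub>R b)"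
      by (intro Bochner_Integration.integrable_sum integrable_scaleR_left) (rule id)
    then show ?thesis by (simp add: scaleR_sum_right mult.commute)
  qed
  have i2: "integrable lborel (\<lambda>x. \<phi> x *\<^sub>R w' x)"
    by (rule integrable_mult_locally[OF Cc_infty_continuous[OF \<phi>] S(1,3) loc(2)[OF S(1,2)]])
  have c1: "(\<integral>x. v' x *\<^sub>R ?\<psi> x \<partial>lborel) \<bullet> b = (\<integral>x. v' x * dderiv (\<iota> b) \<phi> x \<partial>lborel)" if b: "b \<in> Basis" for b
  proof -
    have "(\<integral>x. v' x *\<^sub>R ?\<psi> x \<partial>lborel) \<bullet> b = (\<integral>x. (v' x *\<^sub>R ?\<psi> x) \<bullet> b \<partial>lborel)"
      by (rule integral_inner_left[symmetric]) (rule i1)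
    also have "\<dots> = (\<integral>x. v' x * dderiv (\<iota> b) \<phi> x \<partial>lborel)"
      using b by simp
    finally show ?thesis .
  qed
  have c2: "(\<integral>x. \<phi> x *\<^sub>R w' x \<partial>lborel) \<bullet> b = (\<integral>x. \<phi> x * (w' x \<bullet> b) \<partial>lborel)" for b
  proof -
    have "(\<integral>x. \<phi> x *\<^sub>R w' x \<partial>lborel) \<bullet> b = (\<integral>x. (\<phi> x *\<^sub>R w' x) \<bullet> b \<partial>lborel)"
      by (rule integral_inner_left[symmetric]) (rule i2)
    then show ?thesis by simp
  qed
  show ?thesis
    unfolding 1 2 e1 e2 euclidean_eq_iff[of "\<integral>x. v' x *\<^sub>R ?\<psi> x \<partial>lborel"] inner_minus_left c2
    using c1 by (intro ball_cong) simp_all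
qed

lemma spatial_grad_dderiv:
  fixes \<phi> :: "'a::euclidean_space \<times> real \<Rightarrow> real"
  assumes "\<phi> \<in> Cc_infty U"
  shows "spatial_grad \<phi> z = (\<Sum>b\<in>Basis. dderiv (b, 0) \<phi> z *\<^sub>R b)"
proof -
  have "((\<lambda>y. \<phi> (y, snd z)) has_derivative (\<lambda>v. dderiv (v, 0) \<phi> z)) (at (fst z))"
    by (rule has_derivative_compose[where f="\<lambda>y. (y, snd z)" and g=\<phi> and f'="\<lambda>v. (v, 0)"])
       (use Cc_infty_has_derivative[OF assms, of z] in \<open>auto intro!: derivative_eq_intros\<close>)
  from frechet_derivative_at[OF this, symmetric] show ?thesis
    by (simp add: spatial_grad_def grad_def)
qed

lemma time_deriv_dderiv:
  fixes \<phi> :: "'a::euclidean_space \<times> real \<Rightarrow> real"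
  assumes "\<phi> \<in> Cc_infty U"
  shows "time_deriv \<phi> z = dderiv (0, 1) \<phi> z"
proof -
  have "((\<lambda>s. \<phi> (fst z, s)) has_real_derivative dderiv (0, 1) \<phi> z) (at (snd z))"
    using has_line_deriv_at[OF Cc_infty_has_line_deriv[OF assms, of "(0, 1)"], of "(fst z, 0)" "snd z"] by simp
  then show ?thesis by (simp add: time_deriv_def DERIV_imp_deriv)
qed

lemma has_weak_spatial_grad_iff:
  fixes v v' :: "'a::euclidean_space \<times> real \<Rightarrow> real" and w w' :: "'a \<times> real \<Rightarrow> 'a"
  assumes U: "open U" and m: "v' \<in> borel_measurable borel" "w' \<in> borel_measurable borel"
    and eq: "AE x in lborel. x \<in> U \<longrightarrow> v x = v' x" "AE x in lborel. x \<in> U \<longrightarrow> w x = w' x"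
  shows "has_weak_spatial_grad U v w \<longleftrightarrow>
    (\<forall>K. compact K \<and> K \<subseteq> U \<longrightarrow> integrable lborel (\<lambda>x. indicator K x *\<^sub>R v' x)) \<and>
    (\<forall>K. compact K \<and> K \<subseteq> U \<longrightarrow> integrable lborel (\<lambda>x. indicator K x *\<^sub>R w' x)) \<and>
    (\<forall>\<phi>\<in>Cc_infty U. \<forall>b\<in>Basis. (\<integral>x. v' x * dderiv (b, 0) \<phi> x \<partial>lborel) = - (\<integral>x. \<phi> x * (w' x \<bullet> b) \<partial>lborel))"
proof -
  have "(\<forall>\<phi>\<in>Cc_infty U. (LINT z|lebesgue_on U. v z *\<^sub>R spatial_grad \<phi> z) = - (LINT z|lebesgue_on U. \<phi> z *\<^sub>R w z)) \<longleftrightarrow>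
      (\<forall>\<phi>\<in>Cc_infty U. \<forall>b\<in>Basis. (\<integral>x. v' x * dderiv (b, 0) \<phi> x \<partial>lborel) = - (\<integral>x. \<phi> x * (w' x \<bullet> b) \<partial>lborel))"
    if "\<forall>K. compact K \<and> K \<subseteq> U \<longrightarrow> integrable lborel (\<lambda>x. indicator K x *\<^sub>R v' x)"
      "\<forall>K. compact K \<and> K \<subseteq> U \<longrightarrow> integrable lborel (\<lambda>x. indicator K x *\<^sub>R w' x)"
  proof (rule ball_cong[OF refl])
    fix \<phi> :: "'a \<times> real \<Rightarrow> real" assume \<phi>: "\<phi> \<in> Cc_infty U"
    show "(LINT z|lebesgue_on U. v z *\<^sub>R spatial_grad \<phi> z) = - (LINT z|lebesgue_on U. \<phi> z *\<^sub>R w z) \<longleftrightarrow>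
      (\<forall>b\<in>Basis. (\<integral>x. v' x * dderiv (b, 0) \<phi> x \<partial>lborel) = - (\<integral>x. \<phi> x * (w' x \<bullet> b) \<partial>lborel))"
      unfolding spatial_grad_dderiv[OF \<phi>]
      by (rule weak_gradient_pairing[OF U m eq _ _ \<phi>]) (use that in blast)+
  qed
  then show ?thesis
    unfolding has_weak_spatial_grad_def locally_integrable_on_transfer[OF m(1) eq(1)] locally_integrable_on_transfer[OF m(2) eq(2)]
    by blast
qed

lemma has_weak_grad_iff:
  fixes v v' :: "'a::euclidean_space \<Rightarrow> real" and w w' :: "'a \<Rightarrow> 'a"
  assumes U: "open U" and m: "v' \<in> borel_measurable borel" "w' \<in> borel_measurable borel"
    and eq: "AE x in lborel. x \<in> U \<longrightarrow> v x = v' x" "AE x in lborel. x \<in> U \<longrightarrow> w x = w' x"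
  shows "has_weak_grad U v w \<longleftrightarrow>
    (\<forall>K. compact K \<and> K \<subseteq> U \<longrightarrow> integrable lborel (\<lambda>x. indicator K x *\<^sub>R v' x)) \<and>
    (\<forall>K. compact K \<and> K \<subseteq> U \<longrightarrow> integrable lborel (\<lambda>x. indicator K x *\<^sub>R w' x)) \<and>
    (\<forall>\<phi>\<in>Cc_infty U. \<forall>b\<in>Basis. (\<integral>x. v' x * dderiv b \<phi> x \<partial>lborel) = - (\<integral>x. \<phi> x * (w' x \<bullet> b) \<partial>lborel))"
proof -
  have "(\<forall>\<phi>\<in>Cc_infty U. (LINT z|lebesgue_on U. v z *\<^sub>R grad \<phi> z) = - (LINT z|lebesgue_on U. \<phi> z *\<^sub>R w z)) \<longleftrightarrow>
      (\<forall>\<phi>\<in>Cc_infty U. \<forall>b\<in>Basis. (\<integral>x. v' x * dderiv b \<phi> x \<partial>lborel) = - (\<integral>x. \<phi> x * (w' x \<bullet> b) \<partial>lborel))"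
    if "\<forall>K. compact K \<and> K \<subseteq> U \<longrightarrow> integrable lborel (\<lambda>x. indicator K x *\<^sub>R v' x)"
      "\<forall>K. compact K \<and> K \<subseteq> U \<longrightarrow> integrable lborel (\<lambda>x. indicator K x *\<^sub>R w' x)"
  proof (rule ball_cong[OF refl])
    fix \<phi> :: "'a \<Rightarrow> real" assume \<phi>: "\<phi> \<in> Cc_infty U"
    show "(LINT z|lebesgue_on U. v z *\<^sub>R grad \<phi> z) = - (LINT z|lebesgue_on U. \<phi> z *\<^sub>R w z) \<longleftrightarrow>
      (\<forall>b\<in>Basis. (\<integral>x. v' x * dderiv b \<phi> x \<partial>lborel) = - (\<integral>x. \<phi> x * (w' x \<bullet> b) \<partial>lborel))"
      unfolding grad_def dderiv_def[symmetric]
      by (rule weak_gradient_pairing[OF U m eq _ _ \<phi>, where \<iota>="\<lambda>b. b"]) (use that in blast)+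
  qed
  then show ?thesis
    unfolding has_weak_grad_def locally_integrable_on_transfer[OF m(1) eq(1)] locally_integrable_on_transfer[OF m(2) eq(2)]
    by blast
qed

section \<open>Bochner regularity\<close>

lemma slice_integrable:
  fixes f :: "'a::euclidean_space \<times> real \<Rightarrow> 'b::euclidean_space"
  assumes "integrable lborel f"
  shows "AE t in lborel. integrable lborel (\<lambda>x. f (x, t))"
    and "integrable lborel (\<lambda>t. \<integral>x. f (x, t) \<partial>lborel)"
    and "(\<integral>t. (\<integral>x. f (x, t) \<partial>lborel) \<partial>lborel) = integral\<^sup>L lborel f"
proof -
  have i: "integrable (lborel \<Otimes>\<^sub>M lborel) (case_prod (\<lambda>x t. f (x, t)))"
    using assms by (simp add: lborel_prod)
  show "AE t in lborel. integrable lborel (\<lambda>x. f (x, t))" by (rule lborel_pair.AE_integrable_snd[OF i])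
  show "integrable lborel (\<lambda>t. \<integral>x. f (x, t) \<partial>lborel)" by (rule lborel_pair.integrable_snd[OF i])
  show "(\<integral>t. (\<integral>x. f (x, t) \<partial>lborel) \<partial>lborel) = integral\<^sup>L lborel f"
    using lborel_pair.integral_snd[OF i] by (simp add: lborel_prod)
qed

text \<open>The exceptional set is first enlarged to a measurable null set, since \<open>P\<close>
  itself may fail to be measurable and exchanging the two almost everywhere quantifiers requires
  measurability in the product.\<close>

lemma slice_AE:
  fixes P :: "'a::euclidean_space \<times> real \<Rightarrow> bool"
  assumes "AE z in lborel. P z"
  shows "AE t in lborel. AE x in lborel. P (x, t)"
proof -
  obtain N where N: "{z \<in> space lborel. \<not> P z} \<subseteq> N" "N \<in> null_sets lborel"
    using assms by (auto simp: eventually_ae_filter)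
  have m: "N \<in> sets (lborel \<Otimes>\<^sub>M lborel)" unfolding lborel_prod using N(2) by auto
  have "AE z in lborel \<Otimes>\<^sub>M lborel. z \<notin> N" unfolding lborel_prod by (rule AE_not_in[OF N(2)])
  then have "AE x in lborel. AE t in lborel. (x, t) \<notin> N" by (rule lborel_pair.AE_pair)
  moreover have "{z \<in> space (lborel \<Otimes>\<^sub>M lborel). (fst z, snd z) \<notin> N} \<in> sets (lborel \<Otimes>\<^sub>M lborel)"
  proof -
    have "{z \<in> space (lborel \<Otimes>\<^sub>M lborel). (fst z, snd z) \<notin> N} = space (lborel \<Otimes>\<^sub>M lborel) - N" by auto
    also have "\<dots> \<in> sets (lborel \<Otimes>\<^sub>M lborel)" by (rule sets.compl_sets[OF m])
    finally show ?thesis .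
  qed
  ultimately have "AE t in lborel. AE x in lborel. (x, t) \<notin> N"
    using lborel_pair.AE_commute[of "\<lambda>x t. (x, t) \<notin> N"] by blast
  then show ?thesis
  proof eventually_elim
    case (elim t)
    then show ?case by eventually_elim (use N(1) in auto)
  qed
qed

section \<open>Weak gradients of time slices\<close>

text \<open>The counterpart of \<open>has_weak_grad\<close> for Borel functions on the whole space;
  for representatives the two notions agree by \<open>has_weak_grad_iff\<close>.\<close>

definition borel_weak_grad :: "'a::euclidean_space set \<Rightarrow> ('a \<Rightarrow> real) \<Rightarrow> ('a \<Rightarrow> 'a) \<Rightarrow> bool" where
  "borel_weak_grad D v w \<longleftrightarrow> v \<in> borel_measurable borel \<and> w \<in> borel_measurable borel \<and>
    (\<forall>K. compact K \<and> K \<subseteq> D \<longrightarrow> integrable lborel (\<lambda>x. indicator K x *\<^sub>R v x)) \<and>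
    (\<forall>K. compact K \<and> K \<subseteq> D \<longrightarrow> integrable lborel (\<lambda>x. indicator K x *\<^sub>R w x)) \<and>
    (\<forall>\<phi>\<in>Cc_infty D. \<forall>b\<in>Basis. (\<integral>x. v x * dderiv b \<phi> x \<partial>lborel) = - (\<integral>x. \<phi> x * (w x \<bullet> b) \<partial>lborel))"

lemma borel_weak_gradD:
  assumes "borel_weak_grad D v w"
  shows "v \<in> borel_measurable borel" "w \<in> borel_measurable borel"
    and "compact K \<Longrightarrow> K \<subseteq> D \<Longrightarrow> integrable lborel (\<lambda>x. indicator K x *\<^sub>R v x)"
    and "compact K \<Longrightarrow> K \<subseteq> D \<Longrightarrow> integrable lborel (\<lambda>x. indicator K x *\<^sub>R w x)"
    and "\<phi> \<in> Cc_infty D \<Longrightarrow> b \<in> Basis \<Longrightarrow> (\<integral>x. v x * dderiv b \<phi> x \<partial>lborel) = - (\<integral>x. \<phi> x * (w x \<bullet> b) \<partial>lborel)"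
  using assms unfolding borel_weak_grad_def by (elim conjE, assumption | simp)+

lemma borel_weak_gradI:
  assumes "v \<in> borel_measurable borel" "w \<in> borel_measurable borel"
    and "\<And>K. compact K \<Longrightarrow> K \<subseteq> D \<Longrightarrow> integrable lborel (\<lambda>x. indicator K x *\<^sub>R v x)"
    and "\<And>K. compact K \<Longrightarrow> K \<subseteq> D \<Longrightarrow> integrable lborel (\<lambda>x. indicator K x *\<^sub>R w x)"
    and "\<And>\<phi> b. \<phi> \<in> Cc_infty D \<Longrightarrow> b \<in> Basis \<Longrightarrow> (\<integral>x. v x * dderiv b \<phi> x \<partial>lborel) = - (\<integral>x. \<phi> x * (w x \<bullet> b) \<partial>lborel)"
  shows "borel_weak_grad D v w"
  unfolding borel_weak_grad_def by (intro conjI allI impI ballI assms; (elim conjE)?; assumption)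

lemma borel_weak_grad_imp_has_weak_grad:
  assumes "open D" "borel_weak_grad D v' w'" "AE x in lborel. x \<in> D \<longrightarrow> v x = v' x" "AE x in lborel. x \<in> D \<longrightarrow> w x = w' x"
  shows "has_weak_grad D v w"
  using has_weak_grad_iff[OF assms(1) _ _ assms(3,4)] assms(2) unfolding borel_weak_grad_def by blast

lemma has_weak_grad_imp_borel:
  assumes "open D" "has_weak_grad D v w" "v' \<in> borel_measurable borel" "w' \<in> borel_measurable borel"
    "AE x in lborel. x \<in> D \<longrightarrow> v x = v' x" "AE x in lborel. x \<in> D \<longrightarrow> w x = w' x"
  shows "borel_weak_grad D v' w'"
  using has_weak_grad_iff[OF assms(1,3,4,5,6)] assms(2-4) unfolding borel_weak_grad_def by blast

lemma borel_weak_grad_unique: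
  assumes D: "open D" and w: "borel_weak_grad D v w1" "borel_weak_grad D v w2"
  shows "AE x in lborel. x \<in> D \<longrightarrow> w1 x = w2 x"
proof (rule fundamental_lemma_vector[OF D])
  show "w1 \<in> borel_measurable borel" "w2 \<in> borel_measurable borel" using w unfolding borel_weak_grad_def by blast+
  show "integrable lborel (\<lambda>x. indicator K x *\<^sub>R w1 x)" "integrable lborel (\<lambda>x. indicator K x *\<^sub>R w2 x)"
    if "compact K" "K \<subseteq> D" for K using w that unfolding borel_weak_grad_def by blast+
  fix \<phi> :: "'a \<Rightarrow> real" and b :: 'a
  assume "\<phi> \<in> Cc_infty D" "b \<in> Basis"
  then have "- (\<integral>x. \<phi> x * (w1 x \<bullet> b) \<partial>lborel) = - (\<integral>x. \<phi> x * (w2 x \<bullet> b) \<partial>lborel)"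
    using w unfolding borel_weak_grad_def by metis
  then show "(\<integral>x. \<phi> x * (w1 x \<bullet> b) \<partial>lborel) = (\<integral>x. \<phi> x * (w2 x \<bullet> b) \<partial>lborel)" by simp
qed

lemma borel_weak_grad_diff:
  assumes w: "borel_weak_grad D v1 w1" "borel_weak_grad D v2 w2"
  shows "borel_weak_grad D (\<lambda>x. v1 x - v2 x) (\<lambda>x. w1 x - w2 x)"
proof -
  note m = borel_weak_gradD(1,2)[OF w(1)] borel_weak_gradD(1,2)[OF w(2)]
  note loc = borel_weak_gradD(3,4)[OF w(1)] borel_weak_gradD(3,4)[OF w(2)]
  have form: "(\<integral>x. (v1 x - v2 x) * dderiv b \<phi> x \<partial>lborel) = - (\<integral>x. \<phi> x * ((w1 x - w2 x) \<bullet> b) \<partial>lborel)"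
    if \<phi>: "\<phi> \<in> Cc_infty D" and b: "b \<in> Basis" for \<phi> b
  proof -
    obtain S where S: "compact S" "S \<subseteq> D" "\<And>z. z \<notin> S \<Longrightarrow> \<phi> z = 0" using Cc_infty_support[OF \<phi>] by metis
    have dS: "dderiv e \<phi> z = 0" if "z \<notin> S" for z e by (rule dderiv_eq_zero_off[OF S(1,3) that])
    have i: "integrable lborel (\<lambda>x. v1 x * dderiv b \<phi> x)" "integrable lborel (\<lambda>x. v2 x * dderiv b \<phi> x)"
      using integrable_mult_locally[OF Cc_infty_dderiv_continuous[OF \<phi>] S(1) dS loc(1)[OF S(1,2)], of b]
        integrable_mult_locally[OF Cc_infty_dderiv_continuous[OF \<phi>] S(1) dS loc(3)[OF S(1,2)], of b]
      by (simp_all add: mult.commute)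
    have j: "integrable lborel (\<lambda>x. \<phi> x * (w1 x \<bullet> b))" "integrable lborel (\<lambda>x. \<phi> x * (w2 x \<bullet> b))"
      using integrable_inner_left[OF integrable_mult_locally[OF Cc_infty_continuous[OF \<phi>] S(1,3) loc(2)[OF S(1,2)]], of b]
        integrable_inner_left[OF integrable_mult_locally[OF Cc_infty_continuous[OF \<phi>] S(1,3) loc(4)[OF S(1,2)]], of b] by simp_all
    note e = borel_weak_gradD(5)[OF w(1) \<phi> b] borel_weak_gradD(5)[OF w(2) \<phi> b]
    show ?thesis
      using i j e by (simp add: left_diff_distrib inner_diff_left right_diff_distrib)
  qed
  show ?thesis
  proof (rule borel_weak_gradI)
    show "(\<lambda>x. v1 x - v2 x) \<in> borel_measurable borel" "(\<lambda>x. w1 x - w2 x) \<in> borel_measurable borel"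
      using m by (auto intro: borel_measurable_diff)
    fix K :: "'a set" assume K: "compact K" "K \<subseteq> D"
    show "integrable lborel (\<lambda>x. indicator K x *\<^sub>R (v1 x - v2 x))"
      unfolding scaleR_diff_right by (rule Bochner_Integration.integrable_diff[OF loc(1)[OF K] loc(3)[OF K]])
    show "integrable lborel (\<lambda>x. indicator K x *\<^sub>R (w1 x - w2 x))"
      unfolding scaleR_diff_right by (rule Bochner_Integration.integrable_diff[OF loc(2)[OF K] loc(4)[OF K]])
  qed (rule form)
qed

text \<open>The norm refers to an arbitrarily chosen weak gradient. Uniqueness up to null sets
  allows a concrete one in its place, which makes the norm computable.\<close>

lemma W11_norm_eq:
  assumes D: "open D" and w: "borel_weak_grad D v' w'" and eq: "AE x in lborel. x \<in> D \<longrightarrow> v x = v' x"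
  shows "W11_norm D v = (\<integral>x. indicator D x * \<bar>v' x\<bar> \<partial>lborel) + (\<integral>x. indicator D x * norm (w' x) \<partial>lborel)"
proof -
  have B: "D \<in> sets borel" using D by simp
  have m[measurable]: "v' \<in> borel_measurable borel" "w' \<in> borel_measurable borel" using w unfolding borel_weak_grad_def by blast+
  define w0 where "w0 = (SOME w. has_weak_grad D v w)"
  have "has_weak_grad D v w'" by (rule borel_weak_grad_imp_has_weak_grad[OF D w eq]) simp
  then have w0: "has_weak_grad D v w0" unfolding w0_def by (rule someI[of "has_weak_grad D v"])
  then have "locally_integrable_on w0 D" unfolding has_weak_grad_def by blast
  then obtain w1 where w1: "w1 \<in> borel_measurable borel" "AE x in lborel. x \<in> D \<longrightarrow> w0 x = w1 x"
    by (rule locally_integrable_representative[OF D])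
  have "borel_weak_grad D v' w1" by (rule has_weak_grad_imp_borel[OF D w0 m(1) w1(1) eq w1(2)])
  from borel_weak_grad_unique[OF D this w] have "AE x in lborel. x \<in> D \<longrightarrow> w1 x = w' x" .
  with w1(2) have e: "AE x in lborel. x \<in> D \<longrightarrow> norm (w0 x) = norm (w' x)" by eventually_elim auto
  have e': "AE x in lborel. x \<in> D \<longrightarrow> \<bar>v x\<bar> = \<bar>v' x\<bar>" using eq by eventually_elim auto
  have "(LINT x|lebesgue_on D. \<bar>v x\<bar>) = (\<integral>x. indicator D x *\<^sub>R \<bar>v' x\<bar> \<partial>lborel)"
    by (rule lebesgue_on_transfer(2)[OF B _ e']) measurable
  moreover have "(LINT x|lebesgue_on D. norm (w0 x)) = (\<integral>x. indicator D x *\<^sub>R norm (w' x) \<partial>lborel)"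
    by (rule lebesgue_on_transfer(2)[OF B _ e]) measurable
  ultimately show ?thesis by (simp add: W11_norm_def w0_def)
qed

section \<open>Time sampling and Bochner measurability\<close>

lemma grid_simple:
  fixes s1 s2 :: real and m :: nat
  assumes "s1 < s2"
  defines "\<gamma> \<equiv> \<lambda>t. s1 + real_of_int \<lfloor>(t - s1) * real (Suc m)\<rfloor> / real (Suc m)"
  shows "simple_function (lebesgue_on {s1<..<s2}) \<gamma>"
    and "t \<in> {s1<..<s2} \<Longrightarrow> \<gamma> t \<in> {s1..s2}" and "\<bar>t - \<gamma> t\<bar> < inverse (real (Suc m)) \<or> \<bar>t - \<gamma> t\<bar> = 0"
proof -
  let ?m = "real (Suc m)"
  have mp: "0 < ?m" by simp
  have fl: "real_of_int \<lfloor>(t - s1) * ?m\<rfloor> / ?m \<le> t - s1" for t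
  proof -
    have "real_of_int \<lfloor>(t - s1) * ?m\<rfloor> \<le> (t - s1) * ?m" by simp
    then show ?thesis using mp by (simp only: pos_divide_le_eq)
  qed
  have up: "t - s1 < real_of_int \<lfloor>(t - s1) * ?m\<rfloor> / ?m + inverse ?m" for t
  proof -
    have "(t - s1) * ?m < real_of_int \<lfloor>(t - s1) * ?m\<rfloor> + 1" by linarith
    then have "t - s1 < (real_of_int \<lfloor>(t - s1) * ?m\<rfloor> + 1) / ?m" using mp by (simp only: pos_less_divide_eq)
    then show ?thesis by (simp only: add_divide_distrib inverse_eq_divide)
  qed
  show "\<bar>t - \<gamma> t\<bar> < inverse ?m \<or> \<bar>t - \<gamma> t\<bar> = 0"
    using fl[of t] up[of t] unfolding \<gamma>_def by linarith
  have lo: "0 \<le> real_of_int \<lfloor>(t - s1) * ?m\<rfloor> / ?m" if "s1 < t" for t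
    using that mp by (intro divide_nonneg_pos) auto
  show "t \<in> {s1<..<s2} \<Longrightarrow> \<gamma> t \<in> {s1..s2}"
    using fl[of t] lo[of t] unfolding \<gamma>_def by auto
  show "simple_function (lebesgue_on {s1<..<s2}) \<gamma>"
  proof (rule simple_function_borel_measurable)
    have "\<gamma> \<in> borel_measurable borel" unfolding \<gamma>_def by measurable
    then show "\<gamma> \<in> borel_measurable (lebesgue_on {s1<..<s2})"
      by (intro measurable_restrict_space1 measurable_completion) simp
    have "\<gamma> ` {s1<..<s2} \<subseteq> (\<lambda>j. s1 + real_of_int j / ?m) ` {0..\<lceil>(s2 - s1) * ?m\<rceil>}"
    proof
      fix y assume "y \<in> \<gamma> ` {s1<..<s2}"
      then obtain t where t: "s1 < t" "t < s2" "y = \<gamma> t" by auto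
      have a: "0 \<le> (t - s1) * ?m" "(t - s1) * ?m \<le> (s2 - s1) * ?m" using t by (auto intro: mult_right_mono)
      then have "0 \<le> \<lfloor>(t - s1) * ?m\<rfloor>" "\<lfloor>(t - s1) * ?m\<rfloor> \<le> \<lceil>(s2 - s1) * ?m\<rceil>" by linarith+
      then show "y \<in> (\<lambda>j. s1 + real_of_int j / ?m) ` {0..\<lceil>(s2 - s1) * ?m\<rceil>}"
        unfolding t(3) \<gamma>_def by (intro image_eqI[where x="\<lfloor>(t - s1) * ?m\<rfloor>"]) auto
    qed
    then show "finite (\<gamma> ` space (lebesgue_on {s1<..<s2}))"
      by (simp add: finite_subset)
  qed
qed

context growth
begin

text \<open>Simple functions with values in a function space take finitely many slices as values;
  smooth slices of mollifications at grid times are such values. Convergence in L^1 on the cylinder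
  gives, by Fubini and along a subsequence, convergence on almost every slice, and uniform
  continuity lets the mesh be so fine that sampling costs at most
  \<open>1 / (k + 1)\<close>.\<close>

lemma Bochner_regularity:
  fixes D :: "'a set"
  assumes U: "open U" and w: "wsuper U v w" and M: "0 \<le> M" "\<And>z. \<bar>v z\<bar> \<le> M"
    and D: "open D" and s: "s1 < s2"
    and K0: "compact (closure (D \<times> {s1<..<s2}))" "closure (D \<times> {s1<..<s2}) \<subseteq> U"
    and eq: "AE z in lborel. z \<in> U \<longrightarrow> u z = v z"
  shows "u \<in> Bochner_L1 {s1<..<s2} (W11 D) (W11_norm D)"
    and "u \<in> Bochner_Linf {s1<..<s2} (L2 D) (L2_norm D)"
proof -
  let ?I = "{s1<..<s2}" let ?C = "closure (D \<times> ?I)"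
  have BI: "?I \<in> sets borel" by simp
  have BD[measurable]: "D \<in> sets borel" using D by simp
  have BDI[measurable]: "D \<times> ?I \<in> sets borel" using D by (simp add: open_Times)
  have Ceq: "?C = closure D \<times> {s1..s2}" using s by (simp add: closure_Times)
  have inC: "(x, t) \<in> ?C" if "x \<in> D" "t \<in> {s1..s2}" for x t
    unfolding Ceq using that closure_subset by blast
  have bD: "bounded D"
  proof -
    have "bounded (fst ` ?C)" using K0(1) by (intro compact_imp_bounded compact_continuous_image continuous_intros)
    moreover have "D \<subseteq> fst ` ?C"
    proof
      fix x assume "x \<in> D"
      then have "(x, s1) \<in> ?C" using inC s by simp
      then show "x \<in> fst ` ?C" by force
    qed
    ultimately show ?thesis by (rule bounded_subset)
  qed
  define d where "d = measure lborel D"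
  have iD: "integrable lborel (indicator D :: 'a \<Rightarrow> real)"
    using emeasure_bounded_finite[OF bD] by (intro integrable_real_indicator) auto
  have intD: "(\<integral>x. indicator D x * c \<partial>lborel) = d * c" for c :: real by (simp add: d_def)
  have d0: "0 \<le> d" by (simp add: d_def)
  have m[measurable]: "v \<in> borel_measurable borel" "w \<in> borel_measurable borel"
    using w unfolding wsuper_def by blast+
  have bdd: "integrable lborel (\<lambda>x. indicator D x *\<^sub>R f x)"
    if [measurable]: "f \<in> borel_measurable borel" and "\<And>x. x \<in> D \<Longrightarrow> norm (f x) \<le> c" for f :: "'a \<Rightarrow> 'z::euclidean_space" and c
  proof (rule integrable_bounded_support[OF _ bD, of _ "\<bar>c\<bar>"])
    show "norm (indicator D x *\<^sub>R f x) \<le> \<bar>c\<bar>" for x using that(2)[of x] by (cases "x \<in> D") auto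
  qed auto
  obtain K k0 where K: "compact K" "K \<subseteq> U" "?C \<subseteq> K"
    and k0: "\<And>k z. k \<ge> k0 \<Longrightarrow> z \<in> ?C \<Longrightarrow> cball z (inverse (real (Suc k))) \<subseteq> K"
    by (rule compact_neighbourhood[OF K0 U]) blast
  have DIK: "D \<times> ?I \<subseteq> K" by (rule order_trans[OF closure_subset K(3)])
  have hK: "integrable lborel (\<lambda>z. indicator K z * h (norm (w z)))" using w K unfolding wsuper_def by blast
  define vK where "vK = (\<lambda>z. indicator K z *\<^sub>R v z)"
  define wK where "wK = (\<lambda>z. indicator K z *\<^sub>R w z)"
  have iv: "integrable lborel vK" unfolding vK_def by (rule integrable_loc_bounded[OF m(1) K(1) M(2)])
  have iw: "integrable lborel wK" unfolding wK_def by (rule integrable_loc(1)[OF m(2) K(1) hK])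
  define V where "V = (\<lambda>k. moll (k + k0) vK)"
  define Y where "Y = (\<lambda>k. moll (k + k0) wK)"
  have cV: "continuous_on UNIV (V k)" and cY: "continuous_on UNIV (Y k)" for k
    unfolding V_def Y_def by (intro moll_continuous iv iw)+
  have mV[measurable]: "V k \<in> borel_measurable borel" "Y k \<in> borel_measurable borel" for k
    using cV cY by (auto intro: borel_measurable_continuous_onI)
  have VM: "\<bar>V k z\<bar> \<le> M" for k z
  proof -
    have "norm (vK z) \<le> M" for z using M by (auto simp: vK_def indicator_def)
    then show ?thesis using moll_norm_bound[OF iv, of M "k + k0" z] by (simp add: V_def)
  qed
  have sl: "continuous_on UNIV (\<lambda>x. f (x, t))" if "continuous_on UNIV f" for f :: "'a \<times> real \<Rightarrow> 'z::euclidean_space" and t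
    by (rule continuous_on_compose2[OF that]) (auto intro!: continuous_intros)
  \<comment> \<open>For smooth slices the identity is integration by parts in \<open>x\<close>. The
    derivative is identified by \<open>moll_equations\<close> up to the closure of the cylinder, so
    the endpoints among the grid times are included.\<close>
  have wgV: "borel_weak_grad D (\<lambda>x. V k (x, t)) (\<lambda>x. Y k (x, t))" if t: "t \<in> {s1..s2}" for k t
  proof -
    have loc: "integrable lborel (\<lambda>x. indicator L x *\<^sub>R f (x, t))"
      if "compact L" "continuous_on UNIV f" for L and f :: "'a \<times> real \<Rightarrow> 'z::euclidean_space"
      by (rule borel_integrable_compact[OF that(1) continuous_on_subset[OF sl[OF that(2)]]]) simp
    have form: "(\<integral>x. V k (x, t) * dderiv b \<phi> x \<partial>lborel) = - (\<integral>x. \<phi> x * (Y k (x, t) \<bullet> b) \<partial>lborel)"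
      if \<phi>: "\<phi> \<in> Cc_infty D" and b: "b \<in> Basis" for \<phi> b
    proof -
      obtain S where S: "compact S" "S \<subseteq> D" "\<And>z. z \<notin> S \<Longrightarrow> \<phi> z = 0" using Cc_infty_support[OF \<phi>] by metis
      have dS: "dderiv e \<phi> z = 0" if "z \<notin> S" for z e by (rule dderiv_eq_zero_off[OF S(1,3) that])
      let ?d = "dmoll (b, 0) (k + k0) vK"
      have cd: "continuous_on UNIV ?d" by (rule dmoll_continuous[OF iv])
      have "has_line_deriv (b, 0) (V k) ?d" unfolding V_def by (rule dmoll_line_deriv[OF iv])
      then have ld: "has_line_deriv b (\<lambda>x. V k (x, t)) (\<lambda>x. ?d (x, t))"
        unfolding has_line_deriv_def by auto
      note F = has_line_deriv_mult[OF Cc_infty_has_line_deriv[OF \<phi>] ld]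
      have "(\<integral>x. dderiv b \<phi> x * V k (x, t) + ?d (x, t) * \<phi> x \<partial>lborel) = 0"
        by (rule line_deriv_integral_zero(2)[OF F _ _ S(1)])
          (intro continuous_intros Cc_infty_continuous[OF \<phi>] Cc_infty_dderiv_continuous[OF \<phi>] sl cV cd | simp add: S(3))+
      moreover have "integrable lborel (\<lambda>x. dderiv b \<phi> x * V k (x, t))"
        by (rule integrable_compact_support[OF _ S(1)]) (intro continuous_intros Cc_infty_dderiv_continuous[OF \<phi>] sl cV, simp add: dS)
      moreover have "integrable lborel (\<lambda>x. ?d (x, t) * \<phi> x)"
        by (rule integrable_compact_support[OF _ S(1)]) (intro continuous_intros Cc_infty_continuous[OF \<phi>] sl cd, simp add: S(3))
      ultimately have 1: "(\<integral>x. dderiv b \<phi> x * V k (x, t) \<partial>lborel) + (\<integral>x. ?d (x, t) * \<phi> x \<partial>lborel) = 0" by simp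
      have 2: "?d (x, t) * \<phi> x = \<phi> x * (Y k (x, t) \<bullet> b)" for x
      proof (cases "x \<in> S")
        case True
        then have "(x, t) \<in> ?C" using inC t S(2) by blast
        from moll_equations(1)[OF w M(2) K(1,2) k0[OF _ this] b, of "k + k0"]
        show ?thesis by (simp add: vK_def wK_def Y_def)
      qed (simp add: S(3))
      have 3: "V k (x, t) * dderiv b \<phi> x = dderiv b \<phi> x * V k (x, t)" for x by (rule mult.commute)
      show ?thesis using 1 unfolding 2 3 by linarith
    qed
    show ?thesis
      by (rule borel_weak_gradI[OF borel_measurable_continuous_onI[OF sl[OF cV]] borel_measurable_continuous_onI[OF sl[OF cY]]
            loc[OF _ cV] loc[OF _ cY] form])
  qed
  \<comment> \<open>A certificate that mesh \<open>1 / (n + 1)\<close> is fine enough for the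
    \<open>k\<close>-th mollification and its gradient; a choice function then picks one mesh for
    each \<open>k\<close>.\<close>
  define md where "md = (\<lambda>k n. \<forall>z\<in>?C. \<forall>z'\<in>?C. dist z z' < inverse (real (Suc n)) \<longrightarrow>
      \<bar>V k z - V k z'\<bar> \<le> inverse (real (Suc k)) \<and> norm (Y k z - Y k z') \<le> inverse (real (Suc k)))"
  have "\<forall>k. \<exists>n. md k n"
  proof
    fix k
    have uc: "uniformly_continuous_on ?C (V k)" "uniformly_continuous_on ?C (Y k)"
      by (rule compact_uniformly_continuous[OF continuous_on_subset[OF cV subset_UNIV] K0(1)],
          rule compact_uniformly_continuous[OF continuous_on_subset[OF cY subset_UNIV] K0(1)])
    have e: "0 < inverse (real (Suc k))" by simp
    obtain d1 where d1: "d1 > 0" "\<And>z z'. z \<in> ?C \<Longrightarrow> z' \<in> ?C \<Longrightarrow> dist z' z < d1 \<Longrightarrow> dist (V k z') (V k z) < inverse (real (Suc k))"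
      using uc(1) e unfolding uniformly_continuous_on_def by meson
    obtain d2 where d2: "d2 > 0" "\<And>z z'. z \<in> ?C \<Longrightarrow> z' \<in> ?C \<Longrightarrow> dist z' z < d2 \<Longrightarrow> dist (Y k z') (Y k z) < inverse (real (Suc k))"
      using uc(2) e unfolding uniformly_continuous_on_def by meson
    obtain n where n: "inverse (real (Suc n)) < min d1 d2" using reals_Archimedean[of "min d1 d2"] d1 d2 by auto
    show "\<exists>n. md k n"
      unfolding md_def
    proof (intro exI[of _ n] ballI impI)
      fix z z' assume z: "z \<in> ?C" "z' \<in> ?C" "dist z z' < inverse (real (Suc n))"
      then have "dist z z' < d1" "dist z z' < d2" using n by linarith+
      then show "\<bar>V k z - V k z'\<bar> \<le> inverse (real (Suc k)) \<and> norm (Y k z - Y k z') \<le> inverse (real (Suc k))"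
        using d1(2)[OF z(2,1)] d2(2)[OF z(2,1)] by (simp only: dist_norm real_norm_def less_imp_le)
    qed
  qed
  from choice[OF this] obtain n where "\<forall>k. md k (n k)" ..
  then have n: "\<bar>V k z - V k z'\<bar> \<le> inverse (real (Suc k)) \<and> norm (Y k z - Y k z') \<le> inverse (real (Suc k))"
    if "z \<in> ?C" "z' \<in> ?C" "dist z z' < inverse (real (Suc (n k)))" for k z z'
    using that unfolding md_def by blast
  define \<gamma> where "\<gamma> = (\<lambda>k t. s1 + real_of_int \<lfloor>(t - s1) * real (Suc (n k))\<rfloor> / real (Suc (n k)))"
  have \<gamma>s: "simple_function (lebesgue_on ?I) (\<gamma> k)" for k unfolding \<gamma>_def by (rule grid_simple(1)[OF s])
  have \<gamma>I: "\<gamma> k t \<in> {s1..s2}" if "t \<in> ?I" for k t unfolding \<gamma>_def by (rule grid_simple(2)[OF s that])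
  have close: "\<bar>V k (x, t) - V k (x, \<gamma> k t)\<bar> \<le> inverse (real (Suc k)) \<and> norm (Y k (x, t) - Y k (x, \<gamma> k t)) \<le> inverse (real (Suc k))"
    if x: "x \<in> D" and t: "t \<in> ?I" for k x t
  proof (rule n)
    show "(x, t) \<in> ?C" "(x, \<gamma> k t) \<in> ?C" using inC x t \<gamma>I[OF t] by auto
    have "\<bar>t - \<gamma> k t\<bar> < inverse (real (Suc (n k)))"
      using grid_simple(3)[OF s, of t "n k"] unfolding \<gamma>_def by (metis inverse_positive_iff_positive of_nat_0_less_iff zero_less_Suc)
    then show "dist (x, t) (x, \<gamma> k t) < inverse (real (Suc (n k)))" by (simp add: dist_Pair_Pair dist_real_def)
  qed
  \<comment> \<open>The errors of function and gradient are combined so that one subsequence of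
    slices serves both.\<close>
  define Q where "Q = (\<lambda>k z. indicator (D \<times> ?I) z * (\<bar>V k z - v z\<bar> + norm (Y k z - w z)))"
  have Q0: "0 \<le> Q k z" for k z by (simp add: Q_def)
  have QK: "Q k z \<le> norm (V k z - vK z) + norm (Y k z - wK z)" for k z
    using DIK by (auto simp: Q_def indicator_def vK_def wK_def)
  have iQ': "integrable lborel (\<lambda>z. norm (V k z - vK z))" "integrable lborel (\<lambda>z. norm (Y k z - wK z))" for k
    unfolding V_def Y_def by (intro integrable_norm Bochner_Integration.integrable_diff moll_integrable iv iw)+
  have iQ: "integrable lborel (Q k)" for k
  proof (rule Bochner_Integration.integrable_bound[OF Bochner_Integration.integrable_add[OF iQ']])
    show "Q k \<in> borel_measurable lborel" unfolding Q_def by measurable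
    have "norm (Q k z) \<le> norm (norm (V k z - vK z) + norm (Y k z - wK z))" for z
      using QK[of k z] Q0[of k z] by simp
    then show "AE z in lborel. norm (Q k z) \<le> norm (norm (V k z - vK z) + norm (Y k z - wK z))" by simp
  qed
  have Qlim: "(\<lambda>k. integral\<^sup>L lborel (Q k)) \<longlonglongrightarrow> 0"
  proof (rule tendsto_sandwich[OF _ _ tendsto_const])
    show "\<forall>\<^sub>F k in sequentially. 0 \<le> integral\<^sup>L lborel (Q k)"
      by (intro always_eventually allI integral_nonneg_AE AE_I2 Q0)
    have "integral\<^sup>L lborel (Q k) \<le> (\<integral>z. norm (V k z - vK z) + norm (Y k z - wK z) \<partial>lborel)" for k
      by (rule integral_mono[OF iQ Bochner_Integration.integrable_add[OF iQ'] QK])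
    also have "(\<integral>z. norm (V k z - vK z) + norm (Y k z - wK z) \<partial>lborel) = (\<integral>z. norm (V k z - vK z) \<partial>lborel) + (\<integral>z. norm (Y k z - wK z) \<partial>lborel)" for k
      by (rule Bochner_Integration.integral_add[OF iQ'])
    finally show "\<forall>\<^sub>F k in sequentially. integral\<^sup>L lborel (Q k) \<le> (\<integral>z. norm (V k z - vK z) \<partial>lborel) + (\<integral>z. norm (Y k z - wK z) \<partial>lborel)"
      by (intro always_eventually allI)
    have "(\<lambda>k. \<integral>z. norm (V k z - vK z) \<partial>lborel) \<longlonglongrightarrow> 0" "(\<lambda>k. \<integral>z. norm (Y k z - wK z) \<partial>lborel) \<longlonglongrightarrow> 0"
      unfolding V_def Y_def using LIMSEQ_ignore_initial_segment[OF moll_tendsto[OF iv], of k0] LIMSEQ_ignore_initial_segment[OF moll_tendsto[OF iw], of k0] .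
    from tendsto_add[OF this] show "(\<lambda>k. (\<integral>z. norm (V k z - vK z) \<partial>lborel) + (\<integral>z. norm (Y k z - wK z) \<partial>lborel)) \<longlonglongrightarrow> 0" by simp
  qed
  define q where "q = (\<lambda>k t. \<integral>x. Q k (x, t) \<partial>lborel)"
  have q0: "0 \<le> q k t" for k t unfolding q_def by (intro integral_nonneg_AE AE_I2 Q0)
  have iq: "integrable lborel (q k)" for k unfolding q_def by (rule slice_integrable(2)[OF iQ])
  have qI: "(\<integral>t. norm (q k t) \<partial>lborel) = integral\<^sup>L lborel (Q k)" for k
    using slice_integrable(3)[OF iQ, of k] q0 by (simp add: q_def)
  obtain r :: "nat \<Rightarrow> nat" where r: "strict_mono r" "AE t in lborel. (\<lambda>k. q (r k) t) \<longlonglongrightarrow> 0"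
    using tendsto_L1_AE_subseq[of lborel q, OF iq] Qlim unfolding qI by blast
  define S where "S = (\<lambda>k t x. V (r k) (x, \<gamma> (r k) t))"
  define e where "e = (\<lambda>k. inverse (real (Suc k)))"
  have e: "e \<longlonglongrightarrow> 0" unfolding e_def by (rule LIMSEQ_inverse_real_of_nat)
  have er: "inverse (real (Suc (r k))) \<le> e k" for k
    unfolding e_def using strict_mono_imp_increasing[OF r(1), of k] by (intro le_imp_inverse_le) auto
  have Ssimple: "simple_function (lebesgue_on ?I) (S k)" for k
  proof -
    \<comment> \<open>The sampled map factors through the grid, from which it inherits finitely many
      values and measurable level sets.\<close>
    have "S k = (\<lambda>\<tau> x. V (r k) (x, \<tau>)) \<circ> \<gamma> (r k)" by (simp add: S_def fun_eq_iff)
    then show ?thesis using simple_function_compose[OF \<gamma>s] by simp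
  qed
  have mS: "S k t \<in> borel_measurable borel" for k t
    unfolding S_def using sl[OF cV] by (rule borel_measurable_continuous_onI)
  have SM: "\<bar>S k t x\<bar> \<le> M" for k t x unfolding S_def by (rule VM)
  define YS where "YS = (\<lambda>k t x. Y (r k) (x, \<gamma> (r k) t))"
  have wgS: "borel_weak_grad D (S k t) (YS k t)" if "t \<in> ?I" for k t
    unfolding S_def YS_def by (rule wgV[OF \<gamma>I[OF that]])
  have S_W11: "S k t \<in> W11 D" if t: "t \<in> ?I" for k t
  proof -
    have mY: "YS k t \<in> borel_measurable borel" unfolding YS_def using sl[OF cY] by (rule borel_measurable_continuous_onI)
    obtain c where c: "\<And>z. z \<in> ?C \<Longrightarrow> norm (Y (r k) z) \<le> c"
    proof -
      have "bounded (Y (r k) ` ?C)" by (intro compact_imp_bounded compact_continuous_image continuous_on_subset[OF cY subset_UNIV] K0(1))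
      then show thesis using that unfolding bounded_iff by blast
    qed
    have ae: "AE x in lborel. x \<in> D \<longrightarrow> f x = f x" for f :: "'a \<Rightarrow> 'z" by simp
    have "integrable lborel (\<lambda>x. indicator D x *\<^sub>R S k t x)" by (rule bdd[OF mS, of _ _ M]) (simp add: SM)
    then have "integrable (lebesgue_on D) (S k t)" unfolding lebesgue_on_transfer(1)[OF BD mS ae] .
    moreover have "has_weak_grad D (S k t) (YS k t)" by (rule borel_weak_grad_imp_has_weak_grad[OF D wgS[OF t] ae ae])
    moreover have "integrable (lebesgue_on D) (YS k t)"
    proof -
      have "norm (YS k t x) \<le> c" if "x \<in> D" for x
        unfolding YS_def by (rule c[OF inC[OF that \<gamma>I[OF t]]])
      then have "integrable lborel (\<lambda>x. indicator D x *\<^sub>R YS k t x)" by (rule bdd[OF mY])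
      then show ?thesis unfolding lebesgue_on_transfer(1)[OF BD mY ae] .
    qed
    ultimately show ?thesis unfolding W11_def by blast
  qed
  have L2I: "f \<in> L2 D" and L2N: "L2_norm D f = sqrt (\<integral>x. indicator D x * (f' x)\<^sup>2 \<partial>lborel)"
    if f': "f' \<in> borel_measurable borel" and fM: "\<And>x. \<bar>f' x\<bar> \<le> c" and fe: "AE x in lborel. x \<in> D \<longrightarrow> f x = f' x" for f f' c
  proof -
    note [measurable] = f'
    have fe2: "AE x in lborel. x \<in> D \<longrightarrow> (f x)\<^sup>2 = (f' x)\<^sup>2" using fe by eventually_elim auto
    have m2: "(\<lambda>x. (f' x)\<^sup>2) \<in> borel_measurable borel" by measurable
    have "norm ((f' x)\<^sup>2) \<le> c\<^sup>2" for x using power_mono[OF fM[of x] abs_ge_zero, of 2] by simp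
    then have "integrable lborel (\<lambda>x. indicator D x *\<^sub>R (f' x)\<^sup>2)" by (intro bdd m2)
    then have "integrable (lebesgue_on D) (\<lambda>x. (f x)\<^sup>2)" using lebesgue_on_transfer(1)[OF BD m2 fe2] by blast
    then show "f \<in> L2 D" unfolding L2_def using borel_measurable_lebesgue_on_AE[OF BD f' fe] by blast
    show "L2_norm D f = sqrt (\<integral>x. indicator D x * (f' x)\<^sup>2 \<partial>lborel)"
      unfolding L2_norm_def lebesgue_on_transfer(2)[OF BD m2 fe2] by simp
  qed
  \<comment> \<open>Extended by zero, the gradient is integrable on space-time, so Fubini makes
    almost every slice integrable on the whole space.\<close>
  define wD where "wD = (\<lambda>z. indicator (D \<times> ?I) z *\<^sub>R w z)"
  have iwD: "integrable lborel wD"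
  proof (rule Bochner_Integration.integrable_bound[OF iw])
    show "wD \<in> borel_measurable lborel" unfolding wD_def by measurable
    show "AE z in lborel. norm (wD z) \<le> norm (wK z)"
      using DIK by (intro AE_I2) (auto simp: wD_def wK_def indicator_def)
  qed
  have sliceU: "AE t in lborel. t \<in> ?I \<longrightarrow> (AE x in lborel. x \<in> D \<longrightarrow> u (x, t) = v (x, t))"
    using slice_AE[OF eq]
  proof eventually_elim
    case (elim t)
    show ?case
    proof
      assume t: "t \<in> ?I"
      show "AE x in lborel. x \<in> D \<longrightarrow> u (x, t) = v (x, t)"
        using elim by eventually_elim (use t DIK K(2) in blast)
    qed
  qed
  have iQt: "AE t in lborel. \<forall>k. integrable lborel (\<lambda>x. Q k (x, t))"
    unfolding AE_all_countable using slice_integrable(1)[OF iQ] by blast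
  have msl: "(\<lambda>x. v (x, t)) \<in> borel_measurable borel" "(\<lambda>x. w (x, t)) \<in> borel_measurable borel" for t
    using m by measurable
  \<comment> \<open>All that is needed of a single time: the representative on the slice, its weak
    gradient, and the two L^1 rates. Exceptional times are collected once, and what follows is
    argued at a fixed good time.\<close>
  let ?good = "\<lambda>t. (AE x in lborel. x \<in> D \<longrightarrow> u (x, t) = v (x, t)) \<and>
      borel_weak_grad D (\<lambda>x. v (x, t)) (\<lambda>x. wD (x, t)) \<and> integrable lborel (\<lambda>x. wD (x, t)) \<and>
      (\<forall>k. (\<integral>x. indicator D x * \<bar>v (x, t) - S k t x\<bar> \<partial>lborel) \<le> q (r k) t + d * e k) \<and>
      (\<forall>k. (\<integral>x. indicator D x * norm (wD (x, t) - YS k t x) \<partial>lborel) \<le> q (r k) t + d * e k) \<and>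
      (\<lambda>k. q (r k) t) \<longlonglongrightarrow> 0"
  have good: "AE t in lborel. t \<in> ?I \<longrightarrow> ?good t"
    using sliceU slice_integrable(1)[OF iwD] iQt r(2)
  proof eventually_elim
    case (elim t)
    show ?case
    proof
      assume t: "t \<in> ?I"
      have tI: "t \<in> {s1..s2}" using t by simp
      have QD: "Q k (x, t) = indicator D x * (\<bar>V k (x, t) - v (x, t)\<bar> + norm (Y k (x, t) - w (x, t)))" for k x
        using t by (simp add: Q_def indicator_def)
      have wDt: "wD (x, t) = indicator D x *\<^sub>R w (x, t)" for x using t by (simp add: wD_def indicator_def)
      have mwD: "(\<lambda>x. wD (x, t)) \<in> borel_measurable borel" using elim(2) by (auto dest: borel_measurable_integrable)
      have iQ1: "integrable lborel (\<lambda>x. Q k (x, t))" for k using elim(3) by blast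
      let ?fv = "\<lambda>x. indicator D x *\<^sub>R v (x, t)"
      have ifv: "integrable lborel ?fv" by (rule bdd[OF msl(1), of _ M]) (simp add: M)
      have iV: "integrable lborel (\<lambda>x. indicator D x *\<^sub>R V k (x, t))" for k
        by (rule bdd[OF borel_measurable_continuous_onI[OF sl[OF cV]], of _ _ M]) (simp add: VM)
      have iY: "integrable lborel (\<lambda>x. indicator D x *\<^sub>R Y k (x, t))" for k
      proof -
        have "bounded (Y k ` ?C)" by (intro compact_imp_bounded compact_continuous_image continuous_on_subset[OF cY subset_UNIV] K0(1))
        then obtain c where c: "\<And>z. z \<in> ?C \<Longrightarrow> norm (Y k z) \<le> c" unfolding bounded_iff by blast
        show ?thesis
          by (rule bdd[OF borel_measurable_continuous_onI[OF sl[OF cY]], of _ _ c]) (rule c[OF inC[OF _ tI]])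
      qed
      have limV: "(\<lambda>k. \<integral>x. norm (indicator D x *\<^sub>R V (r k) (x, t) - ?fv x) \<partial>lborel) \<longlonglongrightarrow> 0"
      proof (rule tendsto_sandwich[OF _ _ tendsto_const elim(4)])
        show "\<forall>\<^sub>F k in sequentially. 0 \<le> (\<integral>x. norm (indicator D x *\<^sub>R V (r k) (x, t) - ?fv x) \<partial>lborel)"
          by (intro always_eventually allI integral_nonneg_AE AE_I2 norm_ge_zero)
        show "\<forall>\<^sub>F k in sequentially. (\<integral>x. norm (indicator D x *\<^sub>R V (r k) (x, t) - ?fv x) \<partial>lborel) \<le> q (r k) t"
          unfolding q_def
        proof (intro always_eventually allI integral_mono iQ1 integrable_norm Bochner_Integration.integrable_diff iV ifv)
          show "norm (indicator D x *\<^sub>R V (r k) (x, t) - ?fv x) \<le> Q (r k) (x, t)" for k x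
            unfolding QD by (simp add: indicator_def)
        qed
      qed
      have limY: "(\<lambda>k. \<integral>x. norm (indicator D x *\<^sub>R Y (r k) (x, t) - wD (x, t)) \<partial>lborel) \<longlonglongrightarrow> 0"
      proof (rule tendsto_sandwich[OF _ _ tendsto_const elim(4)])
        show "\<forall>\<^sub>F k in sequentially. 0 \<le> (\<integral>x. norm (indicator D x *\<^sub>R Y (r k) (x, t) - wD (x, t)) \<partial>lborel)"
          by (intro always_eventually allI integral_nonneg_AE AE_I2 norm_ge_zero)
        show "\<forall>\<^sub>F k in sequentially. (\<integral>x. norm (indicator D x *\<^sub>R Y (r k) (x, t) - wD (x, t)) \<partial>lborel) \<le> q (r k) t"
          unfolding q_def
        proof (intro always_eventually allI integral_mono iQ1 integrable_norm Bochner_Integration.integrable_diff iY elim(2))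
          show "norm (indicator D x *\<^sub>R Y (r k) (x, t) - wD (x, t)) \<le> Q (r k) (x, t)" for k x
            unfolding QD wDt by (simp add: indicator_def)
        qed
      qed
      \<comment> \<open>The weak gradient identity of the slice is the limit of those of the
        mollified slices, which converge in L^1 together with their gradients.\<close>
      have form: "(\<integral>x. v (x, t) * dderiv b \<phi> x \<partial>lborel) = - (\<integral>x. \<phi> x * (wD (x, t) \<bullet> b) \<partial>lborel)"
        if \<phi>: "\<phi> \<in> Cc_infty D" and b: "b \<in> Basis" for \<phi> b
      proof -
        obtain G where G: "compact G" "G \<subseteq> D" "\<And>z. z \<notin> G \<Longrightarrow> \<phi> z = 0" using Cc_infty_support[OF \<phi>] by metis
        have dG: "dderiv e \<phi> z = 0" if "z \<notin> G" for z e by (rule dderiv_eq_zero_off[OF G(1,3) that])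
        obtain B1 where B1: "\<And>z. norm (dderiv b \<phi> z) \<le> B1"
          using compact_support_bounded[OF Cc_infty_dderiv_continuous[OF \<phi>] G(1) dG] by metis
        obtain B2 where B2: "\<And>z. norm (\<phi> z) \<le> B2"
          using compact_support_bounded[OF Cc_infty_continuous[OF \<phi>] G(1,3)] by metis
        have nb: "norm (\<phi> z *\<^sub>R b) \<le> B2" for z using B2[of z] b by simp
        have cb: "continuous_on UNIV (\<lambda>z. \<phi> z *\<^sub>R b)" by (intro continuous_intros Cc_infty_continuous[OF \<phi>])
        have e1: "dderiv b \<phi> x \<bullet> (indicator D x *\<^sub>R c) = c * dderiv b \<phi> x" for x and c :: real
          using dG[of x] G(2) by (cases "x \<in> G") (auto simp: inner_real_def)
        have e2: "(\<phi> x *\<^sub>R b) \<bullet> (indicator D x *\<^sub>R c) = \<phi> x * (c \<bullet> b)" for x and c :: 'a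
          using G(3)[of x] G(2) by (cases "x \<in> G") (auto simp: inner_commute)
        have e3: "(\<phi> x *\<^sub>R b) \<bullet> wD (x, t) = \<phi> x * (wD (x, t) \<bullet> b)" for x by (simp add: inner_commute)
        have l1: "(\<lambda>k. \<integral>x. V (r k) (x, t) * dderiv b \<phi> x \<partial>lborel) \<longlonglongrightarrow> (\<integral>x. v (x, t) * dderiv b \<phi> x \<partial>lborel)"
          using L1_tested_limit(2)[OF iV ifv limV Cc_infty_dderiv_continuous[OF \<phi>] B1] unfolding e1 .
        have l2: "(\<lambda>k. \<integral>x. \<phi> x * (Y (r k) (x, t) \<bullet> b) \<partial>lborel) \<longlonglongrightarrow> (\<integral>x. \<phi> x * (wD (x, t) \<bullet> b) \<partial>lborel)"
          using L1_tested_limit(2)[OF iY elim(2) limY cb nb] unfolding e2 e3 .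
        have "(\<integral>x. V (r k) (x, t) * dderiv b \<phi> x \<partial>lborel) = - (\<integral>x. \<phi> x * (Y (r k) (x, t) \<bullet> b) \<partial>lborel)" for k
          by (rule borel_weak_gradD(5)[OF wgV \<phi> b]) (use t in simp)
        then have "(\<lambda>k. \<integral>x. V (r k) (x, t) * dderiv b \<phi> x \<partial>lborel) \<longlonglongrightarrow> - (\<integral>x. \<phi> x * (wD (x, t) \<bullet> b) \<partial>lborel)"
          using tendsto_minus[OF l2] by simp
        with l1 show ?thesis by (rule LIMSEQ_unique)
      qed
      have iwDD: "integrable lborel (\<lambda>x. indicator D x *\<^sub>R wD (x, t))"
      proof -
        have "(\<lambda>x. indicator D x *\<^sub>R wD (x, t)) = (\<lambda>x. wD (x, t))" by (auto simp: wD_def indicator_def fun_eq_iff)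
        then show ?thesis using elim(2) by simp
      qed
      have wgt: "borel_weak_grad D (\<lambda>x. v (x, t)) (\<lambda>x. wD (x, t))"
      proof -
        have a: "integrable lborel (\<lambda>x. indicator L x *\<^sub>R f x)"
          if L: "compact L" "L \<subseteq> D" and f: "integrable lborel (\<lambda>x. indicator D x *\<^sub>R f x)" for L and f :: "'a \<Rightarrow> 'z::euclidean_space"
        proof -
          have [measurable]: "L \<in> sets borel" using L by (simp add: borel_compact)
          have e: "(\<lambda>x. indicator L x *\<^sub>R f x) = (\<lambda>x. indicator L x *\<^sub>R (indicator D x *\<^sub>R f x))"
            using L(2) by (auto simp: indicator_def fun_eq_iff)
          show ?thesis unfolding e by (rule integrable_mult_indicator[OF _ f]) simp
        qed
        show ?thesis by (rule borel_weak_gradI[OF msl(1) mwD a[OF _ _ ifv] a[OF _ _ iwDD] form])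
      qed
      have iab: "integrable lborel (\<lambda>x. indicator D x * norm (f x - p x))"
        if "integrable lborel (\<lambda>x. indicator D x *\<^sub>R f x)" "integrable lborel (\<lambda>x. indicator D x *\<^sub>R p x)" for f p :: "'a \<Rightarrow> 'z::euclidean_space"
      proof -
        have e: "(\<lambda>x. indicator D x * norm (f x - p x)) = (\<lambda>x. norm (indicator D x *\<^sub>R f x - indicator D x *\<^sub>R p x))"
          by (auto simp: indicator_def fun_eq_iff)
        show ?thesis unfolding e by (intro integrable_norm Bochner_Integration.integrable_diff that)
      qed
      have iQe: "integrable lborel (\<lambda>x. Q (r k) (x, t) + indicator D x * e k)" for k
        by (intro Bochner_Integration.integrable_add iQ1 integrable_mult_left iD)
      have IQe: "(\<integral>x. Q (r k) (x, t) + indicator D x * e k \<partial>lborel) = q (r k) t + d * e k" for k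
        using Bochner_Integration.integral_add[OF iQ1 integrable_mult_left[OF iD], of "r k" "e k"] unfolding q_def intD .
      have iS: "integrable lborel (\<lambda>x. indicator D x *\<^sub>R S k t x)" for k by (rule bdd[OF mS, of _ _ M]) (simp add: SM)
      have iYS: "integrable lborel (\<lambda>x. indicator D x *\<^sub>R YS k t x)" for k
      proof -
        have "bounded (Y (r k) ` ?C)" by (intro compact_imp_bounded compact_continuous_image continuous_on_subset[OF cY subset_UNIV] K0(1))
        then obtain c where c: "\<And>z. z \<in> ?C \<Longrightarrow> norm (Y (r k) z) \<le> c" unfolding bounded_iff by blast
        show ?thesis unfolding YS_def
          by (rule bdd[OF borel_measurable_continuous_onI[OF sl[OF cY]], of _ _ c]) (rule c[OF inC[OF _ \<gamma>I[OF t]]])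
      qed
      have n1: "(\<integral>x. indicator D x * \<bar>v (x, t) - S k t x\<bar> \<partial>lborel) \<le> q (r k) t + d * e k" for k
        unfolding IQe[symmetric]
      proof (rule integral_mono[OF _ iQe])
        show "integrable lborel (\<lambda>x. indicator D x * \<bar>v (x, t) - S k t x\<bar>)" using iab[OF ifv iS] by simp
        show "indicator D x * \<bar>v (x, t) - S k t x\<bar> \<le> Q (r k) (x, t) + indicator D x * e k" for x
        proof (cases "x \<in> D")
          case True
          have "\<bar>v (x, t) - S k t x\<bar> \<le> \<bar>V (r k) (x, t) - v (x, t)\<bar> + \<bar>V (r k) (x, t) - S k t x\<bar>" by linarith
          moreover have "\<bar>V (r k) (x, t) - S k t x\<bar> \<le> e k" using close[OF True t, of "r k"] er[of k] unfolding S_def by linarith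
          moreover have "0 \<le> norm (Y (r k) (x, t) - w (x, t))" by simp
          ultimately have "\<bar>v (x, t) - S k t x\<bar> \<le> \<bar>V (r k) (x, t) - v (x, t)\<bar> + norm (Y (r k) (x, t) - w (x, t)) + e k" by linarith
          then show ?thesis using True unfolding QD by simp
        qed (simp add: QD)
      qed
      have n2: "(\<integral>x. indicator D x * norm (wD (x, t) - YS k t x) \<partial>lborel) \<le> q (r k) t + d * e k" for k
        unfolding IQe[symmetric]
      proof (rule integral_mono[OF _ iQe])
        show "integrable lborel (\<lambda>x. indicator D x * norm (wD (x, t) - YS k t x))" by (rule iab[OF iwDD iYS])
        show "indicator D x * norm (wD (x, t) - YS k t x) \<le> Q (r k) (x, t) + indicator D x * e k" for x
        proof (cases "x \<in> D")
          case True
          have "norm (w (x, t) - YS k t x) \<le> norm (Y (r k) (x, t) - w (x, t)) + norm (Y (r k) (x, t) - YS k t x)"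
            using norm_triangle_ineq4[of "Y (r k) (x, t) - YS k t x" "Y (r k) (x, t) - w (x, t)"] by simp
          moreover have "norm (Y (r k) (x, t) - YS k t x) \<le> e k" using close[OF True t, of "r k"] er[of k] unfolding YS_def by linarith
          moreover have "0 \<le> \<bar>V (r k) (x, t) - v (x, t)\<bar>" by simp
          ultimately have "norm (w (x, t) - YS k t x) \<le> \<bar>V (r k) (x, t) - v (x, t)\<bar> + norm (Y (r k) (x, t) - w (x, t)) + e k" by linarith
          then show ?thesis using True unfolding QD wDt by simp
        qed (simp add: QD)
      qed
      show "?good t" using elim(1) t wgt elim(2) n1 n2 elim(4) by blast
    qed
  qed
  have bnd: "(\<lambda>k. q (r k) t + d * e k) \<longlonglongrightarrow> 0" if "(\<lambda>k. q (r k) t) \<longlonglongrightarrow> 0" for t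
    using tendsto_add[OF that tendsto_mult_left[OF e, of d]] by simp
  have Wn: "W11_norm D (\<lambda>x. u (x, t)) = (\<integral>x. indicator D x * \<bar>v (x, t)\<bar> \<partial>lborel) + (\<integral>x. indicator D x * norm (wD (x, t)) \<partial>lborel)"
    and WnS: "(\<lambda>k. W11_norm D (\<lambda>x. u (x, t) - S k t x)) \<longlonglongrightarrow> 0" and uW: "(\<lambda>x. u (x, t)) \<in> W11 D"
    and Ln: "L2_norm D (\<lambda>x. u (x, t)) \<le> sqrt (d * M\<^sup>2)" and LnS: "(\<lambda>k. L2_norm D (\<lambda>x. u (x, t) - S k t x)) \<longlonglongrightarrow> 0"
    and uL: "(\<lambda>x. u (x, t)) \<in> L2 D"
    if t: "t \<in> ?I" and g: "?good t" for t
  proof -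
    have ue: "AE x in lborel. x \<in> D \<longrightarrow> u (x, t) = v (x, t)" and wgt: "borel_weak_grad D (\<lambda>x. v (x, t)) (\<lambda>x. wD (x, t))"
      and iwt: "integrable lborel (\<lambda>x. wD (x, t))"
      and n1: "\<And>k. (\<integral>x. indicator D x * \<bar>v (x, t) - S k t x\<bar> \<partial>lborel) \<le> q (r k) t + d * e k"
      and n2: "\<And>k. (\<integral>x. indicator D x * norm (wD (x, t) - YS k t x) \<partial>lborel) \<le> q (r k) t + d * e k"
      and ql: "(\<lambda>k. q (r k) t) \<longlonglongrightarrow> 0" using g by blast+
    show "W11_norm D (\<lambda>x. u (x, t)) = (\<integral>x. indicator D x * \<bar>v (x, t)\<bar> \<partial>lborel) + (\<integral>x. indicator D x * norm (wD (x, t)) \<partial>lborel)"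
      by (rule W11_norm_eq[OF D wgt ue])
    have ue': "AE x in lborel. x \<in> D \<longrightarrow> u (x, t) - S k t x = v (x, t) - S k t x" for k
      using ue by eventually_elim auto
    have WS: "W11_norm D (\<lambda>x. u (x, t) - S k t x) = (\<integral>x. indicator D x * \<bar>v (x, t) - S k t x\<bar> \<partial>lborel)
        + (\<integral>x. indicator D x * norm (wD (x, t) - YS k t x) \<partial>lborel)" for k
      by (rule W11_norm_eq[OF D borel_weak_grad_diff[OF wgt wgS[OF t]] ue'])
    show "(\<lambda>k. W11_norm D (\<lambda>x. u (x, t) - S k t x)) \<longlonglongrightarrow> 0"
    proof (rule tendsto_sandwich[OF _ _ tendsto_const])
      show "\<forall>\<^sub>F k in sequentially. 0 \<le> W11_norm D (\<lambda>x. u (x, t) - S k t x)"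
        unfolding WS by (intro always_eventually allI add_nonneg_nonneg integral_nonneg_AE AE_I2) simp_all
      show "\<forall>\<^sub>F k in sequentially. W11_norm D (\<lambda>x. u (x, t) - S k t x) \<le> (q (r k) t + d * e k) + (q (r k) t + d * e k)"
        unfolding WS by (intro always_eventually allI add_mono n1 n2)
      show "(\<lambda>k. (q (r k) t + d * e k) + (q (r k) t + d * e k)) \<longlonglongrightarrow> 0"
        using tendsto_add[OF bnd[OF ql] bnd[OF ql]] by simp
    qed
    have "integrable (lebesgue_on D) (\<lambda>x. u (x, t))"
      unfolding lebesgue_on_transfer(1)[OF BD msl(1) ue] by (rule bdd[OF msl(1), of _ M]) (simp add: M)
    moreover have "has_weak_grad D (\<lambda>x. u (x, t)) (\<lambda>x. wD (x, t))"
      by (rule borel_weak_grad_imp_has_weak_grad[OF D wgt ue]) simp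
    moreover have "integrable (lebesgue_on D) (\<lambda>x. wD (x, t))"
    proof -
      have mw: "(\<lambda>x. wD (x, t)) \<in> borel_measurable borel" using borel_measurable_integrable[OF iwt] by simp
      have "indicator D x *\<^sub>R wD (x, t) = wD (x, t)" for x by (auto simp: wD_def indicator_def)
      then show ?thesis using iwt lebesgue_on_transfer(1)[OF BD mw, of "\<lambda>x. wD (x, t)"] by simp
    qed
    ultimately show "(\<lambda>x. u (x, t)) \<in> W11 D" unfolding W11_def by blast
    show "(\<lambda>x. u (x, t)) \<in> L2 D" by (rule L2I[OF msl(1) M(2) ue])
    have "(\<integral>x. indicator D x * (v (x, t))\<^sup>2 \<partial>lborel) \<le> (\<integral>x. indicator D x * M\<^sup>2 \<partial>lborel)"
    proof (rule integral_mono)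
      have vm: "(v z)\<^sup>2 \<le> M\<^sup>2" for z using power_mono[OF M(2)[of z] abs_ge_zero, of 2] by simp
      have "(\<lambda>x. (v (x, t))\<^sup>2) \<in> borel_measurable borel" using msl(1)[of t] by measurable
      from bdd[OF this, of "M\<^sup>2"] vm show "integrable lborel (\<lambda>x. indicator D x * (v (x, t))\<^sup>2)" by simp
      show "integrable lborel (\<lambda>x. indicator D x * M\<^sup>2)" by (rule integrable_mult_left[OF iD])
      show "indicator D x * (v (x, t))\<^sup>2 \<le> indicator D x * M\<^sup>2" for x using vm by (intro mult_left_mono) auto
    qed
    then show "L2_norm D (\<lambda>x. u (x, t)) \<le> sqrt (d * M\<^sup>2)"
      unfolding L2N[OF msl(1) M(2) ue] intD by (rule real_sqrt_le_mono)
    show "(\<lambda>k. L2_norm D (\<lambda>x. u (x, t) - S k t x)) \<longlonglongrightarrow> 0"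
    proof (rule tendsto_sandwich[OF _ _ tendsto_const])
      have ms: "(\<lambda>x. v (x, t) - S k t x) \<in> borel_measurable borel" for k using msl(1)[of t] mS[of k t] by measurable
      have b2: "\<bar>v (x, t) - S k t x\<bar> \<le> 2 * M" for k x using M(2)[of "(x, t)"] SM[of k t x] by linarith
      show "\<forall>\<^sub>F k in sequentially. 0 \<le> L2_norm D (\<lambda>x. u (x, t) - S k t x)"
        unfolding L2N[OF ms b2 ue'] by (intro always_eventually allI real_sqrt_ge_zero integral_nonneg_AE AE_I2) simp
      \<comment> \<open>Both functions are bounded by \<open>M\<close>, so the square of the
        difference is at most \<open>2 * M\<close> times the difference itself, and the L^1 rate
        carries over to L^2.\<close>
      have "(\<integral>x. indicator D x * (v (x, t) - S k t x)\<^sup>2 \<partial>lborel) \<le> (2 * M) * (q (r k) t + d * e k)" for k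
      proof -
        have b3: "(v (x, t) - S k t x)\<^sup>2 \<le> 2 * M * \<bar>v (x, t) - S k t x\<bar>" for x
          using mult_right_mono[OF b2[of x k] abs_ge_zero[of "v (x, t) - S k t x"]] by (simp add: power2_eq_square)
        have "(\<integral>x. indicator D x * (v (x, t) - S k t x)\<^sup>2 \<partial>lborel) \<le> (\<integral>x. 2 * M * (indicator D x * \<bar>v (x, t) - S k t x\<bar>) \<partial>lborel)"
        proof (rule integral_mono)
          have sq: "(\<lambda>x. (v (x, t) - S k t x)\<^sup>2) \<in> borel_measurable borel" using ms[of k] by measurable
          have "norm ((v (x, t) - S k t x)\<^sup>2) \<le> (2 * M)\<^sup>2" for x using power_mono[OF b2[of x k] abs_ge_zero, of 2] by simp
          from bdd[OF sq this] show "integrable lborel (\<lambda>x. indicator D x * (v (x, t) - S k t x)\<^sup>2)" by simp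
          have "(\<lambda>x. \<bar>v (x, t) - S k t x\<bar>) \<in> borel_measurable borel" using ms[of k] by measurable
          from bdd[OF this, of "2 * M"] b2 show "integrable lborel (\<lambda>x. 2 * M * (indicator D x * \<bar>v (x, t) - S k t x\<bar>))"
            by (intro integrable_mult_right) simp
          show "indicator D x * (v (x, t) - S k t x)\<^sup>2 \<le> 2 * M * (indicator D x * \<bar>v (x, t) - S k t x\<bar>)" for x
            using b3[of x] by (simp add: indicator_def)
        qed
        also have "\<dots> = 2 * M * (\<integral>x. indicator D x * \<bar>v (x, t) - S k t x\<bar> \<partial>lborel)" by simp
        also have "\<dots> \<le> 2 * M * (q (r k) t + d * e k)" using n1[of k] M(1) by (intro mult_left_mono) auto
        finally show ?thesis .
      qed
      then show "\<forall>\<^sub>F k in sequentially. L2_norm D (\<lambda>x. u (x, t) - S k t x) \<le> sqrt ((2 * M) * (q (r k) t + d * e k))"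
        unfolding L2N[OF ms b2 ue'] by (intro always_eventually allI real_sqrt_le_mono)
      show "(\<lambda>k. sqrt ((2 * M) * (q (r k) t + d * e k))) \<longlonglongrightarrow> 0"
        using tendsto_real_sqrt[OF tendsto_mult_left[OF bnd[OF ql], of "2 * M"]] by simp
    qed
  qed
  have aeI: "AE t in lebesgue_on ?I. P t" if "\<And>t. t \<in> ?I \<Longrightarrow> ?good t \<Longrightarrow> P t" for P
    unfolding AE_lebesgue_on[OF BI] using good by eventually_elim (use that in blast)
  have SL2: "S k t \<in> L2 D" for k t by (rule L2I[OF mS[of k t] SM]) simp
  have "strongly_measurable_into (W11 D) (W11_norm D) ?I u"
    unfolding strongly_measurable_into_def
  proof (intro conjI exI[of _ S] allI)
    show "AE t in lebesgue_on ?I. (\<lambda>x. u (x, t)) \<in> W11 D" by (rule aeI) (rule uW)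
    show "AE t in lebesgue_on ?I. (\<lambda>k. W11_norm D (\<lambda>x. u (x, t) - S k t x)) \<longlonglongrightarrow> 0" by (rule aeI) (rule WnS)
  qed (use Ssimple S_W11 in auto)
  moreover have "integrable (lebesgue_on ?I) (\<lambda>t. W11_norm D (\<lambda>x. u (x, t)))"
  proof -
    \<comment> \<open>Integrability of the norm in time includes its measurability, which is read
      off from Fubini: the norm agrees almost everywhere with the slice integrals of
      \<open>F\<close>.\<close>
    define F where "F = (\<lambda>z. indicator (D \<times> ?I) z * (\<bar>v z\<bar> + norm (w z)))"
    have iF: "integrable lborel F"
    proof (rule Bochner_Integration.integrable_bound[OF Bochner_Integration.integrable_add[OF integrable_norm[OF iv] integrable_norm[OF iw]]])
      show "F \<in> borel_measurable lborel" unfolding F_def by measurable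
      show "AE z in lborel. norm (F z) \<le> norm (norm (vK z) + norm (wK z))"
        using DIK by (intro AE_I2) (auto simp: F_def vK_def wK_def indicator_def)
    qed
    define N where "N = (\<lambda>t. \<integral>x. F (x, t) \<partial>lborel)"
    have iN: "integrable lborel N" unfolding N_def by (rule slice_integrable(2)[OF iF])
    have mN: "N \<in> borel_measurable borel" using borel_measurable_integrable[OF iN] by simp
    have "AE t in lborel. t \<in> ?I \<longrightarrow> W11_norm D (\<lambda>x. u (x, t)) = N t"
      using good
    proof eventually_elim
      case (elim t)
      show ?case
      proof
        assume t: "t \<in> ?I"
        have g: "?good t" using elim t by blast
        have iwt: "integrable lborel (\<lambda>x. wD (x, t))" using g by blast
        have wDt: "indicator D x * norm (wD (x, t)) = norm (wD (x, t))" for x by (auto simp: wD_def indicator_def)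
        have i1: "integrable lborel (\<lambda>x. indicator D x * \<bar>v (x, t)\<bar>)"
          using integrable_norm[OF bdd[OF msl(1)[of t], of M]] M(2) by (simp add: abs_mult)
        have i2: "integrable lborel (\<lambda>x. indicator D x * norm (wD (x, t)))" unfolding wDt by (rule integrable_norm[OF iwt])
        have "N t = (\<integral>x. indicator D x * \<bar>v (x, t)\<bar> + indicator D x * norm (wD (x, t)) \<partial>lborel)"
          unfolding N_def F_def using t by (intro arg_cong[where f="integral\<^sup>L lborel"]) (auto simp: wD_def indicator_def fun_eq_iff)
        also have "\<dots> = (\<integral>x. indicator D x * \<bar>v (x, t)\<bar> \<partial>lborel) + (\<integral>x. indicator D x * norm (wD (x, t)) \<partial>lborel)"
          by (rule Bochner_Integration.integral_add[OF i1 i2])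
        finally show "W11_norm D (\<lambda>x. u (x, t)) = N t" using Wn[OF t g] by simp
      qed
    qed
    from lebesgue_on_transfer(1)[OF BI mN this] show ?thesis
      using integrable_mult_indicator[OF _ iN, of ?I] by simp
  qed
  ultimately show "u \<in> Bochner_L1 ?I (W11 D) (W11_norm D)" unfolding Bochner_L1_def by blast
  have "strongly_measurable_into (L2 D) (L2_norm D) ?I u"
    unfolding strongly_measurable_into_def
  proof (intro conjI exI[of _ S] allI)
    show "AE t in lebesgue_on ?I. (\<lambda>x. u (x, t)) \<in> L2 D" by (rule aeI) (rule uL)
    show "AE t in lebesgue_on ?I. (\<lambda>k. L2_norm D (\<lambda>x. u (x, t) - S k t x)) \<longlonglongrightarrow> 0" by (rule aeI) (rule LnS)
  qed (use Ssimple SL2 in auto)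
  moreover have "AE t in lebesgue_on ?I. L2_norm D (\<lambda>x. u (x, t)) \<le> sqrt (d * M\<^sup>2)" by (rule aeI) (rule Ln)
  ultimately show "u \<in> Bochner_Linf ?I (L2 D) (L2_norm D)" unfolding Bochner_Linf_def by blast
qed

end

section \<open>Stability of weak supersolutions\<close>

text \<open>Local membership in the function space is given only on cylinders compactly contained in
  the domain, so a compact set has to be placed in one of these: the interior of a compact
  neighbourhood of its spatial projection, and times halfway to the ends of the interval.\<close>

lemma compact_in_cylinder:
  fixes K :: "('a::euclidean_space \<times> real) set"
  assumes K: "compact K" "K \<subseteq> D \<times> {t1<..<t2}" and D: "open D" and t: "t1 < t2"
  obtains D' s1 s2 where "open D'" "s1 < s2" "compact (closure (D' \<times> {s1<..<s2}))"
    "closure (D' \<times> {s1<..<s2}) \<subseteq> D \<times> {t1<..<t2}" "K \<subseteq> D' \<times> {s1<..<s2}"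
proof -
  have "compact (fst ` K)" "fst ` K \<subseteq> D"
    using K by (auto intro!: compact_continuous_image continuous_intros)
  from compact_neighbourhood[OF this D] obtain K1 k0 where K1: "compact K1" "K1 \<subseteq> D"
    "\<And>k z. k \<ge> k0 \<Longrightarrow> z \<in> fst ` K \<Longrightarrow> cball z (inverse (real (Suc k))) \<subseteq> K1" by metis
  have sub: "fst ` K \<subseteq> interior K1"
  proof
    fix z assume z: "z \<in> fst ` K"
    have "ball z (inverse (real (Suc k0))) \<subseteq> K1" using K1(3)[OF order_refl z] ball_subset_cball by blast
    from interior_maximal[OF this open_ball] show "z \<in> interior K1" by (auto simp: subset_iff)
  qed
  \<comment> \<open>The midpoint is inserted so that the set of times is nonempty even if
    \<open>K\<close> is empty, and its extrema exist.\<close>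
  let ?T = "insert ((t1 + t2) / 2) (snd ` K)"
  have T: "compact ?T" "?T \<noteq> {}" "?T \<subseteq> {t1<..<t2}"
    using K t by (auto intro!: compact_insert compact_continuous_image continuous_intros)
  obtain a where a: "a \<in> ?T" "\<And>x. x \<in> ?T \<Longrightarrow> a \<le> x" using compact_attains_inf[OF T(1,2)] by metis
  obtain b where b: "b \<in> ?T" "\<And>x. x \<in> ?T \<Longrightarrow> x \<le> b" using compact_attains_sup[OF T(1,2)] by metis
  have ab: "t1 < a" "a \<le> b" "b < t2" using a(1) b T(3) by auto
  let ?s1 = "(t1 + a) / 2" and ?s2 = "(b + t2) / 2"
  have cl: "closure (interior K1 \<times> {?s1<..<?s2}) \<subseteq> K1 \<times> {?s1..?s2}"
    by (intro closure_minimal closed_Times compact_imp_closed K1 closed_atLeastAtMost Sigma_mono interior_subset) auto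
  show thesis
  proof (rule that[of "interior K1" ?s1 ?s2])
    show "compact (closure (interior K1 \<times> {?s1<..<?s2}))"
      using closed_Int_compact[OF closed_closure compact_Times[OF K1(1) compact_Icc[of ?s1 ?s2]], of "interior K1 \<times> {?s1<..<?s2}"] cl
      by (simp add: Int_absorb2)
    have "K1 \<times> {?s1..?s2} \<subseteq> D \<times> {t1<..<t2}" using K1(2) ab by auto
    with cl show "closure (interior K1 \<times> {?s1<..<?s2}) \<subseteq> D \<times> {t1<..<t2}" by (rule subset_trans)
    show "K \<subseteq> interior K1 \<times> {?s1<..<?s2}"
    proof
      fix z assume z: "z \<in> K"
      have "a \<le> snd z" "snd z \<le> b" using a(2) b(2) z by auto
      moreover have "fst z \<in> interior K1" using sub z by auto
      ultimately show "z \<in> interior K1 \<times> {?s1<..<?s2}" using ab by (cases z) auto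
    qed
  qed (use ab in auto)
qed

section \<open>From weak supersolutions to Borel representatives and back\<close>

context growth
begin

text \<open>Monotonicity on the whole line suffices; at negative arguments the integral is over an
  empty interval and vanishes.\<close>

lemma primitive_measurable [measurable]: "primitive g \<in> borel_measurable borel"
proof (rule borel_measurable_mono, rule monoI)
  fix x y :: real assume "x \<le> y"
  moreover have "primitive g s = 0" if "s < 0" for s using that by (simp add: primitive_def)
  ultimately show "primitive g x \<le> primitive g y"
    by (cases "x < 0"; cases "y < 0") (auto intro: primitive_nonneg primitive_mono)
qed

lemma lebesgue_on_tested:
  fixes v v' :: "'a \<times> real \<Rightarrow> real" and w w' :: "'a \<times> real \<Rightarrow> 'a"
  assumes U: "open U" and [measurable]: "v' \<in> borel_measurable borel" "w' \<in> borel_measurable borel"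
    and eq: "AE z in lborel. z \<in> U \<longrightarrow> v z = v' z" "AE z in lborel. z \<in> U \<longrightarrow> w z = w' z"
    and \<eta>: "\<eta> \<in> Cc_infty U"
  shows "(LINT z|lebesgue_on U. v z * time_deriv \<eta> z) = (\<integral>z. v' z * dderiv (0, 1) \<eta> z \<partial>lborel)"
    and "(LINT z|lebesgue_on U. A (w z) \<bullet> spatial_grad \<eta> z)
      = (\<integral>z. (\<Sum>b\<in>Basis. (A (w' z) \<bullet> b) * dderiv (b, 0) \<eta> z) \<partial>lborel)"
proof -
  have BU: "U \<in> sets borel" using U by simp
  have [measurable]: "dderiv e \<eta> \<in> borel_measurable borel" for e
    by (rule borel_measurable_continuous_onI[OF Cc_infty_dderiv_continuous[OF \<eta>]])
  obtain S where S: "compact S" "S \<subseteq> U" "\<And>z. z \<notin> S \<Longrightarrow> \<eta> z = 0" using Cc_infty_support[OF \<eta>] by metis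
  have d0: "dderiv e \<eta> z = 0" if "z \<notin> U" for z e
    by (rule dderiv_eq_zero_off[OF S(1,3)]) (use that S(2) in blast)+
  have m1: "(\<lambda>z. v' z * dderiv (0, 1) \<eta> z) \<in> borel_measurable borel" by measurable
  have e1: "AE z in lborel. z \<in> U \<longrightarrow> v z * time_deriv \<eta> z = v' z * dderiv (0, 1) \<eta> z"
    using eq(1) by eventually_elim (simp add: time_deriv_dderiv[OF \<eta>])
  have i1: "indicator U z *\<^sub>R (v' z * dderiv (0, 1) \<eta> z) = v' z * dderiv (0, 1) \<eta> z" for z
    using d0[of z] by (cases "z \<in> U") auto
  show "(LINT z|lebesgue_on U. v z * time_deriv \<eta> z) = (\<integral>z. v' z * dderiv (0, 1) \<eta> z \<partial>lborel)"
    unfolding lebesgue_on_transfer(2)[OF BU m1 e1] i1 ..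
  have m2: "(\<lambda>z. \<Sum>b\<in>Basis. (A (w' z) \<bullet> b) * dderiv (b, 0) \<eta> z) \<in> borel_measurable borel" by measurable
  have e2: "AE z in lborel. z \<in> U \<longrightarrow> A (w z) \<bullet> spatial_grad \<eta> z = (\<Sum>b\<in>Basis. (A (w' z) \<bullet> b) * dderiv (b, 0) \<eta> z)"
    using eq(2) by eventually_elim (simp add: spatial_grad_dderiv[OF \<eta>] inner_sum_right mult.commute)
  have i2: "indicator U z *\<^sub>R (\<Sum>b\<in>Basis. (A (w' z) \<bullet> b) * dderiv (b, 0) \<eta> z)
      = (\<Sum>b\<in>Basis. (A (w' z) \<bullet> b) * dderiv (b, 0) \<eta> z)" for z
    using d0[of z] by (cases "z \<in> U") auto
  show "(LINT z|lebesgue_on U. A (w z) \<bullet> spatial_grad \<eta> z)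
      = (\<integral>z. (\<Sum>b\<in>Basis. (A (w' z) \<bullet> b) * dderiv (b, 0) \<eta> z) \<partial>lborel)"
    unfolding lebesgue_on_transfer(2)[OF BU m2 e2] i2 ..
qed

text \<open>The gradient in the inequality and the gradient with Orlicz integrability on a small
  cylinder come from independent existence statements. The fundamental lemma identifies them on the
  cylinder, and \<open>h \<le> g1 * primitive g\<close> then gives local integrability of
  \<open>h\<close> for the former.\<close>

lemma weak_supersolution_wsuper:
  assumes D: "open D" and t: "t1 < t2" and v: "weak_supersolution g A (D \<times> {t1<..<t2}) v"
    and M: "0 \<le> M" "AE z in lebesgue_on (D \<times> {t1<..<t2}). \<bar>v z\<bar> \<le> M"
  obtains v' w' where "wsuper (D \<times> {t1<..<t2}) v' w'" "\<forall>z. \<bar>v' z\<bar> \<le> M"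
    "AE z in lborel. z \<in> D \<times> {t1<..<t2} \<longrightarrow> v z = v' z"
proof -
  let ?U = "D \<times> {t1<..<t2}"
  have U: "open ?U" using D by (intro open_Times) auto
  have BU: "?U \<in> sets borel" using U by (rule borel_open)
  have vl: "v \<in> V2G_loc (primitive g) ?U" using v unfolding weak_supersolution_def by (rule conjunct1)
  obtain Du where Du: "has_weak_spatial_grad ?U v Du"
    and super: "\<forall>\<eta>\<in>Cc_infty ?U. (\<forall>z. 0 \<le> \<eta> z) \<longrightarrow> 0 \<le> - (LINT z|lebesgue_on ?U. v z * time_deriv \<eta> z)
               + (LINT z|lebesgue_on ?U. A (Du z) \<bullet> spatial_grad \<eta> z)"
    using v unfolding weak_supersolution_def by (elim conjE exE)
  have lv: "locally_integrable_on v ?U"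
    using Du unfolding has_weak_spatial_grad_def by (rule conjunct1)
  have lD: "locally_integrable_on Du ?U"
    using Du unfolding has_weak_spatial_grad_def by (rule conjunct2[THEN conjunct1])
  obtain v0 where v0: "v0 \<in> borel_measurable borel" "AE z in lborel. z \<in> ?U \<longrightarrow> v z = v0 z"
    by (rule locally_integrable_representative[OF U lv])
  obtain w' where w': "w' \<in> borel_measurable borel" "AE z in lborel. z \<in> ?U \<longrightarrow> Du z = w' z"
    by (rule locally_integrable_representative[OF U lD])
  \<comment> \<open>Clipping turns the almost everywhere bound into one at every point, and changes
    the representative of \<open>v\<close> only on a null subset of the domain.\<close>
  define v' where "v' = (\<lambda>z. max (- M) (min M (v0 z)))"
  have v'm: "v' \<in> borel_measurable borel" unfolding v'_def using v0(1) by measurable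
  have v'M: "\<bar>v' z\<bar> \<le> M" for z unfolding v'_def using M(1) by auto
  have eq: "AE z in lborel. z \<in> ?U \<longrightarrow> v z = v' z"
    using v0(2) M(2)[unfolded AE_lebesgue_on[OF BU]] by eventually_elim (auto simp: v'_def)
  note Du' = Du[unfolded has_weak_spatial_grad_iff[OF U v'm w'(1) eq w'(2)]]
  have hK: "integrable lborel (\<lambda>z. indicator K z * h (norm (w' z)))" if K: "compact K" "K \<subseteq> ?U" for K
  proof -
    obtain D' s1 s2 where C: "open D'" "s1 < s2" "compact (closure (D' \<times> {s1<..<s2}))"
      "closure (D' \<times> {s1<..<s2}) \<subseteq> ?U" "K \<subseteq> D' \<times> {s1<..<s2}"
      using compact_in_cylinder[OF K D t] by metis
    let ?C = "D' \<times> {s1<..<s2}"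
    have oC: "open ?C" using C(1) by (intro open_Times) auto
    have BC: "?C \<in> sets borel" using oC by (rule borel_open)
    have CU: "?C \<subseteq> ?U" by (rule subset_trans[OF closure_subset C(4)])
    have "v \<in> V2G (primitive g) D' s1 s2" by (rule vl[unfolded V2G_loc_def mem_Collect_eq, rule_format, OF conjI[OF C(1) conjI[OF C(2) conjI[OF C(3,4)]]]])
    then obtain w2 where w2: "has_weak_spatial_grad ?C v w2" "w2 \<in> Orlicz (primitive g) ?C"
      unfolding V2G_def VG_def by blast
    have lw: "locally_integrable_on w2 ?C" using w2(1) unfolding has_weak_spatial_grad_def by (rule conjunct2[THEN conjunct1])
    obtain w3 where w3: "w3 \<in> borel_measurable borel" "AE z in lborel. z \<in> ?C \<longrightarrow> w2 z = w3 z"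
      by (rule locally_integrable_representative[OF oC lw])
    have eqC: "AE z in lborel. z \<in> ?C \<longrightarrow> v z = v' z" using eq by eventually_elim (use CU in blast)
    note w2' = w2(1)[unfolded has_weak_spatial_grad_iff[OF oC v'm w3(1) eqC w3(2)]]
    have "AE z in lborel. z \<in> ?C \<longrightarrow> w3 z = w' z"
    proof (rule fundamental_lemma_vector[OF oC w3(1) w'(1)])
      fix S assume S: "compact S" "S \<subseteq> ?C"
      show "integrable lborel (\<lambda>x. indicator S x *\<^sub>R w3 x)" using w2' S by blast
      have "S \<subseteq> ?U" using S(2) CU by (rule subset_trans)
      then show "integrable lborel (\<lambda>x. indicator S x *\<^sub>R w' x)" using Du' S(1) by blast
    next
      fix \<phi> and b :: 'a assume \<phi>: "\<phi> \<in> Cc_infty ?C" and b: "b \<in> Basis"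
      have "(\<integral>x. v' x * dderiv (b, 0) \<phi> x \<partial>lborel) = - (\<integral>x. \<phi> x * (w3 x \<bullet> b) \<partial>lborel)" using w2' \<phi> b by blast
      moreover have "\<phi> \<in> Cc_infty ?U" using \<phi> Cc_infty_mono[OF CU] by blast
      then have "(\<integral>x. v' x * dderiv (b, 0) \<phi> x \<partial>lborel) = - (\<integral>x. \<phi> x * (w' x \<bullet> b) \<partial>lborel)" using Du' b by blast
      ultimately show "(\<integral>x. \<phi> x * (w3 x \<bullet> b) \<partial>lborel) = (\<integral>x. \<phi> x * (w' x \<bullet> b) \<partial>lborel)" by linarith
    qed
    then have "AE z in lborel. z \<in> ?C \<longrightarrow> ennreal (primitive g (norm (w2 z))) = ennreal (primitive g (norm (w' z)))"
      using w3(2) by eventually_elim auto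
    from nn_integral_lebesgue_on[OF BC this]
    have fin: "(\<integral>\<^sup>+z. ennreal (primitive g (norm (w' z))) * indicator ?C z \<partial>lborel) < \<infinity>"
      using w2(2) unfolding Orlicz_def by simp
    note [measurable] = w'(1) BC
    have [measurable]: "K \<in> sets borel" using K(1) by (simp add: borel_compact)
    have "(\<integral>\<^sup>+z. ennreal (norm (indicator K z * h (norm (w' z)))) \<partial>lborel)
      \<le> (\<integral>\<^sup>+z. ennreal g1 * (ennreal (primitive g (norm (w' z))) * indicator ?C z) \<partial>lborel)"
    proof (rule nn_integral_mono)
      fix z
      show "ennreal (norm (indicator K z * h (norm (w' z)))) \<le> ennreal g1 * (ennreal (primitive g (norm (w' z))) * indicator ?C z)"
      proof (cases "z \<in> K")
        case True
        have "h (norm (w' z)) \<le> g1 * primitive g (norm (w' z))" by (rule h_le_primitive) simp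
        then have "ennreal (h (norm (w' z))) \<le> ennreal g1 * ennreal (primitive g (norm (w' z)))"
          using g1_gt by (simp add: ennreal_mult[symmetric] primitive_nonneg ennreal_leI)
        moreover have "z \<in> ?C" using True C(5) by blast
        ultimately show ?thesis using True h_nonneg[of "norm (w' z)"] by simp
      qed simp
    qed
    also have "\<dots> = ennreal g1 * (\<integral>\<^sup>+z. ennreal (primitive g (norm (w' z))) * indicator ?C z \<partial>lborel)"
      by (rule nn_integral_cmult) measurable
    also have "\<dots> < \<infinity>" using fin by (simp add: ennreal_mult_less_top)
    finally show ?thesis by (intro integrableI_bounded) measurable
  qed
  have "wsuper ?U v' w'"
    unfolding wsuper_def
  proof (intro conjI allI ballI impI)
    fix \<eta> assume \<eta>: "\<eta> \<in> Cc_infty ?U" and pos: "\<forall>z. 0 \<le> \<eta> z"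
    show "0 \<le> - (\<integral>z. v' z * dderiv (0, 1) \<eta> z \<partial>lborel)
        + (\<integral>z. (\<Sum>b\<in>Basis. (A (w' z) \<bullet> b) * dderiv (b, 0) \<eta> z) \<partial>lborel)"
      using super[rule_format, OF \<eta>] pos unfolding lebesgue_on_tested[OF U v'm w'(1) eq w'(2) \<eta>] by simp
  next
    fix K assume "compact K \<and> K \<subseteq> ?U"
    then show "integrable lborel (\<lambda>z. indicator K z * h (norm (w' z)))" by (elim conjE) (rule hK)
  qed (use v'm w'(1) Du' in blast)+
  then show thesis by (rule that[OF _ allI[OF v'M] eq])
qed

text \<open>On a bounded cylinder the bound \<open>M\<close> makes \<open>u\<close> a member of the
  Orlicz class, and \<open>primitive g \<le> h\<close> does so for its gradient. The two Bochner
  spaces are supplied by \<open>Bochner_regularity\<close>.\<close>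

lemma wsuper_weak_supersolution:
  assumes U: "open U" and w: "wsuper U v w" and M: "0 \<le> M" "\<And>z. \<bar>v z\<bar> \<le> M"
    and eq: "AE z in lborel. z \<in> U \<longrightarrow> u z = v z"
  shows "weak_supersolution g A U u"
proof -
  have vm: "v \<in> borel_measurable borel" and wm: "w \<in> borel_measurable borel"
    and hK: "\<And>K. compact K \<Longrightarrow> K \<subseteq> U \<Longrightarrow> integrable lborel (\<lambda>z. indicator K z * h (norm (w z)))"
    and form: "\<And>\<phi> b. \<phi> \<in> Cc_infty U \<Longrightarrow> b \<in> Basis \<Longrightarrow>
      (\<integral>z. v z * dderiv (b, 0) \<phi> z \<partial>lborel) = - (\<integral>z. \<phi> z * (w z \<bullet> b) \<partial>lborel)"
    and super: "\<And>\<eta>. \<eta> \<in> Cc_infty U \<Longrightarrow> \<forall>z. 0 \<le> \<eta> z \<Longrightarrow> 0 \<le> - (\<integral>z. v z * dderiv (0, 1) \<eta> z \<partial>lborel)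
        + (\<integral>z. (\<Sum>b\<in>Basis. (A (w z) \<bullet> b) * dderiv (b, 0) \<eta> z) \<partial>lborel)"
    using w unfolding wsuper_def by (elim conjE; simp)+
  note [measurable] = vm wm
  have grad: "has_weak_spatial_grad X u w" if X: "open X" "X \<subseteq> U" for X
  proof -
    have eX: "AE z in lborel. z \<in> X \<longrightarrow> u z = v z" using eq by eventually_elim (use X(2) in blast)
    have ww: "AE z in lborel. z \<in> X \<longrightarrow> w z = w z" by simp
    show ?thesis
      unfolding has_weak_spatial_grad_iff[OF X(1) vm wm eX ww]
    proof (intro conjI allI impI ballI; (elim conjE)?)
      fix K assume K: "compact K" "K \<subseteq> X"
      show "integrable lborel (\<lambda>x. indicator K x *\<^sub>R v x)" by (rule integrable_loc_bounded[OF vm K(1) M(2)])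
      show "integrable lborel (\<lambda>x. indicator K x *\<^sub>R w x)"
        by (rule integrable_loc(1)[OF wm K(1) hK[OF K(1) subset_trans[OF K(2) X(2)]]])
    next
      fix \<phi> and b :: 'a assume "\<phi> \<in> Cc_infty X" and b: "b \<in> Basis"
      then have "\<phi> \<in> Cc_infty U" using Cc_infty_mono[OF X(2)] by blast
      from form[OF this b] show "(\<integral>x. v x * dderiv (b, 0) \<phi> x \<partial>lborel) = - (\<integral>x. \<phi> x * (w x \<bullet> b) \<partial>lborel)" .
    qed
  qed
  have V2G: "u \<in> V2G (primitive g) D s1 s2"
    if D: "open D" "s1 < s2" and cC: "compact (closure (D \<times> {s1<..<s2}))" and CU: "closure (D \<times> {s1<..<s2}) \<subseteq> U" for D s1 s2
  proof -
    let ?C = "D \<times> {s1<..<s2}"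
    have oC: "open ?C" using D(1) by (intro open_Times) auto
    have BC[measurable]: "?C \<in> sets borel" using oC by (rule borel_open)
    have sub: "?C \<subseteq> U" by (rule subset_trans[OF closure_subset CU])
    have eC: "AE z in lborel. z \<in> ?C \<longrightarrow> u z = v z" using eq by eventually_elim (use sub in blast)
    have um: "u \<in> borel_measurable (lebesgue_on ?C)" by (rule borel_measurable_lebesgue_on_AE[OF BC vm eC])
    have wmC: "w \<in> borel_measurable (lebesgue_on ?C)" by (rule borel_measurable_lebesgue_on_AE[OF BC wm]) simp
    have ePu: "AE z in lborel. z \<in> ?C \<longrightarrow> ennreal (primitive g (norm (u z))) = ennreal (primitive g (norm (v z)))"
      using eC by eventually_elim auto
    have fC: "emeasure lborel ?C < \<infinity>"
    proof -
      have "bounded ?C" using compact_imp_bounded[OF cC] closure_subset by (rule bounded_subset)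
      then show ?thesis by (rule emeasure_bounded_finite)
    qed
    have "(\<integral>\<^sup>+z. ennreal (primitive g (norm (u z))) \<partial>lebesgue_on ?C)
        = (\<integral>\<^sup>+z. ennreal (primitive g (norm (v z))) * indicator ?C z \<partial>lborel)"
      by (rule nn_integral_lebesgue_on[OF BC ePu])
    also have "\<dots> \<le> (\<integral>\<^sup>+z. ennreal (primitive g M) * indicator ?C z \<partial>lborel)"
      using M(2) by (intro nn_integral_mono mult_right_mono ennreal_leI primitive_mono) auto
    also have "\<dots> = ennreal (primitive g M) * emeasure lborel ?C" by (rule nn_integral_cmult_indicator) simp
    also have "\<dots> < \<infinity>" using fC by (simp add: ennreal_mult_less_top)
    finally have Ou: "u \<in> Orlicz (primitive g) ?C" using um unfolding Orlicz_def by blast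
    have "(\<integral>\<^sup>+z. ennreal (primitive g (norm (w z))) \<partial>lebesgue_on ?C)
        = (\<integral>\<^sup>+z. ennreal (primitive g (norm (w z))) * indicator ?C z \<partial>lborel)"
      by (rule nn_integral_lebesgue_on[OF BC]) simp
    also have "\<dots> \<le> (\<integral>\<^sup>+z. ennreal (norm (indicator (closure ?C) z * h (norm (w z)))) \<partial>lborel)"
    proof (rule nn_integral_mono)
      fix z
      have "ennreal (primitive g (norm (w z))) \<le> ennreal (h (norm (w z)))" by (intro ennreal_leI primitive_le_h) simp
      moreover have "norm (h (norm (w z))) = h (norm (w z))" using h_nonneg[of "norm (w z)"] by simp
      ultimately have le: "ennreal (primitive g (norm (w z))) \<le> ennreal (norm (h (norm (w z))))" by simp
      show "ennreal (primitive g (norm (w z))) * indicator ?C z \<le> ennreal (norm (indicator (closure ?C) z * h (norm (w z))))"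
      proof (cases "z \<in> ?C")
        case True
        then have "z \<in> closure ?C" by (rule subsetD[OF closure_subset])
        with True le show ?thesis by (simp only: indicator_simps mult_1 mult_1_right)
      next
        case False
        then show ?thesis by (simp only: indicator_simps not_False_eq_True mult_zero_right zero_le)
      qed
    qed
    also have "\<dots> < \<infinity>" using hK[OF cC CU] unfolding integrable_iff_bounded by blast
    finally have Ow: "w \<in> Orlicz (primitive g) ?C" using wmC unfolding Orlicz_def by blast
    note B = Bochner_regularity[OF U w M D cC CU eq]
    show ?thesis unfolding V2G_def VG_def using B Ou Ow grad[OF oC sub] by blast
  qed
  have "u \<in> V2G_loc (primitive g) U"
    unfolding V2G_loc_def by (intro CollectI allI impI, elim conjE) (rule V2G)
  moreover have "0 \<le> - (LINT z|lebesgue_on U. u z * time_deriv \<eta> z) + (LINT z|lebesgue_on U. A (w z) \<bullet> spatial_grad \<eta> z)"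
    if "\<eta> \<in> Cc_infty U" "\<forall>z. 0 \<le> \<eta> z" for \<eta>
  proof -
    have ww: "AE z in lborel. z \<in> U \<longrightarrow> w z = w z" by simp
    from super[OF that] show ?thesis unfolding lebesgue_on_tested[OF U vm wm eq ww that(1)] .
  qed
  ultimately show ?thesis unfolding weak_supersolution_def using grad[OF U subset_refl] by blast
qed

lemma weak_supersolution_limit:
  assumes D: "open D" "t1 < t2" and M: "0 \<le> M"
    and us: "\<And>i. weak_supersolution g A (D \<times> {t1<..<t2}) (us i)"
    and bd: "\<And>i. AE z in lebesgue_on (D \<times> {t1<..<t2}). \<bar>us i z\<bar> \<le> M"
    and lim: "AE z in lebesgue_on (D \<times> {t1<..<t2}). (\<lambda>i. us i z) \<longlonglongrightarrow> u z"
  shows "weak_supersolution g A (D \<times> {t1<..<t2}) u"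
proof -
  let ?U = "D \<times> {t1<..<t2}"
  have U: "open ?U" using D by (intro open_Times) auto
  have BU: "?U \<in> sets borel" using U by (rule borel_open)
  have "\<forall>i. \<exists>v w. wsuper ?U v w \<and> (\<forall>z. \<bar>v z\<bar> \<le> M) \<and> (AE z in lborel. z \<in> ?U \<longrightarrow> us i z = v z)"
  proof
    fix i
    show "\<exists>v w. wsuper ?U v w \<and> (\<forall>z. \<bar>v z\<bar> \<le> M) \<and> (AE z in lborel. z \<in> ?U \<longrightarrow> us i z = v z)"
      by (rule weak_supersolution_wsuper[OF D us[of i] M bd[of i]]) (intro exI conjI)
  qed
  from choice[OF this] obtain v where
    "\<forall>i. \<exists>w. wsuper ?U (v i) w \<and> (\<forall>z. \<bar>v i z\<bar> \<le> M) \<and> (AE z in lborel. z \<in> ?U \<longrightarrow> us i z = v i z)" ..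
  from choice[OF this] obtain w where all: "\<forall>i. wsuper ?U (v i) (w i) \<and> (\<forall>z. \<bar>v i z\<bar> \<le> M) \<and> (AE z in lborel. z \<in> ?U \<longrightarrow> us i z = v i z)" ..
  have vw: "wsuper ?U (v i) (w i)" "\<bar>v i z\<bar> \<le> M" "AE z in lborel. z \<in> ?U \<longrightarrow> us i z = v i z" for i z
    using all[rule_format, THEN conjunct1, of i] all[rule_format, THEN conjunct2, THEN conjunct1, rule_format, of i z]
      all[rule_format, THEN conjunct2, THEN conjunct2, of i] .
  have [measurable]: "v i \<in> borel_measurable borel" for i using vw(1)[of i] unfolding wsuper_def by (rule conjunct1)
  \<comment> \<open>Where the representatives diverge \<open>lim\<close> is a default value;
    clipping keeps it within the bound, so \<open>u'\<close> is Borel and bounded at every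
    point.\<close>
  define u' where "u' = (\<lambda>z. max (- M) (min M (lim (\<lambda>i. v i z))))"
  have um: "u' \<in> borel_measurable borel" unfolding u'_def by measurable
  have uM: "\<bar>u' z\<bar> \<le> M" for z unfolding u'_def using M by auto
  have all: "AE z in lborel. \<forall>i. z \<in> ?U \<longrightarrow> us i z = v i z" unfolding AE_all_countable by (rule allI) (rule vw(3))
  have conv: "AE z in lborel. z \<in> ?U \<longrightarrow> (\<lambda>i. v i z) \<longlonglongrightarrow> u z \<and> u z = u' z"
    using all lim[unfolded AE_lebesgue_on[OF BU]]
  proof eventually_elim
    case (elim z)
    show ?case
    proof
      assume z: "z \<in> ?U"
      have l: "(\<lambda>i. v i z) \<longlonglongrightarrow> u z" using elim z by simp
      have "\<bar>u z\<bar> \<le> M" by (rule LIMSEQ_le_const2[OF tendsto_rabs[OF l]]) (use vw(2) in blast)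
      then have "u z = u' z" unfolding u'_def limI[OF l] by auto
      with l show "(\<lambda>i. v i z) \<longlonglongrightarrow> u z \<and> u z = u' z" by (rule conjI)
    qed
  qed
  have "AE z in lborel. z \<in> ?U \<longrightarrow> (\<lambda>i. v i z) \<longlonglongrightarrow> u' z" using conv by eventually_elim auto
  from wsuper_limit[OF U M vw(1) vw(2) um uM this] obtain w' where w': "wsuper ?U u' w'" ..
  have "AE z in lborel. z \<in> ?U \<longrightarrow> u z = u' z" using conv by eventually_elim auto
  from wsuper_weak_supersolution[OF U w' M uM this] show ?thesis .
qed

end

theorem theorem3p9:
  fixes \<Omega> D :: "(real ^ 'n) set"
    and T t1 t2 g0 g1 \<nu> L M :: real
    and g g' :: "real \<Rightarrow> real"
    and A :: "real ^ 'n \<Rightarrow> real ^ 'n"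
    and DA :: "real ^ 'n \<Rightarrow> (real ^ 'n) \<Rightarrow>\<^sub>L (real ^ 'n)"
    and us :: "nat \<Rightarrow> (real ^ 'n) \<times> real \<Rightarrow> real"
    and u :: "(real ^ 'n) \<times> real \<Rightarrow> real"
  assumes "CARD('n) \<ge> 2"
    and "open \<Omega>" "connected \<Omega>" "\<Omega> \<noteq> {}" "bounded \<Omega>"
    and "T > 0"
    and "\<And>s. s \<ge> 0 \<Longrightarrow> g s \<ge> 0"
    and "\<And>s. s > 0 \<Longrightarrow> g s > 0"
    and "\<And>s. s \<ge> 0 \<Longrightarrow> (g has_real_derivative g' s) (at s within {0..})"
    and "continuous_on {0..} g'"
    and "\<And>s. s > 0 \<Longrightarrow> g0 - 1 \<le> s * g' s / g s \<and> s * g' s / g s \<le> g1 - 1"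
    and "2 * real CARD('n) / (real CARD('n) + 2) < g0" "g0 \<le> g1"
    and "integral {0..1} g = 1"
    and "\<And>\<xi>. (A has_derivative blinfun_apply (DA \<xi>)) (at \<xi>)"
    and "continuous_on UNIV DA"
    and "A 0 = 0"
    and "0 < \<nu>" "\<nu> \<le> 1" "1 \<le> L"
    and "\<And>\<xi> \<zeta>. \<xi> \<noteq> 0 \<Longrightarrow>
           blinfun_apply (DA \<xi>) \<zeta> \<bullet> \<zeta> \<ge> \<nu> * (g (norm \<xi>) / norm \<xi>) * (norm \<zeta>)\<^sup>2"
    and "\<And>\<xi>. \<xi> \<noteq> 0 \<Longrightarrow> norm (DA \<xi>) \<le> L * (g (norm \<xi>) / norm \<xi>)"
    and "open D" "D \<subseteq> \<Omega>" "t1 < t2"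
    and "D \<times> {t1<..<t2} \<subseteq> \<Omega> \<times> {0<..<T}"
    and "M \<ge> 1"
    and "\<And>i. weak_supersolution g A (D \<times> {t1<..<t2}) (us i)"
    and "\<And>i. AE z in lebesgue_on (D \<times> {t1<..<t2}). \<bar>us i z\<bar> \<le> M"
    and "AE z in lebesgue_on (D \<times> {t1<..<t2}). (\<lambda>i. us i z) \<longlonglongrightarrow> u z"
  shows "weak_supersolution g A (D \<times> {t1<..<t2}) u"
proof -
  \<comment> \<open>For positive \<open>n\<close> the inequality \<open>n + 2 \<le> 2 n\<close> says
    \<open>n \<ge> 2\<close>; this is where the dimension gives \<open>1 < g0\<close>.\<close>
  have "1 \<le> 2 * real CARD('n) / (real CARD('n) + 2)" using assms(1) by (simp add: field_simps)
  then have "1 < g0" using assms(12) by linarith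
  then interpret growth A DA g g' g0 g1 \<nu> L
    using assms(7-11,15,17,18,20-22) by unfold_locales
  show ?thesis by (rule weak_supersolution_limit[OF assms(23,25) _ assms(28-30)]) (use assms(27) in simp)
qed

end
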